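(* Let $G$ be a compact connected Lie group that is locally isomorphic to a product of copies of $\mathrm{SU}(2)$ and $\mathrm{U}(1)$, and let $F_n$ be the free group of rank $n$. If $n>2$, then the action of $\mathrm{Out}(F_n)$ on $\mathrm{Hom}(F_n,G)/G$ is ergodic.
   Context: $\mathrm{Out}(F_n)=\mathrm{Aut}(F_n)/\mathrm{Inn}(F_n)$. Choosing free generators $X_1,\dots,X_n$ of $F_n$ identifies $\mathrm{Hom}(F_n,G)$ with $G^n$ via $\rho\mapsto(\rho(X_1),\dots,\rho(X_n))$; the natural volume (the product Haar measure on $G^n$) is invariant under $\mathrm{Aut}(F_n)$, which acts by $\phi\cdot\rho=\rho\circ\phi^{-1}$. $\mathrm{Hom}(F_n,G)/G$ denotes the quotient by the action of $G$ by conjugation, $(g\cdot\rho)(w)=g\rho(w)g^{-1}$, equipped with the pushforward of this finite measure. The $\mathrm{Aut}(F_n)$-action descends to a measure-preserving action of $\mathrm{Out}(F_n)$ on $\mathrm{Hom}(F_n,G)/G$. Ergodic means that every invariant measurable function is constant almost everywhere with respect to this measure. *)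

theory Defs
  imports
    "HOL-Analysis.Analysis"
    "HOL-Algebra.Group_Action"
    "HOL-Algebra.Product_Groups"
begin

section \<open>Lie groups\<close>

text \<open>
  \<^term>\<open>Euclidean_space d\<close> is the library's model of $R^d$ inside
  \<^typ>\<open>nat \<Rightarrow> real\<close>; unlike the class \<open>euclidean_space\<close> it includes dimension 0,
  so that the trivial group is a Lie group. Functions on open subsets of it are total in HOL, but
  only their values on the open subset enter below: if \<open>U\<close> is open, \<open>x \<in> U\<close> and \<open>i < d\<close>, then
  \<open>x(i := t) \<in> U\<close> for \<open>t\<close> near \<open>x i\<close>.
\<close>

definition partial_deriv :: "nat \<Rightarrow> ((nat \<Rightarrow> real) \<Rightarrow> real) \<Rightarrow> (nat \<Rightarrow> real) \<Rightarrow> real" where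
  "partial_deriv i f x = deriv (\<lambda>t. f (x(i := t))) (x i)"

primrec Ck_on :: "nat \<Rightarrow> nat \<Rightarrow> (nat \<Rightarrow> real) set \<Rightarrow> ((nat \<Rightarrow> real) \<Rightarrow> real) \<Rightarrow> bool" where
  "Ck_on 0 d U f \<longleftrightarrow>
     continuous_map (subtopology (Euclidean_space d) U) euclideanreal f"
| "Ck_on (Suc k) d U f \<longleftrightarrow>
     continuous_map (subtopology (Euclidean_space d) U) euclideanreal f \<and>
     (\<forall>i<d. (\<forall>x\<in>U. (\<lambda>t. f (x(i := t))) differentiable (at (x i))) \<and>
            Ck_on k d U (partial_deriv i f))"

definition smooth_on :: "nat \<Rightarrow> (nat \<Rightarrow> real) set \<Rightarrow> nat \<Rightarrow> ((nat \<Rightarrow> real) \<Rightarrow> (nat \<Rightarrow> real)) \<Rightarrow> bool"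
  where "smooth_on d U e f \<longleftrightarrow>
    f \<in> U \<rightarrow> topspace (Euclidean_space e) \<and> (\<forall>j<e. \<forall>k. Ck_on k d U (\<lambda>x. f x j))"

text \<open>A chart is a pair of its (open) domain and its coordinate function.\<close>

type_synonym 'g chart = "'g set \<times> ('g \<Rightarrow> nat \<Rightarrow> real)"

definition smooth_atlas :: "nat \<Rightarrow> 'g topology \<Rightarrow> 'g chart set \<Rightarrow> bool" where
  "smooth_atlas d X A \<longleftrightarrow>
     (\<forall>(U, \<phi>)\<in>A. openin X U \<and> openin (Euclidean_space d) (\<phi> ` U) \<and>
        homeomorphic_map (subtopology X U) (subtopology (Euclidean_space d) (\<phi> ` U)) \<phi>) \<and>
     (\<Union>(U, \<phi>)\<in>A. U) = topspace X \<and>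
     (\<forall>(U, \<phi>)\<in>A. \<forall>(V, \<psi>)\<in>A. smooth_on d (\<phi> ` (U \<inter> V)) d (\<psi> \<circ> inv_into U \<phi>))"

definition smooth_manifold :: "nat \<Rightarrow> 'g topology \<Rightarrow> 'g chart set \<Rightarrow> bool" where
  "smooth_manifold d X A \<longleftrightarrow> Hausdorff_space X \<and> second_countable X \<and> smooth_atlas d X A"

definition smooth_map ::
  "nat \<Rightarrow> 'g topology \<Rightarrow> 'g chart set \<Rightarrow> nat \<Rightarrow> 'h topology \<Rightarrow> 'h chart set \<Rightarrow> ('g \<Rightarrow> 'h) \<Rightarrow> bool"
  where "smooth_map d X A e Y B f \<longleftrightarrow>
    continuous_map X Y f \<and>
    (\<forall>(U, \<phi>)\<in>A. \<forall>(V, \<psi>)\<in>B. smooth_on d (\<phi> ` (U \<inter> f -` V)) e (\<psi> \<circ> f \<circ> inv_into U \<phi>))"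

definition prod_atlas :: "nat \<Rightarrow> 'g chart set \<Rightarrow> 'h chart set \<Rightarrow> ('g \<times> 'h) chart set" where
  "prod_atlas d A B =
    (\<lambda>((U, \<phi>), (V, \<psi>)). (U \<times> V, \<lambda>(x, y) i. if i < d then \<phi> x i else \<psi> y (i - d))) ` (A \<times> B)"

definition lie_group ::
  "nat \<Rightarrow> ('g, 'm) monoid_scheme \<Rightarrow> 'g topology \<Rightarrow> 'g chart set \<Rightarrow> bool" where
  "lie_group d G X A \<longleftrightarrow>
     group G \<and> topspace X = carrier G \<and> smooth_manifold d X A \<and>
     smooth_map (d + d) (prod_topology X X) (prod_atlas d A A) d X A (\<lambda>(x, y). x \<otimes>\<^bsub>G\<^esub> y) \<and>
     smooth_map d X A d X A (\<lambda>x. inv\<^bsub>G\<^esub> x)"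

text \<open>
  Local isomorphism of topological groups. Between Lie groups a continuous local homomorphism is
  automatically smooth, and a smooth local isomorphism is in particular a local isomorphism in
  this sense.
\<close>

definition locally_isomorphic ::
  "('g, 'm) monoid_scheme \<Rightarrow> 'g topology \<Rightarrow> ('h, 'l) monoid_scheme \<Rightarrow> 'h topology \<Rightarrow> bool" where
  "locally_isomorphic G X H Y \<longleftrightarrow>
     (\<exists>U V f. openin X U \<and> \<one>\<^bsub>G\<^esub> \<in> U \<and> openin Y V \<and> \<one>\<^bsub>H\<^esub> \<in> V \<and>
        homeomorphic_map (subtopology X U) (subtopology Y V) f \<and>
        (\<forall>x\<in>U. \<forall>y\<in>U. (x \<otimes>\<^bsub>G\<^esub> y \<in> U \<longleftrightarrow> f x \<otimes>\<^bsub>H\<^esub> f y \<in> V) \<and>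
           (x \<otimes>\<^bsub>G\<^esub> y \<in> U \<longrightarrow> f (x \<otimes>\<^bsub>G\<^esub> y) = f x \<otimes>\<^bsub>H\<^esub> f y)))"

definition SU2 :: "(complex^2^2) monoid" where
  "SU2 = \<lparr>carrier = {M. M ** (\<chi> i j. cnj (M $ j $ i)) = mat 1 \<and> det M = 1},
          mult = (**), one = mat 1\<rparr>"

definition U1 :: "complex monoid" where
  "U1 = \<lparr>carrier = {z. cmod z = 1}, mult = (*), one = 1\<rparr>"

text \<open>The group $SU(2)^a \times U(1)^b$ with its product topology.\<close>

definition SU2_U1_product :: "nat \<Rightarrow> nat \<Rightarrow> ((nat \<Rightarrow> complex^2^2) \<times> (nat \<Rightarrow> complex)) monoid" where
  "SU2_U1_product a b = product_group {..<a} (\<lambda>_. SU2) \<times>\<times> product_group {..<b} (\<lambda>_. U1)"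

definition SU2_U1_topology :: "nat \<Rightarrow> nat \<Rightarrow> ((nat \<Rightarrow> complex^2^2) \<times> (nat \<Rightarrow> complex)) topology" where
  "SU2_U1_topology a b =
     prod_topology (product_topology (\<lambda>_. top_of_set (carrier SU2)) {..<a})
                   (product_topology (\<lambda>_. top_of_set (carrier U1)) {..<b})"


section \<open>Haar measure\<close>

text \<open>
  Left Haar measures on the Borel sets, determined up to a positive factor and not normalised.
  Regularity is automatic on a second countable locally compact group.
\<close>

definition haar_measure :: "('g, 'm) monoid_scheme \<Rightarrow> 'g topology \<Rightarrow> 'g measure \<Rightarrow> bool" where
  "haar_measure G X \<mu> \<longleftrightarrow>
     space \<mu> = topspace X \<and> sets \<mu> = sets (sigma (topspace X) {U. openin X U}) \<and>
     (\<forall>K\<in>sets \<mu>. compactin X K \<longrightarrow> emeasure \<mu> K < \<infinity>) \<and>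
     (\<forall>U. openin X U \<and> U \<noteq> {} \<longrightarrow> emeasure \<mu> U > 0) \<and>
     (\<forall>g\<in>carrier G. \<forall>B\<in>sets \<mu>. emeasure \<mu> (g <#\<^bsub>G\<^esub> B) = emeasure \<mu> B)"


section \<open>Free groups\<close>

text \<open>
  The letter \<open>(s, True)\<close> stands for the generator \<open>s\<close> and \<open>(s, False)\<close> for its inverse;
  elements of the free group are the reduced words.
\<close>

definition flip :: "'a \<times> bool \<Rightarrow> 'a \<times> bool" where
  "flip x = (fst x, \<not> snd x)"

definition reduced :: "('a \<times> bool) list \<Rightarrow> bool" where
  "reduced = successively (\<lambda>x y. y \<noteq> flip x)"

fun prepend :: "'a \<times> bool \<Rightarrow> ('a \<times> bool) list \<Rightarrow> ('a \<times> bool) list" where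
  "prepend x [] = [x]"
| "prepend x (y # w) = (if y = flip x then w else x # y # w)"

definition free_group :: "'a set \<Rightarrow> ('a \<times> bool) list monoid" where
  "free_group S = \<lparr>carrier = {w. reduced w \<and> fst ` set w \<subseteq> S},
                   mult = foldr prepend, one = []\<rparr>"

definition gen :: "'a \<Rightarrow> ('a \<times> bool) list" where
  "gen s = [(s, True)]"



section \<open>Outer automorphisms\<close>

definition Inn :: "('a, 'm) monoid_scheme \<Rightarrow> ('a \<Rightarrow> 'a) set" where
  "Inn G = (\<lambda>g. \<lambda>h\<in>carrier G. g \<otimes>\<^bsub>G\<^esub> h \<otimes>\<^bsub>G\<^esub> inv\<^bsub>G\<^esub> g) ` carrier G"

definition Out :: "('a, 'm) monoid_scheme \<Rightarrow> ('a \<Rightarrow> 'a) set monoid" where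
  "Out G = AutoGroup G Mod Inn G"


section \<open>The representation space\<close>

definition Hom :: "('a, 'k) monoid_scheme \<Rightarrow> ('g, 'm) monoid_scheme \<Rightarrow> ('a \<Rightarrow> 'g) set" where
  "Hom \<Gamma> G = hom \<Gamma> G \<inter> extensional (carrier \<Gamma>)"

definition aut_act ::
  "('a, 'k) monoid_scheme \<Rightarrow> ('g, 'm) monoid_scheme \<Rightarrow> ('a \<Rightarrow> 'a) \<Rightarrow> ('a \<Rightarrow> 'g) \<Rightarrow> ('a \<Rightarrow> 'g)" where
  "aut_act \<Gamma> G \<phi> = (\<lambda>\<rho>\<in>Hom \<Gamma> G. compose (carrier \<Gamma>) \<rho> (inv\<^bsub>AutoGroup \<Gamma>\<^esub> \<phi>))"

definition conj_act ::
  "('a, 'k) monoid_scheme \<Rightarrow> ('g, 'm) monoid_scheme \<Rightarrow> 'g \<Rightarrow> ('a \<Rightarrow> 'g) \<Rightarrow> ('a \<Rightarrow> 'g)" where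
  "conj_act \<Gamma> G g = (\<lambda>\<rho>\<in>Hom \<Gamma> G. \<lambda>w\<in>carrier \<Gamma>. g \<otimes>\<^bsub>G\<^esub> \<rho> w \<otimes>\<^bsub>G\<^esub> inv\<^bsub>G\<^esub> g)"

definition conj_class ::
  "('a, 'k) monoid_scheme \<Rightarrow> ('g, 'm) monoid_scheme \<Rightarrow> ('a \<Rightarrow> 'g) \<Rightarrow> ('a \<Rightarrow> 'g) set" where
  "conj_class \<Gamma> G \<rho> = orbit G (conj_act \<Gamma> G) \<rho>"

definition Hom_mod :: "('a, 'k) monoid_scheme \<Rightarrow> ('g, 'm) monoid_scheme \<Rightarrow> ('a \<Rightarrow> 'g) set set" where
  "Hom_mod \<Gamma> G = orbits G (Hom \<Gamma> G) (conj_act \<Gamma> G)"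

text \<open>
  A coset \<open>C\<close> of inner automorphisms sends a conjugacy class \<open>c\<close> to the set of all
  \<open>\<phi> \<cdot> \<rho>\<close> with \<open>\<phi> \<in> C\<close> and \<open>\<rho> \<in> c\<close>, which is again a single conjugacy class; see
  \<open>out_act_conj_class\<close> below.
\<close>

definition out_act ::
  "('a, 'k) monoid_scheme \<Rightarrow> ('g, 'm) monoid_scheme \<Rightarrow>
    ('a \<Rightarrow> 'a) set \<Rightarrow> ('a \<Rightarrow> 'g) set \<Rightarrow> ('a \<Rightarrow> 'g) set" where
  "out_act \<Gamma> G C = (\<lambda>c\<in>Hom_mod \<Gamma> G. {aut_act \<Gamma> G \<phi> \<rho> | \<phi> \<rho>. \<phi> \<in> C \<and> \<rho> \<in> c})"

definition gen_values :: "nat \<Rightarrow> ((nat \<times> bool) list \<Rightarrow> 'g) \<Rightarrow> (nat \<Rightarrow> 'g)" where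
  "gen_values n \<rho> = (\<lambda>i\<in>{..<n}. \<rho> (gen i))"

text \<open>The product measure on $G^n$, transported along the bijection \<open>gen_values n\<close>.\<close>

definition Hom_measure ::
  "nat \<Rightarrow> ('g, 'm) monoid_scheme \<Rightarrow> 'g measure \<Rightarrow> ((nat \<times> bool) list \<Rightarrow> 'g) measure" where
  "Hom_measure n G \<mu> =
     distr (\<Pi>\<^sub>M i\<in>{..<n}. \<mu>)
       (vimage_algebra (Hom (free_group {..<n}) G) (gen_values n) (\<Pi>\<^sub>M i\<in>{..<n}. \<mu>))
       (inv_into (Hom (free_group {..<n}) G) (gen_values n))"

text \<open>Pushforward to the quotient, which carries the largest \<open>\<sigma>\<close>-algebra making
  the quotient map measurable.\<close>

definition Hom_mod_measure ::
  "nat \<Rightarrow> ('g, 'm) monoid_scheme \<Rightarrow> 'g measure \<Rightarrow> ((nat \<times> bool) list \<Rightarrow> 'g) set measure" where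
  "Hom_mod_measure n G \<mu> =
     distr (Hom_measure n G \<mu>)
       (sigma (Hom_mod (free_group {..<n}) G)
          {B. B \<subseteq> Hom_mod (free_group {..<n}) G \<and>
              {\<rho>\<in>Hom (free_group {..<n}) G. conj_class (free_group {..<n}) G \<rho> \<in> B} \<in> sets (Hom_measure n G \<mu>)})
       (conj_class (free_group {..<n}) G)"


section \<open>Ergodicity\<close>

definition ergodic_action :: "('c, 'k) monoid_scheme \<Rightarrow> 'x measure \<Rightarrow> ('c \<Rightarrow> 'x \<Rightarrow> 'x) \<Rightarrow> bool" where
  "ergodic_action \<Gamma> M act \<longleftrightarrow>
     (\<forall>f::'x \<Rightarrow> real. f \<in> borel_measurable M \<and>
        (\<forall>\<gamma>\<in>carrier \<Gamma>. \<forall>x\<in>space M. f (act \<gamma> x) = f x) \<longrightarrow>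
        (\<exists>c. AE x in M. f x = c))"


section \<open>Well-definedness of the constructions\<close>

lemma flip_flip [simp]: "flip (flip x) = x"
  by (simp add: flip_def)

lemma flip_neq [simp]: "flip x \<noteq> x" "x \<noteq> flip x"
  by (auto simp: flip_def prod_eq_iff)

lemma flip_swap: "flip x = y \<longleftrightarrow> x = flip y"
  by (metis flip_flip)

lemma reduced_Nil [simp]: "reduced []"
  and reduced_single [simp]: "reduced [x]"
  and reduced_Cons2 [simp]: "reduced (x # y # w) \<longleftrightarrow> y \<noteq> flip x \<and> reduced (y # w)"
  by (simp_all add: reduced_def)

lemma reduced_tl: "reduced (x # w) \<Longrightarrow> reduced w"
  by (cases w) auto

lemma prepend_reduced: "reduced w \<Longrightarrow> reduced (prepend x w)"
  by (cases w) (auto dest: reduced_tl)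

lemma foldr_prepend_reduced: "reduced w \<Longrightarrow> reduced (foldr prepend u w)"
  by (induction u) (auto intro: prepend_reduced)

lemma prepend_flip: "reduced w \<Longrightarrow> prepend x (prepend (flip x) w) = w"
  by (cases w; cases "tl w") auto

lemma foldr_prepend_prepend:
  assumes "reduced w" "reduced v"
  shows "foldr prepend (prepend x v) w = prepend x (foldr prepend v w)"
proof (cases v)
  case (Cons y v')
  have "prepend x (prepend (flip x) (foldr prepend v' w)) = foldr prepend v' w"
    by (intro prepend_flip foldr_prepend_reduced assms)
  with Cons show ?thesis by simp
qed simp

lemma foldr_prepend_assoc:
  assumes "reduced v" "reduced w"
  shows "foldr prepend (foldr prepend u v) w = foldr prepend u (foldr prepend v w)"
  by (induction u) (simp_all add: foldr_prepend_prepend foldr_prepend_reduced assms)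

lemma set_prepend: "fst ` set (prepend x w) \<subseteq> insert (fst x) (fst ` set w)"
  by (cases w) auto

lemma set_foldr_prepend: "fst ` set (foldr prepend u w) \<subseteq> fst ` set u \<union> fst ` set w"
proof (induction u)
  case (Cons x u)
  have "fst ` set (foldr prepend (x # u) w) \<subseteq> insert (fst x) (fst ` set (foldr prepend u w))"
    using set_prepend[of x "foldr prepend u w"] by simp
  also have "\<dots> \<subseteq> fst ` set (x # u) \<union> fst ` set w"
    using Cons by auto
  finally show ?case .
qed simp

lemma foldr_prepend_Nil: "reduced w \<Longrightarrow> foldr prepend w [] = w"
proof (induction w)
  case (Cons x w)
  then show ?case by (cases w) auto
qed simp

lemma reduced_inverse_word: "reduced w \<Longrightarrow> reduced (rev (map flip w))"
proof -
  assume "reduced w"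
  then show ?thesis
    unfolding reduced_def successively_rev successively_map
    by (rule successively_mono) (metis flip_flip)
qed

lemma foldr_inverse_word: "reduced z \<Longrightarrow> foldr prepend (rev (map flip w)) (foldr prepend w z) = z"
proof (induction w)
  case (Cons x w)
  then show ?case
    using prepend_flip[of "foldr prepend w z" "flip x"] by (simp add: foldr_prepend_reduced)
qed simp

theorem group_free_group: "group (free_group S)"
proof (rule groupI)
  fix w assume w: "w \<in> carrier (free_group S)"
  show "\<exists>v\<in>carrier (free_group S). v \<otimes>\<^bsub>free_group S\<^esub> w = \<one>\<^bsub>free_group S\<^esub>"
  proof
    show "rev (map flip w) \<in> carrier (free_group S)"
      using w by (auto simp: free_group_def reduced_inverse_word flip_def)
    show "rev (map flip w) \<otimes>\<^bsub>free_group S\<^esub> w = \<one>\<^bsub>free_group S\<^esub>"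
      using w foldr_inverse_word[of "[]" w] by (simp add: free_group_def foldr_prepend_Nil)
  qed
next
  fix u v assume "u \<in> carrier (free_group S)" "v \<in> carrier (free_group S)"
  then have "reduced v" "fst ` set u \<union> fst ` set v \<subseteq> S"
    by (auto simp: free_group_def)
  then show "u \<otimes>\<^bsub>free_group S\<^esub> v \<in> carrier (free_group S)"
    using subset_trans[OF set_foldr_prepend[of u v]]
    by (simp add: free_group_def foldr_prepend_reduced)
qed (auto simp: free_group_def foldr_prepend_assoc)

definition letter_value :: "('g, 'm) monoid_scheme \<Rightarrow> ('a \<Rightarrow> 'g) \<Rightarrow> 'a \<times> bool \<Rightarrow> 'g" where
  "letter_value G f x = (if snd x then f (fst x) else inv\<^bsub>G\<^esub> (f (fst x)))"

definition word_value :: "('g, 'm) monoid_scheme \<Rightarrow> ('a \<Rightarrow> 'g) \<Rightarrow> ('a \<times> bool) list \<Rightarrow> 'g" where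
  "word_value G f w = foldr (\<lambda>x z. letter_value G f x \<otimes>\<^bsub>G\<^esub> z) w \<one>\<^bsub>G\<^esub>"

lemma word_value_simps [simp]:
  "word_value G f [] = \<one>\<^bsub>G\<^esub>"
  "word_value G f (x # w) = letter_value G f x \<otimes>\<^bsub>G\<^esub> word_value G f w"
  by (simp_all add: word_value_def)

context
  fixes G :: "('g, 'm) monoid_scheme" (structure) and S :: "'a set" and f :: "'a \<Rightarrow> 'g"
  assumes G: "group G" and f: "f \<in> S \<rightarrow> carrier G"
begin

interpretation group G by (rule G)

lemma letter_value_closed: "fst x \<in> S \<Longrightarrow> letter_value G f x \<in> carrier G"
  using f by (auto simp: letter_value_def)

lemma letter_value_flip: "fst x \<in> S \<Longrightarrow> letter_value G f (flip x) = inv (letter_value G f x)"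
  using f by (cases "snd x") (auto simp: letter_value_def flip_def Pi_iff)

lemma word_value_closed: "fst ` set w \<subseteq> S \<Longrightarrow> word_value G f w \<in> carrier G"
  by (induction w) (auto simp: letter_value_closed)

lemma word_value_prepend:
  assumes "fst x \<in> S" "fst ` set w \<subseteq> S"
  shows "word_value G f (prepend x w) = letter_value G f x \<otimes> word_value G f w"
  using assms
  by (cases w) (auto simp: letter_value_flip letter_value_closed word_value_closed m_assoc[symmetric])

lemma word_value_foldr:
  assumes "fst ` set u \<subseteq> S" "fst ` set w \<subseteq> S"
  shows "word_value G f (foldr prepend u w) = word_value G f u \<otimes> word_value G f w"
  using assms(1)
proof (induction u)
  case (Cons x u)
  have "fst ` set (foldr prepend u w) \<subseteq> S"
    by (rule subset_trans[OF set_foldr_prepend]) (use Cons.prems assms(2) in auto)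
  then show ?case using Cons assms
    by (auto simp: word_value_prepend m_assoc letter_value_closed word_value_closed)
qed (simp add: word_value_closed assms)

lemma word_value_Hom: "restrict (word_value G f) (carrier (free_group S)) \<in> Hom (free_group S) G"
  using group.is_monoid[OF group_free_group[of S], THEN monoid.m_closed]
  by (auto simp: Hom_def hom_def word_value_closed free_group_def word_value_foldr)

lemma Hom_free_group_unique:
  assumes \<rho>: "\<rho> \<in> Hom (free_group S) G" and eq: "\<And>s. s \<in> S \<Longrightarrow> \<rho> (gen s) = f s"
    and w: "w \<in> carrier (free_group S)"
  shows "\<rho> w = word_value G f w"
proof -
  interpret FG: group "free_group S" by (rule group_free_group)
  interpret h: group_hom "free_group S" G \<rho>
    using \<rho> by unfold_locales (auto simp: Hom_def)
  have gen_in: "[x] \<in> carrier (free_group S)" if "fst x \<in> S" for x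
    using that by (auto simp: free_group_def)
  have letter: "\<rho> [x] = letter_value G f x" if x: "fst x \<in> S" for x
  proof (cases "snd x")
    case True
    then have "[x] = gen (fst x)" by (simp add: gen_def prod_eq_iff)
    then show ?thesis using True x by (simp add: eq letter_value_def)
  next
    case False
    then have "flip x = (fst x, True)" by (simp add: flip_def)
    then have g: "[flip x] = gen (fst x)" by (simp add: gen_def)
    have "[x] \<otimes>\<^bsub>free_group S\<^esub> [flip x] = \<one>\<^bsub>free_group S\<^esub>"
      by (simp add: free_group_def)
    moreover have fx: "[flip x] \<in> carrier (free_group S)"
      using x by (intro gen_in) (simp add: flip_def)
    ultimately have "[x] = inv\<^bsub>free_group S\<^esub> [flip x]"
      using gen_in[OF x] FG.inv_equality by metis
    then have "\<rho> [x] = inv (\<rho> [flip x])" using fx by simp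
    then show ?thesis using False x g by (simp add: eq letter_value_def)
  qed
  show ?thesis using w
  proof (induction w)
    case Nil
    then show ?case using h.hom_one by (simp add: free_group_def)
  next
    case (Cons x w)
    have x: "fst x \<in> S" and w: "w \<in> carrier (free_group S)"
      using Cons.prems by (auto simp: free_group_def dest: reduced_tl)
    have "x # w = [x] \<otimes>\<^bsub>free_group S\<^esub> w"
      using Cons.prems by (cases w) (auto simp: free_group_def)
    then have "\<rho> (x # w) = \<rho> [x] \<otimes> \<rho> w" using gen_in[OF x] w by simp
    then show ?case using Cons.IH[OF w] letter[OF x] by simp
  qed
qed

end

lemma gen_in_free_group: "s \<in> S \<Longrightarrow> gen s \<in> carrier (free_group S)"
  by (simp add: gen_def free_group_def)

theorem bij_betw_gen_values:
  assumes G: "group G"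
  shows "bij_betw (gen_values n) (Hom (free_group {..<n}) G) (\<Pi>\<^sub>E i\<in>{..<n}. carrier G)"
proof (rule bij_betwI')
  interpret group G by (rule G)
  let ?F = "free_group {..<n}"
  have closed: "\<rho> (gen i) \<in> carrier G" if "\<rho> \<in> Hom ?F G" "i < n" for \<rho> i
    using that gen_in_free_group[of i "{..<n}"] by (auto simp: Hom_def hom_def)
  show "gen_values n \<rho> \<in> (\<Pi>\<^sub>E i\<in>{..<n}. carrier G)" if "\<rho> \<in> Hom ?F G" for \<rho>
    using that closed by (auto simp: gen_values_def)
  show "(gen_values n \<rho> = gen_values n \<sigma>) = (\<rho> = \<sigma>)"
    if \<rho>: "\<rho> \<in> Hom ?F G" and \<sigma>: "\<sigma> \<in> Hom ?F G" for \<rho> \<sigma>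
  proof
    assume eq: "gen_values n \<rho> = gen_values n \<sigma>"
    have "\<sigma> (gen i) = \<rho> (gen i)" if "i \<in> {..<n}" for i
      using fun_cong[OF eq, of i] that by (simp add: gen_values_def)
    moreover have "(\<lambda>i. \<rho> (gen i)) \<in> {..<n} \<rightarrow> carrier G"
      using closed[OF \<rho>] by auto
    ultimately have "\<rho> w = \<sigma> w" if "w \<in> carrier ?F" for w
      using Hom_free_group_unique[OF G _ \<rho> _ that, of "\<lambda>i. \<rho> (gen i)"]
        Hom_free_group_unique[OF G _ \<sigma> _ that, of "\<lambda>i. \<rho> (gen i)"] by simp
    then show "\<rho> = \<sigma>"
      using \<rho> \<sigma> by (auto simp: Hom_def intro: extensionalityI)
  qed simp
  fix f assume f: "f \<in> (\<Pi>\<^sub>E i\<in>{..<n}. carrier G)"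
  then have f': "f \<in> {..<n} \<rightarrow> carrier G" by auto
  let ?\<rho> = "restrict (word_value G f) (carrier ?F)"
  have "?\<rho> \<in> Hom ?F G" by (rule word_value_Hom[OF G f'])
  moreover have "f = gen_values n ?\<rho>"
  proof
    fix i show "f i = gen_values n ?\<rho> i"
    proof (cases "i < n")
      case True
      then have "f i \<in> carrier G" using f by auto
      then show ?thesis using True gen_in_free_group[of i "{..<n}"]
        by (simp add: gen_values_def gen_def letter_value_def)
    next
      case False
      then show ?thesis using PiE_arb[OF f, of i] by (simp add: gen_values_def)
    qed
  qed
  ultimately show "\<exists>\<rho>\<in>Hom ?F G. f = gen_values n \<rho>" by blast
qed

theorem group_action_conj_act:
  assumes G: "group G" and \<Gamma>: "group \<Gamma>"
  shows "group_action G (Hom \<Gamma> G) (conj_act \<Gamma> G)"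
proof -
  interpret group G by (rule G)
  interpret \<Gamma>: group \<Gamma> by (rule \<Gamma>)
  have val: "\<rho> w \<in> carrier G" if "\<rho> \<in> Hom \<Gamma> G" "w \<in> carrier \<Gamma>" for \<rho> w
    using that by (auto simp: Hom_def hom_def)
  have closed: "conj_act \<Gamma> G g \<rho> \<in> Hom \<Gamma> G" if g: "g \<in> carrier G" and \<rho>: "\<rho> \<in> Hom \<Gamma> G" for g \<rho>
  proof -
    have "g \<otimes>\<^bsub>G\<^esub> (\<rho> x \<otimes>\<^bsub>G\<^esub> \<rho> y) \<otimes>\<^bsub>G\<^esub> inv\<^bsub>G\<^esub> g =
        (g \<otimes>\<^bsub>G\<^esub> \<rho> x \<otimes>\<^bsub>G\<^esub> inv\<^bsub>G\<^esub> g) \<otimes>\<^bsub>G\<^esub> (g \<otimes>\<^bsub>G\<^esub> \<rho> y \<otimes>\<^bsub>G\<^esub> inv\<^bsub>G\<^esub> g)"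
      if "x \<in> carrier \<Gamma>" "y \<in> carrier \<Gamma>" for x y
    proof -
      have "inv\<^bsub>G\<^esub> g \<otimes>\<^bsub>G\<^esub> (g \<otimes>\<^bsub>G\<^esub> z) = z" if "z \<in> carrier G" for z
        using that g by (simp add: m_assoc[symmetric])
      then show ?thesis using val[OF \<rho>] that g by (simp add: m_assoc)
    qed
    then show ?thesis
      using \<rho> g val[OF \<rho>] by (auto simp: conj_act_def Hom_def hom_def)
  qed
  have comp: "conj_act \<Gamma> G g (conj_act \<Gamma> G h \<rho>) = conj_act \<Gamma> G (g \<otimes>\<^bsub>G\<^esub> h) \<rho>"
    if g: "g \<in> carrier G" and h: "h \<in> carrier G" and \<rho>: "\<rho> \<in> Hom \<Gamma> G" for g h \<rho>
  proof -
    have "g \<otimes>\<^bsub>G\<^esub> (h \<otimes>\<^bsub>G\<^esub> \<rho> w \<otimes>\<^bsub>G\<^esub> inv\<^bsub>G\<^esub> h) \<otimes>\<^bsub>G\<^esub> inv\<^bsub>G\<^esub> g =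
        g \<otimes>\<^bsub>G\<^esub> h \<otimes>\<^bsub>G\<^esub> \<rho> w \<otimes>\<^bsub>G\<^esub> inv\<^bsub>G\<^esub> (g \<otimes>\<^bsub>G\<^esub> h)" if "w \<in> carrier \<Gamma>" for w
      using val[OF \<rho>] that g h by (simp add: m_assoc inv_mult_group)
    then have "(\<lambda>w\<in>carrier \<Gamma>. g \<otimes>\<^bsub>G\<^esub> conj_act \<Gamma> G h \<rho> w \<otimes>\<^bsub>G\<^esub> inv\<^bsub>G\<^esub> g) =
        (\<lambda>w\<in>carrier \<Gamma>. g \<otimes>\<^bsub>G\<^esub> h \<otimes>\<^bsub>G\<^esub> \<rho> w \<otimes>\<^bsub>G\<^esub> inv\<^bsub>G\<^esub> (g \<otimes>\<^bsub>G\<^esub> h))"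
      using \<rho> by (intro restrict_ext) (simp add: conj_act_def)
    then show ?thesis using closed[OF h \<rho>] \<rho> by (simp add: conj_act_def)
  qed
  have one: "conj_act \<Gamma> G \<one>\<^bsub>G\<^esub> \<rho> = \<rho>" if \<rho>: "\<rho> \<in> Hom \<Gamma> G" for \<rho>
  proof -
    have "(\<lambda>w\<in>carrier \<Gamma>. \<one>\<^bsub>G\<^esub> \<otimes>\<^bsub>G\<^esub> \<rho> w \<otimes>\<^bsub>G\<^esub> inv\<^bsub>G\<^esub> \<one>\<^bsub>G\<^esub>) = \<rho>"
      using \<rho> val[OF \<rho>] by (intro extensionalityI[of _ "carrier \<Gamma>"]) (auto simp: Hom_def)
    then show ?thesis using \<rho> by (simp add: conj_act_def)
  qed
  have bij: "conj_act \<Gamma> G g \<in> Bij (Hom \<Gamma> G)" if g: "g \<in> carrier G" for g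
  proof -
    have "bij_betw (conj_act \<Gamma> G g) (Hom \<Gamma> G) (Hom \<Gamma> G)"
      by (rule bij_betw_byWitness[where f' = "conj_act \<Gamma> G (inv\<^bsub>G\<^esub> g)"])
        (use g in \<open>auto simp: comp one closed\<close>)
    then show ?thesis by (simp add: Bij_def conj_act_def)
  qed
  have "conj_act \<Gamma> G (g \<otimes>\<^bsub>G\<^esub> h) = compose (Hom \<Gamma> G) (conj_act \<Gamma> G g) (conj_act \<Gamma> G h)"
    if "g \<in> carrier G" "h \<in> carrier G" for g h
    by (rule extensionalityI[of _ "Hom \<Gamma> G"])
      (use that comp in \<open>auto simp: compose_def\<close>, simp add: conj_act_def)
  then have "conj_act \<Gamma> G \<in> hom G (BijGroup (Hom \<Gamma> G))"
    by (auto simp: hom_def BijGroup_def bij)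
  then show ?thesis
    by (simp add: group_action_def group_hom_def group_hom_axioms_def group_BijGroup G)
qed

lemma AutoGroup_simps:
  "carrier (AutoGroup \<Gamma>) = auto \<Gamma>"
  "\<one>\<^bsub>AutoGroup \<Gamma>\<^esub> = (\<lambda>w\<in>carrier \<Gamma>. w)"
  "\<phi> \<in> auto \<Gamma> \<Longrightarrow> \<psi> \<in> auto \<Gamma> \<Longrightarrow> \<phi> \<otimes>\<^bsub>AutoGroup \<Gamma>\<^esub> \<psi> = compose (carrier \<Gamma>) \<phi> \<psi>"
  by (auto simp: AutoGroup_def BijGroup_def auto_def)

lemma autoD:
  assumes "\<phi> \<in> auto \<Gamma>"
  shows "\<phi> \<in> hom \<Gamma> \<Gamma>" "\<phi> \<in> extensional (carrier \<Gamma>)" "w \<in> carrier \<Gamma> \<Longrightarrow> \<phi> w \<in> carrier \<Gamma>"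
  using assms by (auto simp: auto_def Bij_def hom_def)

context
  fixes \<Gamma> :: "('a, 'k) monoid_scheme" (structure)
  assumes \<Gamma>: "group \<Gamma>"
begin

interpretation group \<Gamma> by (rule \<Gamma>)
interpretation Aut: group "AutoGroup \<Gamma>" by (rule AutoGroup)

abbreviation (input) inn :: "'a \<Rightarrow> 'a \<Rightarrow> 'a" where
  "inn g \<equiv> \<lambda>h\<in>carrier \<Gamma>. g \<otimes> h \<otimes> inv g"

lemma inn_auto:
  assumes g: "g \<in> carrier \<Gamma>" shows "inn g \<in> auto \<Gamma>"
proof -
  have "inv g \<otimes> (g \<otimes> z) = z" if "z \<in> carrier \<Gamma>" for z
    using that g by (simp add: m_assoc[symmetric])
  then have "inn g \<in> hom \<Gamma> \<Gamma>"
    using g by (auto simp: hom_def m_assoc)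
  moreover have "inn g \<in> Bij (carrier \<Gamma>)"
    using conjugation_is_hom g by (auto simp: hom_def BijGroup_def)
  ultimately show ?thesis by (simp add: auto_def)
qed

lemma inn_hom: "inn \<in> hom \<Gamma> (AutoGroup \<Gamma>)"
  using conjugation_is_hom inn_auto by (simp add: hom_def AutoGroup_def Pi_iff)

theorem Inn_normal: "Inn \<Gamma> \<lhd> AutoGroup \<Gamma>"
proof -
  interpret h: group_hom \<Gamma> "AutoGroup \<Gamma>" inn
    by unfold_locales (rule inn_hom)
  have "\<phi> \<otimes>\<^bsub>AutoGroup \<Gamma>\<^esub> h \<otimes>\<^bsub>AutoGroup \<Gamma>\<^esub> inv\<^bsub>AutoGroup \<Gamma>\<^esub> \<phi> \<in> Inn \<Gamma>"
    if \<phi>: "\<phi> \<in> auto \<Gamma>" and h: "h \<in> Inn \<Gamma>" for \<phi> h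
  proof -
    obtain g where g: "g \<in> carrier \<Gamma>" and h: "h = inn g"
      using h by (auto simp: Inn_def)
    interpret \<phi>: group_hom \<Gamma> \<Gamma> \<phi>
      by unfold_locales (rule autoD(1)[OF \<phi>])
    have "compose (carrier \<Gamma>) \<phi> (inn g) = compose (carrier \<Gamma>) (inn (\<phi> g)) \<phi>"
      using g by (intro extensionalityI[of _ "carrier \<Gamma>"]) (auto simp: compose_def)
    then have "\<phi> \<otimes>\<^bsub>AutoGroup \<Gamma>\<^esub> inn g = inn (\<phi> g) \<otimes>\<^bsub>AutoGroup \<Gamma>\<^esub> \<phi>"
      using \<phi> g by (simp add: AutoGroup_simps inn_auto del: restrict_apply)
    then have "\<phi> \<otimes>\<^bsub>AutoGroup \<Gamma>\<^esub> h \<otimes>\<^bsub>AutoGroup \<Gamma>\<^esub> inv\<^bsub>AutoGroup \<Gamma>\<^esub> \<phi> = inn (\<phi> g)"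
      using Aut.inv_solve_right'[of "inn (\<phi> g)" "\<phi> \<otimes>\<^bsub>AutoGroup \<Gamma>\<^esub> inn g" \<phi>] \<phi> g
        inn_auto[OF g] inn_auto[of "\<phi> g"] Aut.m_closed[of \<phi> "inn g"]
      by (simp only: h AutoGroup_simps(1) \<phi>.hom_closed)
    then show ?thesis using g by (auto simp: Inn_def)
  qed
  moreover have "subgroup (Inn \<Gamma>) (AutoGroup \<Gamma>)"
    unfolding Inn_def by (rule h.img_is_subgroup)
  ultimately show ?thesis
    by (simp add: Aut.normal_inv_iff AutoGroup_simps)
qed

context
  fixes G :: "('g, 'm) monoid_scheme"
  assumes G: "group G"
begin

interpretation G: group G by (rule G)
interpretation conj: group_action G "Hom \<Gamma> G" "conj_act \<Gamma> G"
  by (rule group_action_conj_act[OF G \<Gamma>])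

lemma Hom_closed: "\<rho> \<in> Hom \<Gamma> G \<Longrightarrow> w \<in> carrier \<Gamma> \<Longrightarrow> \<rho> w \<in> carrier G"
  by (auto simp: Hom_def hom_def)

lemma conj_act_closed: "g \<in> carrier G \<Longrightarrow> \<rho> \<in> Hom \<Gamma> G \<Longrightarrow> conj_act \<Gamma> G g \<rho> \<in> Hom \<Gamma> G"
  by (rule conj.element_image) auto

lemma aut_inv_auto: "\<phi> \<in> auto \<Gamma> \<Longrightarrow> inv\<^bsub>AutoGroup \<Gamma>\<^esub> \<phi> \<in> auto \<Gamma>"
  using Aut.inv_closed by (simp add: AutoGroup_simps)

lemma aut_act_apply:
  "\<rho> \<in> Hom \<Gamma> G \<Longrightarrow> w \<in> carrier \<Gamma> \<Longrightarrow> aut_act \<Gamma> G \<phi> \<rho> w = \<rho> ((inv\<^bsub>AutoGroup \<Gamma>\<^esub> \<phi>) w)"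
  by (simp add: aut_act_def compose_def)

lemma aut_act_closed:
  assumes \<phi>: "\<phi> \<in> auto \<Gamma>" and \<rho>: "\<rho> \<in> Hom \<Gamma> G"
  shows "aut_act \<Gamma> G \<phi> \<rho> \<in> Hom \<Gamma> G"
proof -
  have "compose (carrier \<Gamma>) \<rho> (inv\<^bsub>AutoGroup \<Gamma>\<^esub> \<phi>) \<in> hom \<Gamma> G"
    using \<rho> autoD(1)[OF aut_inv_auto[OF \<phi>]] by (intro hom_compose) (auto simp: Hom_def)
  then show ?thesis using \<rho> by (simp add: aut_act_def Hom_def)
qed

lemma Hom_eqI:
  "\<rho> \<in> Hom \<Gamma> G \<Longrightarrow> \<sigma> \<in> Hom \<Gamma> G \<Longrightarrow> (\<And>w. w \<in> carrier \<Gamma> \<Longrightarrow> \<rho> w = \<sigma> w) \<Longrightarrow> \<rho> = \<sigma>"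
  by (auto simp: Hom_def intro: extensionalityI)

lemma aut_act_mult:
  assumes \<phi>: "\<phi> \<in> auto \<Gamma>" and \<psi>: "\<psi> \<in> auto \<Gamma>" and \<rho>: "\<rho> \<in> Hom \<Gamma> G"
  shows "aut_act \<Gamma> G (\<phi> \<otimes>\<^bsub>AutoGroup \<Gamma>\<^esub> \<psi>) \<rho> = aut_act \<Gamma> G \<phi> (aut_act \<Gamma> G \<psi> \<rho>)"
proof (rule Hom_eqI)
  show "aut_act \<Gamma> G (\<phi> \<otimes>\<^bsub>AutoGroup \<Gamma>\<^esub> \<psi>) \<rho> \<in> Hom \<Gamma> G"
    using Aut.m_closed[of \<phi> \<psi>] \<phi> \<psi> \<rho> by (intro aut_act_closed) (auto simp: AutoGroup_simps)
  show "aut_act \<Gamma> G \<phi> (aut_act \<Gamma> G \<psi> \<rho>) \<in> Hom \<Gamma> G"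
    using \<phi> \<psi> \<rho> by (intro aut_act_closed)
  fix w assume w: "w \<in> carrier \<Gamma>"
  have "inv\<^bsub>AutoGroup \<Gamma>\<^esub> (\<phi> \<otimes>\<^bsub>AutoGroup \<Gamma>\<^esub> \<psi>) =
      compose (carrier \<Gamma>) (inv\<^bsub>AutoGroup \<Gamma>\<^esub> \<psi>) (inv\<^bsub>AutoGroup \<Gamma>\<^esub> \<phi>)"
    using \<phi> \<psi> aut_inv_auto Aut.inv_mult_group[of \<phi> \<psi>] by (simp add: AutoGroup_simps)
  then show "aut_act \<Gamma> G (\<phi> \<otimes>\<^bsub>AutoGroup \<Gamma>\<^esub> \<psi>) \<rho> w = aut_act \<Gamma> G \<phi> (aut_act \<Gamma> G \<psi> \<rho>) w"
    using w \<rho> \<psi> autoD(3)[OF aut_inv_auto[OF \<phi>] w]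
    by (simp add: aut_act_apply aut_act_closed compose_def)
qed

lemma aut_act_one:
  assumes \<rho>: "\<rho> \<in> Hom \<Gamma> G" shows "aut_act \<Gamma> G \<one>\<^bsub>AutoGroup \<Gamma>\<^esub> \<rho> = \<rho>"
proof (rule Hom_eqI[OF _ \<rho>])
  show "aut_act \<Gamma> G \<one>\<^bsub>AutoGroup \<Gamma>\<^esub> \<rho> \<in> Hom \<Gamma> G"
    using Aut.one_closed by (intro aut_act_closed \<rho>) (simp only: AutoGroup_simps(1))
  show "aut_act \<Gamma> G \<one>\<^bsub>AutoGroup \<Gamma>\<^esub> \<rho> w = \<rho> w" if w: "w \<in> carrier \<Gamma>" for w
    by (simp only: aut_act_apply[OF \<rho> w] Aut.inv_one) (simp add: w AutoGroup_simps)
qed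

lemma aut_act_inn:
  assumes g: "g \<in> carrier \<Gamma>" and \<rho>: "\<rho> \<in> Hom \<Gamma> G"
  shows "aut_act \<Gamma> G (inn g) \<rho> = conj_act \<Gamma> G (inv\<^bsub>G\<^esub> (\<rho> g)) \<rho>"
proof (rule Hom_eqI)
  interpret h: group_hom \<Gamma> "AutoGroup \<Gamma>" inn
    by unfold_locales (rule inn_hom)
  interpret \<rho>: group_hom \<Gamma> G \<rho>
    by unfold_locales (use \<rho> in \<open>simp add: Hom_def\<close>)
  show "aut_act \<Gamma> G (inn g) \<rho> \<in> Hom \<Gamma> G"
    by (intro aut_act_closed inn_auto g \<rho>)
  show "conj_act \<Gamma> G (inv\<^bsub>G\<^esub> (\<rho> g)) \<rho> \<in> Hom \<Gamma> G"
    by (intro conj_act_closed \<rho>) (use g in simp)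
  fix w assume w: "w \<in> carrier \<Gamma>"
  have "aut_act \<Gamma> G (inn g) \<rho> w = \<rho> (inn (inv g) w)"
    by (simp only: aut_act_apply[OF \<rho> w] h.hom_inv[OF g, symmetric])
  then show "aut_act \<Gamma> G (inn g) \<rho> w = conj_act \<Gamma> G (inv\<^bsub>G\<^esub> (\<rho> g)) \<rho> w"
    using g w \<rho> by (simp add: conj_act_def)
qed

lemma aut_act_conj_act:
  assumes \<phi>: "\<phi> \<in> auto \<Gamma>" and g: "g \<in> carrier G" and \<rho>: "\<rho> \<in> Hom \<Gamma> G"
  shows "aut_act \<Gamma> G \<phi> (conj_act \<Gamma> G g \<rho>) = conj_act \<Gamma> G g (aut_act \<Gamma> G \<phi> \<rho>)"
proof (rule Hom_eqI)
  show "aut_act \<Gamma> G \<phi> (conj_act \<Gamma> G g \<rho>) \<in> Hom \<Gamma> G" "conj_act \<Gamma> G g (aut_act \<Gamma> G \<phi> \<rho>) \<in> Hom \<Gamma> G"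
    by (intro aut_act_closed conj_act_closed \<phi> g \<rho>)+
  fix w assume w: "w \<in> carrier \<Gamma>"
  show "aut_act \<Gamma> G \<phi> (conj_act \<Gamma> G g \<rho>) w = conj_act \<Gamma> G g (aut_act \<Gamma> G \<phi> \<rho>) w"
    using w \<rho> autoD(3)[OF aut_inv_auto[OF \<phi>] w]
    by (simp add: aut_act_apply[OF conj_act_closed[OF g \<rho>]])
       (simp add: conj_act_def aut_act_closed[OF \<phi>] aut_act_apply)
qed

theorem out_act_conj_class:
  assumes \<phi>: "\<phi> \<in> auto \<Gamma>" and \<rho>: "\<rho> \<in> Hom \<Gamma> G"
  shows "out_act \<Gamma> G (Inn \<Gamma> #>\<^bsub>AutoGroup \<Gamma>\<^esub> \<phi>) (conj_class \<Gamma> G \<rho>) =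
    conj_class \<Gamma> G (aut_act \<Gamma> G \<phi> \<rho>)"
proof -
  let ?A = "aut_act \<Gamma> G" and ?c = "conj_act \<Gamma> G" and ?\<sigma> = "aut_act \<Gamma> G \<phi> \<rho>"
  have \<sigma>: "?\<sigma> \<in> Hom \<Gamma> G" by (rule aut_act_closed[OF \<phi> \<rho>])
  have eq: "?A (inn g \<otimes>\<^bsub>AutoGroup \<Gamma>\<^esub> \<phi>) (?c h \<rho>) =
      ?c (inv\<^bsub>G\<^esub> (?c h ?\<sigma> g) \<otimes>\<^bsub>G\<^esub> h) ?\<sigma>"
    if g: "g \<in> carrier \<Gamma>" and h: "h \<in> carrier G" for g h
  proof -
    have "?A (inn g \<otimes>\<^bsub>AutoGroup \<Gamma>\<^esub> \<phi>) (?c h \<rho>) = ?A (inn g) (?c h ?\<sigma>)"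
      by (simp only: aut_act_mult[OF inn_auto[OF g] \<phi> conj_act_closed[OF h \<rho>]]
          aut_act_conj_act[OF \<phi> h \<rho>])
    also have "\<dots> = ?c (inv\<^bsub>G\<^esub> (?c h ?\<sigma> g)) (?c h ?\<sigma>)"
      by (rule aut_act_inn[OF g conj_act_closed[OF h \<sigma>]])
    also have "\<dots> = ?c (inv\<^bsub>G\<^esub> (?c h ?\<sigma> g) \<otimes>\<^bsub>G\<^esub> h) ?\<sigma>"
      by (rule conj.composition_rule[symmetric])
        (use \<sigma> h Hom_closed[OF conj_act_closed[OF h \<sigma>] g] in auto)
    finally show ?thesis .
  qed
  have "{?A \<alpha> \<tau> | \<alpha> \<tau>. \<alpha> \<in> Inn \<Gamma> #>\<^bsub>AutoGroup \<Gamma>\<^esub> \<phi> \<and> \<tau> \<in> conj_class \<Gamma> G \<rho>} =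
      conj_class \<Gamma> G ?\<sigma>" (is "?L = ?R")
  proof (intro subset_antisym subsetI)
    fix x assume "x \<in> ?L"
    then obtain g h where g: "g \<in> carrier \<Gamma>" and h: "h \<in> carrier G"
      and x: "x = ?A (inn g \<otimes>\<^bsub>AutoGroup \<Gamma>\<^esub> \<phi>) (?c h \<rho>)"
      by (auto simp: r_coset_def Inn_def conj_class_def orbit_def)
    have "inv\<^bsub>G\<^esub> (?c h ?\<sigma> g) \<otimes>\<^bsub>G\<^esub> h \<in> carrier G"
      using h Hom_closed[OF conj_act_closed[OF h \<sigma>] g] by simp
    then show "x \<in> ?R" unfolding x eq[OF g h] conj_class_def orbit_def by blast
  next
    fix x assume "x \<in> ?R"
    then obtain h where h: "h \<in> carrier G" and x: "x = ?c h ?\<sigma>"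
      by (auto simp: conj_class_def orbit_def)
    have "x = ?A \<phi> (?c h \<rho>)" by (simp only: x aut_act_conj_act[OF \<phi> h \<rho>])
    moreover have "\<phi> \<in> Inn \<Gamma> #>\<^bsub>AutoGroup \<Gamma>\<^esub> \<phi>"
      using Aut.rcos_self[of \<phi> "Inn \<Gamma>"] normal_imp_subgroup[OF Inn_normal] \<phi>
      by (simp add: AutoGroup_simps)
    moreover have "?c h \<rho> \<in> conj_class \<Gamma> G \<rho>"
      using h by (auto simp: conj_class_def orbit_def)
    ultimately show "x \<in> ?L" by blast
  qed
  moreover have "conj_class \<Gamma> G \<rho> \<in> Hom_mod \<Gamma> G"
    using \<rho> by (auto simp: conj_class_def Hom_mod_def orbits_def)
  ultimately show ?thesis by (simp add: out_act_def)
qed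

theorem group_action_out_act: "group_action (Out \<Gamma>) (Hom_mod \<Gamma> G) (out_act \<Gamma> G)"
proof -
  interpret N: normal "Inn \<Gamma>" "AutoGroup \<Gamma>" by (rule Inn_normal)
  let ?cl = "\<lambda>\<phi>. Inn \<Gamma> #>\<^bsub>AutoGroup \<Gamma>\<^esub> \<phi>"
  have Out: "group (Out \<Gamma>)" unfolding Out_def by (rule N.factorgroup_is_group)
  have Out_elem: "\<exists>\<phi>\<in>auto \<Gamma>. C = ?cl \<phi>" if "C \<in> carrier (Out \<Gamma>)" for C
    using that by (auto simp: Out_def FactGroup_def RCOSETS_def AutoGroup_simps)
  have Out_mult: "?cl \<phi> \<otimes>\<^bsub>Out \<Gamma>\<^esub> ?cl \<psi> = ?cl (\<phi> \<otimes>\<^bsub>AutoGroup \<Gamma>\<^esub> \<psi>)"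
    if "\<phi> \<in> auto \<Gamma>" "\<psi> \<in> auto \<Gamma>" for \<phi> \<psi>
    using that N.rcos_sum by (simp add: Out_def FactGroup_def AutoGroup_simps)
  have Hom_mod_elem: "\<exists>\<rho>\<in>Hom \<Gamma> G. c = conj_class \<Gamma> G \<rho>" if "c \<in> Hom_mod \<Gamma> G" for c
    using that by (auto simp: conj_class_def Hom_mod_def orbits_def)
  have closed: "out_act \<Gamma> G C c \<in> Hom_mod \<Gamma> G" if "C \<in> carrier (Out \<Gamma>)" "c \<in> Hom_mod \<Gamma> G" for C c
    using Out_elem[OF that(1)] Hom_mod_elem[OF that(2)] aut_act_closed
    by (auto simp: out_act_conj_class) (auto simp: conj_class_def Hom_mod_def orbits_def)
  have mult: "out_act \<Gamma> G (C \<otimes>\<^bsub>Out \<Gamma>\<^esub> D) c = out_act \<Gamma> G C (out_act \<Gamma> G D c)"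
    if C: "C \<in> carrier (Out \<Gamma>)" and D: "D \<in> carrier (Out \<Gamma>)" and c: "c \<in> Hom_mod \<Gamma> G" for C D c
  proof -
    obtain \<phi> \<psi> \<rho> where *: "\<phi> \<in> auto \<Gamma>" "\<psi> \<in> auto \<Gamma>" "\<rho> \<in> Hom \<Gamma> G"
      "C = ?cl \<phi>" "D = ?cl \<psi>" "c = conj_class \<Gamma> G \<rho>"
      using Out_elem[OF C] Out_elem[OF D] Hom_mod_elem[OF c] by blast
    have "\<phi> \<otimes>\<^bsub>AutoGroup \<Gamma>\<^esub> \<psi> \<in> auto \<Gamma>"
      using Aut.m_closed[of \<phi> \<psi>] * by (simp only: AutoGroup_simps)
    then show ?thesis
      using * by (simp only: Out_mult out_act_conj_class aut_act_closed aut_act_mult)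
  qed
  have one: "out_act \<Gamma> G \<one>\<^bsub>Out \<Gamma>\<^esub> c = c" if c: "c \<in> Hom_mod \<Gamma> G" for c
  proof -
    obtain \<rho> where \<rho>: "\<rho> \<in> Hom \<Gamma> G" "c = conj_class \<Gamma> G \<rho>" using Hom_mod_elem[OF c] by blast
    have "\<one>\<^bsub>Out \<Gamma>\<^esub> = ?cl \<one>\<^bsub>AutoGroup \<Gamma>\<^esub>"
      using Aut.coset_mult_one[OF N.subset] by (simp add: Out_def FactGroup_def)
    moreover have "\<one>\<^bsub>AutoGroup \<Gamma>\<^esub> \<in> auto \<Gamma>"
      using Aut.one_closed by (simp only: AutoGroup_simps(1))
    ultimately show ?thesis using \<rho> by (simp add: out_act_conj_class aut_act_one)
  qed
  have bij: "out_act \<Gamma> G C \<in> Bij (Hom_mod \<Gamma> G)" if C: "C \<in> carrier (Out \<Gamma>)" for C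
  proof -
    have "inv\<^bsub>Out \<Gamma>\<^esub> C \<in> carrier (Out \<Gamma>)" using group.inv_closed[OF Out C] .
    then have "bij_betw (out_act \<Gamma> G C) (Hom_mod \<Gamma> G) (Hom_mod \<Gamma> G)"
      by (intro bij_betw_byWitness[where f' = "out_act \<Gamma> G (inv\<^bsub>Out \<Gamma>\<^esub> C)"])
        (use C closed in \<open>auto simp: mult[symmetric] one group.l_inv[OF Out] group.r_inv[OF Out]\<close>)
    then show ?thesis by (simp add: Bij_def out_act_def)
  qed
  have "out_act \<Gamma> G (C \<otimes>\<^bsub>Out \<Gamma>\<^esub> D) = compose (Hom_mod \<Gamma> G) (out_act \<Gamma> G C) (out_act \<Gamma> G D)"
    if "C \<in> carrier (Out \<Gamma>)" "D \<in> carrier (Out \<Gamma>)" for C D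
    by (rule extensionalityI[of _ "Hom_mod \<Gamma> G"])
      (use that mult in \<open>auto simp: compose_def\<close>, simp add: out_act_def)
  then have "out_act \<Gamma> G \<in> hom (Out \<Gamma>) (BijGroup (Hom_mod \<Gamma> G))"
    by (auto simp: hom_def BijGroup_def bij)
  then show ?thesis
    by (simp add: group_action_def group_hom_def group_hom_axioms_def group_BijGroup Out)
qed

end

end

lemma
  assumes G: "group G" and \<mu>: "space \<mu> = carrier G"
  shows space_Hom_measure: "space (Hom_measure n G \<mu>) = Hom (free_group {..<n}) G"
    and sets_Hom_measure: "sets (Hom_measure n G \<mu>) =
      (\<lambda>B. {\<rho>\<in>Hom (free_group {..<n}) G. gen_values n \<rho> \<in> B}) ` sets (\<Pi>\<^sub>M i\<in>{..<n}. \<mu>)"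
    and emeasure_Hom_measure: "B \<in> sets (\<Pi>\<^sub>M i\<in>{..<n}. \<mu>) \<Longrightarrow>
      emeasure (Hom_measure n G \<mu>) {\<rho>\<in>Hom (free_group {..<n}) G. gen_values n \<rho> \<in> B} =
      emeasure (\<Pi>\<^sub>M i\<in>{..<n}. \<mu>) B"
proof -
  let ?H = "Hom (free_group {..<n}) G" and ?P = "\<Pi>\<^sub>M i\<in>{..<n}. \<mu>"
  let ?V = "vimage_algebra ?H (gen_values n) ?P" and ?inv = "inv_into ?H (gen_values n)"
  have P: "space ?P = (\<Pi>\<^sub>E i\<in>{..<n}. carrier G)"
    by (simp add: space_PiM \<mu>)
  have bij: "bij_betw (gen_values n) ?H (space ?P)"
    unfolding P by (rule bij_betw_gen_values[OF G])
  have sets: "sets ?V = (\<lambda>B. {\<rho>\<in>?H. gen_values n \<rho> \<in> B}) ` sets ?P"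
    using bij by (subst sets_vimage_algebra2) (auto simp: bij_betw_def)
  have preimage: "?inv -` {\<rho>\<in>?H. gen_values n \<rho> \<in> B} \<inter> space ?P = B" if "B \<in> sets ?P" for B
    using sets.sets_into_space[OF that] bij_betw_inv_into[OF bij] bij_betw_inv_into_right[OF bij]
    by (auto simp: bij_betw_def)
  have "?inv \<in> measurable ?P ?V"
    by (rule measurableI)
      (use bij_betw_inv_into[OF bij] preimage in \<open>auto simp: sets bij_betw_def\<close>)
  then show "B \<in> sets ?P \<Longrightarrow>
      emeasure (Hom_measure n G \<mu>) {\<rho>\<in>?H. gen_values n \<rho> \<in> B} = emeasure ?P B"
    unfolding Hom_measure_def by (subst emeasure_distr) (auto simp: sets preimage simp del: vimage_Collect_eq)
  show "space (Hom_measure n G \<mu>) = ?H"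
    by (simp add: Hom_measure_def)
  show "sets (Hom_measure n G \<mu>) = (\<lambda>B. {\<rho>\<in>?H. gen_values n \<rho> \<in> B}) ` sets ?P"
    by (simp add: Hom_measure_def sets)
qed

lemma
  assumes G: "group G" and \<mu>: "space \<mu> = carrier G"
  shows space_Hom_mod_measure: "space (Hom_mod_measure n G \<mu>) = Hom_mod (free_group {..<n}) G"
    and sets_Hom_mod_measure: "sets (Hom_mod_measure n G \<mu>) =
      {B. B \<subseteq> Hom_mod (free_group {..<n}) G \<and>
        {\<rho>\<in>Hom (free_group {..<n}) G. conj_class (free_group {..<n}) G \<rho> \<in> B}
          \<in> sets (Hom_measure n G \<mu>)}"
    and emeasure_Hom_mod_measure: "B \<in> sets (Hom_mod_measure n G \<mu>) \<Longrightarrow>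
      emeasure (Hom_mod_measure n G \<mu>) B = emeasure (Hom_measure n G \<mu>)
        {\<rho>\<in>Hom (free_group {..<n}) G. conj_class (free_group {..<n}) G \<rho> \<in> B}"
proof -
  let ?H = "Hom (free_group {..<n}) G" and ?Q = "Hom_mod (free_group {..<n}) G"
  let ?M = "Hom_measure n G \<mu>" and ?q = "conj_class (free_group {..<n}) G"
  let ?S = "{B. B \<subseteq> ?Q \<and> {\<rho>\<in>?H. ?q \<rho> \<in> B} \<in> sets ?M}"
  have H: "space ?M = ?H" by (rule space_Hom_measure[OF G \<mu>])
  have q: "?q \<rho> \<in> ?Q" if "\<rho> \<in> ?H" for \<rho>
    using that by (auto simp: conj_class_def Hom_mod_def orbits_def)
  have "sigma_algebra ?Q ?S"
  proof (rule sigma_algebra_iff2[THEN iffD2], intro conjI ballI allI impI)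
    fix B assume B: "B \<in> ?S"
    have "{\<rho>\<in>?H. ?q \<rho> \<in> ?Q - B} = space ?M - {\<rho>\<in>?H. ?q \<rho> \<in> B}"
      using q by (auto simp: H)
    then show "?Q - B \<in> ?S" using B by auto
  next
    fix B :: "nat \<Rightarrow> _" assume B: "range B \<subseteq> ?S"
    have "{\<rho>\<in>?H. ?q \<rho> \<in> (\<Union>i. B i)} = (\<Union>i. {\<rho>\<in>?H. ?q \<rho> \<in> B i})"
      by auto
    moreover have "(\<Union>i. {\<rho>\<in>?H. ?q \<rho> \<in> B i}) \<in> sets ?M"
      using B by (intro sets.countable_UN) auto
    ultimately show "(\<Union>i. B i) \<in> ?S" using B by auto
  qed auto
  then have sets: "sets (sigma ?Q ?S) = ?S"
    by (simp add: sets_measure_of sigma_algebra.sigma_sets_eq Collect_mono_iff Pow_def)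
  show "space (Hom_mod_measure n G \<mu>) = ?Q"
    by (auto simp: Hom_mod_measure_def space_measure_of_conv)
  show sets': "sets (Hom_mod_measure n G \<mu>) = ?S"
    by (simp add: Hom_mod_measure_def sets)
  have space: "space (sigma ?Q ?S) = ?Q" by (simp add: space_measure_of_conv)
  have "?q \<in> measurable ?M (sigma ?Q ?S)"
  proof (rule measurableI)
    fix B assume "B \<in> sets (sigma ?Q ?S)"
    moreover have "?q -` B \<inter> space ?M = {\<rho>\<in>?H. ?q \<rho> \<in> B}" by (auto simp: H)
    ultimately show "?q -` B \<inter> space ?M \<in> sets ?M" by (simp add: sets)
  qed (simp add: space H q)
  moreover assume "B \<in> sets (Hom_mod_measure n G \<mu>)"
  ultimately show "emeasure (Hom_mod_measure n G \<mu>) B = emeasure ?M {\<rho>\<in>?H. ?q \<rho> \<in> B}"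
    unfolding sets' Hom_mod_measure_def
    by (subst emeasure_distr) (auto simp: sets H intro!: arg_cong2[where f = emeasure])
qed

end

theory Submission
  imports Defs "HOL-Library.Function_Algebras"
begin

text \<open>
  An invariant function on the quotient lifts to a function on $G^n$ that is invariant under the
  Nielsen moves \<open>x i \<mapsto> x j \<otimes> x i\<close>. Fix all coordinates but the \<open>i\<close>-th. As \<open>n > 2\<close>, two further
  coordinates \<open>x j\<close>, \<open>x k\<close> are available; if they generate a dense subgroup, then the lifted function
  is, in the variable \<open>x i\<close>, invariant under left translation by a dense subgroup, so it is almost
  everywhere constant in \<open>x i\<close> by uniqueness of Haar measure. A function that is almost everywhere
  constant in each variable separately is almost everywhere constant.

  That almost every pair generates a dense subgroup is seen as follows. Since SU(2) is simply
  connected, the local isomorphism extends to homomorphisms from SU(2), and the one-parameter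
  groups in the remaining directions can be replaced by circles because \<open>G\<close> is compact; so \<open>G\<close> is a
  quotient of a product of copies of SU(2) and U(1). A generic first element of that
  product generates a dense subgroup of a maximal torus (Kronecker), and a second element that
  moves each of the circles in the SU(2) factors then yields everything.
\<close>

section \<open>Borel sets of second countable topologies\<close>

text \<open>Four points carry the difficulty. Passing from a dense subgroup to all translations
  fails pointwise, because the function is only measurable; weighting by the indicator of an open
  set, which is lower semicontinuous, brings in Fatou's lemma. A local homomorphism is extended over
  SU(2) without path lifting: take a 2^k-th root near the identity and raise the value there to the
  power 2^k. Roots degenerate only at -1, so this is done on a large cap, which is glued to its
  negative. A circle of the local model need not map to a circle of G: its local homomorphism
  extends only to a real line. Compactness bounds the line parameters needed to reach any element,
  and what the lines share with the SU(2) part is central there, hence has square 1; so the kernel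
  of the map from R^b is cocompact and contains vectors spanning R^b, along which the lines close
  up. Finally, the image of the product measure upstairs is left invariant, hence a multiple of Haar
  measure, so null sets can be recognised in coordinates.\<close>

definition borel_of :: "'g topology \<Rightarrow> 'g measure \<Rightarrow> bool" where
  "borel_of X M \<longleftrightarrow> space M = topspace X \<and> sets M = sets (sigma (topspace X) {U. openin X U})"

lemma borel_of_sigma_sets:
  assumes "borel_of X M" shows "sets M = sigma_sets (topspace X) {U. openin X U}"
proof -
  have "{U. openin X U} \<subseteq> Pow (topspace X)" by (auto dest: openin_subset)
  then show ?thesis using assms by (simp add: borel_of_def)
qed

lemma borel_of_open: "borel_of X M \<Longrightarrow> openin X U \<Longrightarrow> U \<in> sets M"
  by (simp add: borel_of_sigma_sets sigma_sets.Basic)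

lemma measurable_borel_of:
  assumes "borel_of X N" "f \<in> space M \<rightarrow> topspace X"
    and "\<And>U. openin X U \<Longrightarrow> {x \<in> space M. f x \<in> U} \<in> sets M"
  shows "f \<in> measurable M N"
proof (rule measurable_sigma_sets[OF borel_of_sigma_sets[OF assms(1)]])
  show "{U. openin X U} \<subseteq> Pow (topspace X)" by (auto dest: openin_subset)
  show "f \<in> space M \<rightarrow> topspace X" by fact
  fix U assume "U \<in> {U. openin X U}"
  then show "f -` U \<inter> space M \<in> sets M"
    using assms(3)[of U] by (simp add: vimage_def Int_def conj_commute)
qed

text \<open>Second countability makes every open set of the product a countable union of open
  rectangles; joint measurability of the group operation rests on this.\<close>

lemma open_in_pair_measure:
  assumes X: "second_countable X" and Y: "second_countable Y"
    and M: "borel_of X M" and N: "borel_of Y N" and W: "openin (prod_topology X Y) W"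
  shows "W \<in> sets (M \<Otimes>\<^sub>M N)"
proof -
  obtain BX where BX: "countable BX" "\<And>V. V \<in> BX \<Longrightarrow> openin X V"
      "\<And>U x. openin X U \<Longrightarrow> x \<in> U \<Longrightarrow> \<exists>V\<in>BX. x \<in> V \<and> V \<subseteq> U"
    using X unfolding second_countable_def by metis
  obtain BY where BY: "countable BY" "\<And>V. V \<in> BY \<Longrightarrow> openin Y V"
      "\<And>U x. openin Y U \<Longrightarrow> x \<in> U \<Longrightarrow> \<exists>V\<in>BY. x \<in> V \<and> V \<subseteq> U"
    using Y unfolding second_countable_def by metis
  have "W = (\<Union>(U,V)\<in>{p\<in>BX \<times> BY. fst p \<times> snd p \<subseteq> W}. U \<times> V)" (is "_ = ?R")
  proof
    show "W \<subseteq> ?R"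
    proof clarify
      fix x y assume "(x, y) \<in> W"
      then obtain U V where "openin X U" "openin Y V" "x \<in> U" "y \<in> V" "U \<times> V \<subseteq> W"
        using W unfolding openin_prod_topology_alt by metis
      then obtain U' V' where "U' \<in> BX" "V' \<in> BY" "x \<in> U'" "y \<in> V'" "U' \<subseteq> U" "V' \<subseteq> V"
        using BX(3) BY(3) by metis
      then show "(x, y) \<in> ?R" using \<open>U \<times> V \<subseteq> W\<close>
        by (intro UN_I[of "(U', V')"]) auto
    qed
  qed auto
  moreover have "?R \<in> sets (M \<Otimes>\<^sub>M N)"
    using BX BY borel_of_open[OF M] borel_of_open[OF N]
    by (intro sets.countable_UN') (auto intro!: pair_measureI)
  ultimately show ?thesis by simp
qed

section \<open>Haar measure on compact groups\<close>

locale compact_haar_group = group G for G :: "('g, 'm) monoid_scheme" (structure) +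
  fixes X :: "'g topology" and \<mu> :: "'g measure"
  assumes topspace_X: "topspace X = carrier G"
    and Hausdorff_X: "Hausdorff_space X"
    and second_countable_X: "second_countable X"
    and compact_X: "compact_space X"
    and continuous_mult: "continuous_map (prod_topology X X) X (\<lambda>(x, y). x \<otimes> y)"
    and continuous_inv: "continuous_map X X (\<lambda>x. inv x)"
    and haar: "haar_measure G X \<mu>"
begin

lemma borel_of_\<mu>: "borel_of X \<mu>"
  using haar by (simp add: haar_measure_def borel_of_def)

lemma space_\<mu> [simp]: "space \<mu> = carrier G"
  using borel_of_\<mu> by (simp add: borel_of_def topspace_X)

lemma open_sets: "openin X U \<Longrightarrow> U \<in> sets \<mu>"
  by (rule borel_of_open[OF borel_of_\<mu>])

lemma emeasure_\<mu>_finite: "emeasure \<mu> (carrier G) < \<infinity>"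
proof -
  have "compactin X (carrier G)" using compact_X by (simp add: compact_space_def topspace_X)
  moreover have "carrier G \<in> sets \<mu>" using sets.top[of \<mu>] by simp
  ultimately show ?thesis using haar by (simp add: haar_measure_def)
qed

lemma emeasure_\<mu>_pos: "emeasure \<mu> (carrier G) > 0"
proof -
  have "openin X (carrier G)" using openin_topspace[of X] by (simp add: topspace_X)
  then show ?thesis using haar one_closed unfolding haar_measure_def by blast
qed

sublocale \<mu>: finite_measure \<mu>
  by (rule finite_measureI) (use emeasure_\<mu>_finite in simp)

lemma continuous_mult_left: "g \<in> carrier G \<Longrightarrow> continuous_map X X (\<lambda>y. g \<otimes> y)"
  using continuous_map_compose[OF _ continuous_mult, of X "\<lambda>y. (g, y)"]
  by (simp add: o_def continuous_map_pairwise topspace_X)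

lemma continuous_mult_right: "g \<in> carrier G \<Longrightarrow> continuous_map X X (\<lambda>y. y \<otimes> g)"
  using continuous_map_compose[OF _ continuous_mult, of X "\<lambda>y. (y, g)"]
  by (simp add: o_def continuous_map_pairwise topspace_X)

lemma continuous_map_mult:
  "continuous_map Y X f \<Longrightarrow> continuous_map Y X g \<Longrightarrow> continuous_map Y X (\<lambda>y. f y \<otimes> g y)"
  using continuous_map_compose[OF _ continuous_mult, of Y "\<lambda>y. (f y, g y)"]
  by (simp add: o_def continuous_map_pairwise)

lemma measurable_continuous: "continuous_map X X f \<Longrightarrow> f \<in> measurable \<mu> \<mu>"
  by (rule measurable_borel_of[OF borel_of_\<mu>])
     (auto simp: topspace_X continuous_map_def intro!: open_sets)

lemma measurable_mult: "(\<lambda>(x, y). x \<otimes> y) \<in> measurable (\<mu> \<Otimes>\<^sub>M \<mu>) \<mu>"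
proof (rule measurable_borel_of[OF borel_of_\<mu>])
  show "(\<lambda>(x, y). x \<otimes> y) \<in> space (\<mu> \<Otimes>\<^sub>M \<mu>) \<rightarrow> topspace X"
    by (auto simp: space_pair_measure topspace_X)
  fix U assume "openin X U"
  then have "openin (prod_topology X X) {p \<in> topspace (prod_topology X X). (case p of (x, y) \<Rightarrow> x \<otimes> y) \<in> U}"
    using continuous_mult unfolding continuous_map_def by blast
  from open_in_pair_measure[OF second_countable_X second_countable_X borel_of_\<mu> borel_of_\<mu> this]
  show "{p \<in> space (\<mu> \<Otimes>\<^sub>M \<mu>). (case p of (x, y) \<Rightarrow> x \<otimes> y) \<in> U} \<in> sets (\<mu> \<Otimes>\<^sub>M \<mu>)"
    by (simp add: space_pair_measure topspace_X)
qed

lemma measurable_mult_left: "g \<in> carrier G \<Longrightarrow> (\<lambda>y. g \<otimes> y) \<in> measurable \<mu> \<mu>"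
  by (intro measurable_continuous continuous_mult_left)

lemma measurable_inv: "(\<lambda>y. inv y) \<in> measurable \<mu> \<mu>"
  by (intro measurable_continuous continuous_inv)

text \<open>Haar measure is defined through translated sets, whereas \<open>distr\<close> speaks of
  preimages; this converts one into the other.\<close>

lemma l_coset_vimage:
  assumes "g \<in> carrier G" "B \<subseteq> carrier G"
  shows "inv g <# B = {y \<in> carrier G. g \<otimes> y \<in> B}"
proof (intro equalityI subsetI)
  fix y assume "y \<in> inv g <# B"
  then show "y \<in> {y \<in> carrier G. g \<otimes> y \<in> B}"
    using assms by (auto simp: l_coset_def m_assoc[symmetric] subset_iff)
next
  fix y assume "y \<in> {y \<in> carrier G. g \<otimes> y \<in> B}"
  then show "y \<in> inv g <# B"
    using assms by (auto simp: l_coset_def m_assoc[symmetric] intro!: bexI[of _ "g \<otimes> y"])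
qed

section \<open>Uniqueness of left invariant measures\<close>

definition left_inv :: "'g measure \<Rightarrow> bool" where
  "left_inv \<nu> \<longleftrightarrow> sets \<nu> = sets \<mu> \<and>
    (\<forall>g\<in>carrier G. \<forall>B\<in>sets \<mu>. emeasure \<nu> {y \<in> carrier G. g \<otimes> y \<in> B} = emeasure \<nu> B)"

lemma left_inv_\<mu>: "left_inv \<mu>"
proof -
  have "emeasure \<mu> {y \<in> carrier G. g \<otimes> y \<in> B} = emeasure \<mu> B"
    if "g \<in> carrier G" "B \<in> sets \<mu>" for g B
  proof -
    have "B \<subseteq> carrier G" using sets.sets_into_space[OF that(2)] by simp
    then show ?thesis using haar that l_coset_vimage[of g B] inv_closed[of g]
      unfolding haar_measure_def by metis
  qed
  then show ?thesis by (simp add: left_inv_def)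
qed

lemma distr_left_inv:
  assumes "left_inv \<nu>" "g \<in> carrier G"
  shows "distr \<nu> \<nu> (\<lambda>y. g \<otimes> y) = \<nu>"
proof (rule measure_eqI)
  have s: "sets \<nu> = sets \<mu>" using assms by (simp add: left_inv_def)
  have sp: "space \<nu> = carrier G" using sets_eq_imp_space_eq[OF s] by simp
  have m: "(\<lambda>y. g \<otimes> y) \<in> measurable \<nu> \<nu>"
    using measurable_mult_left[OF assms(2)] measurable_cong_sets[OF s s] by blast
  fix B assume "B \<in> sets (distr \<nu> \<nu> (\<lambda>y. g \<otimes> y))"
  then have B: "B \<in> sets \<nu>" by simp
  have "(\<lambda>y. g \<otimes> y) -` B \<inter> space \<nu> = {y \<in> carrier G. g \<otimes> y \<in> B}" using sp by auto
  then show "emeasure (distr \<nu> \<nu> (\<lambda>y. g \<otimes> y)) B = emeasure \<nu> B"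
    using emeasure_distr[OF m B] assms B s by (simp add: left_inv_def)
qed simp

lemma nn_integral_mult_left:
  assumes "g \<in> carrier G" "f \<in> borel_measurable \<mu>"
  shows "(\<integral>\<^sup>+ y. f (g \<otimes> y) \<partial>\<mu>) = (\<integral>\<^sup>+ y. f y \<partial>\<mu>)"
  using nn_integral_distr[OF measurable_mult_left[OF assms(1)], of f] assms(2)
  by (simp add: distr_left_inv[OF left_inv_\<mu> assms(1)])

text \<open>Inversion exchanges left and right translations, so the image of \<open>\<mu>\<close>
  under inversion is right invariant. That it equals \<open>\<mu>\<close> is not yet known
  here.\<close>

lemma emeasure_vimage_mult_right:
  assumes y: "y \<in> carrier G" and B: "B \<in> sets \<mu>"
  shows "emeasure (distr \<mu> \<mu> (\<lambda>x. inv x)) {g \<in> carrier G. g \<otimes> y \<in> B} =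
    emeasure (distr \<mu> \<mu> (\<lambda>x. inv x)) B"
proof -
  have R: "{g \<in> carrier G. g \<otimes> y \<in> B} \<in> sets \<mu>"
    using measurable_sets[OF measurable_continuous[OF continuous_mult_right[OF y]] B]
    by (simp add: vimage_def Int_def conj_commute)
  have I: "{g \<in> carrier G. inv g \<in> B} \<in> sets \<mu>"
    using measurable_sets[OF measurable_inv B] by (simp add: vimage_def Int_def conj_commute)
  have "emeasure (distr \<mu> \<mu> (\<lambda>x. inv x)) {g \<in> carrier G. g \<otimes> y \<in> B} =
      emeasure \<mu> {g \<in> carrier G. inv g \<otimes> y \<in> B}"
    by (subst emeasure_distr[OF measurable_inv R]) (auto intro!: arg_cong2[where f=emeasure])
  also have "{g \<in> carrier G. inv g \<otimes> y \<in> B} =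
      {g \<in> carrier G. inv y \<otimes> g \<in> {g \<in> carrier G. inv g \<in> B}}"
    using y by (auto simp: inv_mult_group)
  also have "emeasure \<mu> \<dots> = emeasure \<mu> {g \<in> carrier G. inv g \<in> B}"
    using left_inv_\<mu> I inv_closed[OF y] unfolding left_inv_def by blast
  also have "\<dots> = emeasure (distr \<mu> \<mu> (\<lambda>x. inv x)) B"
    by (subst emeasure_distr[OF measurable_inv B]) (auto intro!: arg_cong2[where f=emeasure])
  finally show ?thesis .
qed

text \<open>Fubini for the indicator of the pairs with \<open>g \<otimes> y\<close> in
  \<open>B\<close>: integrating over \<open>y\<close> first uses left invariance of
  \<open>\<nu>\<close>, integrating over \<open>g\<close> first uses right invariance of the
  inverted Haar measure. Each inner integral is then constant.\<close>

lemma haar_unique_aux: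
  assumes \<nu>: "left_inv \<nu>" and fin: "emeasure \<nu> (carrier G) < \<infinity>" and B: "B \<in> sets \<mu>"
  shows "emeasure \<nu> B * emeasure \<mu> (carrier G) =
    emeasure \<nu> (carrier G) * emeasure (distr \<mu> \<mu> (\<lambda>x. inv x)) B"
proof -
  let ?\<mu>' = "distr \<mu> \<mu> (\<lambda>x. inv x)"
  have s: "sets \<nu> = sets \<mu>" using \<nu> by (simp add: left_inv_def)
  have sp: "space \<nu> = carrier G" using sets_eq_imp_space_eq[OF s] by simp
  interpret \<nu>: finite_measure \<nu> by (rule finite_measureI) (use fin sp in auto)
  interpret \<mu>': finite_measure ?\<mu>' by (intro \<mu>.finite_measure_distr measurable_inv)
  interpret P: pair_sigma_finite ?\<mu>' \<nu> ..
  have tot: "emeasure ?\<mu>' (carrier G) = emeasure \<mu> (carrier G)"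
  proof -
    have "(\<lambda>x. inv x) -` carrier G \<inter> carrier G = carrier G" by auto
    then show ?thesis using emeasure_distr[OF measurable_inv, of "carrier G"] sets.top[of \<mu>] by simp
  qed
  have B': "B \<in> sets \<nu>" using B s by simp
  have m: "(\<lambda>(g, y). indicator B (g \<otimes> y) :: ennreal) \<in> borel_measurable (?\<mu>' \<Otimes>\<^sub>M \<nu>)"
  proof -
    have e: "sets (?\<mu>' \<Otimes>\<^sub>M \<nu>) = sets (\<mu> \<Otimes>\<^sub>M \<mu>)" by (rule sets_pair_measure_cong) (simp_all add: s)
    have "(\<lambda>p. indicator B ((\<lambda>(x, y). x \<otimes> y) p) :: ennreal) \<in> borel_measurable (\<mu> \<Otimes>\<^sub>M \<mu>)"
      by (rule measurable_compose[OF measurable_mult]) (use B in simp)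
    then show ?thesis by (simp add: measurable_cong_sets[OF e refl] case_prod_unfold)
  qed
  have "(\<integral>\<^sup>+ g. (\<integral>\<^sup>+ y. indicator B (g \<otimes> y) \<partial>\<nu>) \<partial>?\<mu>') = (\<integral>\<^sup>+ g. emeasure \<nu> B \<partial>?\<mu>')"
  proof (rule nn_integral_cong)
    fix g assume "g \<in> space ?\<mu>'"
    then have g: "g \<in> carrier G" by simp
    have V: "{y \<in> carrier G. g \<otimes> y \<in> B} \<in> sets \<nu>"
      using measurable_sets[OF measurable_mult_left[OF g] B] s
      by (simp add: vimage_def Int_def conj_commute)
    have "(\<integral>\<^sup>+ y. indicator B (g \<otimes> y) \<partial>\<nu>) = (\<integral>\<^sup>+ y. indicator {y \<in> carrier G. g \<otimes> y \<in> B} y \<partial>\<nu>)"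
      by (rule nn_integral_cong) (simp add: sp indicator_def)
    also have "\<dots> = emeasure \<nu> B" using V g B \<nu> by (simp add: left_inv_def)
    finally show "(\<integral>\<^sup>+ y. indicator B (g \<otimes> y) \<partial>\<nu>) = emeasure \<nu> B" .
  qed
  also have "\<dots> = emeasure \<nu> B * emeasure \<mu> (carrier G)" by (simp add: tot)
  finally have 1: "(\<integral>\<^sup>+ g. (\<integral>\<^sup>+ y. indicator B (g \<otimes> y) \<partial>\<nu>) \<partial>?\<mu>') = emeasure \<nu> B * emeasure \<mu> (carrier G)" .
  have "(\<integral>\<^sup>+ y. (\<integral>\<^sup>+ g. indicator B (g \<otimes> y) \<partial>?\<mu>') \<partial>\<nu>) = (\<integral>\<^sup>+ y. emeasure ?\<mu>' B \<partial>\<nu>)"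
  proof (rule nn_integral_cong)
    fix y assume "y \<in> space \<nu>"
    then have y: "y \<in> carrier G" by (simp add: sp)
    have V: "{g \<in> carrier G. g \<otimes> y \<in> B} \<in> sets ?\<mu>'"
      using measurable_sets[OF measurable_continuous[OF continuous_mult_right[OF y]] B]
      by (simp add: vimage_def Int_def conj_commute)
    have "(\<integral>\<^sup>+ g. indicator B (g \<otimes> y) \<partial>?\<mu>') = (\<integral>\<^sup>+ g. indicator {g \<in> carrier G. g \<otimes> y \<in> B} g \<partial>?\<mu>')"
      by (rule nn_integral_cong) (simp add: indicator_def)
    also have "\<dots> = emeasure ?\<mu>' B"
      using V emeasure_vimage_mult_right[OF y B] by simp
    finally show "(\<integral>\<^sup>+ g. indicator B (g \<otimes> y) \<partial>?\<mu>') = emeasure ?\<mu>' B" .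
  qed
  also have "\<dots> = emeasure \<nu> (carrier G) * emeasure ?\<mu>' B" by (simp add: sp mult.commute)
  finally have 2: "(\<integral>\<^sup>+ y. (\<integral>\<^sup>+ g. indicator B (g \<otimes> y) \<partial>?\<mu>') \<partial>\<nu>) = emeasure \<nu> (carrier G) * emeasure ?\<mu>' B" .
  show ?thesis using P.Fubini'[OF m] 1 2 by simp
qed

text \<open>The case \<open>\<nu> = \<mu>\<close> of the previous identity, after cancelling the
  finite positive total mass, shows that \<open>\<mu>\<close> is invariant under inversion; the
  inverted measure can then be replaced by \<open>\<mu>\<close>.\<close>

theorem haar_unique:
  assumes \<nu>: "left_inv \<nu>" and fin: "emeasure \<nu> (carrier G) < \<infinity>" and B: "B \<in> sets \<mu>"
  shows "emeasure \<nu> B * emeasure \<mu> (carrier G) = emeasure \<nu> (carrier G) * emeasure \<mu> B"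
proof -
  have "emeasure \<mu> B * emeasure \<mu> (carrier G) =
      emeasure \<mu> (carrier G) * emeasure (distr \<mu> \<mu> (\<lambda>x. inv x)) B"
    by (rule haar_unique_aux[OF left_inv_\<mu> emeasure_\<mu>_finite B])
  then have "emeasure (distr \<mu> \<mu> (\<lambda>x. inv x)) B = emeasure \<mu> B"
    using emeasure_\<mu>_finite emeasure_\<mu>_pos
    by (metis ennreal_mult_cancel_left mult.commute not_gr_zero top.not_eq_extremum infinity_ennreal_def)
  then show ?thesis using haar_unique_aux[OF assms] by simp
qed

section \<open>Functions invariant under a dense set of translations\<close>

definition dense_in :: "'g set \<Rightarrow> bool" where
  "dense_in H \<longleftrightarrow> (\<forall>U. openin X U \<and> U \<noteq> {} \<longrightarrow> U \<inter> H \<noteq> {})"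

text \<open>Invariance is known only for \<open>\<gamma>\<close> in a dense set and \<open>h\<close>
  is merely measurable, so there is no pointwise limit in \<open>\<gamma>\<close>. The translation
  is moved from \<open>h\<close> to the indicator of the open set \<open>U\<close>: that indicator
  is lower semicontinuous, and Fatou's lemma gives the inequality.\<close>

lemma nn_integral_translate_le:
  fixes h :: "'g \<Rightarrow> ennreal"
  assumes h: "h \<in> borel_measurable \<mu>" and H: "H \<subseteq> carrier G" "dense_in H"
    and inv: "\<And>\<gamma> y. \<gamma> \<in> H \<Longrightarrow> y \<in> carrier G \<Longrightarrow> h (\<gamma> \<otimes> y) = h y"
    and U: "openin X U" and g: "g \<in> carrier G"
  shows "(\<integral>\<^sup>+ y. h (g \<otimes> y) * indicator U y \<partial>\<mu>) \<le> (\<integral>\<^sup>+ y. h y * indicator U y \<partial>\<mu>)"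
proof -
  obtain \<B> where \<B>: "countable \<B>" "\<And>V. V \<in> \<B> \<Longrightarrow> openin X V"
      "\<And>U. openin X U \<Longrightarrow> g \<in> U \<Longrightarrow> \<exists>V\<in>\<B>. g \<in> V \<and> V \<subseteq> U"
    using second_countable_X unfolding second_countable_def by metis
  define \<C> where "\<C> = {V\<in>\<B>. g \<in> V}"
  have "countable \<C>" using \<B>(1) by (simp add: \<C>_def)
  moreover have "\<C> \<noteq> {}"
    using \<B>(3)[OF openin_topspace] g by (auto simp: \<C>_def topspace_X)
  ultimately have b: "range (from_nat_into \<C>) = \<C>" by (simp add: range_from_nat_into)
  define b where "b = from_nat_into \<C>"
  \<comment> \<open>Finite intersections turn the countable neighbourhood base at \<open>g\<close>
    into a decreasing one, from which a sequence in \<open>H\<close> converging to \<open>g\<close>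
    is picked.\<close>
  define V where "V n = (\<Inter>i\<le>n. b i)" for n :: nat
  have bC: "b i \<in> \<C>" for i using b unfolding b_def by (metis rangeI)
  have bo: "openin X (b i)" and bg: "g \<in> b i" for i
    using bC[of i] \<B>(2) by (simp_all add: \<C>_def)
  have Vo: "openin X (V n)" for n
    unfolding V_def by (rule openin_Inter) (auto simp: bo)
  have gV: "g \<in> V n" for n by (simp add: V_def bg)
  have "\<exists>\<gamma>\<in>H. \<gamma> \<in> V n" for n using H(2) Vo gV unfolding dense_in_def by blast
  then obtain \<gamma> where \<gamma>: "\<And>n. \<gamma> n \<in> H" "\<And>n. \<gamma> n \<in> V n" by metis
  have ev: "eventually (\<lambda>n. \<gamma> n \<in> W) sequentially" if W: "openin X W" "g \<in> W" for W
  proof -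
    obtain B where "B \<in> \<C>" "B \<subseteq> W" using \<B>(3)[OF W] by (auto simp: \<C>_def)
    then obtain i where i: "b i \<subseteq> W" using b unfolding b_def by (metis imageE)
    have "V n \<subseteq> b i" if "i \<le> n" for n using that by (auto simp: V_def)
    then show ?thesis using \<gamma>(2) i unfolding eventually_sequentially by blast
  qed
  have Um: "U \<in> sets \<mu>" by (rule open_sets[OF U])
  \<comment> \<open>The translation parameter now occurs in the indicator alone; invariance of
    \<open>\<mu>\<close> identifies the integral of \<open>?F x\<close> with that of the translate
    by \<open>x\<close>.\<close>
  let ?F = "\<lambda>x y. h y * indicator U (inv x \<otimes> y) :: ennreal"
  have Fm: "?F x \<in> borel_measurable \<mu>" if "x \<in> carrier G" for x
  proof -
    have "(\<lambda>y. indicator U (inv x \<otimes> y) :: ennreal) \<in> borel_measurable \<mu>"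
      using measurable_compose[OF measurable_mult_left[of "inv x"] borel_measurable_indicator[OF Um]] that
      by simp
    then show ?thesis using h by simp
  qed
  have tr: "(\<integral>\<^sup>+ y. ?F x y \<partial>\<mu>) = (\<integral>\<^sup>+ y. h (x \<otimes> y) * indicator U y \<partial>\<mu>)" if x: "x \<in> carrier G" for x
  proof -
    have "(\<integral>\<^sup>+ y. ?F x y \<partial>\<mu>) = (\<integral>\<^sup>+ y. ?F x (x \<otimes> y) \<partial>\<mu>)"
      by (rule nn_integral_mult_left[symmetric, OF x Fm[OF x]])
    also have "\<dots> = (\<integral>\<^sup>+ y. h (x \<otimes> y) * indicator U y \<partial>\<mu>)"
      by (rule nn_integral_cong) (simp add: x m_assoc[symmetric])
    finally show ?thesis .
  qed
  have \<gamma>c: "\<gamma> n \<in> carrier G" for n using \<gamma>(1) H(1) by blast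
  have "(\<integral>\<^sup>+ y. h (g \<otimes> y) * indicator U y \<partial>\<mu>) = (\<integral>\<^sup>+ y. ?F g y \<partial>\<mu>)" by (rule tr[OF g, symmetric])
  also have "\<dots> \<le> (\<integral>\<^sup>+ y. liminf (\<lambda>n. ?F (\<gamma> n) y) \<partial>\<mu>)"
  proof (rule nn_integral_mono)
    fix y assume "y \<in> space \<mu>"
    then have y: "y \<in> carrier G" by simp
    show "?F g y \<le> liminf (\<lambda>n. ?F (\<gamma> n) y)"
    proof (cases "inv g \<otimes> y \<in> U")
      case True
      have "continuous_map X X (\<lambda>x. inv x \<otimes> y)"
        using continuous_map_compose[OF continuous_inv continuous_mult_right[OF y]] by (simp add: o_def)
      then have "openin X {x \<in> topspace X. inv x \<otimes> y \<in> U}"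
        using U unfolding continuous_map_def by blast
      from ev[OF this] have "eventually (\<lambda>n. ?F g y \<le> ?F (\<gamma> n) y) sequentially"
        using True g by (auto simp: topspace_X elim!: eventually_mono)
      then show ?thesis by (rule Liminf_bounded)
    qed simp
  qed
  also have "\<dots> \<le> liminf (\<lambda>n. \<integral>\<^sup>+ y. ?F (\<gamma> n) y \<partial>\<mu>)"
    by (rule nn_integral_liminf) (rule Fm[OF \<gamma>c])
  also have "(\<lambda>n. \<integral>\<^sup>+ y. ?F (\<gamma> n) y \<partial>\<mu>) = (\<lambda>n. \<integral>\<^sup>+ y. h y * indicator U y \<partial>\<mu>)"
  proof
    fix n
    have "(\<integral>\<^sup>+ y. ?F (\<gamma> n) y \<partial>\<mu>) = (\<integral>\<^sup>+ y. h (\<gamma> n \<otimes> y) * indicator U y \<partial>\<mu>)" by (rule tr[OF \<gamma>c])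
    also have "\<dots> = (\<integral>\<^sup>+ y. h y * indicator U y \<partial>\<mu>)"
      by (rule nn_integral_cong) (simp add: inv[OF \<gamma>(1)])
    finally show "(\<integral>\<^sup>+ y. ?F (\<gamma> n) y \<partial>\<mu>) = (\<integral>\<^sup>+ y. h y * indicator U y \<partial>\<mu>)" .
  qed
  also have "liminf (\<lambda>n. \<integral>\<^sup>+ y. h y * indicator U y \<partial>\<mu>) = (\<integral>\<^sup>+ y. h y * indicator U y \<partial>\<mu>)"
    by (simp add: Liminf_const)
  finally show ?thesis .
qed

text \<open>The reverse inequality comes from applying the previous lemma to the translate
  \<open>h (g \<otimes> _)\<close>, which is invariant under the conjugate of \<open>H\<close> by \<open>g\<close>.\<close>

lemma nn_integral_translate_eq:
  fixes h :: "'g \<Rightarrow> ennreal"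
  assumes h: "h \<in> borel_measurable \<mu>" and H: "H \<subseteq> carrier G" "dense_in H"
    and inv: "\<And>\<gamma> y. \<gamma> \<in> H \<Longrightarrow> y \<in> carrier G \<Longrightarrow> h (\<gamma> \<otimes> y) = h y"
    and U: "openin X U" and g: "g \<in> carrier G"
  shows "(\<integral>\<^sup>+ y. h (g \<otimes> y) * indicator U y \<partial>\<mu>) = (\<integral>\<^sup>+ y. h y * indicator U y \<partial>\<mu>)"
proof (rule antisym[OF nn_integral_translate_le[OF assms]])
  define H' where "H' = {\<delta> \<in> carrier G. g \<otimes> \<delta> \<otimes> inv g \<in> H}"
  have "dense_in H'"
    unfolding dense_in_def
  proof clarify
    fix W assume W: "openin X W" "W \<noteq> {}" "W \<inter> H' = {}"
    have "continuous_map X X (\<lambda>y. inv g \<otimes> y \<otimes> g)"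
      using continuous_map_compose[OF continuous_mult_left[of "inv g"] continuous_mult_right[OF g]] g
      by (simp add: o_def)
    then have o: "openin X {y \<in> topspace X. inv g \<otimes> y \<otimes> g \<in> W}"
      using W unfolding continuous_map_def by blast
    obtain w where w: "w \<in> W" using W by blast
    have wc: "w \<in> carrier G" using w W(1) openin_subset topspace_X by blast
    have conj1: "inv g \<otimes> (g \<otimes> z \<otimes> inv g) \<otimes> g = z" if "z \<in> carrier G" for z
      using that g by (metis inv_solve_left inv_solve_right inv_closed m_closed m_assoc)
    have conj2: "g \<otimes> (inv g \<otimes> z \<otimes> g) \<otimes> inv g = z" if "z \<in> carrier G" for z
      using that g by (metis inv_solve_left inv_solve_right inv_closed m_closed m_assoc)
    have "g \<otimes> w \<otimes> inv g \<in> {y \<in> topspace X. inv g \<otimes> y \<otimes> g \<in> W}"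
      using w wc g by (simp add: topspace_X conj1)
    then obtain \<gamma> where \<gamma>: "\<gamma> \<in> H" "\<gamma> \<in> carrier G" "inv g \<otimes> \<gamma> \<otimes> g \<in> W"
      using H(2) o unfolding dense_in_def topspace_X by blast
    then have "inv g \<otimes> \<gamma> \<otimes> g \<in> H'" using g by (simp add: H'_def conj2)
    then show False using \<gamma> W by blast
  qed
  moreover have "H' \<subseteq> carrier G" by (auto simp: H'_def)
  moreover have "(\<lambda>y. h (g \<otimes> y)) \<in> borel_measurable \<mu>"
    by (rule measurable_compose[OF measurable_mult_left[OF g] h])
  moreover have "h (g \<otimes> (\<delta> \<otimes> y)) = h (g \<otimes> y)" if "\<delta> \<in> H'" "y \<in> carrier G" for \<delta> y
  proof -
    have d: "\<delta> \<in> carrier G" using that by (simp add: H'_def)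
    have "inv g \<otimes> (g \<otimes> y) = y" using g that by (simp add: m_assoc[symmetric])
    then have "g \<otimes> (\<delta> \<otimes> y) = (g \<otimes> \<delta> \<otimes> inv g) \<otimes> (g \<otimes> y)"
      using d g that by (simp add: m_assoc)
    then show ?thesis using inv[of "g \<otimes> \<delta> \<otimes> inv g" "g \<otimes> y"] that g by (simp add: H'_def)
  qed
  ultimately have "(\<integral>\<^sup>+ y. h (g \<otimes> (inv g \<otimes> y)) * indicator U y \<partial>\<mu>) \<le> (\<integral>\<^sup>+ y. h (g \<otimes> y) * indicator U y \<partial>\<mu>)"
    using nn_integral_translate_le[where h = "\<lambda>y. h (g \<otimes> y)", OF _ _ _ _ U inv_closed[OF g]] by blast
  moreover have "(\<integral>\<^sup>+ y. h (g \<otimes> (inv g \<otimes> y)) * indicator U y \<partial>\<mu>) = (\<integral>\<^sup>+ y. h y * indicator U y \<partial>\<mu>)"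
    by (rule nn_integral_cong) (simp add: g m_assoc[symmetric])
  ultimately show "(\<integral>\<^sup>+ y. h y * indicator U y \<partial>\<mu>) \<le> (\<integral>\<^sup>+ y. h (g \<otimes> y) * indicator U y \<partial>\<mu>)" by simp
qed

text \<open>The measure with density \<open>h\<close> is left invariant, hence a constant multiple
  of \<open>\<mu>\<close> by uniqueness of Haar measure, and densities with respect to a finite
  measure are unique almost everywhere.\<close>

theorem dense_invariant_imp_AE_const:
  fixes h :: "'g \<Rightarrow> ennreal"
  assumes h: "h \<in> borel_measurable \<mu>" and H: "H \<subseteq> carrier G" "dense_in H"
    and inv: "\<And>\<gamma> y. \<gamma> \<in> H \<Longrightarrow> y \<in> carrier G \<Longrightarrow> h (\<gamma> \<otimes> y) = h y"
    and fin: "(\<integral>\<^sup>+ y. h y \<partial>\<mu>) < \<infinity>"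
  shows "\<exists>c. AE y in \<mu>. h y = c"
proof -
  let ?\<rho> = "density \<mu> h"
  have tot: "emeasure ?\<rho> (carrier G) = (\<integral>\<^sup>+ y. h y \<partial>\<mu>)"
    using emeasure_density[OF h sets.top] by (simp add: nn_integral_set_ennreal[symmetric])
       (rule nn_integral_cong, simp)
  have "left_inv ?\<rho>"
    unfolding left_inv_def
  proof (intro conjI ballI)
    fix g B assume g: "g \<in> carrier G" and B: "B \<in> sets \<mu>"
    have mg: "(\<lambda>y. g \<otimes> y) \<in> measurable ?\<rho> \<mu>" using measurable_mult_left[OF g] by simp
    \<comment> \<open>Equality is checked on open sets only, where the translation identity is
      available; they form a generator stable under intersection.\<close>
    have "distr ?\<rho> \<mu> (\<lambda>y. g \<otimes> y) = ?\<rho>"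
    proof (rule measure_eqI_generator_eq[where \<Omega> = "topspace X" and E = "{U. openin X U}" and A = "\<lambda>_. carrier G"])
      show "Int_stable {U. openin X U}" by (auto simp: Int_stable_def)
      show "{U. openin X U} \<subseteq> Pow (topspace X)" by (auto dest: openin_subset)
      show "sets (distr ?\<rho> \<mu> (\<lambda>y. g \<otimes> y)) = sigma_sets (topspace X) {U. openin X U}"
        "sets ?\<rho> = sigma_sets (topspace X) {U. openin X U}"
        using borel_of_sigma_sets[OF borel_of_\<mu>] by simp_all
      show "range (\<lambda>_. carrier G) \<subseteq> {U. openin X U}"
        using openin_topspace[of X] by (simp add: topspace_X)
      show "(\<Union>i. carrier G) = topspace X" by (simp add: topspace_X)
      have "(\<lambda>y. g \<otimes> y) -` carrier G \<inter> carrier G = carrier G" using g by auto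
      then show "emeasure (distr ?\<rho> \<mu> (\<lambda>y. g \<otimes> y)) (carrier G) \<noteq> \<infinity>" for i
        using emeasure_distr[OF mg, of "carrier G"] sets.top[of \<mu>] fin tot by auto
      fix U assume "U \<in> {U. openin X U}"
      then have U: "openin X U" by simp
      have Um: "U \<in> sets \<mu>" by (rule open_sets[OF U])
      have V: "{y \<in> carrier G. g \<otimes> y \<in> U} \<in> sets \<mu>"
        using measurable_sets[OF measurable_mult_left[OF g] Um] by (simp add: vimage_def Int_def conj_commute)
      have "emeasure (distr ?\<rho> \<mu> (\<lambda>y. g \<otimes> y)) U = emeasure ?\<rho> {y \<in> carrier G. g \<otimes> y \<in> U}"
        by (subst emeasure_distr[OF mg Um]) (auto intro!: arg_cong2[where f=emeasure])
      also have "\<dots> = (\<integral>\<^sup>+ y. h y * indicator U (g \<otimes> y) \<partial>\<mu>)"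
        by (subst emeasure_density[OF h V]) (rule nn_integral_cong, simp add: indicator_def)
      also have "\<dots> = (\<integral>\<^sup>+ y. h (inv g \<otimes> (g \<otimes> y)) * indicator U (g \<otimes> y) \<partial>\<mu>)"
        by (rule nn_integral_cong) (simp add: g m_assoc[symmetric])
      also have "\<dots> = (\<integral>\<^sup>+ y. h (inv g \<otimes> y) * indicator U y \<partial>\<mu>)"
        by (rule nn_integral_mult_left[OF g, where f = "\<lambda>y. h (inv g \<otimes> y) * indicator U y"])
           (intro borel_measurable_times_ennreal borel_measurable_indicator Um
              measurable_compose[OF measurable_mult_left[OF inv_closed[OF g]] h])
      also have "\<dots> = (\<integral>\<^sup>+ y. h y * indicator U y \<partial>\<mu>)"
        by (rule nn_integral_translate_eq[OF h H inv U inv_closed[OF g]])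
      also have "\<dots> = emeasure ?\<rho> U" by (rule emeasure_density[OF h Um, symmetric])
      finally show "emeasure (distr ?\<rho> \<mu> (\<lambda>y. g \<otimes> y)) U = emeasure ?\<rho> U" .
    qed
    then have "emeasure ?\<rho> B = emeasure (distr ?\<rho> \<mu> (\<lambda>y. g \<otimes> y)) B" by simp
    also have "\<dots> = emeasure ?\<rho> {y \<in> carrier G. g \<otimes> y \<in> B}"
      by (subst emeasure_distr[OF mg B]) (auto intro!: arg_cong2[where f=emeasure])
    finally show "emeasure ?\<rho> {y \<in> carrier G. g \<otimes> y \<in> B} = emeasure ?\<rho> B" by simp
  qed simp
  then have U: "emeasure ?\<rho> B * emeasure \<mu> (carrier G) = emeasure ?\<rho> (carrier G) * emeasure \<mu> B"
    if "B \<in> sets \<mu>" for B using haar_unique that fin tot by simp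
  define c where "c = emeasure ?\<rho> (carrier G) / emeasure \<mu> (carrier G)"
  have "?\<rho> = density \<mu> (\<lambda>_. c)"
  proof (rule measure_eqI)
    fix B assume "B \<in> sets ?\<rho>"
    then have B: "B \<in> sets \<mu>" by simp
    have "emeasure ?\<rho> B = emeasure ?\<rho> B * emeasure \<mu> (carrier G) / emeasure \<mu> (carrier G)"
      using emeasure_\<mu>_finite emeasure_\<mu>_pos by (simp add: ennreal_mult_divide_eq)
    also have "\<dots> = c * emeasure \<mu> B"
      unfolding U[OF B] c_def by (simp add: ennreal_times_divide mult.commute)
    also have "\<dots> = emeasure (density \<mu> (\<lambda>_. c)) B" using B by (simp add: emeasure_density nn_integral_cmult_indicator)
    finally show "emeasure ?\<rho> B = emeasure (density \<mu> (\<lambda>_. c)) B" .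
  qed simp
  then have "AE y in \<mu>. h y = c" by (intro \<mu>.density_unique[OF h]) auto
  then show ?thesis by blast
qed

end

section \<open>Unit quaternions\<close>

text \<open>The pair \<open>(a, b)\<close> stands for the matrix with first column \<open>(a, b)\<close> and second
  column \<open>(- cnj b, cnj a)\<close>; the unit sphere is thus SU(2).\<close>

type_synonym quat = "complex \<times> complex"

definition qmul :: "quat \<Rightarrow> quat \<Rightarrow> quat" (infixl "\<odot>" 70) where
  "p \<odot> q = (fst p * fst q - cnj (snd p) * snd q, snd p * fst q + cnj (fst p) * snd q)"

definition qcnj :: "quat \<Rightarrow> quat" where "qcnj p = (cnj (fst p), - snd p)"

definition qone :: quat where "qone = (1, 0)"

definition qre :: "quat \<Rightarrow> real" where "qre p = Re (fst p)"

definition S3 :: "quat set" where "S3 = {p. norm p = 1}"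

lemma qmul_assoc: "p \<odot> q \<odot> r = p \<odot> (q \<odot> r)"
  by (simp add: qmul_def algebra_simps)

lemma qmul_one [simp]: "p \<odot> qone = p" "qone \<odot> p = p"
  by (simp_all add: qmul_def qone_def prod_eq_iff)

lemma norm_quat_sq: "(norm (p::quat))\<^sup>2 = (cmod (fst p))\<^sup>2 + (cmod (snd p))\<^sup>2"
  by (simp add: norm_prod_def)

text \<open>Euler's four-square identity, in real coordinates.\<close>

lemma norm_qmul: "norm (p \<odot> q) = norm p * norm q"
proof -
  have "(norm (p \<odot> q))\<^sup>2 = (norm p * norm q)\<^sup>2"
    unfolding power_mult_distrib norm_quat_sq cmod_power2
    by (simp add: qmul_def) algebra
  then show ?thesis by (simp add: power2_eq_iff_nonneg)
qed

lemma norm_qcnj [simp]: "norm (qcnj p) = norm p"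
  by (simp add: qcnj_def norm_prod_def)

lemma qmul_add: "p \<odot> (q + r) = p \<odot> q + p \<odot> r" "(p + q) \<odot> r = p \<odot> r + q \<odot> r"
  and qmul_diff: "p \<odot> (q - r) = p \<odot> q - p \<odot> r" "(p - q) \<odot> r = p \<odot> r - q \<odot> r"
  and qmul_minus [simp]: "p \<odot> (- q) = - (p \<odot> q)" "(- p) \<odot> q = - (p \<odot> q)"
  and qmul_scaleR [simp]: "p \<odot> (c *\<^sub>R q) = c *\<^sub>R (p \<odot> q)" "(c *\<^sub>R p) \<odot> q = c *\<^sub>R (p \<odot> q)"
  by (simp_all add: qmul_def algebra_simps)

lemma bounded_bilinear_qmul: "bounded_bilinear (\<odot>)"
  by (rule bounded_bilinear.intro) (auto simp: qmul_add norm_qmul intro: exI[of _ 1])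

lemmas continuous_on_qmul [continuous_intros] = bounded_bilinear.continuous_on[OF bounded_bilinear_qmul]

lemma continuous_on_qre [continuous_intros]:
  "continuous_on A f \<Longrightarrow> continuous_on A (\<lambda>x. qre (f x))"
  unfolding qre_def by (intro continuous_intros)

lemma qcnj_qcnj [simp]: "qcnj (qcnj p) = p"
  by (simp add: qcnj_def)

lemma qcnj_minus: "qcnj (- p) = - qcnj p"
  by (simp add: qcnj_def)

lemma qcnj_qmul: "qcnj (p \<odot> q) = qcnj q \<odot> qcnj p"
  by (simp add: qcnj_def qmul_def)

lemma qmul_qcnj: "p \<odot> qcnj p = (norm p)\<^sup>2 *\<^sub>R qone" "qcnj p \<odot> p = (norm p)\<^sup>2 *\<^sub>R qone"
  unfolding norm_quat_sq cmod_power2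
  by (simp_all add: qmul_def qcnj_def qone_def complex_eq_iff power2_eq_square)

lemma S3_qone [simp]: "qone \<in> S3" and S3_qmul [simp]: "p \<in> S3 \<Longrightarrow> q \<in> S3 \<Longrightarrow> p \<odot> q \<in> S3"
  and S3_qcnj [simp]: "p \<in> S3 \<Longrightarrow> qcnj p \<in> S3" and S3_minus [simp]: "- p \<in> S3 \<longleftrightarrow> p \<in> S3"
  by (simp_all add: S3_def norm_qmul) (simp add: qone_def norm_prod_def)

lemma S3_inverse [simp]: "p \<in> S3 \<Longrightarrow> p \<odot> qcnj p = qone" "p \<in> S3 \<Longrightarrow> qcnj p \<odot> p = qone"
  by (simp_all add: qmul_qcnj S3_def)

lemma S3_cancel [simp]:
  "p \<in> S3 \<Longrightarrow> p \<odot> (qcnj p \<odot> q) = q" "p \<in> S3 \<Longrightarrow> qcnj p \<odot> (p \<odot> q) = q"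
  by (simp_all add: qmul_assoc[symmetric])

lemma compact_S3: "compact S3"
proof -
  have "S3 = sphere 0 1" by (auto simp: S3_def)
  then show ?thesis by (metis compact_sphere)
qed

lemma norm_qmul_diff_left: "p \<in> S3 \<Longrightarrow> norm (p \<odot> q - p \<odot> r) = norm (q - r)"
  unfolding qmul_diff[symmetric] by (simp add: norm_qmul S3_def)

lemma norm_qmul_diff_right: "p \<in> S3 \<Longrightarrow> norm (q \<odot> p - r \<odot> p) = norm (q - r)"
  unfolding qmul_diff[symmetric] by (simp add: norm_qmul S3_def)

lemma norm_qmul_minus_one:
  assumes "p \<in> S3" shows "norm (p \<odot> q - qone) \<le> norm (p - qone) + norm (q - qone)"
proof -
  have "p \<odot> q - qone = (p \<odot> q - p \<odot> qone) + (p - qone)" by simp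
  then have "norm (p \<odot> q - qone) \<le> norm (p \<odot> q - p \<odot> qone) + norm (p - qone)"
    by (metis norm_triangle_ineq)
  then show ?thesis unfolding norm_qmul_diff_left[OF assms] by simp
qed

lemma norm_conj_minus_one:
  assumes "p \<in> S3" shows "norm (p \<odot> q \<odot> qcnj p - qone) = norm (q - qone)"
proof -
  have "p \<odot> q \<odot> qcnj p - qone = (p \<odot> q) \<odot> qcnj p - (p \<odot> qone) \<odot> qcnj p" using assms by simp
  also have "norm \<dots> = norm (q - qone)"
    using assms by (simp only: norm_qmul_diff_right S3_qcnj norm_qmul_diff_left)
  finally show ?thesis .
qed

lemma norm_sq_minus_qone: "p \<in> S3 \<Longrightarrow> (norm (p - qone))\<^sup>2 = 2 - 2 * qre p"
proof -
  assume "p \<in> S3"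
  then have "(Re (fst p))\<^sup>2 + (Im (fst p))\<^sup>2 + ((Re (snd p))\<^sup>2 + (Im (snd p))\<^sup>2) = 1"
    using norm_quat_sq[of p] by (simp add: S3_def cmod_power2)
  then show ?thesis unfolding norm_quat_sq cmod_power2
    by (simp add: qone_def qre_def power2_eq_square algebra_simps)
qed

lemma qre_le: "\<bar>qre p\<bar> \<le> norm p"
proof -
  have "\<bar>qre p\<bar> \<le> cmod (fst p)" by (simp add: qre_def abs_Re_le_cmod)
  also have "\<dots> \<le> norm p" using norm_fst_le[of "fst p" "snd p"] by simp
  finally show ?thesis .
qed

lemma qre_minus [simp]: "qre (- p) = - qre p"
  by (simp add: qre_def)

lemma qre_diff: "qre (p - q) = qre p - qre q"
  by (simp add: qre_def)

subsection \<open>Iterated square roots\<close>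

text \<open>The normalised midpoint of the chord from the identity to \<open>s\<close>, that is, the
  square root that halves the angle; it degenerates only at the antipode of the identity.\<close>

definition qsqrt :: "quat \<Rightarrow> quat" where
  "qsqrt s = (qone + s) /\<^sub>R norm (qone + s)"

text \<open>The bound \<open>-1/2\<close> keeps the norm of \<open>qone + s\<close> at least 1, so
  away from the antipode, while this cap and its negative still cover the sphere and overlap in a
  whole band around the equator.\<close>

definition S3_right :: "quat set" where
  "S3_right = {s \<in> S3. qre s \<ge> - (1 / 2)}"

lemma norm_qone_add:
  assumes "s \<in> S3" shows "(norm (qone + s))\<^sup>2 = 2 + 2 * qre s"
proof -
  have "norm (- s - qone) = norm (qone + s)"
  proof -
    have "- s - qone = - (qone + s)" by simp
    then show ?thesis by (simp only: norm_minus_cancel)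
  qed
  then show ?thesis using norm_sq_minus_qone[of "- s"] assms by (simp only: S3_minus qre_minus)
qed

text \<open>The contraction: with \<open>r\<close> the norm of \<open>qone + s\<close>, the squared
  distances to the identity are \<open>2 - r\<close> after and \<open>4 - r\<^sup>2\<close> before
  the root. Their ratio is \<open>1 / (2 + r)\<close>, at most \<open>1/3\<close> as
  \<open>r\<close> is at least 1. The constant \<open>3/5\<close> is a convenient rational above the
  square root of \<open>1/3\<close>.\<close>

lemma qsqrt:
  assumes "s \<in> S3_right"
  shows "qsqrt s \<odot> qsqrt s = s" "qsqrt s \<in> S3_right"
    "norm (qsqrt s - qone) \<le> 3/5 * norm (s - qone)"
proof -
  have s: "s \<in> S3" "qre s \<ge> - (1/2)" using assms by (auto simp: S3_right_def)
  define r where "r = norm (qone + s)"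
  have r2: "r\<^sup>2 = 2 + 2 * qre s" unfolding r_def by (rule norm_qone_add[OF s(1)])
  then have r2': "r\<^sup>2 \<ge> 1" using s(2) by simp
  have r0: "r \<ge> 0" by (simp add: r_def)
  have r: "r \<ge> 1" using r2' r0 by (metis one_power2 power2_le_imp_le)
  have nn: "(Re (fst s))\<^sup>2 + (Im (fst s))\<^sup>2 + (cmod (snd s))\<^sup>2 = 1"
    using norm_quat_sq[of s] s by (simp add: S3_def cmod_power2)
  have sq: "(qone + s) \<odot> (qone + s) = (2 + 2 * qre s) *\<^sub>R s"
    using nn unfolding cmod_power2
    by (auto simp: qmul_def qone_def qre_def prod_eq_iff complex_eq_iff power2_eq_square algebra_simps)
  have "qsqrt s \<odot> qsqrt s = (inverse r * inverse r) *\<^sub>R ((qone + s) \<odot> (qone + s))"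
    by (simp add: qsqrt_def r_def[symmetric])
  also have "\<dots> = (inverse r * inverse r * r\<^sup>2) *\<^sub>R s" unfolding sq r2 by simp
  also have "inverse r * inverse r * r\<^sup>2 = 1" using r by (simp add: power2_eq_square divide_inverse[symmetric] field_simps)
  finally show "qsqrt s \<odot> qsqrt s = s" by simp
  have qr: "qre (qsqrt s) = r / 2"
  proof -
    have "qre (qsqrt s) = (1 + qre s) / r"
      by (simp add: qsqrt_def r_def[symmetric]) (simp add: qre_def qone_def divide_inverse mult.commute)
    also have "1 + qre s = r\<^sup>2 / 2" using r2 by simp
    finally show ?thesis using r by (simp add: power2_eq_square)
  qed
  have S: "qsqrt s \<in> S3" using r by (simp add: S3_def qsqrt_def r_def[symmetric])
  then show "qsqrt s \<in> S3_right" using qr r by (simp add: S3_right_def)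
  have "(norm (qsqrt s - qone))\<^sup>2 = 2 - r" using norm_sq_minus_qone[OF S] qr by simp
  moreover have n2: "(norm (s - qone))\<^sup>2 = 4 - r\<^sup>2" using norm_sq_minus_qone[OF s(1)] r2 by simp
  moreover have "2 - r \<ge> 0" using zero_le_power2[of "norm (qsqrt s - qone)"] calculation(1) by simp
  then have "(3/5)\<^sup>2 * (4 - r\<^sup>2) \<ge> 2 - r"
  proof -
    have "(3/5)\<^sup>2 * (4 - r\<^sup>2) - (2 - r) = (2 - r) * ((3/5)\<^sup>2 * (2 + r) - 1)"
      by (simp add: power2_eq_square algebra_simps)
    also have "\<dots> \<ge> 0" using \<open>2 - r \<ge> 0\<close> r by (intro mult_nonneg_nonneg) (simp_all add: power2_eq_square)
    finally show ?thesis by simp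
  qed
  ultimately have "(norm (qsqrt s - qone))\<^sup>2 \<le> (3/5 * norm (s - qone))\<^sup>2"
    unfolding power_mult_distrib by (simp only: )
  then show "norm (qsqrt s - qone) \<le> 3/5 * norm (s - qone)"
    by (rule power2_le_imp_le) simp
qed

lemma qsqrt_iter:
  assumes "s \<in> S3_right"
  shows "(qsqrt ^^ k) s \<in> S3_right" "((\<lambda>p. p \<odot> p) ^^ k) ((qsqrt ^^ k) s) = s"
    "norm ((qsqrt ^^ k) s - qone) \<le> (3/5) ^ k * norm (s - qone)"
proof (induction k)
  case (Suc k)
  { case 1 show ?case using Suc.IH(1) qsqrt(2) by simp }
  { case 2
    have "((\<lambda>p. p \<odot> p) ^^ k) (qsqrt ((qsqrt ^^ k) s) \<odot> qsqrt ((qsqrt ^^ k) s)) = s"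
      using qsqrt(1)[OF Suc.IH(1)] Suc.IH(2) by simp
    then show ?case unfolding funpow_Suc_right[of k "\<lambda>p. p \<odot> p"] funpow.simps(2)[of k qsqrt] o_apply . }
  { case 3
    have "norm (qsqrt ((qsqrt ^^ k) s) - qone) \<le> 3/5 * norm ((qsqrt ^^ k) s - qone)"
      by (rule qsqrt(3)[OF Suc.IH(1)])
    then show ?case using Suc.IH(3) by simp }
qed (use assms in auto)

lemma continuous_on_qsqrt_iter: "continuous_on S3_right (qsqrt ^^ k)"
proof (induction k)
  case (Suc k)
  have "norm (qone + s) \<noteq> 0" if "s \<in> S3_right" for s
    using that norm_qone_add[of s] by (auto simp: S3_right_def)
  then have "continuous_on S3_right qsqrt"
    unfolding qsqrt_def by (intro continuous_intros) auto
  moreover have "(qsqrt ^^ k) ` S3_right \<subseteq> S3_right" using qsqrt_iter(1) by blast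
  ultimately show ?case
    using Suc by (simp add: continuous_on_compose2[of S3_right qsqrt] o_def)
qed (simp add: continuous_on_id)

lemma compact_S3_right: "compact S3_right"
proof -
  have "S3_right = S3 \<inter> {s. qre s \<ge> - (1/2)}" by (auto simp: S3_right_def)
  moreover have "closed {s. qre s \<ge> - (1/2)}"
    unfolding qre_def by (intro closed_Collect_le continuous_intros)
  ultimately show ?thesis using compact_S3 by (metis compact_Int_closed)
qed

lemma small_root_exists:
  assumes "\<delta> > 0"
  shows "\<exists>k. \<forall>s\<in>S3_right. norm ((qsqrt ^^ k) s - qone) < \<delta>"
proof -
  obtain k where k: "(3/5) ^ k < \<delta> / 2"
    using real_arch_pow_inv[of "\<delta> / 2" "3/5"] assms by auto
  have "norm ((qsqrt ^^ k) s - qone) < \<delta>" if s: "s \<in> S3_right" for s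
  proof -
    have "norm (s - qone) \<le> norm s + norm qone" by (rule norm_triangle_ineq4)
    also have "\<dots> = 2" using s S3_qone by (simp add: S3_def S3_right_def)
    finally have "(3/5) ^ k * norm (s - qone) \<le> (3/5) ^ k * 2" by (intro mult_left_mono) auto
    then show ?thesis using qsqrt_iter(3)[OF s, of k] k by linarith
  qed
  then show ?thesis by blast
qed

text \<open>Elements of the cap are iterated squares of a root lying in the ball, and every element
  is a product of two elements of the cap. With \<open>T\<close> closed under products only, this
  serves as an induction principle for multiplicative properties.\<close>

lemma S3_generated_by_ball:
  assumes T: "\<And>p q. p \<in> T \<Longrightarrow> q \<in> T \<Longrightarrow> p \<odot> q \<in> T"
    and ball: "\<delta> > 0" "\<And>w. w \<in> S3 \<Longrightarrow> norm (w - qone) < \<delta> \<Longrightarrow> w \<in> T"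
  shows "S3 \<subseteq> T"
proof -
  have right: "s \<in> T" if s: "s \<in> S3_right" for s
  proof -
    obtain k where k: "norm ((qsqrt ^^ k) s - qone) < \<delta>" using small_root_exists[OF ball(1)] s by blast
    have sq: "((\<lambda>p. p \<odot> p) ^^ j) p \<in> T" if "p \<in> T" for p j
      by (induction j) (use that T in auto)
    have "(qsqrt ^^ k) s \<in> T" using ball(2) k qsqrt_iter(1)[OF s, of k] by (simp add: S3_right_def)
    then show ?thesis using sq[of "(qsqrt ^^ k) s" k] qsqrt_iter(2)[OF s, of k] by simp
  qed
  show ?thesis
  proof
    fix t assume t: "t \<in> S3"
    \<comment> \<open>The sign makes the real part of \<open>t \<odot> qcnj i\<close> equal to the
      absolute value of \<open>Im (fst t)\<close>, so this factor and the purely imaginary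
      \<open>i\<close> both lie in the cap.\<close>
    define c :: real where "c = (if Im (fst t) \<ge> 0 then 1 else - 1)"
    define i where "i = (Complex 0 c, 0::complex)"
    have i: "i \<in> S3" by (simp add: i_def c_def S3_def norm_prod_def cmod_def)
    have "qre i = 0" by (simp add: i_def qre_def)
    then have "i \<in> T" using i by (intro right) (simp add: S3_right_def)
    moreover have "qre (t \<odot> qcnj i) = \<bar>Im (fst t)\<bar>"
      by (simp add: i_def qcnj_def qmul_def qre_def c_def)
    then have "t \<odot> qcnj i \<in> T" using t i by (intro right) (simp add: S3_right_def)
    ultimately have "t \<odot> qcnj i \<odot> i \<in> T" by (rule T[rotated])
    then show "t \<in> T" using i by (simp add: qmul_assoc)
  qed
qed

text \<open>The band is the image of an interval times the 2-sphere of imaginary directions, taken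
  in \<open>real \<times> complex\<close>. Connectedness of that sphere is the topological input for
  gluing the two lifts below.\<close>

lemma connected_S3_equator: "connected {s \<in> S3. \<bar>qre s\<bar> < 1/2}"
proof -
  let ?f = "\<lambda>(t::real, x::real, b::complex).
    (Complex t (sqrt (1 - t\<^sup>2) * x), complex_of_real (sqrt (1 - t\<^sup>2)) * b)"
  have n: "norm (x::real, b::complex) = 1 \<longleftrightarrow> x\<^sup>2 + (cmod b)\<^sup>2 = 1" for x b
    by (simp add: norm_prod_def)
  have eq: "?f ` ({-1/2<..<1/2} \<times> sphere 0 1) = {s \<in> S3. \<bar>qre s\<bar> < 1/2}" (is "?L = ?R")
  proof (intro equalityI subsetI)
    fix s assume "s \<in> ?L"
    then obtain t x b where t: "- 1/2 < t" "t < 1/2" and xb: "x\<^sup>2 + (cmod b)\<^sup>2 = 1" and s: "s = ?f (t, x, b)"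
      by (auto simp: n)
    have "\<bar>t\<bar> < 1" using t by linarith
    then have t1: "t\<^sup>2 < 1" by (simp add: abs_square_less_1)
    have "(norm s)\<^sup>2 = t\<^sup>2 + (1 - t\<^sup>2) * (x\<^sup>2 + (cmod b)\<^sup>2)"
      unfolding norm_quat_sq s using t1
      by (simp add: cmod_power2 norm_mult power_mult_distrib algebra_simps)
    then have "norm s = 1" unfolding xb by (simp add: power2_eq_1_iff) (use norm_ge_zero[of s] in linarith)
    then show "s \<in> ?R" using t s by (auto simp: S3_def qre_def)
  next
    fix s assume s: "s \<in> ?R"
    define t where "t = qre s"
    have "\<bar>t\<bar> < 1" using s by (simp add: t_def)
    then have t1: "t\<^sup>2 < 1" by (simp add: abs_square_less_1)
    define r where "r = sqrt (1 - t\<^sup>2)"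
    have r: "r > 0" "r\<^sup>2 = 1 - t\<^sup>2" using t1 by (simp_all add: r_def)
    have nn: "t\<^sup>2 + (Im (fst s))\<^sup>2 + (cmod (snd s))\<^sup>2 = 1"
      using norm_quat_sq[of s] s by (simp add: S3_def cmod_power2 t_def qre_def)
    have "s = ?f (t, Im (fst s) / r, snd s / of_real r)"
      using r(1) unfolding split_conv r_def[symmetric] by (simp add: prod_eq_iff complex_eq_iff t_def qre_def)
    moreover have "(Im (fst s) / r)\<^sup>2 + (cmod (snd s / of_real r))\<^sup>2 = 1"
    proof -
      have "(Im (fst s) / r)\<^sup>2 + (cmod (snd s / of_real r))\<^sup>2 = ((Im (fst s))\<^sup>2 + (cmod (snd s))\<^sup>2) / r\<^sup>2"
        using r(1) by (simp add: norm_divide power_divide add_divide_distrib)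
      also have "\<dots> = 1" using nn r by (metis add_diff_cancel_left' add.assoc divide_self power_not_zero less_numeral_extra(3))
      finally show ?thesis .
    qed
    ultimately show "s \<in> ?L" using s
      by (intro image_eqI[of _ _ "(t, Im (fst s) / r, snd s / of_real r)"])
         (auto simp: n t_def)
  qed
  have C: "connected ({-1/2<..<1/2::real} \<times> sphere (0::real \<times> complex) 1)"
    by (intro connected_Times connected_Ioo connected_sphere) (simp add: DIM_complex)
  have "continuous_on UNIV ?f"
    unfolding Complex_eq case_prod_unfold by (intro continuous_intros)
  then have "continuous_on ({-1/2<..<1/2} \<times> sphere 0 1) ?f"
    by (rule continuous_on_subset) simp
  from connected_continuous_image[OF this C] show ?thesis unfolding eq .
qed

section \<open>Extending local homomorphisms from SU(2)\<close>

locale local_hom_S3 = group G for G :: "('g, 'm) monoid_scheme" (structure) +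
  fixes \<phi> :: "quat \<Rightarrow> 'g" and \<epsilon> :: real
  assumes eps: "\<epsilon> > 0"
    and closed: "\<And>w. w \<in> S3 \<Longrightarrow> norm (w - qone) < \<epsilon> \<Longrightarrow> \<phi> w \<in> carrier G"
    and local_hom: "\<And>v w. v \<in> S3 \<Longrightarrow> w \<in> S3 \<Longrightarrow> norm (v - qone) < \<epsilon> \<Longrightarrow> norm (w - qone) < \<epsilon> \<Longrightarrow>
      norm (v \<odot> w - qone) < \<epsilon> \<Longrightarrow> \<phi> (v \<odot> w) = \<phi> v \<otimes> \<phi> w"
begin

abbreviation sq :: "'g \<Rightarrow> 'g" where "sq x \<equiv> x \<otimes> x"
abbreviation qsq :: "quat \<Rightarrow> quat" where "qsq p \<equiv> p \<odot> p"

lemma sq_closed: "x \<in> carrier G \<Longrightarrow> (sq ^^ k) x \<in> carrier G"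
  by (induction k) auto

lemma qsq_closed: "p \<in> S3 \<Longrightarrow> (qsq ^^ k) p \<in> S3"
  by (induction k) auto

lemma phi_one: "\<phi> qone = \<one>"
proof -
  have "\<phi> qone = \<phi> qone \<otimes> \<phi> qone" using local_hom[of qone qone] eps by simp
  then show ?thesis using closed[of qone] eps by simp
qed

text \<open>\<open>x\<close> conjugates small values of \<open>\<phi>\<close> as \<open>a\<close>
  conjugates their arguments. This is the information about a value at \<open>a\<close> that
  survives when \<open>a\<close> is too far from the identity for the local homomorphism
  law.\<close>

definition implements :: "quat \<Rightarrow> 'g \<Rightarrow> bool" where
  "implements a x \<longleftrightarrow> a \<in> S3 \<and> x \<in> carrier G \<and>
    (\<forall>w\<in>S3. norm (w - qone) < \<epsilon> / 2 \<longrightarrow> \<phi> w \<otimes> x = x \<otimes> \<phi> (qcnj a \<odot> w \<odot> a))"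

lemma norm_conj_minus_one':
  "p \<in> S3 \<Longrightarrow> norm (qcnj p \<odot> q \<odot> p - qone) = norm (q - qone)"
  using norm_conj_minus_one[of "qcnj p" q] by simp

lemma implements_phi:
  assumes a: "a \<in> S3" "norm (a - qone) < \<epsilon> / 2"
  shows "implements a (\<phi> a)"
  unfolding implements_def
proof (intro conjI ballI impI)
  show "\<phi> a \<in> carrier G" using closed[of a] a eps by simp
  fix w assume w: "w \<in> S3" "norm (w - qone) < \<epsilon> / 2"
  have "norm (w \<odot> a - qone) < \<epsilon>" using norm_qmul_minus_one[of w a] w a by simp
  then have "\<phi> w \<otimes> \<phi> a = \<phi> (w \<odot> a)" using local_hom[of w a] w a eps by simp
  also have "w \<odot> a = a \<odot> (qcnj a \<odot> w \<odot> a)" using a by (simp add: qmul_assoc)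
  also have "\<phi> \<dots> = \<phi> a \<otimes> \<phi> (qcnj a \<odot> w \<odot> a)"
    using \<open>norm (w \<odot> a - qone) < \<epsilon>\<close> a w eps norm_conj_minus_one'[of a w]
    by (intro local_hom) (simp_all add: qmul_assoc)
  finally show "\<phi> w \<otimes> \<phi> a = \<phi> a \<otimes> \<phi> (qcnj a \<odot> w \<odot> a)" .
qed (rule a)

lemma implements_sq:
  assumes "implements a x" shows "implements (a \<odot> a) (x \<otimes> x)"
  unfolding implements_def
proof (intro conjI ballI impI)
  have a: "a \<in> S3" and x: "x \<in> carrier G" using assms by (auto simp: implements_def)
  then show "a \<odot> a \<in> S3" "x \<otimes> x \<in> carrier G" by auto
  fix w assume w: "w \<in> S3" "norm (w - qone) < \<epsilon> / 2"
  let ?w = "qcnj a \<odot> w \<odot> a"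
  have w': "?w \<in> S3" "norm (?w - qone) < \<epsilon> / 2" using w a norm_conj_minus_one' by auto
  then have w'': "norm (qcnj a \<odot> ?w \<odot> a - qone) < \<epsilon> / 2" using a norm_conj_minus_one' by auto
  have c: "\<phi> w \<in> carrier G" "\<phi> ?w \<in> carrier G" "\<phi> (qcnj a \<odot> ?w \<odot> a) \<in> carrier G"
    using closed w w' w'' a eps by auto
  have "\<phi> w \<otimes> (x \<otimes> x) = x \<otimes> (\<phi> ?w \<otimes> x)"
    using assms w x c by (simp add: implements_def m_assoc[symmetric])
  also have "\<phi> ?w \<otimes> x = x \<otimes> \<phi> (qcnj a \<odot> ?w \<odot> a)"
    using assms w' by (simp add: implements_def)
  finally show "\<phi> w \<otimes> (x \<otimes> x) = x \<otimes> x \<otimes> \<phi> (qcnj (a \<odot> a) \<odot> w \<odot> (a \<odot> a))"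
    using x c by (simp add: m_assoc qcnj_qmul qmul_assoc)
qed

text \<open>Two nearby roots are followed through \<open>j\<close> squarings. With \<open>c\<close>
  the quotient of the iterates, the next quotient is a conjugate of \<open>c\<close> times
  \<open>c\<close>, so its distance to the identity at most doubles; \<open>implements\<close> moves
  \<open>\<phi> c\<close> past \<open>x\<close>, which gives the same recursion in \<open>G\<close>.
  The hypothesis with \<open>2 ^ k\<close> is the budget for all \<open>k\<close> doublings.\<close>

lemma sq_iter_phi:
  assumes a: "a \<in> S3" "norm (a - qone) < \<epsilon> / 2" and b: "b \<in> S3" "norm (b - qone) < \<epsilon> / 2"
    and d: "2 ^ k * norm (qcnj a \<odot> b - qone) < \<epsilon> / 2" and "j \<le> k"
  shows "implements ((qsq ^^ j) a) ((sq ^^ j) (\<phi> a)) \<and>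
    norm (qcnj ((qsq ^^ j) a) \<odot> (qsq ^^ j) b - qone) \<le> 2 ^ j * norm (qcnj a \<odot> b - qone) \<and>
    (sq ^^ j) (\<phi> b) = (sq ^^ j) (\<phi> a) \<otimes> \<phi> (qcnj ((qsq ^^ j) a) \<odot> (qsq ^^ j) b)"
  using \<open>j \<le> k\<close>
proof (induction j)
  case 0
  let ?c = "qcnj a \<odot> b"
  have "norm (?c - qone) \<le> 2 ^ k * norm (?c - qone)"
    using mult_right_mono[of 1 "2 ^ k :: real" "norm (?c - qone)"] by simp
  then have "norm (?c - qone) < \<epsilon>" using d eps by linarith
  then have "\<phi> (a \<odot> ?c) = \<phi> a \<otimes> \<phi> ?c"
    using a b eps by (intro local_hom) simp_all
  then show ?case using a implements_phi[OF a] by simp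
next
  case (Suc j)
  define a' where "a' = (qsq ^^ j) a"
  define b' where "b' = (qsq ^^ j) b"
  define x where "x = (sq ^^ j) (\<phi> a)"
  define y where "y = (sq ^^ j) (\<phi> b)"
  define c where "c = qcnj a' \<odot> b'"
  have S: "a' \<in> S3" "b' \<in> S3" using a b qsq_closed by (auto simp: a'_def b'_def)
  then have cS: "c \<in> S3" by (simp add: c_def)
  have imp: "implements a' x" and nc: "norm (c - qone) \<le> 2 ^ j * norm (qcnj a \<odot> b - qone)"
    and y: "y = x \<otimes> \<phi> c"
    using Suc.IH Suc.prems by (auto simp: a'_def b'_def x_def y_def c_def)
  have "2 * norm (c - qone) \<le> 2 ^ Suc j * norm (qcnj a \<odot> b - qone)" using nc by simp
  also have "\<dots> \<le> 2 ^ k * norm (qcnj a \<odot> b - qone)"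
    using Suc.prems by (intro mult_right_mono power_increasing) auto
  finally have n: "2 * norm (c - qone) < \<epsilon> / 2" using d by simp
  let ?c = "qcnj a' \<odot> c \<odot> a'"
  have n': "norm (?c - qone) = norm (c - qone)" by (rule norm_conj_minus_one'[OF S(1)])
  have b'c: "b' = a' \<odot> c" using S by (simp add: c_def)
  have e: "qcnj (a' \<odot> a') \<odot> (b' \<odot> b') = ?c \<odot> c"
    unfolding b'c using S by (simp add: qcnj_qmul qmul_assoc)
  have n2: "norm (?c \<odot> c - qone) \<le> 2 * norm (c - qone)"
    using norm_qmul_minus_one[of ?c c] S cS n' by simp
  have cl: "x \<in> carrier G" "\<phi> c \<in> carrier G" "\<phi> ?c \<in> carrier G"
  proof -
    have p: "norm (c - qone) \<ge> 0" by simp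
    show "x \<in> carrier G" using imp by (simp add: implements_def)
    show "\<phi> c \<in> carrier G" by (rule closed[OF cS]) (use n p in linarith)
    show "\<phi> ?c \<in> carrier G" by (rule closed) (use S cS n n' p in \<open>simp, linarith\<close>)
  qed
  have "y \<otimes> y = x \<otimes> (\<phi> c \<otimes> x) \<otimes> \<phi> c" unfolding y using cl by (simp add: m_assoc)
  also have "\<phi> c \<otimes> x = x \<otimes> \<phi> ?c"
  proof -
    have "norm (c - qone) < \<epsilon> / 2" using n norm_ge_zero[of "c - qone"] by linarith
    then show ?thesis using imp cS unfolding implements_def by blast
  qed
  also have "x \<otimes> (x \<otimes> \<phi> ?c) \<otimes> \<phi> c = x \<otimes> x \<otimes> (\<phi> ?c \<otimes> \<phi> c)" using cl by (simp add: m_assoc)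
  also have "\<phi> ?c \<otimes> \<phi> c = \<phi> (?c \<odot> c)"
  proof (rule local_hom[symmetric])
    have p: "norm (c - qone) \<ge> 0" by simp
    show "norm (c - qone) < \<epsilon>" "norm (?c - qone) < \<epsilon>" "norm (?c \<odot> c - qone) < \<epsilon>"
      using n n' n2 p eps by linarith+
  qed (use S cS in simp_all)
  finally have "y \<otimes> y = x \<otimes> x \<otimes> \<phi> (qcnj (a' \<odot> a') \<odot> (b' \<odot> b'))" unfolding e .
  moreover have "norm (qcnj (a' \<odot> a') \<odot> (b' \<odot> b') - qone) \<le> 2 ^ Suc j * norm (qcnj a \<odot> b - qone)"
    unfolding e using n2 nc by simp
  ultimately show ?case using implements_sq[OF imp]
    by (simp add: a'_def b'_def x_def y_def)
qed

text \<open>\<open>\<sigma>\<close> takes a small \<open>2 ^ k\<close>-th root, applies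
  \<open>\<phi>\<close> and raises to the power \<open>2 ^ k\<close>. The cap is not closed under
  products, so the homomorphism law is recorded in a local form, for uniformly close
  arguments.\<close>

lemma extend_right:
  "\<exists>\<sigma> \<delta>. \<delta> > 0 \<and> \<sigma> qone = \<one> \<and> (\<forall>s\<in>S3_right. \<sigma> s \<in> carrier G) \<and>
    (\<forall>s\<in>S3_right. \<forall>t\<in>S3_right. norm (s - t) < \<delta> \<longrightarrow> \<sigma> t = \<sigma> s \<otimes> \<phi> (qcnj s \<odot> t))"
proof -
  obtain k where k: "\<And>s. s \<in> S3_right \<Longrightarrow> norm ((qsqrt ^^ k) s - qone) < \<epsilon> / 2"
    using small_root_exists[of "\<epsilon> / 2"] eps by auto
  define \<sigma> where "\<sigma> s = (sq ^^ k) (\<phi> ((qsqrt ^^ k) s))" for s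
  \<comment> \<open>Compactness of the cap gives one \<open>\<delta>\<close> for all pairs. The
    roots must be within \<open>\<epsilon> / 2 ^ Suc k\<close>, since \<open>k\<close> squarings may
    enlarge their distance by \<open>2 ^ k\<close>.\<close>
  have "uniformly_continuous_on S3_right (qsqrt ^^ k)"
    by (rule compact_uniformly_continuous[OF continuous_on_qsqrt_iter compact_S3_right])
  moreover have "\<epsilon> / 2 ^ Suc k > 0" using eps by simp
  ultimately obtain \<delta> where \<delta>: "\<delta> > 0"
    "\<And>s t. s \<in> S3_right \<Longrightarrow> t \<in> S3_right \<Longrightarrow> dist t s < \<delta> \<Longrightarrow>
      dist ((qsqrt ^^ k) t) ((qsqrt ^^ k) s) < \<epsilon> / 2 ^ Suc k"
    unfolding uniformly_continuous_on_def by metis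
  have one: "(qsqrt ^^ k) qone = qone"
  proof (induction k)
    case (Suc k)
    have "norm (qone + qone) = 2"
      by (simp add: qone_def norm_prod_def)
    then have "qsqrt qone = qone"
      by (simp add: qsqrt_def scaleR_2[symmetric])
    then show ?case using Suc by simp
  qed simp
  have onek: "(sq ^^ k) \<one> = \<one>" by (induction k) auto
  have "\<sigma> qone = \<one>" unfolding \<sigma>_def one phi_one onek by simp
  moreover have "\<sigma> s \<in> carrier G" if "s \<in> S3_right" for s
    unfolding \<sigma>_def using k[OF that] qsqrt_iter(1)[OF that, of k] eps
    by (intro sq_closed closed) (auto simp: S3_right_def)
  moreover have "\<sigma> t = \<sigma> s \<otimes> \<phi> (qcnj s \<odot> t)"
    if s: "s \<in> S3_right" and t: "t \<in> S3_right" and st: "norm (s - t) < \<delta>" for s t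
  proof -
    let ?a = "(qsqrt ^^ k) s" and ?b = "(qsqrt ^^ k) t"
    have S: "?a \<in> S3" "?b \<in> S3" using qsqrt_iter(1) s t by (auto simp: S3_right_def)
    have "norm (qcnj ?a \<odot> ?b - qone) = norm (?a \<odot> (qcnj ?a \<odot> ?b) - ?a \<odot> qone)"
      by (rule norm_qmul_diff_left[OF S(1), symmetric])
    also have "\<dots> = norm (?b - ?a)" using S by simp
    also have "\<dots> < \<epsilon> / 2 ^ Suc k" using \<delta>(2)[OF s t] st by (simp add: dist_norm norm_minus_commute)
    finally have "2 ^ k * norm (qcnj ?a \<odot> ?b - qone) < \<epsilon> / 2" by (simp add: field_simps)
    from sq_iter_phi[OF S(1) k[OF s] S(2) k[OF t] this order_refl]
    show ?thesis by (simp add: \<sigma>_def qsqrt_iter(2) s t)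
  qed
  ultimately show ?thesis using \<delta>(1) by blast
qed

text \<open>On the overlap of the two right/left pieces the lifts of \<open>s\<close> and \<open>- s\<close> differ by a locally
  constant factor; the overlap is connected, which is where simple connectedness of SU(2) enters.\<close>

theorem extend_local_hom:
  "\<exists>p \<delta>. \<delta> > 0 \<and> (\<forall>s\<in>S3. p s \<in> carrier G) \<and> (\<forall>s\<in>S3. \<forall>t\<in>S3. p (s \<odot> t) = p s \<otimes> p t) \<and>
    (\<forall>w\<in>S3. norm (w - qone) < \<delta> \<longrightarrow> p w = \<phi> w)"
proof -
  obtain \<sigma> \<delta>0 where \<delta>0: "\<delta>0 > 0" and one: "\<sigma> qone = \<one>"
    and \<sigma>c: "\<And>s. s \<in> S3_right \<Longrightarrow> \<sigma> s \<in> carrier G"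
    and \<sigma>: "\<And>s t. s \<in> S3_right \<Longrightarrow> t \<in> S3_right \<Longrightarrow> norm (s - t) < \<delta>0 \<Longrightarrow> \<sigma> t = \<sigma> s \<otimes> \<phi> (qcnj s \<odot> t)"
    using extend_right by metis
  define E where "E = {s \<in> S3. \<bar>qre s\<bar> < 1/2}"
  have E_right: "s \<in> S3_right" "- s \<in> S3_right" if "s \<in> E" for s
    using that by (auto simp: E_def S3_right_def)
  \<comment> \<open>The bound \<open>1/2\<close> forces two close points on opposite sides of
    \<open>qre = 0\<close> into the band \<open>E\<close>; this settles the mixed cases of the
    gluing.\<close>
  define \<delta> where "\<delta> = min (min \<delta>0 \<epsilon>) (1/2)"
  have \<delta>: "\<delta> > 0" "\<delta> \<le> \<delta>0" "\<delta> \<le> \<epsilon>" "\<delta> \<le> 1/2" using \<delta>0 eps by (auto simp: \<delta>_def)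
  define h where "h s = \<sigma> (- s) \<otimes> inv (\<sigma> s)" for s
  have hl: "h t = h s" if s: "s \<in> E" and t: "t \<in> E" and st: "norm (s - t) < \<delta>" for s t
  proof -
    let ?w = "qcnj s \<odot> t"
    have sS: "s \<in> S3" "t \<in> S3" using s t by (auto simp: E_def)
    have "norm (?w - qone) = norm (s \<odot> ?w - s \<odot> qone)" by (rule norm_qmul_diff_left[OF sS(1), symmetric])
    also have "\<dots> = norm (s - t)" using sS by (simp add: norm_minus_commute)
    finally have w: "\<phi> ?w \<in> carrier G" using closed[of ?w] sS st \<delta> by simp
    have "\<sigma> t = \<sigma> s \<otimes> \<phi> ?w" using \<sigma> E_right s t st \<delta> by simp
    moreover have "\<sigma> (- t) = \<sigma> (- s) \<otimes> \<phi> (qcnj (- s) \<odot> (- t))"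
      using \<sigma>[of "- s" "- t"] E_right s t st \<delta> by (simp add: norm_minus_commute)
    moreover have "qcnj (- s) \<odot> (- t) = ?w" by (simp add: qcnj_def qmul_def)
    moreover have "\<phi> ?w \<otimes> (inv (\<phi> ?w) \<otimes> z) = z" if "z \<in> carrier G" for z
      using that w by (simp add: m_assoc[symmetric])
    ultimately show ?thesis
      using w \<sigma>c E_right[OF s] by (simp add: h_def inv_mult_group m_assoc)
  qed
  have "h constant_on E"
  proof (rule locally_constant_imp_constant)
    show "connected E" unfolding E_def by (rule connected_S3_equator)
    fix a assume a: "a \<in> E"
    have op: "openin (top_of_set E) (E \<inter> ball a \<delta>)" by (simp add: openin_open_Int)
    have aT: "a \<in> E \<inter> ball a \<delta>" using a \<delta>(1) by simp
    have "h x = h a" if "x \<in> E \<inter> ball a \<delta>" for x using hl[OF a, of x] that by (simp add: dist_norm)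
    with op aT show "\<exists>T. openin (top_of_set E) T \<and> a \<in> T \<and> (\<forall>x\<in>T. h x = h a)" by blast
  qed
  then obtain z where z: "\<And>s. s \<in> E \<Longrightarrow> h s = z" unfolding constant_on_def by metis
  \<comment> \<open>A point of \<open>E\<close>, showing that the constant \<open>z\<close>, the
    future value of \<open>p\<close> at \<open>- qone\<close>, lies in the group.\<close>
  have i: "(\<i>, 0) \<in> E" by (simp add: E_def S3_def qre_def norm_prod_def)
  have zc: "z \<in> carrier G" using z[OF i] \<sigma>c E_right[OF i] by (auto simp: h_def)
  have z1: "\<sigma> (- s) = z \<otimes> \<sigma> s" if s: "s \<in> E" for s
    using z[OF s, symmetric] \<sigma>c[OF E_right(1)[OF s]] \<sigma>c[OF E_right(2)[OF s]]
    by (simp add: h_def m_assoc)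
  \<comment> \<open>The band is symmetric, so the previous fact applies to \<open>- s\<close>; on
    the band both branches of \<open>p\<close> below therefore agree.\<close>
  have z2: "\<sigma> s = z \<otimes> \<sigma> (- s)" if s: "s \<in> E" for s
    using z1[of "- s"] s by (auto simp: E_def)
  define p where "p s = (if qre s \<ge> 0 then \<sigma> s else z \<otimes> \<sigma> (- s))" for s
  have right: "qre s \<ge> 0 \<Longrightarrow> s \<in> S3_right" "qre s \<le> 0 \<Longrightarrow> - s \<in> S3_right" if "s \<in> S3" for s
    using that by (auto simp: S3_right_def)
  have pc: "p s \<in> carrier G" if "s \<in> S3" for s
    using right[OF that] \<sigma>c zc by (simp add: p_def)
  have p\<phi>: "p (s \<odot> w) = p s \<otimes> \<phi> w" if s: "s \<in> S3" and w: "w \<in> S3" "norm (w - qone) < \<delta>" for s w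
  proof -
    let ?t = "s \<odot> w"
    have t: "?t \<in> S3" using s w by simp
    have n: "norm (s - ?t) < \<delta>" using norm_qmul_diff_left[OF s, of qone w] w by (simp add: norm_minus_commute)
    have sw: "qcnj s \<odot> ?t = w" "qcnj (- s) \<odot> (- ?t) = w" using s by (simp_all add: qcnj_minus)
    have wc: "\<phi> w \<in> carrier G" using closed[OF w(1)] w(2) \<delta> by simp
    have up: "\<sigma> ?t = \<sigma> s \<otimes> \<phi> w" if "s \<in> S3_right" "?t \<in> S3_right"
      using \<sigma>[OF that] n \<delta> sw by simp
    have down: "\<sigma> (- ?t) = \<sigma> (- s) \<otimes> \<phi> w" if "- s \<in> S3_right" "- ?t \<in> S3_right"
      using \<sigma>[OF that] n \<delta> sw by (simp add: norm_minus_commute)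
    have r: "\<bar>qre s - qre ?t\<bar> < 1/2" using qre_le[of "s - ?t"] n \<delta> by (simp add: qre_diff)
    consider "qre s \<ge> 0" "qre ?t \<ge> 0" | "qre s < 0" "qre ?t < 0" | "qre s \<ge> 0" "qre ?t < 0"
      | "qre s < 0" "qre ?t \<ge> 0" by linarith
    then show ?thesis
    proof cases
      case 1 then show ?thesis using up right s t by (simp add: p_def)
    next
      case 2
      then show ?thesis using down right[OF s] right[OF t] zc wc \<sigma>c by (simp add: p_def m_assoc)
    next
      case 3
      then have E: "s \<in> E" "?t \<in> E" using r s t by (auto simp: E_def)
      then have "p ?t = \<sigma> ?t" using z2[of ?t] 3 by (simp add: p_def)
      then show ?thesis using up E_right E 3 by (simp add: p_def)
    next
      case 4
      then have E: "s \<in> E" "?t \<in> E" using r s t by (auto simp: E_def)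
      then have "p s = \<sigma> s" using z2[of s] 4 by (simp add: p_def)
      then show ?thesis using up E_right E 4 by (simp add: p_def)
    qed
  qed
  have p1: "p qone = \<one>" by (simp add: p_def one) (simp add: qre_def qone_def)
  have pw: "p w = \<phi> w" if "w \<in> S3" "norm (w - qone) < \<delta>" for w
    using p\<phi>[of qone w] that p1 closed[of w] \<delta> by simp
  \<comment> \<open>The homomorphism law is known for right factors near the identity; the right
    factors that satisfy it against every left factor are closed under products.\<close>
  define T where "T = {t \<in> S3. \<forall>s\<in>S3. p (s \<odot> t) = p s \<otimes> p t}"
  have "S3 \<subseteq> T"
  proof (rule S3_generated_by_ball[OF _ \<delta>(1)])
    fix a b assume a: "a \<in> T" and b: "b \<in> T"
    then have S: "a \<in> S3" "b \<in> S3" by (auto simp: T_def)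
    have "p (s \<odot> (a \<odot> b)) = p s \<otimes> p (a \<odot> b)" if s: "s \<in> S3" for s
    proof -
      have "p (s \<odot> a \<odot> b) = p s \<otimes> p a \<otimes> p b" using a b s S by (simp add: T_def)
      moreover have "p (a \<odot> b) = p a \<otimes> p b" using b S by (simp add: T_def)
      ultimately show ?thesis using pc S s by (simp add: qmul_assoc m_assoc)
    qed
    then show "a \<odot> b \<in> T" using S by (simp add: T_def)
  qed (simp add: T_def p\<phi> pw)
  then show ?thesis using \<delta>(1) pc pw unfolding T_def by blast
qed

end

section \<open>Quaternion coordinates on SU(2) and U(1)\<close>

text \<open>The circle is placed among the quaternions, as the diagonal matrices, so that both kinds
  of factors share one type and one product.\<close>

definition S1 :: "quat set" where "S1 = {p \<in> S3. snd p = 0}"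

lemma S1_subset_S3: "S1 \<subseteq> S3"
  by (auto simp: S1_def)

lemma S1_qone [simp]: "qone \<in> S1"
  by (simp add: S1_def) (simp add: qone_def)

lemma S1_qmul [simp]: "p \<in> S1 \<Longrightarrow> q \<in> S1 \<Longrightarrow> p \<odot> q \<in> S1"
  by (simp add: S1_def) (simp add: qmul_def)

lemma S1_qcnj [simp]: "p \<in> S1 \<Longrightarrow> qcnj p \<in> S1"
  by (simp add: S1_def) (simp add: qcnj_def)

lemma S1_iff: "p \<in> S1 \<longleftrightarrow> cmod (fst p) = 1 \<and> snd p = 0"
proof -
  have "cmod z = 1" if "(cmod z)\<^sup>2 = 1" for z
    using that power2_eq_imp_eq[of "cmod z" 1] by simp
  then show ?thesis by (auto simp: S1_def S3_def norm_prod_def)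
qed

definition qmat :: "quat \<Rightarrow> complex^2^2" where
  "qmat p = (\<chi> i j. if i = 1 then (if j = 1 then fst p else - cnj (snd p))
                    else (if j = 1 then snd p else cnj (fst p)))"

lemma qmat_entries [simp]:
  "qmat p $ 1 $ 1 = fst p" "qmat p $ 2 $ 1 = snd p" "qmat p $ 1 $ 2 = - cnj (snd p)" "qmat p $ 2 $ 2 = cnj (fst p)"
  by (simp_all add: qmat_def)

lemma qmat_qmul: "qmat (p \<odot> q) = qmat p ** qmat q"
  by (simp add: vec_eq_iff forall_2 matrix_matrix_mult_def sum_2 qmul_def algebra_simps)

lemma qmat_qone: "qmat qone = mat 1"
  by (simp add: vec_eq_iff forall_2 qone_def mat_def)

lemma qmat_in_SU2:
  assumes "p \<in> S3" shows "qmat p \<in> carrier SU2"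
proof -
  have n: "fst p * cnj (fst p) + snd p * cnj (snd p) = 1"
    using norm_quat_sq[of p] assms
    by (simp add: S3_def complex_norm_square[symmetric] flip: of_real_add of_real_power)
  then show ?thesis
    by (simp add: SU2_def vec_eq_iff forall_2 matrix_matrix_mult_def sum_2 det_2 mat_def) (simp add: algebra_simps)
qed

text \<open>The inverse of a matrix of determinant 1 is its adjugate, that of a unitary matrix its
  conjugate transpose; comparing the two determines the second column from the first.\<close>

lemma SU2_imp_qmat:
  assumes "M \<in> carrier SU2"
  shows "(M $ 1 $ 1, M $ 2 $ 1) \<in> S3" "qmat (M $ 1 $ 1, M $ 2 $ 1) = M"
proof -
  define a where "a = M $ 1 $ 1"
  define b where "b = M $ 1 $ 2"
  define c where "c = M $ 2 $ 1"
  define d where "d = M $ 2 $ 2"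
  have e: "a * cnj a + b * cnj b = 1" "a * cnj c + b * cnj d = 0" "c * cnj c + d * cnj d = 1"
    "c * cnj a + d * cnj b = 0" "a * d - b * c = 1"
    using assms
    by (simp_all add: SU2_def vec_eq_iff forall_2 matrix_matrix_mult_def sum_2 det_2 mat_def a_def b_def c_def d_def)
  have d: "cnj a = d"
  proof -
    have "cnj a = cnj a * (a * d - b * c)" using e by simp
    also have "\<dots> = d * (a * cnj a) - b * (c * cnj a)" by (simp add: algebra_simps)
    also have "c * cnj a = - (d * cnj b)" using e(4) by (simp add: add_eq_0_iff2)
    also have "d * (a * cnj a) - b * - (d * cnj b) = d * (a * cnj a + b * cnj b)" by (simp add: algebra_simps)
    finally show ?thesis using e by simp
  qed
  have b: "- cnj c = b"
  proof -
    have "cnj c = cnj c * (a * d - b * c)" using e by simp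
    also have "\<dots> = d * (a * cnj c) - b * (c * cnj c)" by (simp add: algebra_simps)
    also have "a * cnj c = - (b * cnj d)" using e(2) by (simp add: add_eq_0_iff2)
    also have "d * - (b * cnj d) - b * (c * cnj c) = - b * (c * cnj c + d * cnj d)" by (simp add: algebra_simps)
    finally show ?thesis using e by simp
  qed
  show "qmat (M $ 1 $ 1, M $ 2 $ 1) = M"
    using b d by (simp add: vec_eq_iff forall_2 a_def b_def c_def d_def)
  have "of_real ((norm (a, c))\<^sup>2) = a * d + c * - b"
    unfolding norm_quat_sq d[symmetric] b[symmetric] of_real_add complex_norm_square by simp
  also have "\<dots> = 1" using e by (simp add: algebra_simps)
  finally have "(norm (a, c))\<^sup>2 = 1" by (metis of_real_eq_1_iff)
  then show "(M $ 1 $ 1, M $ 2 $ 1) \<in> S3"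
    using power2_eq_imp_eq[of "norm (a, c)" 1] by (simp add: S3_def a_def c_def)
qed

lemma continuous_on_qmat: "continuous_on A qmat"
  unfolding qmat_def
proof (intro continuous_on_vec_lambda)
  fix i j :: 2
  show "continuous_on A (\<lambda>x. if i = 1 then if j = 1 then fst x else - cnj (snd x)
      else if j = 1 then snd x else cnj (fst x))"
    by (cases "i = 1"; cases "j = 1") (simp_all add: continuous_intros)
qed

section \<open>Coordinate boxes around the identity\<close>

text \<open>The first \<open>a\<close> of the \<open>a + b\<close> coordinates belong to the SU(2) factors.\<close>

definition fac :: "nat \<Rightarrow> nat \<Rightarrow> quat set" where
  "fac a k = (if k < a then S3 else S1)"

definition qbox :: "nat \<Rightarrow> nat \<Rightarrow> real \<Rightarrow> (nat \<Rightarrow> quat) set" where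
  "qbox a N \<epsilon> = {l. \<forall>k<N. l k \<in> fac a k \<and> norm (l k - qone) < \<epsilon>}"

definition to_product :: "nat \<Rightarrow> nat \<Rightarrow> (nat \<Rightarrow> quat) \<Rightarrow> (nat \<Rightarrow> complex^2^2) \<times> (nat \<Rightarrow> complex)" where
  "to_product a b l = (\<lambda>j\<in>{..<a}. qmat (l j), \<lambda>i\<in>{..<b}. fst (l (a + i)))"

lemma fac_subset_S3: "l \<in> fac a k \<Longrightarrow> l \<in> S3"
  using S1_subset_S3 by (auto simp: fac_def split: if_splits)

lemma fac_qmul [simp]: "p \<in> fac a k \<Longrightarrow> q \<in> fac a k \<Longrightarrow> p \<odot> q \<in> fac a k"
  and fac_qone [simp]: "qone \<in> fac a k"
  and fac_qcnj [simp]: "p \<in> fac a k \<Longrightarrow> qcnj p \<in> fac a k"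
  by (auto simp: fac_def)

lemma uniform_eps:
  assumes "\<And>j. j < n \<Longrightarrow> \<exists>e>0. Q j e" and mono: "\<And>j e e'. Q j e \<Longrightarrow> e' \<le> e \<Longrightarrow> Q j e'"
  shows "\<exists>e>0::real. \<forall>j<n::nat. Q j e"
  using assms(1)
proof (induction n)
  case (Suc n)
  then obtain e where "e > 0" "\<forall>j<n. Q j e" by (meson less_SucI)
  moreover obtain e' where "e' > 0" "Q n e'" using Suc.prems by blast
  ultimately show ?case
    using mono by (intro exI[of _ "min e e'"]) (auto simp: less_Suc_eq intro: min.cobounded1 min.cobounded2)
qed (auto intro: exI[of _ 1])

lemma to_product_box_subset:
  assumes V: "openin (SU2_U1_topology a b) V" and one: "\<one>\<^bsub>SU2_U1_product a b\<^esub> \<in> V"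
  shows "\<exists>\<delta>>0. to_product a b ` qbox a (a + b) \<delta> \<subseteq> V"
proof -
  let ?o = "(\<lambda>j\<in>{..<a}. mat 1 :: complex^2^2, \<lambda>i\<in>{..<b}. 1 :: complex)"
  have "?o \<in> V" using one by (simp add: SU2_U1_product_def DirProd_def SU2_def U1_def)
  then obtain V1 V2 where V1: "openin (product_topology (\<lambda>_. top_of_set (carrier SU2)) {..<a}) V1"
    and V2: "openin (product_topology (\<lambda>_. top_of_set (carrier U1)) {..<b}) V2"
    and o: "fst ?o \<in> V1" "snd ?o \<in> V2" and sub: "V1 \<times> V2 \<subseteq> V"
    using V unfolding SU2_U1_topology_def openin_prod_topology_alt by (metis fst_conv snd_conv)
  obtain W1 where W1: "\<And>j. j < a \<Longrightarrow> openin (top_of_set (carrier SU2)) (W1 j)"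
    and oW1: "fst ?o \<in> Pi\<^sub>E {..<a} W1" and sW1: "Pi\<^sub>E {..<a} W1 \<subseteq> V1"
    using V1[unfolded openin_product_topology_alt, rule_format, OF o(1)] by auto
  obtain W2 where W2: "\<And>j. j < b \<Longrightarrow> openin (top_of_set (carrier U1)) (W2 j)"
    and oW2: "snd ?o \<in> Pi\<^sub>E {..<b} W2" and sW2: "Pi\<^sub>E {..<b} W2 \<subseteq> V2"
    using V2[unfolded openin_product_topology_alt, rule_format, OF o(2)] by auto
  have "\<exists>e>0. \<forall>s\<in>S3. norm (s - qone) < e \<longrightarrow> qmat s \<in> W1 j" if j: "j < a" for j
  proof -
    obtain T where T: "open T" "W1 j = carrier SU2 \<inter> T" using W1[OF j] by (auto simp: openin_open)
    have "open (qmat -` T)" using T continuous_on_qmat[of UNIV] by (simp add: open_vimage)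
    moreover have "qone \<in> qmat -` T" using oW1 j T by (auto simp: PiE_iff qmat_qone)
    ultimately obtain e where "e > 0" "ball qone e \<subseteq> qmat -` T" by (rule openE)
    then show ?thesis using T(2) qmat_in_SU2
      by (intro exI[of _ e]) (auto simp: subset_iff dist_norm norm_minus_commute)
  qed
  then obtain e1 where e1: "e1 > 0" "\<forall>j<a. \<forall>s\<in>S3. norm (s - qone) < e1 \<longrightarrow> qmat s \<in> W1 j"
    using uniform_eps[of a "\<lambda>j e. \<forall>s\<in>S3. norm (s - qone) < e \<longrightarrow> qmat s \<in> W1 j"] by fastforce
  have "\<exists>e>0. \<forall>s\<in>S1. norm (s - qone) < e \<longrightarrow> fst s \<in> W2 j" if j: "j < b" for j
  proof -
    obtain T where T: "open T" "W2 j = carrier U1 \<inter> T" using W2[OF j] by (auto simp: openin_open)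
    have "open (fst -` T :: quat set)" using T by (simp add: open_vimage_fst)
    moreover have "qone \<in> fst -` T" using oW2 j T by (auto simp: PiE_iff qone_def)
    ultimately obtain e where "e > 0" "ball qone e \<subseteq> fst -` T" by (rule openE)
    moreover have "fst s \<in> W2 j" if "s \<in> S1" "norm (s - qone) < e" for s
    proof -
      have "s \<in> ball qone e" using that(2) by (simp add: dist_norm norm_minus_commute)
      then have "fst s \<in> T" using calculation(2) by blast
      then show ?thesis using that(1) T(2) by (simp add: U1_def S1_iff)
    qed
    ultimately show ?thesis by blast
  qed
  then obtain e2 where e2: "e2 > 0" "\<forall>j<b. \<forall>s\<in>S1. norm (s - qone) < e2 \<longrightarrow> fst s \<in> W2 j"
    using uniform_eps[of b "\<lambda>j e. \<forall>s\<in>S1. norm (s - qone) < e \<longrightarrow> fst s \<in> W2 j"] by fastforce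
  have "to_product a b l \<in> V" if l: "l \<in> qbox a (a + b) (min e1 e2)" for l
  proof -
    have lk: "l k \<in> fac a k \<and> norm (l k - qone) < min e1 e2" if "k < a + b" for k
      using l that unfolding qbox_def by blast
    have "(\<lambda>j\<in>{..<a}. qmat (l j)) \<in> Pi\<^sub>E {..<a} W1"
    proof (rule PiE_I)
      fix j assume "j \<in> {..<a}"
      then have j: "j < a" by simp
      then have "l j \<in> fac a j \<and> norm (l j - qone) < min e1 e2" using lk[of j] by simp
      then have "l j \<in> S3" "norm (l j - qone) < e1" using j by (simp_all add: fac_def)
      then show "(\<lambda>j\<in>{..<a}. qmat (l j)) j \<in> W1 j" using j e1(2) by simp
    qed simp
    moreover have "(\<lambda>i\<in>{..<b}. fst (l (a + i))) \<in> Pi\<^sub>E {..<b} W2"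
    proof (rule PiE_I)
      fix j assume "j \<in> {..<b}"
      then have j: "j < b" by simp
      then have "l (a + j) \<in> fac a (a + j) \<and> norm (l (a + j) - qone) < min e1 e2" using lk[of "a + j"] by simp
      then have "l (a + j) \<in> S1" "norm (l (a + j) - qone) < e2" by (simp_all add: fac_def)
      then show "(\<lambda>i\<in>{..<b}. fst (l (a + i))) j \<in> W2 j" using j e2(2) by simp
    qed simp
    ultimately show ?thesis unfolding to_product_def using sub sW1 sW2 by blast
  qed
  then show ?thesis using e1(1) e2(1) by (intro exI[of _ "min e1 e2"]) auto
qed

text \<open>With \<open>to_product_box_subset\<close> this makes the boxes a base of open
  neighbourhoods of the identity.\<close>

lemma openin_to_product_box:
  "openin (SU2_U1_topology a b) (to_product a b ` qbox a (a + b) \<epsilon>)"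
proof -
  let ?W1 = "{M \<in> carrier SU2. norm ((M $ 1 $ 1, M $ 2 $ 1) - qone) < \<epsilon>}"
  let ?W2 = "{z \<in> carrier U1. norm (z - 1) < \<epsilon>}"
  have n1: "norm ((z, 0::complex) - qone) = cmod (z - 1)" for z
    by (simp add: qone_def norm_prod_def)
  have "to_product a b ` qbox a (a + b) \<epsilon> = Pi\<^sub>E {..<a} (\<lambda>_. ?W1) \<times> Pi\<^sub>E {..<b} (\<lambda>_. ?W2)" (is "?L = ?R")
  proof (intro equalityI subsetI)
    fix x assume "x \<in> ?L"
    then obtain l where l: "\<And>k. k < a + b \<Longrightarrow> l k \<in> fac a k \<and> norm (l k - qone) < \<epsilon>" and x: "x = to_product a b l"
      by (auto simp: qbox_def)
    have "qmat (l j) \<in> ?W1" if "j < a" for j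
      using l[of j] that qmat_in_SU2 by (simp add: fac_def)
    moreover have "fst (l (a + j)) \<in> ?W2" if j: "j < b" for j
    proof -
      have s: "l (a + j) \<in> S1" "norm (l (a + j) - qone) < \<epsilon>" using l[of "a + j"] j by (simp_all add: fac_def)
      then have "l (a + j) = (fst (l (a + j)), 0)" by (simp add: S1_iff prod_eq_iff)
      then have "norm (fst (l (a + j)) - 1) < \<epsilon>" using s(2) n1 by metis
      then show ?thesis using s(1) by (simp add: U1_def S1_iff)
    qed
    ultimately show "x \<in> ?R" unfolding x to_product_def by auto
  next
    fix x assume "x \<in> ?R"
    then obtain u v where x: "x = (u, v)" and u: "u \<in> Pi\<^sub>E {..<a} (\<lambda>_. ?W1)" and v: "v \<in> Pi\<^sub>E {..<b} (\<lambda>_. ?W2)"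
      by blast
    define l where "l k = (if k < a then (u k $ 1 $ 1, u k $ 2 $ 1) else (v (k - a), 0))" for k
    have "l \<in> qbox a (a + b) \<epsilon>"
      unfolding qbox_def
    proof (intro CollectI allI impI)
      fix k assume k: "k < a + b"
      show "l k \<in> fac a k \<and> norm (l k - qone) < \<epsilon>"
      proof (cases "k < a")
        case True
        then have "u k \<in> ?W1" using PiE_mem[OF u, of k] by simp
        then show ?thesis using True SU2_imp_qmat(1) by (simp add: l_def fac_def)
      next
        case False
        then have "v (k - a) \<in> ?W2" using PiE_mem[OF v, of "k - a"] k by simp
        then show ?thesis using False by (simp add: l_def fac_def S1_iff n1 U1_def)
      qed
    qed
    moreover have "to_product a b l = x"
    proof -
      have "(\<lambda>j\<in>{..<a}. qmat (l j)) = u"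
      proof (rule extensionalityI[of _ "{..<a}"])
        fix j assume j: "j \<in> {..<a}"
        then have "u j \<in> ?W1" using PiE_mem[OF u, of j] by simp
        then have "u j \<in> carrier SU2" by simp
        then show "(\<lambda>j\<in>{..<a}. qmat (l j)) j = u j" using j SU2_imp_qmat(2) by (simp add: l_def)
      next
        show "u \<in> extensional {..<a}" using u by (simp add: PiE_iff)
      qed simp
      moreover have "(\<lambda>i\<in>{..<b}. fst (l (a + i))) = v"
        using v by (intro extensionalityI[of _ "{..<b}"]) (simp_all add: l_def PiE_iff)
      ultimately show ?thesis by (simp add: to_product_def x)
    qed
    ultimately show "x \<in> ?L" by blast
  qed
  moreover have "openin (top_of_set (carrier SU2)) ?W1"
  proof -
    have "open {M :: complex^2^2. norm ((M $ 1 $ 1, M $ 2 $ 1) - qone) < \<epsilon>}"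
      by (intro open_Collect_less continuous_intros)
    moreover have "?W1 = carrier SU2 \<inter> {M. norm ((M $ 1 $ 1, M $ 2 $ 1) - qone) < \<epsilon>}" by blast
    ultimately show ?thesis unfolding openin_open by blast
  qed
  moreover have "openin (top_of_set (carrier U1)) ?W2"
  proof -
    have "open {z :: complex. norm (z - 1) < \<epsilon>}" by (intro open_Collect_less continuous_intros)
    moreover have "?W2 = carrier U1 \<inter> {z. norm (z - 1) < \<epsilon>}" by blast
    ultimately show ?thesis unfolding openin_open by blast
  qed
  ultimately show ?thesis
    unfolding SU2_U1_topology_def by (simp add: openin_prod_Times_iff openin_PiE_gen)
qed

lemma to_product_mult:
  assumes "\<And>k. k < a + b \<Longrightarrow> l k \<in> fac a k" "\<And>k. k < a + b \<Longrightarrow> m k \<in> fac a k"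
  shows "to_product a b l \<otimes>\<^bsub>SU2_U1_product a b\<^esub> to_product a b m = to_product a b (\<lambda>k. l k \<odot> m k)"
proof -
  have "fst (l (a + i)) * fst (m (a + i)) = fst (l (a + i) \<odot> m (a + i))" if "i < b" for i
    using assms(1)[of "a + i"] assms(2)[of "a + i"] that by (simp add: fac_def S1_iff qmul_def)
  then show ?thesis
    by (auto simp: SU2_U1_product_def DirProd_def to_product_def SU2_def U1_def qmat_qmul product_group_def
        intro!: restrict_ext)
qed

lemma to_product_inj:
  assumes l: "\<And>k. k < a + b \<Longrightarrow> l k \<in> fac a k" and m: "\<And>k. k < a + b \<Longrightarrow> m k \<in> fac a k"
    and eq: "to_product a b l = to_product a b m" and k: "k < a + b"
  shows "l k = m k"
proof (cases "k < a")
  case True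
  have "(\<lambda>j\<in>{..<a}. qmat (l j)) k = (\<lambda>j\<in>{..<a}. qmat (m j)) k" using eq by (simp add: to_product_def)
  then have "qmat (l k) = qmat (m k)" using True by simp
  then show ?thesis by (metis prod_eqI qmat_entries(1,2))
next
  case False
  have "(\<lambda>i\<in>{..<b}. fst (l (a + i))) (k - a) = (\<lambda>i\<in>{..<b}. fst (m (a + i))) (k - a)"
    using eq by (simp add: to_product_def)
  moreover have "k - a < b" "a + (k - a) = k" using False k by auto
  ultimately have "fst (l k) = fst (m k)" by simp
  then show ?thesis using l[OF k] m[OF k] False by (simp add: fac_def S1_iff prod_eq_iff)
qed

context compact_haar_group
begin

text \<open>The local isomorphism read backwards, from quaternion coordinates to \<open>G\<close>.
  Boxes consist of functions on all of \<open>nat\<close>, so the last clause states that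
  \<open>\<Phi>\<close> depends only on the coordinates below \<open>a + b\<close>.\<close>

lemma local_chart:
  assumes "locally_isomorphic G X (SU2_U1_product a b) (SU2_U1_topology a b)"
  obtains \<Phi> \<epsilon> where "\<epsilon> > 0"
    "\<And>l. l \<in> qbox a (a + b) \<epsilon> \<Longrightarrow> \<Phi> l \<in> carrier G"
    "\<And>l m. l \<in> qbox a (a + b) \<epsilon> \<Longrightarrow> m \<in> qbox a (a + b) \<epsilon> \<Longrightarrow> (\<lambda>k. l k \<odot> m k) \<in> qbox a (a + b) \<epsilon> \<Longrightarrow>
      \<Phi> (\<lambda>k. l k \<odot> m k) = \<Phi> l \<otimes> \<Phi> m"
    "\<And>l m k. l \<in> qbox a (a + b) \<epsilon> \<Longrightarrow> m \<in> qbox a (a + b) \<epsilon> \<Longrightarrow> \<Phi> l = \<Phi> m \<Longrightarrow> k < a + b \<Longrightarrow> l k = m k"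
    "\<And>\<delta>. \<delta> > 0 \<Longrightarrow> \<delta> \<le> \<epsilon> \<Longrightarrow> openin X (\<Phi> ` qbox a (a + b) \<delta>)"
    "\<And>W. openin X W \<Longrightarrow> \<one> \<in> W \<Longrightarrow> \<exists>\<delta>>0. \<delta> \<le> \<epsilon> \<and> \<Phi> ` qbox a (a + b) \<delta> \<subseteq> W"
    "\<And>l m. \<forall>k<a + b. l k = m k \<Longrightarrow> \<Phi> l = \<Phi> m"
proof -
  let ?H = "SU2_U1_product a b" and ?Y = "SU2_U1_topology a b"
  obtain U V f where U: "openin X U" "\<one> \<in> U" and V: "openin ?Y V" "\<one>\<^bsub>?H\<^esub> \<in> V"
    and hf: "homeomorphic_map (subtopology X U) (subtopology ?Y V) f"
    and hom: "\<And>x y. x \<in> U \<Longrightarrow> y \<in> U \<Longrightarrow> (x \<otimes> y \<in> U \<longleftrightarrow> f x \<otimes>\<^bsub>?H\<^esub> f y \<in> V)"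
      "\<And>x y. x \<in> U \<Longrightarrow> y \<in> U \<Longrightarrow> x \<otimes> y \<in> U \<Longrightarrow> f (x \<otimes> y) = f x \<otimes>\<^bsub>?H\<^esub> f y"
    using assms unfolding locally_isomorphic_def by metis
  obtain g where g: "homeomorphic_maps (subtopology X U) (subtopology ?Y V) f g"
    using hf homeomorphic_map_maps by blast
  have tU: "topspace (subtopology X U) = U" using openin_subset[OF U(1)] by (simp add: Int_absorb1)
  have tV: "topspace (subtopology ?Y V) = V" using openin_subset[OF V(1)] by (simp add: Int_absorb1)
  have cf: "continuous_map (subtopology X U) (subtopology ?Y V) f"
    and cg: "continuous_map (subtopology ?Y V) (subtopology X U) g"
    and gf: "\<And>x. x \<in> U \<Longrightarrow> g (f x) = x" and fg: "\<And>y. y \<in> V \<Longrightarrow> f (g y) = y"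
    using g unfolding homeomorphic_maps_def tU tV by auto
  have gU: "g y \<in> U" if "y \<in> V" for y
    using continuous_map_funspace[OF cg] that unfolding tU tV by blast
  have fV: "f x \<in> V" if "x \<in> U" for x
    using continuous_map_funspace[OF cf] that unfolding tU tV by blast
  have UG: "U \<subseteq> carrier G" using openin_subset[OF U(1)] by (simp add: topspace_X)
  obtain \<epsilon> where eps: "\<epsilon> > 0" "to_product a b ` qbox a (a + b) \<epsilon> \<subseteq> V"
    using to_product_box_subset[OF V] by blast
  \<comment> \<open>The definition of local isomorphism does not say that \<open>f\<close> preserves
    the identity. Its preimage under \<open>f\<close> is idempotent in \<open>G\<close>, hence the
    identity.\<close>
  have f1: "f \<one> = \<one>\<^bsub>?H\<^esub>"
  proof -
    have one: "\<one>\<^bsub>?H\<^esub> = to_product a b (\<lambda>_. qone)"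
      by (simp add: SU2_U1_product_def DirProd_def to_product_def SU2_def U1_def qmat_qone) (simp add: qone_def)
    have oo: "\<one>\<^bsub>?H\<^esub> \<otimes>\<^bsub>?H\<^esub> \<one>\<^bsub>?H\<^esub> = \<one>\<^bsub>?H\<^esub>"
      unfolding one by (subst to_product_mult) auto
    have "g \<one>\<^bsub>?H\<^esub> \<otimes> g \<one>\<^bsub>?H\<^esub> \<in> U"
      using hom(1)[OF gU[OF V(2)] gU[OF V(2)]] V(2) by (simp add: fg oo)
    moreover have "f (g \<one>\<^bsub>?H\<^esub> \<otimes> g \<one>\<^bsub>?H\<^esub>) = \<one>\<^bsub>?H\<^esub>"
      using hom(2)[OF gU[OF V(2)] gU[OF V(2)] calculation] V(2) by (simp add: fg oo)
    ultimately have "g \<one>\<^bsub>?H\<^esub> \<otimes> g \<one>\<^bsub>?H\<^esub> = g \<one>\<^bsub>?H\<^esub>" using gf by metis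
    then have "g \<one>\<^bsub>?H\<^esub> = \<one>" using gU[OF V(2)] UG by (metis r_cancel_one' subsetD)
    then show ?thesis using fg[OF V(2)] by simp
  qed
  define \<Phi> where "\<Phi> l = g (to_product a b l)" for l
  have mono: "qbox a (a + b) \<delta> \<subseteq> qbox a (a + b) \<epsilon>" if "\<delta> \<le> \<epsilon>" for \<delta>
    using that by (auto simp: qbox_def)
  have EV: "to_product a b l \<in> V" if "l \<in> qbox a (a + b) \<epsilon>" for l using eps that by blast
  show thesis
  proof (rule that[OF eps(1), of \<Phi>])
    fix l assume l: "l \<in> qbox a (a + b) \<epsilon>"
    show "\<Phi> l \<in> carrier G" using gU[OF EV[OF l]] UG by (auto simp: \<Phi>_def)
    fix m assume m: "m \<in> qbox a (a + b) \<epsilon>"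
    { assume lm: "(\<lambda>k. l k \<odot> m k) \<in> qbox a (a + b) \<epsilon>"
      have e: "to_product a b l \<otimes>\<^bsub>?H\<^esub> to_product a b m = to_product a b (\<lambda>k. l k \<odot> m k)"
        using l m by (intro to_product_mult) (auto simp: qbox_def)
      have "\<Phi> l \<in> U" "\<Phi> m \<in> U" unfolding \<Phi>_def using gU EV l m by auto
      moreover from this have "\<Phi> l \<otimes> \<Phi> m \<in> U"
        using hom(1)[of "\<Phi> l" "\<Phi> m"] EV[OF lm] by (simp add: \<Phi>_def fg EV l m e)
      ultimately have "f (\<Phi> l \<otimes> \<Phi> m) = to_product a b (\<lambda>k. l k \<odot> m k)"
        using hom(2)[of "\<Phi> l" "\<Phi> m"] by (simp add: \<Phi>_def fg EV l m e)
      then show "\<Phi> (\<lambda>k. l k \<odot> m k) = \<Phi> l \<otimes> \<Phi> m"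
        using gf[OF \<open>\<Phi> l \<otimes> \<Phi> m \<in> U\<close>] by (simp add: \<Phi>_def) }
    fix k assume "\<Phi> l = \<Phi> m" "k < a + b"
    then have "to_product a b l = to_product a b m" using fg EV l m unfolding \<Phi>_def by metis
    then show "l k = m k" using l m \<open>k < a + b\<close> by (intro to_product_inj[of a b]) (auto simp: qbox_def)
  next
    fix \<delta> assume "\<delta> > 0" "\<delta> \<le> \<epsilon>"
    let ?B = "to_product a b ` qbox a (a + b) \<delta>"
    have BV: "?B \<subseteq> V" using mono[OF \<open>\<delta> \<le> \<epsilon>\<close>] eps by blast
    then have "openin (subtopology ?Y V) ?B" using openin_to_product_box[of a b \<delta>]
      by (auto simp: openin_subtopology)
    then have "openin (subtopology X U) {x \<in> U. f x \<in> ?B}"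
      using cf unfolding continuous_map_def tU by blast
    then have "openin X {x \<in> U. f x \<in> ?B}" using U(1) openin_trans_full by blast
    moreover have "{x \<in> U. f x \<in> ?B} = g ` ?B"
    proof (intro equalityI subsetI)
      fix x assume "x \<in> {x \<in> U. f x \<in> ?B}"
      then have "x = g (f x)" "f x \<in> ?B" using gf by auto
      then show "x \<in> g ` ?B" by blast
    next
      fix x assume "x \<in> g ` ?B"
      then obtain y where "y \<in> ?B" "x = g y" by blast
      moreover from this have "y \<in> V" using BV by blast
      ultimately show "x \<in> {x \<in> U. f x \<in> ?B}" using gU fg by simp
    qed
    ultimately show "openin X (\<Phi> ` qbox a (a + b) \<delta>)" by (simp add: \<Phi>_def image_image)
  next
    fix W assume W: "openin X W" "\<one> \<in> W"
    have "openin (subtopology X U) (U \<inter> W)" using W by (auto simp: openin_subtopology)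
    then have "openin (subtopology ?Y V) {y \<in> V. g y \<in> U \<inter> W}"
      using cg unfolding continuous_map_def tV by blast
    then have o: "openin ?Y {y \<in> V. g y \<in> U \<inter> W}" using V(1) openin_trans_full by blast
    have "g \<one>\<^bsub>?H\<^esub> = \<one>" using f1 gf[OF U(2)] by simp
    then have "\<one>\<^bsub>?H\<^esub> \<in> {y \<in> V. g y \<in> U \<inter> W}" using V U W by simp
    from to_product_box_subset[OF o this] obtain \<delta> where d: "\<delta> > 0"
      "to_product a b ` qbox a (a + b) \<delta> \<subseteq> {y \<in> V. g y \<in> U \<inter> W}" by blast
    have "qbox a (a + b) (min \<delta> \<epsilon>) \<subseteq> qbox a (a + b) \<delta>" by (auto simp: qbox_def)
    then have "\<Phi> ` qbox a (a + b) (min \<delta> \<epsilon>) \<subseteq> W" using d(2) by (auto simp: \<Phi>_def)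
    then show "\<exists>\<delta>>0. \<delta> \<le> \<epsilon> \<and> \<Phi> ` qbox a (a + b) \<delta> \<subseteq> W"
      using d(1) eps(1) by (intro exI[of _ "min \<delta> \<epsilon>"]) auto
  next
    fix l m :: "nat \<Rightarrow> quat" assume "\<forall>k<a + b. l k = m k"
    then have "to_product a b l = to_product a b m"
      unfolding to_product_def by (intro arg_cong2[where f = Pair] restrict_ext) simp_all
    then show "\<Phi> l = \<Phi> m" by (simp add: \<Phi>_def)
  qed
qed

end

section \<open>Bases inside a cocompact subgroup\<close>

text \<open>The dimension \<open>b\<close> is a term, so the finite-dimensional space is modelled
  inside \<open>nat \<Rightarrow> real\<close> by the functions vanishing from \<open>b\<close>
  on.\<close>

global_interpretation nat_real: vector_space "\<lambda>(c::real) (f::nat \<Rightarrow> real) i. c * f i"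
  by unfold_locales (auto simp: fun_eq_iff plus_fun_def algebra_simps)

lemma sum_fun_apply: "(\<Sum>x\<in>A. f x) i = (\<Sum>x\<in>A. f x (i::nat) :: real)"
  by (induction A rule: infinite_finite_induct) (auto simp: plus_fun_def zero_fun_def)

text \<open>A linear form vanishing on \<open>L\<close> but not on the \<open>k\<close>-th unit vector would be bounded on
  the multiples of this vector, by the hypothesis.\<close>

lemma cocompact_contains_basis:
  fixes L :: "(nat \<Rightarrow> real) set"
  assumes supp: "\<And>v i. v \<in> L \<Longrightarrow> i \<ge> b \<Longrightarrow> v i = 0"
    and cocompact: "\<And>k r. k < b \<Longrightarrow> \<exists>t. (\<forall>i<b. \<bar>t i\<bar> \<le> R) \<and> (\<forall>i\<ge>b. t i = 0) \<and>
      (\<lambda>i. 2 * ((if i = k then r else 0) - t i)) \<in> L"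
  shows "\<exists>(m::nat) v c. (\<forall>j<m. v j \<in> L) \<and>
    (\<forall>k<b. \<forall>i. (if i = k then 1 else 0) = (\<Sum>j<m. c k j * v j i))"
proof -
  define e where "e k = (\<lambda>i::nat. if i = k then 1 else 0 :: real)" for k
  have expand: "t = (\<Sum>k<b. (\<lambda>i. t k * e k i))" if "\<forall>i\<ge>b. t i = 0" for t
  proof
    fix i
    have "(\<Sum>k<b. t k * e k i) = (\<Sum>k<b. if k = i then t i else 0)"
      by (rule sum.cong) (auto simp: e_def)
    also have "\<dots> = t i" using that by (simp add: not_less)
    finally show "t i = (\<Sum>k<b. (\<lambda>i. t k * e k i)) i" by (simp add: sum_fun_apply)
  qed
  obtain B where B: "B \<subseteq> L" "nat_real.independent B" "L \<subseteq> nat_real.span B"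
    using nat_real.maximal_independent_subset by blast
  have "v \<in> nat_real.span (e ` {..<b})" if "v \<in> L" for v
  proof -
    have "\<forall>i\<ge>b. v i = 0" using supp that by blast
    from expand[OF this] have "v = (\<Sum>k<b. (\<lambda>i. v k * e k i))" .
    also have "\<dots> \<in> nat_real.span (e ` {..<b})"
      by (intro nat_real.span_sum nat_real.span_scale nat_real.span_base imageI)
    finally show ?thesis .
  qed
  then have fin: "finite B"
    using nat_real.independent_span_bound[of "e ` {..<b}" B] B by blast
  interpret vector_space_pair "\<lambda>(c::real) (f::nat \<Rightarrow> real) i. c * f i" "(*) :: real \<Rightarrow> real \<Rightarrow> real"
    by (intro vector_space_pair.intro nat_real.vector_space_axioms) (unfold_locales, auto simp: algebra_simps)
  have span: "e k \<in> nat_real.span B" if k: "k < b" for k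
  proof (rule ccontr)
    assume nk: "e k \<notin> nat_real.span B"
    then have ind: "nat_real.independent (insert (e k) B)" using B(2) nat_real.independent_insert by auto
    obtain f where f: "Vector_Spaces.linear (\<lambda>c f i. c * f i) (*) f" "\<forall>x\<in>insert (e k) B. f x = (if x = e k then 1 else 0)"
      using linear_independent_extend[OF ind, of "\<lambda>x. if x = e k then 1 else 0"] by blast
    have "e k \<notin> B" using nk nat_real.span_base by blast
    then have "f x = 0" if "x \<in> B" for x using f(2) that by auto
    then have f0: "f x = 0" if "x \<in> nat_real.span B" for x
      using linear_eq_0_on_span[OF f(1)] that by blast
    have fk: "f (e k) = 1" using f(2) by simp
    \<comment> \<open>\<open>M\<close> bounds \<open>f\<close> on vectors with entries at most
      \<open>R\<close>, whereas the multiple \<open>M + 1\<close> of the unit vector forces the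
      value \<open>M + 1\<close> there, as \<open>f\<close> vanishes on \<open>L\<close>.\<close>
    define M where "M = (\<Sum>j<b. R * \<bar>f (e j)\<bar>)"
    obtain t where t: "\<forall>i<b. \<bar>t i\<bar> \<le> R" "\<forall>i\<ge>b. t i = 0"
      "(\<lambda>i. 2 * ((if i = k then M + 1 else 0) - t i)) \<in> L"
      using cocompact[OF k, of "M + 1"] by (elim exE conjE) (rule that)
    have ft: "f t = (\<Sum>j<b. t j * f (e j))"
      using arg_cong[OF expand[OF t(2)], of f] by (simp only: linear_sum[OF f(1)] linear_scale[OF f(1)])
    have "f t \<le> M"
      unfolding ft M_def
    proof (rule sum_mono)
      fix j assume "j \<in> {..<b}"
      have "t j * f (e j) \<le> \<bar>t j\<bar> * \<bar>f (e j)\<bar>" by (metis abs_ge_self abs_mult)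
      also have "\<dots> \<le> R * \<bar>f (e j)\<bar>" using t(1) \<open>j \<in> {..<b}\<close> by (intro mult_right_mono) auto
      finally show "t j * f (e j) \<le> R * \<bar>f (e j)\<bar>" .
    qed
    moreover have "f t = M + 1"
    proof -
      have "(\<lambda>i. 2 * ((if i = k then M + 1 else 0) - t i)) = (\<lambda>i. 2 * ((\<lambda>i. (M + 1) * e k i) - t) i)"
        by (auto simp: e_def fun_eq_iff)
      then have "f (\<lambda>i. 2 * ((\<lambda>i. (M + 1) * e k i) - t) i) = 0" using f0 B(3) t(3) by auto
      then have "2 * (f (\<lambda>i. (M + 1) * e k i) - f t) = 0"
        by (simp only: linear_scale[OF f(1)] linear_diff[OF f(1)])
      then show ?thesis by (simp add: linear_scale[OF f(1)] fk)
    qed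
    ultimately show False by simp
  qed
  obtain v where v: "bij_betw v {..<card B} B"
    using ex_bij_betw_nat_finite[OF fin] atLeast0LessThan by metis
  have "\<exists>c. \<forall>i. e k i = (\<Sum>j<card B. c j * v j i)" if k: "k < b" for k
  proof -
    obtain u where u: "e k = (\<Sum>x\<in>B. (\<lambda>i. u x * x i))"
      using span[OF k] unfolding nat_real.span_finite[OF fin] by (elim rangeE)
    have "e k i = (\<Sum>x\<in>B. u x * x i)" for i unfolding u by (rule sum_fun_apply)
    then have "e k i = (\<Sum>j<card B. u (v j) * v j i)" for i
      using sum.reindex_bij_betw[OF v, of "\<lambda>x. u x * x i"] by simp
    then show ?thesis by (intro exI[of _ "\<lambda>j. u (v j)"]) blast
  qed
  then obtain c where "\<forall>k<b. \<forall>i. e k i = (\<Sum>j<card B. c k j * v j i)" by metis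
  moreover have "\<forall>j<card B. v j \<in> L" using v B(1) by (auto simp: bij_betw_def)
  ultimately show ?thesis unfolding e_def by blast
qed

section \<open>Products of commuting factors\<close>

text \<open>The product is ordered because only entries from different factors will commute.\<close>

primrec gprod :: "('g, 'm) monoid_scheme \<Rightarrow> nat \<Rightarrow> (nat \<Rightarrow> 'g) \<Rightarrow> 'g" where
  "gprod G 0 x = \<one>\<^bsub>G\<^esub>"
| "gprod G (Suc n) x = gprod G n x \<otimes>\<^bsub>G\<^esub> x n"

lemma gprod_cong: "(\<And>k. k < n \<Longrightarrow> x k = y k) \<Longrightarrow> gprod G n x = gprod G n y"
  by (induction n) auto

context group
begin

lemma gprod_closed [simp]: "(\<And>k. k < n \<Longrightarrow> x k \<in> carrier G) \<Longrightarrow> gprod G n x \<in> carrier G"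
  by (induction n) auto

lemma gprod_one [simp]: "gprod G n (\<lambda>k. \<one>) = \<one>"
  by (induction n) auto

lemma gprod_commute:
  assumes "y \<in> carrier G" "\<And>k. k < n \<Longrightarrow> x k \<in> carrier G" "\<And>k. k < n \<Longrightarrow> x k \<otimes> y = y \<otimes> x k"
  shows "gprod G n x \<otimes> y = y \<otimes> gprod G n x"
  using assms
proof (induction n)
  case (Suc n)
  have IH: "gprod G n x \<otimes> y = y \<otimes> gprod G n x" using Suc by simp
  have c: "gprod G n x \<in> carrier G" "x n \<in> carrier G" using Suc.prems by auto
  have "gprod G n x \<otimes> x n \<otimes> y = gprod G n x \<otimes> (y \<otimes> x n)"
    using Suc.prems(1,3) c by (simp add: m_assoc)
  also have "\<dots> = y \<otimes> (gprod G n x \<otimes> x n)" using Suc.prems(1) c IH by (simp add: m_assoc[symmetric])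
  finally show ?case by simp
qed simp

text \<open>Only entries with different indices must commute, so each factor may itself be
  non-abelian; this makes a product of factor homomorphisms a homomorphism.\<close>

lemma gprod_mult:
  assumes "\<And>k. k < n \<Longrightarrow> x k \<in> carrier G" "\<And>k. k < n \<Longrightarrow> y k \<in> carrier G"
    and "\<And>j k. j < n \<Longrightarrow> k < n \<Longrightarrow> j \<noteq> k \<Longrightarrow> x j \<otimes> y k = y k \<otimes> x j"
  shows "gprod G n (\<lambda>k. x k \<otimes> y k) = gprod G n x \<otimes> gprod G n y"
  using assms
proof (induction n)
  case (Suc n)
  have c: "gprod G n x \<in> carrier G" "gprod G n y \<in> carrier G" "x n \<in> carrier G" "y n \<in> carrier G"
    using Suc.prems by auto
  have com: "gprod G n y \<otimes> x n = x n \<otimes> gprod G n y"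
    using Suc.prems by (intro gprod_commute) simp_all
  have "gprod G (Suc n) (\<lambda>k. x k \<otimes> y k) = gprod G n x \<otimes> (gprod G n y \<otimes> x n) \<otimes> y n"
    using Suc c by (simp add: m_assoc)
  also have "\<dots> = gprod G n x \<otimes> x n \<otimes> (gprod G n y \<otimes> y n)"
    unfolding com using c by (simp add: m_assoc)
  finally show ?case by simp
qed simp

lemma gprod_single:
  assumes "y \<in> carrier G"
  shows "gprod G n (\<lambda>k. if k = j then y else \<one>) = (if j < n then y else \<one>)"
proof (induction n)
  case (Suc n)
  then show ?case using assms by (cases "j = n") auto
qed simp

lemma gprod_add:
  assumes "\<And>k. k < m + n \<Longrightarrow> x k \<in> carrier G"
  shows "gprod G (m + n) x = gprod G m x \<otimes> gprod G n (\<lambda>k. x (m + k))"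
  using assms by (induction n) (simp_all add: m_assoc)

lemma mult_commute_closed:
  assumes "x \<in> carrier G" "y \<in> carrier G" "z \<in> carrier G" "x \<otimes> z = z \<otimes> x" "y \<otimes> z = z \<otimes> y"
  shows "x \<otimes> y \<otimes> z = z \<otimes> (x \<otimes> y)"
proof -
  have "x \<otimes> y \<otimes> z = x \<otimes> (y \<otimes> z)" using assms(1-3) by (rule m_assoc)
  also have "\<dots> = (x \<otimes> z) \<otimes> y" unfolding assms(5) using assms(1-3) by (simp add: m_assoc)
  also have "\<dots> = z \<otimes> (x \<otimes> y)" unfolding assms(4) using assms(1-3) by (simp add: m_assoc)
  finally show ?thesis .
qed

lemma sq_iter_mult:
  assumes "x \<in> carrier G" "y \<in> carrier G" "x \<otimes> y = y \<otimes> x"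
  shows "((\<lambda>x. x \<otimes> x) ^^ k) (x \<otimes> y) = ((\<lambda>x. x \<otimes> x) ^^ k) x \<otimes> ((\<lambda>x. x \<otimes> x) ^^ k) y"
  using assms
proof (induction k arbitrary: x y)
  case (Suc k)
  have xyy: "x \<otimes> y \<otimes> y = y \<otimes> (x \<otimes> y)" by (rule mult_commute_closed) (use Suc.prems in auto)
  have 1: "(x \<otimes> y) \<otimes> (x \<otimes> y) = (x \<otimes> x) \<otimes> (y \<otimes> y)"
    using Suc.prems by (metis m_assoc m_closed)
  have 2: "(x \<otimes> x) \<otimes> (y \<otimes> y) = (y \<otimes> y) \<otimes> (x \<otimes> x)"
    using Suc.prems by (metis m_assoc m_closed)
  show ?case
    unfolding funpow_Suc_right o_apply 1 by (rule Suc.IH) (use Suc.prems 2 in auto)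
qed simp

lemma sq_iter_closed: "x \<in> carrier G \<Longrightarrow> ((\<lambda>x. x \<otimes> x) ^^ k) x \<in> carrier G"
  by (induction k) auto

text \<open>On the line halving is a global square root, so no gluing occurs: \<open>q t\<close> is
  the \<open>2 ^ k\<close>-th power of the value at \<open>t / 2 ^ k\<close>, independent of the
  large exponent \<open>k\<close>.\<close>

lemma extend_local_hom_real:
  fixes \<psi> :: "real \<Rightarrow> 'a"
  assumes eps: "\<epsilon> > 0" and closed: "\<And>t. \<bar>t\<bar> < \<epsilon> \<Longrightarrow> \<psi> t \<in> carrier G"
    and hom: "\<And>s t. \<bar>s\<bar> < \<epsilon> \<Longrightarrow> \<bar>t\<bar> < \<epsilon> \<Longrightarrow> \<bar>s + t\<bar> < \<epsilon> \<Longrightarrow> \<psi> (s + t) = \<psi> s \<otimes> \<psi> t"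
  shows "\<exists>q. (\<forall>t. q t \<in> carrier G) \<and> (\<forall>s t. q (s + t) = q s \<otimes> q t) \<and> (\<forall>t. \<bar>t\<bar> < \<epsilon> / 2 \<longrightarrow> q t = \<psi> t)"
proof -
  define sq where "sq x = x \<otimes> x" for x :: 'a
  have halve: "(sq ^^ Suc k) (\<psi> (t / 2 ^ Suc k)) = (sq ^^ k) (\<psi> (t / 2 ^ k))" if "\<bar>t\<bar> / 2 ^ k < \<epsilon>" for t k
  proof -
    have a: "\<bar>t / 2 ^ k\<bar> < \<epsilon>" using that by (simp add: abs_divide)
    have e: "t / 2 ^ Suc k + t / 2 ^ Suc k = t / 2 ^ k" by simp
    have "\<bar>t / 2 ^ Suc k\<bar> < \<epsilon>" using a eps by (simp add: abs_divide field_simps)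
    then have "\<psi> (t / 2 ^ k) = sq (\<psi> (t / 2 ^ Suc k))"
      using hom[of "t / 2 ^ Suc k" "t / 2 ^ Suc k"] a unfolding e sq_def by blast
    then show ?thesis by (simp only: funpow_Suc_right o_apply)
  qed
  have indep: "(sq ^^ m) (\<psi> (t / 2 ^ m)) = (sq ^^ k) (\<psi> (t / 2 ^ k))" if "\<bar>t\<bar> / 2 ^ k < \<epsilon>" "k \<le> m" for t k m
    using that(2)
  proof (induction m rule: dec_induct)
    case (step m)
    have "\<bar>t\<bar> / 2 ^ m \<le> \<bar>t\<bar> / 2 ^ k" using step by (intro divide_left_mono power_increasing) auto
    then show ?case using step that(1) halve[of t m] by simp
  qed simp
  \<comment> \<open>An exponent from which on \<open>t / 2 ^ k\<close> is below
    \<open>\<epsilon> / 2\<close>, by \<open>k < 2 ^ k\<close>; half of \<open>\<epsilon>\<close>,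
    so that the sum of two such arguments stays in the domain.\<close>
  define K where "K t = nat \<lceil>2 * \<bar>t\<bar> / \<epsilon>\<rceil>" for t :: real
  have K: "\<bar>t\<bar> / 2 ^ k < \<epsilon> / 2" if "k \<ge> K t" for t k
  proof -
    have "2 * \<bar>t\<bar> / \<epsilon> \<le> real (K t)" unfolding K_def by (rule real_nat_ceiling_ge)
    also have "\<dots> \<le> real k" using that by simp
    also have "\<dots> < 2 ^ k" by (rule of_nat_less_two_power)
    finally show ?thesis using eps by (simp add: field_simps)
  qed
  define q where "q t = (sq ^^ K t) (\<psi> (t / 2 ^ K t))" for t
  have q: "q t = (sq ^^ k) (\<psi> (t / 2 ^ k))" if "\<bar>t\<bar> / 2 ^ k < \<epsilon>" for t k
  proof -
    have "\<bar>t\<bar> / 2 ^ K t < \<epsilon>" using K[OF order_refl, of t] eps by linarith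
    then show ?thesis
      unfolding q_def using indep[OF that, of "max k (K t)"] indep[of t "K t" "max k (K t)"] by simp
  qed
  have "q (s + t) = q s \<otimes> q t" for s t
  proof -
    define k where "k = max (K s) (K t)"
    have s: "\<bar>s / 2 ^ k\<bar> < \<epsilon> / 2" and t: "\<bar>t / 2 ^ k\<bar> < \<epsilon> / 2"
      using K[of s k] K[of t k] by (simp_all add: k_def abs_divide)
    have lt: "\<bar>s / 2 ^ k\<bar> < \<epsilon>" "\<bar>t / 2 ^ k\<bar> < \<epsilon>" using s t eps by linarith+
    have st: "\<bar>s / 2 ^ k + t / 2 ^ k\<bar> < \<epsilon>" using s t by linarith
    then have "\<bar>s + t\<bar> / 2 ^ k < \<epsilon>" by (simp add: add_divide_distrib[symmetric] abs_divide)
    then have "q (s + t) = (sq ^^ k) (\<psi> ((s + t) / 2 ^ k))" by (rule q)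
    also have "(s + t) / 2 ^ k = s / 2 ^ k + t / 2 ^ k" by (simp add: add_divide_distrib)
    also have "\<psi> \<dots> = \<psi> (s / 2 ^ k) \<otimes> \<psi> (t / 2 ^ k)" by (rule hom[OF lt st])
    also have "(sq ^^ k) \<dots> = (sq ^^ k) (\<psi> (s / 2 ^ k)) \<otimes> (sq ^^ k) (\<psi> (t / 2 ^ k))"
      unfolding sq_def
    proof (rule sq_iter_mult)
      show "\<psi> (s / 2 ^ k) \<otimes> \<psi> (t / 2 ^ k) = \<psi> (t / 2 ^ k) \<otimes> \<psi> (s / 2 ^ k)"
        using hom[OF lt st] hom[OF lt(2,1)] st by (simp add: add.commute)
    qed (use closed lt in simp_all)
    also have "(sq ^^ k) (\<psi> (s / 2 ^ k)) = q s" using lt(1) by (intro q[symmetric]) (simp add: abs_divide)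
    also have "(sq ^^ k) (\<psi> (t / 2 ^ k)) = q t" using lt(2) by (intro q[symmetric]) (simp add: abs_divide)
    finally show ?thesis .
  qed
  moreover have "q t = \<psi> t" if "\<bar>t\<bar> < \<epsilon> / 2" for t using q[of t 0] that eps by simp
  moreover have "q t \<in> carrier G" for t
  proof -
    have "\<bar>t / 2 ^ K t\<bar> = \<bar>t\<bar> / 2 ^ K t" by (simp add: abs_divide)
    then have "\<bar>t / 2 ^ K t\<bar> < \<epsilon>" using K[OF order_refl, of t] eps by linarith
    then show ?thesis unfolding q_def sq_def by (intro sq_iter_closed closed)
  qed
  ultimately show ?thesis by blast
qed

end

section \<open>Continuity and generation criteria, and systems of commuting factors\<close>

context compact_haar_group
begin

lemma continuous_map_gprod:
  assumes "\<And>k. k < n \<Longrightarrow> continuous_map Y X (\<lambda>y. x y k)"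
  shows "continuous_map Y X (\<lambda>y. gprod G n (x y))"
  using assms
proof (induction n)
  case 0
  show ?case by (simp add: continuous_map_const topspace_X)
qed (simp add: continuous_map_mult)

lemma continuous_map_real_hom:
  assumes q: "\<And>t. q t \<in> carrier G" "\<And>s t. q (s + t) = q s \<otimes> q t"
    and small: "\<And>W. openin X W \<Longrightarrow> \<one> \<in> W \<Longrightarrow> \<exists>\<delta>>0. \<forall>t. \<bar>t\<bar> < \<delta> \<longrightarrow> q t \<in> W"
  shows "continuous_map euclideanreal X q"
proof -
  have "open {t. q t \<in> U}" if U: "openin X U" for U
  proof (rule openI)
    fix s assume s: "s \<in> {t. q t \<in> U}"
    have "openin X {g \<in> topspace X. q s \<otimes> g \<in> U}"
      using continuous_mult_left[OF q(1)[of s]] U unfolding continuous_map_def by blast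
    moreover have "\<one> \<in> {g \<in> topspace X. q s \<otimes> g \<in> U}" using s q by (simp add: topspace_X)
    ultimately obtain \<delta> where \<delta>: "\<delta> > 0" "\<forall>t. \<bar>t\<bar> < \<delta> \<longrightarrow> q t \<in> {g \<in> topspace X. q s \<otimes> g \<in> U}"
      by (elim small[THEN exE] conjE)
    have "q t \<in> U" if "dist s t < \<delta>" for t
      using \<delta>(2)[rule_format, of "t - s"] that q(2)[of s "t - s"] by (simp add: dist_real_def abs_minus_commute)
    then show "\<exists>e>0. ball s e \<subseteq> {t. q t \<in> U}" using \<delta>(1) by (intro exI[of _ \<delta>]) auto
  qed
  then show ?thesis using q by (simp add: continuous_map_def topspace_X)
qed

text \<open>Translation reduces continuity to the identity. Hence a homomorphism built from an angle
  function with a jump elsewhere can still be checked near 1.\<close>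

lemma continuous_map_quat_hom:
  assumes S: "S \<subseteq> S3" "\<And>s t. s \<in> S \<Longrightarrow> t \<in> S \<Longrightarrow> s \<odot> t \<in> S" "\<And>s. s \<in> S \<Longrightarrow> qcnj s \<in> S"
    and p: "\<And>s. s \<in> S \<Longrightarrow> p s \<in> carrier G" "\<And>s t. s \<in> S \<Longrightarrow> t \<in> S \<Longrightarrow> p (s \<odot> t) = p s \<otimes> p t"
    and small: "\<And>W. openin X W \<Longrightarrow> \<one> \<in> W \<Longrightarrow> \<exists>\<delta>>0. \<forall>s\<in>S. norm (s - qone) < \<delta> \<longrightarrow> p s \<in> W"
  shows "continuous_map (top_of_set S) X p"
proof -
  have "openin (top_of_set S) {t \<in> S. p t \<in> U}" if U: "openin X U" for U
    unfolding openin_euclidean_subtopology_iff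
  proof (intro conjI ballI)
    fix s assume "s \<in> {t \<in> S. p t \<in> U}"
    then have s: "s \<in> S" "p s \<in> U" by auto
    have "openin X {g \<in> topspace X. p s \<otimes> g \<in> U}"
      using continuous_mult_left[OF p(1)[OF s(1)]] U unfolding continuous_map_def by blast
    moreover have "\<one> \<in> {g \<in> topspace X. p s \<otimes> g \<in> U}" using s p by (simp add: topspace_X)
    ultimately obtain \<delta> where \<delta>: "\<delta> > 0"
      "\<forall>t\<in>S. norm (t - qone) < \<delta> \<longrightarrow> p t \<in> {g \<in> topspace X. p s \<otimes> g \<in> U}"
      by (elim small[THEN exE] conjE)
    have "p t \<in> U" if t: "t \<in> S" "dist t s < \<delta>" for t
    proof -
      have sS: "s \<in> S3" using S(1) s by blast
      have "norm (qcnj s \<odot> t - qone) = norm (s \<odot> (qcnj s \<odot> t) - s \<odot> qone)"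
        by (rule norm_qmul_diff_left[OF sS, symmetric])
      also have "\<dots> = dist t s" using sS by (simp add: dist_norm)
      finally have "p s \<otimes> p (qcnj s \<odot> t) \<in> U" using \<delta>(2)[rule_format, of "qcnj s \<odot> t"] S(2,3) s t by simp
      moreover have "p s \<otimes> p (qcnj s \<odot> t) = p t"
        using p(2)[of s "qcnj s \<odot> t"] S(2,3) s t sS by simp
      ultimately show ?thesis by simp
    qed
    then show "\<exists>e>0. \<forall>t\<in>S. dist t s < e \<longrightarrow> t \<in> {t \<in> S. p t \<in> U}" using \<delta>(1) by blast
  qed blast
  then show ?thesis using p by (simp add: continuous_map_def topspace_X)
qed

text \<open>\<open>T\<close> is only closed under products, so openness of the complement is not a
  coset argument: if \<open>inv y \<otimes> x\<close> lies in \<open>U\<close> and \<open>y\<close>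
  in \<open>T\<close>, then \<open>x\<close> lies in \<open>T\<close>.\<close>

lemma connected_generated:
  assumes conn: "connected_space X" and T: "T \<subseteq> carrier G" "\<And>x y. x \<in> T \<Longrightarrow> y \<in> T \<Longrightarrow> x \<otimes> y \<in> T"
    and U: "openin X U" "\<one> \<in> U" "U \<subseteq> T"
  shows "T = carrier G"
proof -
  have tr: "openin X {y \<in> carrier G. inv x \<otimes> y \<in> U}" "openin X {y \<in> carrier G. inv y \<otimes> x \<in> U}" if x: "x \<in> carrier G" for x
  proof -
    show "openin X {y \<in> carrier G. inv x \<otimes> y \<in> U}"
      using continuous_mult_left[OF inv_closed[OF x]] U(1) unfolding continuous_map_def topspace_X by blast
    have "continuous_map X X (\<lambda>y. inv y \<otimes> x)"
      using x by (intro continuous_map_mult continuous_inv) (simp add: topspace_X)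
    then show "openin X {y \<in> carrier G. inv y \<otimes> x \<in> U}"
      using U(1) unfolding continuous_map_def topspace_X by blast
  qed
  have "openin X T"
  proof (subst openin_subopen, intro ballI)
    fix x assume x: "x \<in> T"
    then have xc: "x \<in> carrier G" using T by blast
    have "y \<in> T" if "y \<in> carrier G" "inv x \<otimes> y \<in> U" for y
    proof -
      have "x \<otimes> (inv x \<otimes> y) \<in> T" using T(2) x that U(3) by blast
      then show ?thesis using xc that by (simp add: m_assoc[symmetric])
    qed
    then show "\<exists>V. openin X V \<and> x \<in> V \<and> V \<subseteq> T"
      using tr(1)[OF xc] xc U(2) by (intro exI[of _ "{y \<in> carrier G. inv x \<otimes> y \<in> U}"]) auto
  qed
  moreover have "openin X (carrier G - T)"
  proof (subst openin_subopen, intro ballI)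
    fix x assume x: "x \<in> carrier G - T"
    have "y \<notin> T" if y: "y \<in> carrier G" "inv y \<otimes> x \<in> U" for y
    proof
      assume "y \<in> T"
      then have "y \<otimes> (inv y \<otimes> x) \<in> T" using T(2) y U(3) by blast
      then show False using x y by (simp add: m_assoc[symmetric])
    qed
    then show "\<exists>V. openin X V \<and> x \<in> V \<and> V \<subseteq> carrier G - T"
      using tr(2)[of x] x U(2) by (intro exI[of _ "{y \<in> carrier G. inv y \<otimes> x \<in> U}"]) auto
  qed
  moreover have "T \<noteq> {}" using U by blast
  ultimately show ?thesis
    using conn T(1) unfolding connected_space_clopen_in closedin_def topspace_X by blast
qed

text \<open>A continuous surjective homomorphism onto \<open>G\<close> from a product of copies of
  SU(2) and U(1), given by its restrictions to the factors.\<close>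

definition factor_system :: "nat \<Rightarrow> nat \<Rightarrow> (nat \<Rightarrow> quat \<Rightarrow> 'g) \<Rightarrow> bool" where
  "factor_system a N p \<longleftrightarrow>
    (\<forall>k<N. \<forall>s\<in>fac a k. p k s \<in> carrier G) \<and>
    (\<forall>k<N. \<forall>s\<in>fac a k. \<forall>t\<in>fac a k. p k (s \<odot> t) = p k s \<otimes> p k t) \<and>
    (\<forall>k<N. continuous_map (top_of_set (fac a k)) X (p k)) \<and>
    (\<forall>j<N. \<forall>k<N. j \<noteq> k \<longrightarrow> (\<forall>s\<in>fac a j. \<forall>t\<in>fac a k. p j s \<otimes> p k t = p k t \<otimes> p j s)) \<and>
    (\<forall>g\<in>carrier G. \<exists>l. (\<forall>k<N. l k \<in> fac a k) \<and> g = gprod G N (\<lambda>k. p k (l k)))"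

end

section \<open>From one-parameter groups to circles\<close>

lemma norm_fst_minus_one: "cmod (fst s - 1) \<le> norm (s - qone)"
proof -
  have "s - qone = (fst s - 1, snd s)" by (simp add: qone_def prod_eq_iff)
  then show ?thesis using norm_fst_le[of "fst s - 1" "snd s"] by simp
qed

text \<open>Testing against \<open>i\<close> and \<open>j\<close> shows that the element is real,
  hence plus or minus one.\<close>

lemma S3_central:
  assumes s: "s \<in> S3" and c: "\<And>w. w \<in> S3 \<Longrightarrow> s \<odot> w = w \<odot> s"
  shows "s \<odot> s = qone"
proof -
  have i: "(\<i>, 0) \<in> S3" and j: "(0, 1) \<in> S3" by (simp_all add: S3_def norm_prod_def)
  have "snd s = 0" using c[OF i] by (simp add: qmul_def prod_eq_iff complex_eq_iff)
  moreover have "cnj (fst s) = fst s" using c[OF j] by (simp add: qmul_def prod_eq_iff)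
  moreover have "cmod (fst s) = 1" using s calculation(1) S1_iff[of s] by (simp add: S1_def)
  ultimately show ?thesis
    using complex_norm_square[of "fst s"] by (simp add: qmul_def qone_def)
qed

text \<open>The intermediate stage, with real lines in place of circles: a local homomorphism
  defined near 1 on a circle extends to its universal cover, not in general to the circle.
  \<open>U\<close> records that near the identity line parameters of size at most \<open>pi\<close>
  suffice, and \<open>p_inj\<close> retains the local injectivity of the chart.\<close>

locale real_factors = compact_haar_group +
  fixes a b :: nat and p :: "nat \<Rightarrow> quat \<Rightarrow> 'a" and q :: "nat \<Rightarrow> real \<Rightarrow> 'a"
    and U :: "'a set" and \<delta> :: real
  assumes conn: "connected_space X"
    and p_closed: "\<And>j s. j < a \<Longrightarrow> s \<in> S3 \<Longrightarrow> p j s \<in> carrier G"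
    and p_hom: "\<And>j s t. j < a \<Longrightarrow> s \<in> S3 \<Longrightarrow> t \<in> S3 \<Longrightarrow> p j (s \<odot> t) = p j s \<otimes> p j t"
    and p_cont: "\<And>j. j < a \<Longrightarrow> continuous_map (top_of_set S3) X (p j)"
    and q_closed: "\<And>i t. i < b \<Longrightarrow> q i t \<in> carrier G"
    and q_hom: "\<And>i s t. i < b \<Longrightarrow> q i (s + t) = q i s \<otimes> q i t"
    and q_cont: "\<And>i. i < b \<Longrightarrow> continuous_map euclideanreal X (q i)"
    and pp: "\<And>j k s t. j < a \<Longrightarrow> k < a \<Longrightarrow> j \<noteq> k \<Longrightarrow> s \<in> S3 \<Longrightarrow> t \<in> S3 \<Longrightarrow> p j s \<otimes> p k t = p k t \<otimes> p j s"
    and pq: "\<And>j i s t. j < a \<Longrightarrow> i < b \<Longrightarrow> s \<in> S3 \<Longrightarrow> p j s \<otimes> q i t = q i t \<otimes> p j s"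
    and qq: "\<And>i k s t. i < b \<Longrightarrow> k < b \<Longrightarrow> q i s \<otimes> q k t = q k t \<otimes> q i s"
    and p_inj: "\<delta> > 0" "\<And>j v. j < a \<Longrightarrow> v \<in> S3 \<Longrightarrow> norm (v - qone) < \<delta> \<Longrightarrow> p j v = \<one> \<Longrightarrow> v = qone"
    and U: "openin X U" "\<one> \<in> U"
      "\<And>g. g \<in> U \<Longrightarrow> \<exists>s t. (\<forall>j. s j \<in> S3) \<and> (\<forall>i. \<bar>t i\<bar> \<le> pi) \<and>
        g = gprod G a (\<lambda>j. p j (s j)) \<otimes> gprod G b (\<lambda>i. q i (t i))"
begin

definition P :: "(nat \<Rightarrow> quat) \<Rightarrow> 'a" where "P s = gprod G a (\<lambda>j. p j (s j))"
definition Q :: "(nat \<Rightarrow> real) \<Rightarrow> 'a" where "Q t = gprod G b (\<lambda>i. q i (t i))"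

lemma P_closed: "(\<And>j. s j \<in> S3) \<Longrightarrow> P s \<in> carrier G"
  unfolding P_def by (intro gprod_closed p_closed) auto

lemma Q_closed: "Q t \<in> carrier G"
  unfolding Q_def by (intro gprod_closed q_closed) auto

lemma P_mult:
  assumes "\<And>j. s j \<in> S3" "\<And>j. t j \<in> S3"
  shows "P (\<lambda>j. s j \<odot> t j) = P s \<otimes> P t"
proof -
  have "P (\<lambda>j. s j \<odot> t j) = gprod G a (\<lambda>j. p j (s j) \<otimes> p j (t j))"
    unfolding P_def by (rule gprod_cong) (simp add: p_hom assms)
  also have "\<dots> = P s \<otimes> P t"
    unfolding P_def by (rule gprod_mult) (simp_all add: p_closed assms pp)
  finally show ?thesis .
qed

lemma Q_add: "Q (\<lambda>i. s i + t i) = Q s \<otimes> Q t"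
proof -
  have "Q (\<lambda>i. s i + t i) = gprod G b (\<lambda>j. q j (s j) \<otimes> q j (t j))"
    unfolding Q_def by (rule gprod_cong) (simp add: q_hom)
  also have "\<dots> = Q s \<otimes> Q t"
    unfolding Q_def by (rule gprod_mult) (simp_all add: q_closed qq)
  finally show ?thesis .
qed

lemma q_zero: "i < b \<Longrightarrow> q i 0 = \<one>"
  using q_hom[of i 0 0] q_closed[of i 0] by simp

lemma p_one: "j < a \<Longrightarrow> p j qone = \<one>"
  using p_hom[of j qone qone] p_closed[of j qone] by simp

lemma Q_zero: "Q (\<lambda>i. 0) = \<one>"
  unfolding Q_def using gprod_cong[of b "\<lambda>i. q i 0" "\<lambda>i. \<one>" G] by (simp add: q_zero)

lemma P_one: "P (\<lambda>j. qone) = \<one>"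
  unfolding P_def using gprod_cong[of a "\<lambda>j. p j qone" "\<lambda>i. \<one>" G] by (simp add: p_one)

lemma P_single:
  assumes "j < a" "w \<in> S3" shows "P (\<lambda>k. if k = j then w else qone) = p j w"
proof -
  have "P (\<lambda>k. if k = j then w else qone) = gprod G a (\<lambda>k. if k = j then p j w else \<one>)"
    unfolding P_def by (rule gprod_cong) (simp add: p_one)
  then show ?thesis using gprod_single[of "p j w" a j] assms p_closed by simp
qed

lemma Q_single:
  assumes "i < b" shows "Q (\<lambda>k. if k = i then r else 0) = q i r"
proof -
  have "Q (\<lambda>k. if k = i then r else 0) = gprod G b (\<lambda>k. if k = i then q i r else \<one>)"
    unfolding Q_def by (rule gprod_cong) (simp add: q_zero)
  then show ?thesis using gprod_single[of "q i r" b i] assms q_closed by simp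
qed

lemma p_Q_commute: "j < a \<Longrightarrow> s \<in> S3 \<Longrightarrow> p j s \<otimes> Q t = Q t \<otimes> p j s"
  unfolding Q_def by (rule gprod_commute[symmetric]) (simp_all add: p_closed q_closed pq)

lemma P_Q_commute: "(\<And>j. s j \<in> S3) \<Longrightarrow> P s \<otimes> Q t = Q t \<otimes> P s"
  unfolding P_def by (rule gprod_commute) (simp_all add: p_closed Q_closed p_Q_commute)

lemma Q_commute: "Q s \<otimes> Q t = Q t \<otimes> Q s"
  using Q_add[of s t] Q_add[of t s] by (simp add: add.commute)

lemma PQ_mult:
  assumes "\<And>j. s j \<in> S3" "\<And>j. s' j \<in> S3"
  shows "(P s \<otimes> Q t) \<otimes> (P s' \<otimes> Q t') = P (\<lambda>j. s j \<odot> s' j) \<otimes> Q (\<lambda>i. t i + t' i)"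
proof -
  have c: "P s \<in> carrier G" "P s' \<in> carrier G" "Q t \<in> carrier G" "Q t' \<in> carrier G"
    using assms P_closed Q_closed by auto
  have "(P s \<otimes> Q t) \<otimes> (P s' \<otimes> Q t') = P s \<otimes> (Q t \<otimes> P s') \<otimes> Q t'" using c by (simp add: m_assoc)
  also have "Q t \<otimes> P s' = P s' \<otimes> Q t" using P_Q_commute[of s' t] assms by simp
  also have "P s \<otimes> (P s' \<otimes> Q t) \<otimes> Q t' = (P s \<otimes> P s') \<otimes> (Q t \<otimes> Q t')" using c by (simp add: m_assoc)
  finally show ?thesis by (simp add: P_mult assms Q_add)
qed

section \<open>Bounded line parameters and the kernel of \<open>Q\<close>\<close>

definition bounded_part :: "real \<Rightarrow> 'a set" where
  "bounded_part R = {P s \<otimes> Q t | s t. (\<forall>j. s j \<in> S3) \<and> (\<forall>i<b. \<bar>t i\<bar> \<le> R)}"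

lemma PQ_surj: "g \<in> carrier G \<Longrightarrow> \<exists>s t. (\<forall>j. s j \<in> S3) \<and> g = P s \<otimes> Q t"
proof -
  assume g: "g \<in> carrier G"
  have "{P s \<otimes> Q t | s t. \<forall>j. s j \<in> S3} = carrier G"
  proof (rule connected_generated[OF conn _ _ U(1,2)])
    show "{P s \<otimes> Q t | s t. \<forall>j. s j \<in> S3} \<subseteq> carrier G" using P_closed Q_closed by auto
    show "U \<subseteq> {P s \<otimes> Q t | s t. \<forall>j. s j \<in> S3}" using U(3) unfolding P_def Q_def by blast
    fix x y assume "x \<in> {P s \<otimes> Q t | s t. \<forall>j. s j \<in> S3}" "y \<in> {P s \<otimes> Q t | s t. \<forall>j. s j \<in> S3}"
    then obtain s t s' t' where *: "\<And>j. s j \<in> S3" "\<And>j. s' j \<in> S3" "x = P s \<otimes> Q t" "y = P s' \<otimes> Q t'" by blast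
    then have "x \<otimes> y = P (\<lambda>j. s j \<odot> s' j) \<otimes> Q (\<lambda>i. t i + t' i)" using PQ_mult by simp
    moreover have "\<forall>j. s j \<odot> s' j \<in> S3" using * by simp
    ultimately show "x \<otimes> y \<in> {P s \<otimes> Q t | s t. \<forall>j. s j \<in> S3}" by blast
  qed
  then show ?thesis using g by blast
qed

text \<open>Compactness turns surjectivity into surjectivity with bounded line parameters. The sets
  with bound \<open>n\<close> exhaust the group but need not be open; enlarging each by
  \<open>U\<close> gives an increasing open cover, at the price of adding \<open>pi\<close> to the
  bound.\<close>

lemma bounded_part_eq: "\<exists>R. bounded_part R = carrier G"
proof -
  have bpc: "bounded_part R \<subseteq> carrier G" for R unfolding bounded_part_def using P_closed Q_closed by auto
  have bp_mono: "R \<le> R' \<Longrightarrow> bounded_part R \<subseteq> bounded_part R'" for R R'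
    unfolding bounded_part_def by (blast intro: order_trans)
  have Ubp: "U \<subseteq> bounded_part pi" using U(3) unfolding bounded_part_def P_def Q_def by blast
  have mult: "x \<otimes> y \<in> bounded_part (R + R')" if x: "x \<in> bounded_part R" and y: "y \<in> bounded_part R'" for x y R R'
  proof -
    obtain s t s' t' where *: "\<And>j. s j \<in> S3" "\<And>j. s' j \<in> S3" "x = P s \<otimes> Q t" "y = P s' \<otimes> Q t'"
      "\<And>i. i < b \<Longrightarrow> \<bar>t i\<bar> \<le> R" "\<And>i. i < b \<Longrightarrow> \<bar>t' i\<bar> \<le> R'"
      using x y unfolding bounded_part_def by blast
    have "\<bar>t i + t' i\<bar> \<le> R + R'" if "i < b" for i
      using *(5,6)[OF that] by linarith
    then show ?thesis unfolding bounded_part_def *(3,4) PQ_mult[OF *(1,2)] using *(1,2)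
      by (intro CollectI exI[of _ "\<lambda>j. s j \<odot> s' j"] exI[of _ "\<lambda>i. t i + t' i"] conjI allI impI) simp_all
  qed
  define V where "V n = (\<Union>x\<in>bounded_part (real n). {y \<in> carrier G. inv x \<otimes> y \<in> U})" for n :: nat
  have Vo: "openin X (V n)" for n
    unfolding V_def
  proof (rule openin_Union, clarify)
    fix x assume "x \<in> bounded_part (real n)"
    then have "x \<in> carrier G" using bpc by blast
    then show "openin X {y \<in> carrier G. inv x \<otimes> y \<in> U}"
      using continuous_mult_left[of "inv x"] U(1) unfolding continuous_map_def topspace_X by auto
  qed
  have Vm: "V n \<subseteq> V m" if "n \<le> m" for n m unfolding V_def using bp_mono[of "real n" "real m"] that by auto
  have "carrier G \<subseteq> (\<Union>n. V n)"
  proof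
    fix g assume g: "g \<in> carrier G"
    then obtain s t where st: "\<And>j. s j \<in> S3" "g = P s \<otimes> Q t" using PQ_surj by blast
    obtain n where n: "(\<Sum>i<b. \<bar>t i\<bar>) \<le> real n" using real_arch_simple by blast
    have "\<bar>t i\<bar> \<le> real n" if "i < b" for i
      using member_le_sum[of i "{..<b}" "\<lambda>i. \<bar>t i\<bar>"] n that by simp
    then have "g \<in> bounded_part (real n)" using st unfolding bounded_part_def by blast
    then have "g \<in> V n" unfolding V_def using g U(2) by (intro UN_I[of g]) simp_all
    then show "g \<in> (\<Union>n. V n)" by blast
  qed
  moreover have "\<forall>W\<in>range V. openin X W" using Vo by blast
  ultimately obtain F where F: "finite F" "F \<subseteq> range V" "carrier G \<subseteq> \<Union>F"
    using compact_X unfolding compact_space_alt topspace_X by metis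
  obtain M where M: "finite M" "F = V ` M" using finite_subset_image[OF F(1,2)] by blast
  define m where "m = Max (insert 0 M)"
  have "V n \<subseteq> V m" if "n \<in> M" for n unfolding m_def using M that by (intro Vm Max_ge) auto
  then have sub: "carrier G \<subseteq> V m" using F M by blast
  have "V m \<subseteq> bounded_part (real m + pi)"
  proof
    fix y assume "y \<in> V m"
    then obtain x where x: "x \<in> bounded_part (real m)" "y \<in> carrier G" "inv x \<otimes> y \<in> U"
      unfolding V_def by blast
    then have xc: "x \<in> carrier G" using bpc by blast
    have "x \<otimes> (inv x \<otimes> y) \<in> bounded_part (real m + pi)" by (rule mult) (use x Ubp in auto)
    then show "y \<in> bounded_part (real m + pi)" using xc x by (simp add: m_assoc[symmetric])
  qed
  then show ?thesis using sub bpc by blast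
qed

text \<open>The maps \<open>p j\<close> are injective only near the identity, so centrality in
  \<open>G\<close> cannot be pulled back at once. For \<open>w\<close> close to the identity a
  commutator of \<open>w\<close> and \<open>s j\<close> is small and maps to the identity, hence is
  trivial; so \<open>s j\<close> commutes with a ball and then with all of SU(2).\<close>

lemma P_central:
  assumes s: "\<And>j. s j \<in> S3" and c: "\<And>j w. j < a \<Longrightarrow> w \<in> S3 \<Longrightarrow> P s \<otimes> p j w = p j w \<otimes> P s"
  shows "P s \<otimes> P s = \<one>"
proof -
  have comm: "s j \<odot> w = w \<odot> s j" if j: "j < a" and w: "w \<in> S3" for j w
  proof -
    have small: "s j \<odot> w = w \<odot> s j" if w: "w \<in> S3" "norm (w - qone) < \<delta> / 2" for w
    proof -
      define e where "e = (\<lambda>k. if k = j then w else qone)"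
      define f where "f = (\<lambda>k. if k = j then qcnj (w \<odot> s j) \<odot> (s j \<odot> w) else qone)"
      have eS: "\<And>k. e k \<in> S3" using w by (simp add: e_def)
      have fS: "\<And>k. f k \<in> S3" using w s by (simp add: f_def)
      have ef: "(\<lambda>k. (e k \<odot> s k) \<odot> f k) = (\<lambda>k. s k \<odot> e k)"
        using w s by (auto simp: e_def f_def)
      have Pe: "P e = p j w" unfolding e_def by (rule P_single[OF j w(1)])
      have "P s \<otimes> P e = P (\<lambda>k. (e k \<odot> s k) \<odot> f k)" unfolding ef by (simp add: P_mult s eS)
      also have "\<dots> = P (\<lambda>k. e k \<odot> s k) \<otimes> P f" by (rule P_mult) (simp_all add: s eS fS)
      also have "P (\<lambda>k. e k \<odot> s k) = P e \<otimes> P s" by (rule P_mult) (simp_all add: s eS)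
      finally have "P s \<otimes> P e = P e \<otimes> P s \<otimes> P f" .
      then have "P e \<otimes> P s = P e \<otimes> P s \<otimes> P f" using c[OF j w(1)] Pe by simp
      then have "P f = \<one>"
        using P_closed[of e, OF eS] P_closed[of s, OF s] P_closed[of f, OF fS] by simp
      moreover have "f = (\<lambda>k. if k = j then f j else qone)" by (auto simp: f_def)
      then have "P f = p j (f j)" using P_single[OF j fS[of j]] by simp
      ultimately have "p j (f j) = \<one>" by simp
      moreover have "norm (f j - qone) < \<delta>"
      proof -
        have ws: "w \<odot> s j \<in> S3" using w s by simp
        have "norm (f j - qone) = norm ((w \<odot> s j) \<odot> f j - (w \<odot> s j) \<odot> qone)"
          by (rule norm_qmul_diff_left[OF ws, symmetric])
        also have "(w \<odot> s j) \<odot> f j - (w \<odot> s j) \<odot> qone = (s j \<odot> w - s j \<odot> qone) - (w \<odot> s j - qone \<odot> s j)"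
          using ws by (simp add: f_def)
        also have "norm \<dots> \<le> norm (s j \<odot> w - s j \<odot> qone) + norm (w \<odot> s j - qone \<odot> s j)"
          by (rule norm_triangle_ineq4)
        also have "\<dots> = norm (w - qone) + norm (w - qone)"
          by (simp only: norm_qmul_diff_left[OF s] norm_qmul_diff_right[OF s])
        finally show ?thesis using w by simp
      qed
      ultimately have "f j = qone" using p_inj(2)[OF j] fS by blast
      then have "(w \<odot> s j) \<odot> (qcnj (w \<odot> s j) \<odot> (s j \<odot> w)) = (w \<odot> s j) \<odot> qone" by (simp add: f_def)
      then show ?thesis using w s by simp
    qed
    have "S3 \<subseteq> {w. s j \<odot> w = w \<odot> s j}"
    proof (rule S3_generated_by_ball[of _ "\<delta> / 2"])
      fix x y assume xy: "x \<in> {w. s j \<odot> w = w \<odot> s j}" "y \<in> {w. s j \<odot> w = w \<odot> s j}"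
      have "s j \<odot> (x \<odot> y) = (s j \<odot> x) \<odot> y" by (simp add: qmul_assoc)
      also have "\<dots> = x \<odot> (s j \<odot> y)" using xy by (simp add: qmul_assoc)
      also have "\<dots> = (x \<odot> y) \<odot> s j" using xy by (simp add: qmul_assoc)
      finally show "x \<odot> y \<in> {w. s j \<odot> w = w \<odot> s j}" by simp
    qed (use small p_inj(1) in auto)
    then show ?thesis using w by blast
  qed
  have "P s \<otimes> P s = P (\<lambda>j. s j \<odot> s j)" by (rule P_mult[symmetric]) (simp_all add: s)
  also have "\<dots> = P (\<lambda>j. qone)"
    unfolding P_def using S3_central[OF s comm] by (intro gprod_cong) simp
  finally show ?thesis by (simp add: P_one)
qed

text \<open>By bounded surjectivity \<open>q i r\<close> is \<open>P s \<otimes> Q t\<close> with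
  \<open>t\<close> bounded. Then \<open>P s\<close> is also a value of \<open>Q\<close>, so it
  commutes with every SU(2) factor and has square 1. This is the origin of the factor 2: twice the
  difference of the parameters lies in the kernel of \<open>Q\<close>, the difference itself perhaps
  not.\<close>

lemma Q_cocompact:
  "\<exists>R. \<forall>i<b. \<forall>r. \<exists>t. (\<forall>k<b. \<bar>t k\<bar> \<le> R) \<and> (\<forall>k\<ge>b. t k = 0) \<and>
    Q (\<lambda>k. 2 * ((if k = i then r else 0) - t k)) = \<one>"
proof -
  obtain R where R: "bounded_part R = carrier G" using bounded_part_eq by blast
  have "\<exists>t. (\<forall>k<b. \<bar>t k\<bar> \<le> R) \<and> (\<forall>k\<ge>b. t k = 0) \<and> Q (\<lambda>k. 2 * ((if k = i then r else 0) - t k)) = \<one>"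
    if i: "i < b" for i r
  proof -
    have "q i r \<in> bounded_part R" using q_closed[OF i] R by simp
    then obtain s t where s: "\<And>j. s j \<in> S3" and t: "\<And>k. k < b \<Longrightarrow> \<bar>t k\<bar> \<le> R" and e: "q i r = P s \<otimes> Q t"
      unfolding bounded_part_def by blast
    define t' where "t' k = (if k < b then t k else 0)" for k
    have "Q t' = Q t" unfolding Q_def t'_def by (rule gprod_cong) simp
    then have e': "Q (\<lambda>k. if k = i then r else 0) = P s \<otimes> Q t'" using e Q_single[OF i] by simp
    define u where "u = (\<lambda>k. (if k = i then r else 0) - t' k)"
    have PQ: "P s = Q u"
    proof -
      have "Q u \<otimes> Q t' = Q (\<lambda>k. u k + t' k)" by (rule Q_add[symmetric])
      also have "(\<lambda>k. u k + t' k) = (\<lambda>k. if k = i then r else 0)" by (auto simp: u_def)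
      finally have "Q u \<otimes> Q t' = P s \<otimes> Q t'" using e' by simp
      then show ?thesis using P_closed[of s, OF s] Q_closed by simp
    qed
    have "P s \<otimes> p j w = p j w \<otimes> P s" if "j < a" "w \<in> S3" for j w
      unfolding PQ using p_Q_commute[OF that] by simp
    from P_central[OF s this] have "Q u \<otimes> Q u = \<one>" unfolding PQ .
    moreover have "(\<lambda>k. u k + u k) = (\<lambda>k. 2 * ((if k = i then r else 0) - t' k))" by (auto simp: u_def)
    ultimately have "Q (\<lambda>k. 2 * ((if k = i then r else 0) - t' k)) = \<one>" using Q_add[of u u] by simp
    then show ?thesis using t by (intro exI[of _ t']) (auto simp: t'_def)
  qed
  then show ?thesis by blast
qed

lemma Q_int:
  assumes "Q v = \<one>" shows "Q (\<lambda>i. real_of_int n * v i) = \<one>"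
proof -
  have nat: "Q (\<lambda>i. real m * v i) = \<one>" for m
  proof (induction m)
    case (Suc m)
    have "(\<lambda>i. real (Suc m) * v i) = (\<lambda>i. v i + real m * v i)" by (auto simp: algebra_simps)
    then show ?case using Suc assms Q_add[of v "\<lambda>i. real m * v i"] by simp
  qed (simp add: Q_zero)
  show ?thesis
  proof (cases "n \<ge> 0")
    case True then show ?thesis using nat[of "nat n"] by simp
  next
    case False
    have "Q (\<lambda>i. real_of_int n * v i + real (nat (- n)) * v i) = Q (\<lambda>i. real_of_int n * v i) \<otimes> \<one>"
      unfolding Q_add nat ..
    moreover have "(\<lambda>i. real_of_int n * v i + real (nat (- n)) * v i) = (\<lambda>i. 0)" using False by simp
    ultimately show ?thesis using Q_zero Q_closed by simp
  qed
qed

lemma continuous_map_Q_line: "continuous_map euclideanreal X (\<lambda>r. Q (\<lambda>i. r * v i))"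
  unfolding Q_def
proof (rule continuous_map_gprod)
  fix k assume k: "k < b"
  have "continuous_map euclideanreal euclideanreal (\<lambda>r::real. r * v k)"
    by (simp add: continuous_on_mult_right)
  from continuous_map_compose[OF this q_cont[OF k]]
  show "continuous_map euclideanreal X (\<lambda>r. q k (r * v k))" by (simp add: o_def)
qed

lemma Q_sum: "Q (\<lambda>k. \<Sum>j<m. u j * v j k) = gprod G m (\<lambda>j. Q (\<lambda>k. u j * v j k))"
proof (induction m)
  case (Suc m)
  then show ?case using Q_add[of "\<lambda>k. \<Sum>j<m. u j * v j k" "\<lambda>k. u m * v m k"] by simp
qed (simp add: Q_zero)

text \<open>Along a kernel vector \<open>v j\<close> the line in \<open>G\<close> has period 1 and
  factors through the circle; because these vectors span, their circles still reach every value of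
  \<open>Q\<close>.\<close>

theorem factor_system_exists: "\<exists>N p'. factor_system a N p'"
proof -
  define L where "L = {v. (\<forall>i\<ge>b. v i = 0) \<and> Q v = \<one>}"
  obtain R where R: "\<And>i r. i < b \<Longrightarrow> \<exists>t. (\<forall>k<b. \<bar>t k\<bar> \<le> R) \<and> (\<forall>k\<ge>b. t k = 0) \<and>
    Q (\<lambda>k. 2 * ((if k = i then r else 0) - t k)) = \<one>" using Q_cocompact by blast
  have "\<exists>t. (\<forall>i<b. \<bar>t i\<bar> \<le> R) \<and> (\<forall>i\<ge>b. t i = 0) \<and> (\<lambda>i. 2 * ((if i = k then r else 0) - t i)) \<in> L"
    if k: "k < b" for k r
  proof -
    obtain t where t: "\<forall>k<b. \<bar>t k\<bar> \<le> R" "\<forall>k\<ge>b. t k = 0" "Q (\<lambda>i. 2 * ((if i = k then r else 0) - t i)) = \<one>"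
      using R[OF k, of r] by (elim exE conjE) (rule that)
    then show ?thesis using k by (intro exI[of _ t]) (auto simp: L_def)
  qed
  then have "\<exists>(m::nat) v c. (\<forall>j<m. v j \<in> L) \<and>
      (\<forall>k<b. \<forall>i. (if i = k then 1 else 0) = (\<Sum>j<m. c k j * v j i))"
    by (intro cocompact_contains_basis) (simp_all add: L_def)
  then obtain m :: nat and v c where v': "\<forall>j<m. v j \<in> L"
    and c': "\<forall>k<b. \<forall>i. (if i = k then 1 else 0) = (\<Sum>j<m. c k j * v j i)"
    by (elim exE conjE) (rule that)
  have v: "v j \<in> L" if "j < m" for j using v' that by blast
  have c: "(if i = k then 1 else 0) = (\<Sum>j<m. c k j * v j i)" if "k < b" for k i
    using c'[rule_format, OF that, of i] .
  \<comment> \<open>An angle measured in turns. Its jump at -1 is harmless: products are compared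
    modulo 1 by \<open>period\<close>, and continuity will be tested at the identity only.\<close>
  define ang where "ang z = Arg (fst z) / (2 * pi)" for z :: quat
  define p' where "p' k z = (if k < a then p k z else Q (\<lambda>i. ang z * v (k - a) i))" for k z
  have ang: "fst z = cis (2 * pi * ang z)" if "z \<in> S1" for z
    using that cis_Arg_unique unfolding ang_def S1_iff
    by (simp) (metis cis_Arg norm_eq_zero sgn_eq div_by_1 of_real_1 zero_neq_one)
  have period: "Q (\<lambda>i. x * v j i) = Q (\<lambda>i. y * v j i)" if "cis (2 * pi * x) = cis (2 * pi * y)" "j < m" for x y j
  proof -
    have "sin (2 * pi * x) = sin (2 * pi * y) \<and> cos (2 * pi * x) = cos (2 * pi * y)"
      using that(1) by (simp add: complex_eq_iff)
    then obtain n :: int where "2 * pi * x = 2 * pi * y + 2 * pi * real_of_int n"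
      unfolding sin_cos_eq_iff by blast
    then have "2 * pi * x = 2 * pi * (y + n)" by (simp add: algebra_simps)
    then have x: "x = y + n" by simp
    have "Q (\<lambda>i. x * v j i) = Q (\<lambda>i. y * v j i) \<otimes> Q (\<lambda>i. real_of_int n * v j i)"
      unfolding x Q_add[symmetric] by (simp add: distrib_right)
    also have "Q (\<lambda>i. real_of_int n * v j i) = \<one>" using v[OF that(2)] by (intro Q_int) (simp add: L_def)
    finally show ?thesis using Q_closed by simp
  qed
  have p'r: "p' (a + j) (cis (2 * pi * x), 0) = Q (\<lambda>i. x * v j i)" if "j < m" for j x
  proof -
    have "(cis (2 * pi * x), 0) \<in> S1" by (simp add: S1_iff)
    from ang[OF this] show ?thesis unfolding p'_def using that by (auto intro!: period)
  qed
  have Qcentral: "Q t \<otimes> p j s = p j s \<otimes> Q t" if "j < a" "s \<in> S3" for j s t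
    using p_Q_commute[OF that] by simp
  have p'S: "p' k (s \<odot> t) = p' k s \<otimes> p' k t" if "\<not> k < a" "k < a + m" and S: "s \<in> S1" "t \<in> S1" for k s t
  proof -
    have "cis (2 * pi * ang (s \<odot> t)) = fst (s \<odot> t)" using ang[OF S1_qmul[OF S]] by (rule sym)
    also have "\<dots> = fst s * fst t" using S by (simp add: qmul_def S1_iff)
    also have "\<dots> = cis (2 * pi * (ang s + ang t))"
      using ang[OF S(1)] ang[OF S(2)] by (simp add: cis_mult distrib_left)
    finally have "Q (\<lambda>i. ang (s \<odot> t) * v (k - a) i) = Q (\<lambda>i. (ang s + ang t) * v (k - a) i)"
      using that by (intro period) auto
    then show ?thesis using that by (simp add: p'_def Q_add[symmetric] distrib_right)
  qed
  show ?thesis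
  proof (intro exI)
    show "factor_system a (a + m) p'"
      unfolding factor_system_def
    proof (intro conjI allI impI ballI)
      fix k s assume k: "k < a + m" and s: "s \<in> fac a k"
      show "p' k s \<in> carrier G" using s p_closed Q_closed by (auto simp: p'_def fac_def split: if_splits)
      fix t assume t: "t \<in> fac a k"
      show "p' k (s \<odot> t) = p' k s \<otimes> p' k t"
      proof (cases "k < a")
        case True then show ?thesis using s t p_hom by (simp add: p'_def fac_def)
      next
        case False then show ?thesis using p'S k s t by (simp add: fac_def)
      qed
    next
      fix k assume k: "k < a + m"
      show "continuous_map (top_of_set (fac a k)) X (p' k)"
      proof (cases "k < a")
        case True then show ?thesis using p_cont by (simp add: p'_def[abs_def] fac_def)
      next
        case False
        have "continuous_map (top_of_set S1) X (p' k)"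
        proof (rule continuous_map_quat_hom[OF S1_subset_S3 S1_qmul S1_qcnj])
          show "p' k s \<in> carrier G" for s using False Q_closed by (simp add: p'_def)
          show "p' k (s \<odot> t) = p' k s \<otimes> p' k t" if "s \<in> S1" "t \<in> S1" for s t
            using p'S k False that by simp
          fix W assume W: "openin X W" "\<one> \<in> W"
          have "open {r. Q (\<lambda>i. r * v (k - a) i) \<in> W}"
            using continuous_map_Q_line[of "v (k - a)"] W(1) unfolding continuous_map_def by auto
          moreover have "0 \<in> {r. Q (\<lambda>i. r * v (k - a) i) \<in> W}" using W Q_zero by simp
          ultimately obtain d where d: "d > 0" "ball 0 d \<subseteq> {r. Q (\<lambda>i. r * v (k - a) i) \<in> W}" by (rule openE)
          have "isCont Arg 1" by (rule continuous_at_Arg) simp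
          then have "\<exists>e>0. \<forall>z. dist z 1 < e \<longrightarrow> dist (Arg z) (Arg 1) < 2 * pi * d"
            using d(1) unfolding continuous_at_eps_delta by simp
          then obtain e where e: "e > 0" "\<And>z. dist z 1 < e \<Longrightarrow> \<bar>Arg z\<bar> < 2 * pi * d" by auto
          have "p' k s \<in> W" if s: "s \<in> S1" "norm (s - qone) < e" for s
          proof -
            have "cmod (fst s - 1) \<le> norm (s - qone)" by (rule norm_fst_minus_one)
            then have "\<bar>Arg (fst s)\<bar> < 2 * pi * d" using e(2)[of "fst s"] s by (simp add: dist_norm)
            then have "\<bar>ang s\<bar> < d" by (simp add: ang_def abs_divide field_simps)
            then have "ang s \<in> ball 0 d" by simp
            then show ?thesis using d(2) False by (auto simp: p'_def)
          qed
          then show "\<exists>\<delta>>0. \<forall>s\<in>S1. norm (s - qone) < \<delta> \<longrightarrow> p' k s \<in> W" using e(1) by blast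
        qed
        then show ?thesis using False by (simp add: fac_def)
      qed
    next
      fix j k s t assume "j < a + m" "k < a + m" "j \<noteq> k" "s \<in> fac a j" "t \<in> fac a k"
      then show "p' j s \<otimes> p' k t = p' k t \<otimes> p' j s"
        using pp[of j k s t] Qcentral[of j s] Qcentral[of k t] Q_commute
        by (auto simp: p'_def fac_def split: if_splits)
    next
      fix g assume "g \<in> carrier G"
      then obtain s t where s: "\<And>j. s j \<in> S3" and g: "g = P s \<otimes> Q t" using PQ_surj by blast
      \<comment> \<open>Coordinates of \<open>t\<close> with respect to the family \<open>v\<close>,
        obtained because \<open>c\<close> expresses the unit vectors through it.\<close>
      define u where "u j = (\<Sum>k<b. t k * c k j)" for j
      have "Q t = Q (\<lambda>k. \<Sum>j<m. u j * v j k)"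
        unfolding Q_def
      proof (rule gprod_cong)
        fix i assume i: "i < b"
        have "(\<Sum>j<m. u j * v j i) = (\<Sum>k<b. t k * (\<Sum>j<m. c k j * v j i))"
          unfolding u_def sum_distrib_left sum_distrib_right by (subst sum.swap) (simp add: mult.assoc)
        also have "\<dots> = (\<Sum>k<b. t k * (if i = k then 1 else 0))"
          using c by (intro sum.cong) auto
        also have "\<dots> = (\<Sum>k<b. if i = k then t k else 0)" by (intro sum.cong) auto
        also have "\<dots> = t i" using i by simp
        finally show "q i (t i) = q i (\<Sum>j<m. u j * v j i)" by simp
      qed
      also have "\<dots> = gprod G m (\<lambda>j. Q (\<lambda>k. u j * v j k))" by (rule Q_sum)
      finally have Qt: "Q t = gprod G m (\<lambda>j. Q (\<lambda>k. u j * v j k))" .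
      define l where "l k = (if k < a then s k else (cis (2 * pi * u (k - a)), 0))" for k
      have lf: "l k \<in> fac a k" for k using s by (simp add: l_def fac_def S1_iff)
      have "gprod G (a + m) (\<lambda>k. p' k (l k)) = gprod G a (\<lambda>k. p' k (l k)) \<otimes> gprod G m (\<lambda>k. p' (a + k) (l (a + k)))"
      proof (rule gprod_add)
        fix k assume "k < a + m"
        show "p' k (l k) \<in> carrier G" using s p_closed Q_closed by (auto simp: p'_def l_def)
      qed
      also have "gprod G a (\<lambda>k. p' k (l k)) = P s"
        unfolding P_def by (rule gprod_cong) (simp add: p'_def l_def)
      also have "gprod G m (\<lambda>k. p' (a + k) (l (a + k))) = Q t"
        unfolding Qt by (rule gprod_cong) (simp add: l_def p'r)
      finally show "\<exists>l. (\<forall>k<a + m. l k \<in> fac a k) \<and> g = gprod G (a + m) (\<lambda>k. p' k (l k))"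
        using lf g by (intro exI[of _ l]) simp
    qed
  qed
qed

end

section \<open>Groups locally isomorphic to products of SU(2) and U(1)\<close>

lemma cmod_cis_minus_one: "cmod (cis t - 1) \<le> \<bar>t\<bar>"
proof -
  have "cmod (cis t - 1) = 2 * \<bar>sin (t / 2)\<bar>"
    using dist_exp_i_1[of t] by (simp add: cis_conv_exp)
  also have "\<dots> \<le> \<bar>t\<bar>" using abs_sin_x_le_abs_x[of "t / 2"] by simp
  finally show ?thesis .
qed

lemma norm_cis_minus_qone: "norm ((cis t, 0) - qone) \<le> \<bar>t\<bar>"
proof -
  have "(cis t, 0) - qone = (cis t - 1, 0)" by (simp add: qone_def)
  then show ?thesis using cmod_cis_minus_one[of t] by simp
qed

lemma real_generated_by_interval:
  assumes T: "\<And>s t. s \<in> T \<Longrightarrow> t \<in> T \<Longrightarrow> s + t \<in> T" and small: "d > 0" "\<And>t. \<bar>t\<bar> < d \<Longrightarrow> t \<in> T"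
  shows "(t::real) \<in> T"
proof -
  obtain n where n: "\<bar>t\<bar> / d < real n" using reals_Archimedean2 by blast
  have n0: "n > 0" using n small(1) by (metis abs_ge_zero divide_nonneg_pos gr0I of_nat_0 not_less)
  have "\<bar>t\<bar> < d * real n" using n small(1) by (simp add: field_simps)
  then have "\<bar>t / real n\<bar> < d" using n0 by (simp add: abs_divide field_simps)
  then have tn: "t / real n \<in> T" by (rule small(2))
  have "real m * (t / real n) \<in> T" for m
  proof (induction m)
    case (Suc m)
    have "real (Suc m) * (t / real n) = real m * (t / real n) + t / real n"
      by (simp add: algebra_simps add_divide_distrib)
    then show ?case using T[OF Suc tn] by simp
  qed (simp add: small)
  from this[of n] show ?thesis using n0 by simp
qed

text \<open>Each coordinate axis of the chart gives a local homomorphism that extends to SU(2) or to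
  a real line. Commutation of the extensions is inherited from the chart, since small elements
  generate both SU(2) and the line.\<close>

lemma (in compact_haar_group) locally_isomorphic_factor_system:
  assumes conn: "connected_space X"
    and loc: "locally_isomorphic G X (SU2_U1_product a b) (SU2_U1_topology a b)"
  shows "\<exists>N p. factor_system a N p"
proof -
  define N where "N = a + b"
  obtain \<Phi> \<epsilon> where eps: "\<epsilon> > 0"
    and closed: "\<And>l. l \<in> qbox a N \<epsilon> \<Longrightarrow> \<Phi> l \<in> carrier G"
    and hom: "\<And>l m. l \<in> qbox a N \<epsilon> \<Longrightarrow> m \<in> qbox a N \<epsilon> \<Longrightarrow> (\<lambda>k. l k \<odot> m k) \<in> qbox a N \<epsilon> \<Longrightarrow>
      \<Phi> (\<lambda>k. l k \<odot> m k) = \<Phi> l \<otimes> \<Phi> m"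
    and inj: "\<And>l m k. l \<in> qbox a N \<epsilon> \<Longrightarrow> m \<in> qbox a N \<epsilon> \<Longrightarrow> \<Phi> l = \<Phi> m \<Longrightarrow> k < N \<Longrightarrow> l k = m k"
    and op: "\<And>\<delta>. \<delta> > 0 \<Longrightarrow> \<delta> \<le> \<epsilon> \<Longrightarrow> openin X (\<Phi> ` qbox a N \<delta>)"
    and cont: "\<And>W. openin X W \<Longrightarrow> \<one> \<in> W \<Longrightarrow> \<exists>\<delta>>0. \<delta> \<le> \<epsilon> \<and> \<Phi> ` qbox a N \<delta> \<subseteq> W"
    and cong: "\<And>l m. \<forall>k<N. l k = m k \<Longrightarrow> \<Phi> l = \<Phi> m"
    by (rule local_chart[OF loc, folded N_def]) (rule that)
  define one where "one = (\<lambda>_::nat. qone)"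
  define \<phi> where "\<phi> k w = \<Phi> (one(k := w))" for k w
  have one_box: "one \<in> qbox a N \<delta>" if "\<delta> > 0" for \<delta> using that by (simp add: one_def qbox_def)
  have box: "one(k := w) \<in> qbox a N \<delta>" if "w \<in> fac a k" "norm (w - qone) < \<delta>" for k w \<delta>
    using that le_less_trans[OF norm_ge_zero that(2)] by (auto simp: one_def qbox_def)
  have \<phi>_closed: "\<phi> k w \<in> carrier G" if "w \<in> fac a k" "norm (w - qone) < \<epsilon>" for k w
    unfolding \<phi>_def by (intro closed box that)
  have \<phi>_hom: "\<phi> k (v \<odot> w) = \<phi> k v \<otimes> \<phi> k w"
    if "v \<in> fac a k" "w \<in> fac a k" "norm (v - qone) < \<epsilon>" "norm (w - qone) < \<epsilon>" "norm (v \<odot> w - qone) < \<epsilon>" for k v w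
  proof -
    have e: "(\<lambda>i. (one(k := v)) i \<odot> (one(k := w)) i) = one(k := v \<odot> w)" by (auto simp: one_def)
    have b: "one(k := v) \<in> qbox a N \<epsilon>" "one(k := w) \<in> qbox a N \<epsilon>" "one(k := v \<odot> w) \<in> qbox a N \<epsilon>"
      by (intro box that fac_qmul)+
    show ?thesis
      unfolding \<phi>_def by (rule hom[OF b(1,2), unfolded e, OF b(3)])
  qed
  have \<phi>_comm: "\<phi> j v \<otimes> \<phi> k w = \<phi> k w \<otimes> \<phi> j v"
    if "j \<noteq> k" "v \<in> fac a j" "w \<in> fac a k" "norm (v - qone) < \<epsilon>" "norm (w - qone) < \<epsilon>" for j k v w
  proof -
    have e: "(\<lambda>i. (one(j := v)) i \<odot> (one(k := w)) i) = one(j := v, k := w)"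
      "(\<lambda>i. (one(k := w)) i \<odot> (one(j := v)) i) = one(j := v, k := w)"
      using that(1) by (auto simp: one_def)
    have b: "one(j := v, k := w) \<in> qbox a N \<epsilon>"
      using that eps by (auto simp: one_def qbox_def)
    have "\<phi> j v \<otimes> \<phi> k w = \<Phi> (one(j := v, k := w))"
      unfolding \<phi>_def by (rule hom[OF box[OF that(2,4)] box[OF that(3,5)], unfolded e(1), OF b, symmetric])
    also have "\<dots> = \<phi> k w \<otimes> \<phi> j v"
      unfolding \<phi>_def by (rule hom[OF box[OF that(3,5)] box[OF that(2,4)], unfolded e(2), OF b])
    finally show ?thesis .
  qed
  have \<Phi>_one: "\<Phi> one = \<one>"
  proof -
    have e: "(\<lambda>i. one i \<odot> one i) = one" by (simp add: one_def)
    have "\<Phi> one = \<Phi> one \<otimes> \<Phi> one" using hom[of one one] one_box[OF eps] unfolding e by simp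
    then show ?thesis using closed[OF one_box[OF eps]] by simp
  qed
  have \<phi>_inj: "v = qone" if "k < N" "v \<in> fac a k" "norm (v - qone) < \<epsilon>" "\<phi> k v = \<one>" for k v
    using inj[OF box[OF that(2,3)] one_box[OF eps] _ that(1)] that(4) \<Phi>_one by (simp add: \<phi>_def one_def)
  have fac3: "fac a j = S3" if "j < a" for j using that by (simp add: fac_def)
  have fac1: "fac a (a + i) = S1" for i by (simp add: fac_def)
  have cis1: "(cis t, 0) \<in> S1" for t by (simp add: S1_iff)
  have "\<exists>p d. d > 0 \<and> (\<forall>s\<in>S3. p s \<in> carrier G) \<and> (\<forall>s\<in>S3. \<forall>t\<in>S3. p (s \<odot> t) = p s \<otimes> p t) \<and>
    (\<forall>w\<in>S3. norm (w - qone) < d \<longrightarrow> p w = \<phi> j w)" if j: "j < a" for j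
  proof -
    interpret local_hom_S3 G "\<phi> j" \<epsilon>
      by unfold_locales (use eps \<phi>_closed[of _ j] \<phi>_hom[of _ j] fac3[OF j] in auto)
    show ?thesis by (rule extend_local_hom)
  qed
  then obtain p where p0: "\<forall>j<a. \<exists>d>0. (\<forall>s\<in>S3. p j s \<in> carrier G) \<and> (\<forall>s\<in>S3. \<forall>t\<in>S3. p j (s \<odot> t) = p j s \<otimes> p j t) \<and>
    (\<forall>w\<in>S3. norm (w - qone) < d \<longrightarrow> p j w = \<phi> j w)" by metis
  have p_closed: "p j s \<in> carrier G" if "j < a" "s \<in> S3" for j s using p0 that by blast
  have p_hom: "p j (s \<odot> t) = p j s \<otimes> p j t" if "j < a" "s \<in> S3" "t \<in> S3" for j s t using p0 that by blast
  obtain \<delta>1 where \<delta>1: "\<delta>1 > 0" "\<forall>j<a. \<forall>w\<in>S3. norm (w - qone) < \<delta>1 \<longrightarrow> p j w = \<phi> j w"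
  proof -
    have "\<exists>e>0. \<forall>j<a. \<forall>w\<in>S3. norm (w - qone) < e \<longrightarrow> p j w = \<phi> j w"
      by (rule uniform_eps) (use p0 in \<open>blast, force\<close>)
    then show thesis using that by blast
  qed
  have "\<exists>q. (\<forall>t. q t \<in> carrier G) \<and> (\<forall>s t. q (s + t) = q s \<otimes> q t) \<and>
    (\<forall>t. \<bar>t\<bar> < \<epsilon> / 2 \<longrightarrow> q t = \<phi> (a + i) (cis t, 0))" for i
  proof (rule extend_local_hom_real[OF eps])
    fix t :: real assume t: "\<bar>t\<bar> < \<epsilon>"
    have nt: "norm ((cis t, 0) - qone) < \<epsilon>" using norm_cis_minus_qone[of t] t by linarith
    show "\<phi> (a + i) (cis t, 0) \<in> carrier G" by (rule \<phi>_closed) (simp_all add: fac1 cis1 nt)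
    fix s :: real assume s: "\<bar>s\<bar> < \<epsilon>" and st: "\<bar>s + t\<bar> < \<epsilon>"
    have ns: "norm ((cis s, 0) - qone) < \<epsilon>" using norm_cis_minus_qone[of s] s by linarith
    have nst: "norm ((cis (s + t), 0) - qone) < \<epsilon>" using norm_cis_minus_qone[of "s + t"] st by linarith
    have e: "(cis (s + t), 0) = (cis s, 0) \<odot> (cis t, 0)" by (simp add: qmul_def cis_mult)
    show "\<phi> (a + i) (cis (s + t), 0) = \<phi> (a + i) (cis s, 0) \<otimes> \<phi> (a + i) (cis t, 0)"
      unfolding e by (rule \<phi>_hom) (use ns nt nst in \<open>simp_all add: fac1 cis1 e\<close>)
  qed
  then obtain q where q_closed: "\<And>i t. q i t \<in> carrier G" and q_hom: "\<And>i s t. q i (s + t) = q i s \<otimes> q i t"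
    and q_small: "\<And>i t. \<bar>t\<bar> < \<epsilon> / 2 \<Longrightarrow> q i t = \<phi> (a + i) (cis t, 0)" by metis
  define \<delta> where "\<delta> = min \<delta>1 (\<epsilon> / 2)"
  have \<delta>: "\<delta> > 0" "\<delta> \<le> \<delta>1" "\<delta> \<le> \<epsilon> / 2" using eps \<delta>1 by (auto simp: \<delta>_def)
  have p_small: "p j w = \<phi> j w" if "j < a" "w \<in> S3" "norm (w - qone) < \<delta>" for j w
    using \<delta>1(2) that \<delta> by auto
  \<comment> \<open>Commutation with a fixed \<open>y\<close> passes from a ball to all of SU(2). It
    is used in two rounds: first with \<open>y\<close> a small chart value, then with
    \<open>y\<close> a value of another extension.\<close>
  have p_cent: "p j s \<otimes> y = y \<otimes> p j s"
    if j: "j < a" and y: "y \<in> carrier G" and c: "\<And>w. w \<in> S3 \<Longrightarrow> norm (w - qone) < \<delta> \<Longrightarrow> \<phi> j w \<otimes> y = y \<otimes> \<phi> j w"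
      and s: "s \<in> S3" for j y s
  proof -
    have "S3 \<subseteq> {s \<in> S3. p j s \<otimes> y = y \<otimes> p j s}"
    proof (rule S3_generated_by_ball[OF _ \<delta>(1)])
      fix u v assume "u \<in> {s \<in> S3. p j s \<otimes> y = y \<otimes> p j s}" "v \<in> {s \<in> S3. p j s \<otimes> y = y \<otimes> p j s}"
      then have *: "u \<in> S3" "v \<in> S3" "p j u \<otimes> y = y \<otimes> p j u" "p j v \<otimes> y = y \<otimes> p j v" by auto
      have "p j u \<otimes> p j v \<otimes> y = y \<otimes> (p j u \<otimes> p j v)"
        by (rule mult_commute_closed) (use * p_closed j y in auto)
      then show "u \<odot> v \<in> {s \<in> S3. p j s \<otimes> y = y \<otimes> p j s}" using * p_hom[OF j] by simp
    qed (use c p_small j in auto)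
    then show ?thesis using s by blast
  qed
  have q_cent: "q i t \<otimes> y = y \<otimes> q i t"
    if y: "y \<in> carrier G" and c: "\<And>w. w \<in> S1 \<Longrightarrow> norm (w - qone) < \<delta> \<Longrightarrow> \<phi> (a + i) w \<otimes> y = y \<otimes> \<phi> (a + i) w" for i y t
  proof -
    have "t \<in> {t. q i t \<otimes> y = y \<otimes> q i t}"
    proof (rule real_generated_by_interval[OF _ \<delta>(1)])
      fix u v assume *: "u \<in> {t. q i t \<otimes> y = y \<otimes> q i t}" "v \<in> {t. q i t \<otimes> y = y \<otimes> q i t}"
      have "q i u \<otimes> q i v \<otimes> y = y \<otimes> (q i u \<otimes> q i v)"
        by (rule mult_commute_closed) (use * q_closed y in auto)
      then show "u + v \<in> {t. q i t \<otimes> y = y \<otimes> q i t}" by (simp add: q_hom)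
    next
      fix u :: real assume u: "\<bar>u\<bar> < \<delta>"
      then have "q i u = \<phi> (a + i) (cis u, 0)" using q_small \<delta> by simp
      moreover have "norm ((cis u, 0) - qone) < \<delta>" using norm_cis_minus_qone[of u] u by linarith
      ultimately show "u \<in> {t. q i t \<otimes> y = y \<otimes> q i t}" using c[OF cis1] by simp
    qed
    then show ?thesis by simp
  qed
  have lt: "norm (w - qone) < \<delta> \<Longrightarrow> norm (w - qone) < \<epsilon>" for w using \<delta> eps by linarith
  have Npos: "k < a \<Longrightarrow> k < N" "i < b \<Longrightarrow> a + i < N" for k i by (auto simp: N_def)
  have p\<phi>: "p j s \<otimes> \<phi> k w = \<phi> k w \<otimes> p j s"
    if "j < a" "j \<noteq> k" "s \<in> S3" "w \<in> fac a k" "norm (w - qone) < \<delta>" for j k s w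
    by (rule p_cent) (use that \<phi>_comm[OF that(2)] \<phi>_closed lt fac3 in auto)
  have q\<phi>: "q i t \<otimes> \<phi> k w = \<phi> k w \<otimes> q i t"
    if "a + i \<noteq> k" "w \<in> fac a k" "norm (w - qone) < \<delta>" for i k t w
    by (rule q_cent) (use that \<phi>_comm[OF that(1)] \<phi>_closed lt fac1 in auto)
  \<comment> \<open>Near 1 the principal argument is small, so the argument of a circle coordinate
    in a small box lies where \<open>q\<close> is known to agree with the chart.\<close>
  obtain \<delta>2 where \<delta>2: "\<delta>2 > 0" "\<And>z. cmod (z - 1) < \<delta>2 \<Longrightarrow> \<bar>Arg z\<bar> < \<delta>"
  proof -
    have "isCont Arg 1" by (rule continuous_at_Arg) simp
    then have "\<exists>e>0. \<forall>z. dist z 1 < e \<longrightarrow> dist (Arg z) (Arg 1) < \<delta>"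
      using \<delta>(1) unfolding continuous_at_eps_delta by simp
    then show thesis using that by (auto simp: dist_norm)
  qed
  define \<delta>3 where "\<delta>3 = min \<delta> \<delta>2"
  have \<delta>3: "\<delta>3 > 0" "\<delta>3 \<le> \<delta>" "\<delta>3 \<le> \<delta>2" "\<delta>3 \<le> \<epsilon>" using \<delta> \<delta>2 eps by (auto simp: \<delta>3_def)
  \<comment> \<open>Built up one coordinate at a time; the truncations of \<open>l\<close> remain in
    the box, so the local homomorphism law applies at every stage.\<close>
  have expand: "\<Phi> l = gprod G N (\<lambda>k. \<phi> k (l k))" if l: "l \<in> qbox a N \<epsilon>" for l
  proof -
    have "\<Phi> (\<lambda>k. if k < n then l k else qone) = gprod G n (\<lambda>k. \<phi> k (l k))" if "n \<le> N" for n
      using that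
    proof (induction n)
      case 0
      show ?case using \<Phi>_one by (simp add: one_def)
    next
      case (Suc n)
      let ?l = "\<lambda>k. if k < n then l k else qone"
      have ln: "l n \<in> fac a n" "norm (l n - qone) < \<epsilon>" using l Suc.prems by (auto simp: qbox_def)
      have e: "(\<lambda>k. ?l k \<odot> (one(n := l n)) k) = (\<lambda>k. if k < Suc n then l k else qone)"
        by (auto simp: one_def less_Suc_eq)
      have lb: "(\<lambda>k. if k < m then l k else qone) \<in> qbox a N \<epsilon>" for m using l eps by (auto simp: qbox_def)
      have "\<Phi> (\<lambda>k. if k < Suc n then l k else qone) = \<Phi> ?l \<otimes> \<phi> n (l n)"
        unfolding \<phi>_def by (rule hom[OF lb[of n] box[OF ln], unfolded e, OF lb[of "Suc n"]])
      then show ?case using Suc by simp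
    qed
    from this[of N] have "\<Phi> (\<lambda>k. if k < N then l k else qone) = gprod G N (\<lambda>k. \<phi> k (l k))" by simp
    moreover have "\<Phi> (\<lambda>k. if k < N then l k else qone) = \<Phi> l" by (rule cong) simp
    ultimately show ?thesis by simp
  qed
  have "real_factors G X \<mu> a b p q (\<Phi> ` qbox a N \<delta>3) \<delta>"
  proof unfold_locales
    show "connected_space X" by (rule conn)
    show "\<And>j s. j < a \<Longrightarrow> s \<in> S3 \<Longrightarrow> p j s \<in> carrier G" by (rule p_closed)
    show "\<And>j s t. j < a \<Longrightarrow> s \<in> S3 \<Longrightarrow> t \<in> S3 \<Longrightarrow> p j (s \<odot> t) = p j s \<otimes> p j t" by (rule p_hom)
    show "continuous_map (top_of_set S3) X (p j)" if j: "j < a" for j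
    proof (rule continuous_map_quat_hom)
      fix W assume "openin X W" "\<one> \<in> W"
      then obtain d where d: "d > 0" "d \<le> \<epsilon>" "\<Phi> ` qbox a N d \<subseteq> W" using cont by blast
      have "p j s \<in> W" if s: "s \<in> S3" "norm (s - qone) < min d \<delta>" for s
      proof -
        have "one(j := s) \<in> qbox a N d" using s fac3[OF j] by (intro box) auto
        then show ?thesis using d(3) p_small[OF j] s by (auto simp: \<phi>_def)
      qed
      then show "\<exists>\<delta>>0. \<forall>s\<in>S3. norm (s - qone) < \<delta> \<longrightarrow> p j s \<in> W"
        using d(1) \<delta>(1) by (intro exI[of _ "min d \<delta>"]) auto
    qed (use p_closed p_hom j in auto)
    show "\<And>i t. i < b \<Longrightarrow> q i t \<in> carrier G" by (rule q_closed)
    show "\<And>i s t. i < b \<Longrightarrow> q i (s + t) = q i s \<otimes> q i t" by (rule q_hom)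
    show "continuous_map euclideanreal X (q i)" if i: "i < b" for i
    proof (rule continuous_map_real_hom[OF q_closed q_hom])
      fix W assume "openin X W" "\<one> \<in> W"
      then obtain d where d: "d > 0" "d \<le> \<epsilon>" "\<Phi> ` qbox a N d \<subseteq> W" using cont by blast
      have "q i t \<in> W" if t: "\<bar>t\<bar> < min d \<delta>" for t
      proof -
        have "norm ((cis t, 0) - qone) < d" using norm_cis_minus_qone[of t] t by linarith
        then have "one(a + i := (cis t, 0)) \<in> qbox a N d" using fac1 cis1 by (intro box) auto
        then show ?thesis using d(3) q_small[of t i] t \<delta>(3) by (auto simp: \<phi>_def)
      qed
      then show "\<exists>\<delta>>0. \<forall>t. \<bar>t\<bar> < \<delta> \<longrightarrow> q i t \<in> W"
        using d(1) \<delta>(1) by (intro exI[of _ "min d \<delta>"]) auto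
    qed
    show "p j s \<otimes> p k t = p k t \<otimes> p j s" if "j < a" "k < a" "j \<noteq> k" "s \<in> S3" "t \<in> S3" for j k s t
    proof (rule p_cent[OF that(1) _ _ that(4)])
      show "p k t \<in> carrier G" using p_closed that by blast
      fix w assume "w \<in> S3" "norm (w - qone) < \<delta>"
      then show "\<phi> j w \<otimes> p k t = p k t \<otimes> \<phi> j w" using p\<phi>[of k j t w] that fac3 by simp
    qed
    show pq: "p j s \<otimes> q i t = q i t \<otimes> p j s" if "j < a" "i < b" "s \<in> S3" for j i s t
    proof (rule p_cent[OF that(1) _ _ that(3)])
      show "q i t \<in> carrier G" by (rule q_closed)
      fix w assume "w \<in> S3" "norm (w - qone) < \<delta>"
      then show "\<phi> j w \<otimes> q i t = q i t \<otimes> \<phi> j w" using q\<phi>[of i j w t] that fac3 by simp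
    qed
    show "q i s \<otimes> q k t = q k t \<otimes> q i s" if "i < b" "k < b" for i k s t
    proof (cases "i = k")
      case True
      then show ?thesis using q_hom[of i s t] q_hom[of i t s] by (simp add: add.commute)
    next
      case False
      show ?thesis
      proof (rule q_cent)
        show "q k t \<in> carrier G" by (rule q_closed)
        fix w assume "w \<in> S1" "norm (w - qone) < \<delta>"
        then show "\<phi> (a + i) w \<otimes> q k t = q k t \<otimes> \<phi> (a + i) w" using q\<phi>[of k "a + i" w t] False fac1 by simp
      qed
    qed
    show "\<delta> > 0" by (rule \<delta>(1))
    show "v = qone" if "j < a" "v \<in> S3" "norm (v - qone) < \<delta>" "p j v = \<one>" for j v
      using \<phi>_inj[OF Npos(1)[OF that(1)], of v] that p_small lt fac3 by simp
    show "openin X (\<Phi> ` qbox a N \<delta>3)" by (rule op[OF \<delta>3(1,4)])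
    show "\<one> \<in> \<Phi> ` qbox a N \<delta>3" using one_box[OF \<delta>3(1)] \<Phi>_one by (metis imageI)
    fix g assume "g \<in> \<Phi> ` qbox a N \<delta>3"
    then obtain l where l: "l \<in> qbox a N \<delta>3" and g: "g = \<Phi> l" by blast
    have lk: "l k \<in> fac a k" "norm (l k - qone) < \<delta>3" if "k < N" for k using l that by (auto simp: qbox_def)
    have le: "l \<in> qbox a N \<epsilon>" using l \<delta>3(4) by (auto simp: qbox_def)
    define s where "s j = (if j < a then l j else qone)" for j
    define t where "t i = Arg (fst (l (a + i)))" for i
    have g1: "g = gprod G a (\<lambda>k. \<phi> k (l k)) \<otimes> gprod G b (\<lambda>i. \<phi> (a + i) (l (a + i)))"
      unfolding g expand[OF le] N_def
    proof (rule gprod_add)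
      fix k assume "k < a + b"
      then show "\<phi> k (l k) \<in> carrier G" using lk[of k] \<delta>3(4) by (intro \<phi>_closed) (auto simp: N_def)
    qed
    have "gprod G a (\<lambda>k. \<phi> k (l k)) = gprod G a (\<lambda>j. p j (s j))"
    proof (rule gprod_cong)
      fix k assume k: "k < a"
      then show "\<phi> k (l k) = p k (s k)" using p_small[OF k] lk[OF Npos(1)[OF k]] \<delta>3(2) fac3[OF k] by (simp add: s_def)
    qed
    moreover have "gprod G b (\<lambda>i. \<phi> (a + i) (l (a + i))) = gprod G b (\<lambda>i. q i (t i))"
    proof (rule gprod_cong)
      fix i assume i: "i < b"
      have li: "l (a + i) \<in> S1" "norm (l (a + i) - qone) < \<delta>3" using lk[OF Npos(2)[OF i]] fac1 by auto
      have "cmod (fst (l (a + i)) - 1) < \<delta>2" using norm_fst_minus_one[of "l (a + i)"] li \<delta>3(3) by linarith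
      then have "\<bar>t i\<bar> < \<delta>" unfolding t_def by (rule \<delta>2(2))
      then have "q i (t i) = \<phi> (a + i) (cis (t i), 0)" using \<delta>(3) by (intro q_small) simp
      also have "cis (t i) = fst (l (a + i))"
      proof -
        have "cmod (fst (l (a + i))) = 1" using li(1) by (simp add: S1_iff)
        moreover from this have "fst (l (a + i)) \<noteq> 0" by (metis norm_zero zero_neq_one)
        ultimately show ?thesis using cis_Arg[of "fst (l (a + i))"] by (simp add: t_def sgn_eq)
      qed
      also have "(fst (l (a + i)), 0) = l (a + i)" using li(1) by (simp add: S1_iff prod_eq_iff)
      finally show "\<phi> (a + i) (l (a + i)) = q i (t i)" by simp
    qed
    moreover have "s j \<in> S3" for j
      using lk(1)[OF Npos(1), of j] fac_subset_S3[of "l j" a j] by (simp add: s_def)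
    moreover have "\<bar>t i\<bar> \<le> pi" for i
      using Arg_bounded[of "fst (l (a + i))"] by (simp add: t_def abs_le_iff)
    ultimately show "\<exists>s t. (\<forall>j. s j \<in> S3) \<and> (\<forall>i. \<bar>t i\<bar> \<le> pi) \<and>
        g = gprod G a (\<lambda>j. p j (s j)) \<otimes> gprod G b (\<lambda>i. q i (t i))"
      using g1 by (intro exI[of _ s] exI[of _ t]) simp
  qed
  then show ?thesis by (rule real_factors.factor_system_exists)
qed

section \<open>Topological generation by a generic pair\<close>


lemma qcnj_qone [simp]: "qcnj qone = qone"
  by (simp add: qcnj_def qone_def)

text \<open>The angle lies between 0 and \<open>pi\<close>, so an element of the circle with
  negative imaginary part has to be conjugated by \<open>j\<close>. The last clause says that the
  conjugator still normalises the circle, which keeps the U(1) factors within themselves.\<close>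

lemma S3_diagonalise:
  assumes s: "s \<in> S3"
  shows "\<exists>g\<in>S3. s = g \<odot> (cis (arccos (qre s)), 0) \<odot> qcnj g \<and>
    (s \<in> S1 \<longrightarrow> (\<forall>z\<in>S1. g \<odot> z \<odot> qcnj g \<in> S1 \<and> qcnj g \<odot> z \<odot> g \<in> S1))"
proof -
  obtain x y c where sxy: "s = (Complex x y, c)" by (metis complex_surj surj_pair)
  have x: "qre s = x" by (simp add: sxy qre_def)
  have n: "x\<^sup>2 + y\<^sup>2 + (cmod c)\<^sup>2 = 1"
    using norm_quat_sq[of s] s by (simp add: S3_def sxy cmod_power2)
  have "\<bar>x\<bar> \<le> 1" using qre_le[of s] s x by (simp add: S3_def)
  then have x1: "- 1 \<le> x" "x \<le> 1" by auto
  define r where "r = sqrt (1 - x\<^sup>2)"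
  have "x\<^sup>2 \<le> 1" using \<open>\<bar>x\<bar> \<le> 1\<close> by (simp add: abs_square_le_1)
  then have r: "r \<ge> 0" "r\<^sup>2 = y\<^sup>2 + (cmod c)\<^sup>2" using n by (auto simp: r_def)
  have d: "cis (arccos (qre s)) = Complex x r"
    using x1 unfolding x by (simp add: complex_eq_iff r_def sin_arccos)
  have conj: "s = g \<odot> (Complex x r, 0) \<odot> qcnj g" if g: "g \<in> S3" and e: "s \<odot> g = g \<odot> (Complex x r, 0)" for g
    using g by (simp add: e[symmetric] qmul_assoc)
  show ?thesis
  proof (cases "c = 0")
    case True
    then have ry: "r = \<bar>y\<bar>" by (intro power2_eq_imp_eq[of r "\<bar>y\<bar>"]) (simp_all add: r)
    show ?thesis
    proof (cases "y \<ge> 0")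
      case True
      then show ?thesis unfolding d using ry \<open>c = 0\<close> sxy
        by (intro bexI[of _ qone]) simp_all
    next
      case False
      let ?j = "(0, 1) :: quat"
      have j: "?j \<in> S3" by (simp add: S3_def norm_prod_def)
      have "s = ?j \<odot> (Complex x r, 0) \<odot> qcnj ?j"
        by (rule conj[OF j]) (use False ry \<open>c = 0\<close> sxy in \<open>simp add: qmul_def complex_eq_iff\<close>)
      moreover have "?j \<odot> z \<odot> qcnj ?j \<in> S1 \<and> qcnj ?j \<odot> z \<odot> ?j \<in> S1" if "z \<in> S1" for z
        using that by (simp add: S1_iff qmul_def qcnj_def)
      ultimately show ?thesis unfolding d using j by blast
    qed
  next
    case False
    \<comment> \<open>As a column this is an eigenvector of \<open>qmat s\<close> for the eigenvalue
      \<open>Complex x r\<close>; normalised, it diagonalises \<open>s\<close>.\<close>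
    define g where "g = (complex_of_real (r + y), - \<i> * c)"
    have cc: "c * cnj c = of_real (r\<^sup>2 - y\<^sup>2)" 
  proof -
    have "r\<^sup>2 - y\<^sup>2 = (cmod c)\<^sup>2" using r by simp
    then show ?thesis using complex_norm_square[of c] by simp
  qed
    have e: "s \<odot> g = g \<odot> (Complex x r, 0)"
    proof -
      have "fst (s \<odot> g) = Complex x y * (r + y) + \<i> * (c * cnj c)"
        by (simp add: qmul_def sxy g_def algebra_simps)
      also have "\<dots> = fst (g \<odot> (Complex x r, 0))"
        unfolding cc by (simp add: qmul_def g_def complex_eq_iff power2_eq_square algebra_simps)
      finally have 1: "fst (s \<odot> g) = fst (g \<odot> (Complex x r, 0))" .
      have "snd (s \<odot> g) = snd (g \<odot> (Complex x r, 0))"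
        by (simp add: qmul_def sxy g_def complex_eq_iff algebra_simps)
      then show ?thesis using 1 by (simp add: prod_eq_iff)
    qed
    have g0: "norm g \<noteq> 0" using False by (simp add: g_def prod_eq_iff zero_prod_def)
    define h where "h = g /\<^sub>R norm g"
    have h: "h \<in> S3" using g0 by (simp add: S3_def h_def)
    have "s \<odot> h = h \<odot> (Complex x r, 0)" by (simp add: h_def e)
    then have "s = h \<odot> (Complex x r, 0) \<odot> qcnj h" by (rule conj[OF h])
    moreover have "s \<notin> S1" using False by (simp add: sxy S1_def)
    ultimately show ?thesis unfolding d using h by blast
  qed
qed

text \<open>The double coset of \<open>s\<close> modulo the circle \<open>S1\<close> is determined by \<open>cmod (fst s)\<close>; the double
  coset products of one element off \<open>S1\<close> cover a neighbourhood of \<open>S1\<close>.\<close>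

lemma S1_double_coset:
  assumes "s \<in> S3" "t \<in> S3" "cmod (fst s) = cmod (fst t)"
  shows "\<exists>x\<in>S1. \<exists>y\<in>S1. t = x \<odot> s \<odot> y"
proof -
  have n: "cmod (snd s) = cmod (snd t)"
  proof (rule power2_eq_imp_eq)
    show "(cmod (snd s))\<^sup>2 = (cmod (snd t))\<^sup>2"
    proof -
      have "(norm s)\<^sup>2 = 1" "(norm t)\<^sup>2 = 1" using assms by (simp_all add: S3_def)
      then show ?thesis
        using norm_quat_sq[of s] norm_quat_sq[of t] arg_cong[OF assms(3), of "\<lambda>x. x\<^sup>2"] by linarith
    qed
  qed simp_all
  have phase: "\<exists>\<theta>. z = cis \<theta> * w" if "cmod w = cmod z" for z w
  proof (cases "w = 0")
    case False
    have z0: "z \<noteq> 0" using that False by (metis norm_eq_zero)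
    have "cmod (z / w) = 1" using that z0 by (simp add: norm_divide)
    moreover have "z / w \<noteq> 0" using z0 False by simp
    ultimately have "cis (Arg (z / w)) = z / w" by (simp add: cis_Arg sgn_eq)
    then have "z = cis (Arg (z / w)) * w" using nonzero_eq_divide_eq[OF False] by metis
    then show ?thesis by blast
  qed (use that in auto)
  obtain u v where uv: "fst t = cis u * fst s" "snd t = cis v * snd s"
    using phase[of "fst s" "fst t"] phase[of "snd s" "snd t"] assms n by auto
  \<comment> \<open>Circle elements of angle \<open>x\<close> on the left and \<open>y\<close> on
    the right shift the phase of \<open>fst\<close> by \<open>x + y\<close> and that of
    \<open>snd\<close> by \<open>y - x\<close>; these values solve for \<open>u\<close> and
    \<open>v\<close>.\<close>
  define x where "x = (u - v) / 2"
  define y where "y = (u + v) / 2"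
  have "cis x * cis y = cis u" "cnj (cis x) * cis y = cis v"
    by (simp_all add: cis_mult cis_cnj x_def y_def field_simps)
  moreover have "fst ((cis x, 0) \<odot> s \<odot> (cis y, 0)) = (cis x * cis y) * fst s"
    "snd ((cis x, 0) \<odot> s \<odot> (cis y, 0)) = (cnj (cis x) * cis y) * snd s"
    by (simp_all add: qmul_def del: cis_cnj cis_mult)
  ultimately have "t = (cis x, 0) \<odot> s \<odot> (cis y, 0)"
    using uv by (simp only: prod_eq_iff)
  then show ?thesis by (intro bexI[of _ "(cis x, 0)"] bexI[of _ "(cis y, 0)"]) (auto simp: S1_iff)
qed

text \<open>\<open>T\<close> contains the circle and so, with each element, its whole double coset;
  only the modulus of \<open>fst\<close> counts. Along the products of \<open>k\<close>, a circle
  element and \<open>k\<close> this modulus runs from some \<open>\<rho>\<close> below 1 up to 1,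
  and these double cosets contain a ball around the identity.\<close>

lemma circles_generate_S3:
  assumes T: "\<And>p q. p \<in> T \<Longrightarrow> q \<in> T \<Longrightarrow> p \<odot> q \<in> T" and S1: "S1 \<subseteq> T"
    and w: "w \<in> S3" "fst w \<noteq> 0" "snd w \<noteq> 0" and conj: "\<And>z. z \<in> S1 \<Longrightarrow> w \<odot> z \<odot> qcnj w \<in> T"
  shows "S3 \<subseteq> T"
proof -
  \<comment> \<open>The angle \<open>pi / 4\<close> has nonzero sine and cosine, so both entries of
    \<open>k\<close> are nonzero: the real part of the first is the cosine, and the second is a
    multiple of the sine.\<close>
  define k where "k = w \<odot> (cis (pi / 4), 0) \<odot> qcnj w"
  have kT: "k \<in> T" unfolding k_def by (rule conj) (simp add: S1_iff)
  have kS: "k \<in> S3" unfolding k_def using w S1_subset_S3 by (intro S3_qmul S3_qcnj) (auto simp: S1_iff)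
  define A where "A = fst k"
  define B where "B = snd k"
  have "Re A = ((cmod (fst w))\<^sup>2 + (cmod (snd w))\<^sup>2) * cos (pi / 4)"
    unfolding cmod_power2 by (simp add: A_def k_def qmul_def qcnj_def power2_eq_square algebra_simps)
  also have "\<dots> = cos (pi / 4)" using w(1) norm_quat_sq[of w] by (simp add: S3_def)
  finally have A0: "A \<noteq> 0" using cos_gt_zero[of "pi / 4"] by (auto simp: complex_eq_iff)
  have "B = 2 * \<i> * sin (pi / 4) * (cnj (fst w) * snd w)"
    by (simp add: B_def k_def qmul_def qcnj_def complex_eq_iff algebra_simps)
  then have B0: "B \<noteq> 0" using w sin_gt_zero[of "pi / 4"] by simp
  have AB: "(cmod A)\<^sup>2 + (cmod B)\<^sup>2 = 1"
    using kS norm_quat_sq[of k] by (simp add: S3_def A_def B_def)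
  \<comment> \<open>The two terms of \<open>fst (F t)\<close> have moduli with sum 1. They cancel
    most at the phase giving \<open>\<rho>\<close>, and add up after half a turn of relative phase,
    which \<open>t\<close> achieves by moving through \<open>pi / 2\<close>.\<close>
  define \<rho> where "\<rho> = \<bar>(cmod A)\<^sup>2 - (cmod B)\<^sup>2\<bar>"
  have "(cmod A)\<^sup>2 > 0" "(cmod B)\<^sup>2 > 0" using A0 B0 by auto
  then have \<rho>: "\<rho> < 1" unfolding \<rho>_def abs_less_iff using AB by (intro conjI; linarith)
  define F where "F t = k \<odot> (cis t, 0) \<odot> k" for t
  have Ff: "fst (F t) = A * A * cis t - cnj B * B * cis (- t)" for t
    by (simp add: F_def qmul_def A_def B_def cis_cnj algebra_simps)
  have FT: "F t \<in> T" for t unfolding F_def using kT S1 by (intro T) (auto simp: S1_iff)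
  have FS: "F t \<in> S3" for t unfolding F_def using kS S1_subset_S3 by (intro S3_qmul) (auto simp: S1_iff)
  have Ap: "A * A = (cmod A)\<^sup>2 * cis (2 * Arg A)"
  proof -
    have "A = cmod A * cis (Arg A)" using A0 by (simp add: cis_Arg sgn_eq)
    then have "A * A = (cmod A * cis (Arg A)) * (cmod A * cis (Arg A))" by simp
    also have "\<dots> = (cmod A)\<^sup>2 * (cis (Arg A) * cis (Arg A))" by (simp add: power2_eq_square)
    finally show ?thesis by (simp add: cis_mult)
  qed
  have Bp: "cnj B * B = (cmod B)\<^sup>2" using complex_norm_square[of B] by (simp add: mult.commute)
  have Fp: "cmod (fst (F t)) = cmod ((cmod A)\<^sup>2 * cis (2 * Arg A + 2 * t) - (cmod B)\<^sup>2)" for t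
  proof -
    have "fst (F t) = cis (- t) * ((cmod A)\<^sup>2 * cis (2 * Arg A + 2 * t) - (cmod B)\<^sup>2)"
      unfolding Ff Ap Bp by (simp add: right_diff_distrib cis_mult mult.left_commute mult.commute)
    then show ?thesis by (simp add: norm_mult)
  qed
  have F1: "cmod (fst (F (- Arg A))) = \<rho>"
  proof -
    have "complex_of_real ((cmod A)\<^sup>2) - complex_of_real ((cmod B)\<^sup>2) = of_real ((cmod A)\<^sup>2 - (cmod B)\<^sup>2)" by simp
    then show ?thesis unfolding Fp \<rho>_def using norm_of_real by (simp del: of_real_diff of_real_power)
  qed
  have F2: "cmod (fst (F (- Arg A + pi / 2))) = 1"
  proof -
    have "cis (2 * Arg A + 2 * (- Arg A + pi / 2)) = - 1" by (simp add: distrib_left)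
    then have "cmod (fst (F (- Arg A + pi / 2))) = cmod (- of_real ((cmod A)\<^sup>2 + (cmod B)\<^sup>2))"
      unfolding Fp by simp
    then show ?thesis using AB by (simp del: of_real_add of_real_power)
  qed
  have cont: "continuous_on {- Arg A .. - Arg A + pi / 2} (\<lambda>t. cmod (fst (F t)))"
    unfolding Ff by (intro continuous_intros)
  have big: "s \<in> T" if s: "s \<in> S3" "cmod (fst s) \<ge> \<rho>" for s
  proof -
    have "cmod (fst s) \<le> norm s" using norm_fst_le[of "fst s" "snd s"] by simp
    then have "cmod (fst s) \<le> 1" using s by (simp add: S3_def)
    then obtain t where "cmod (fst (F t)) = cmod (fst s)"
      using IVT'[of "\<lambda>t. cmod (fst (F t))" "- Arg A" "cmod (fst s)" "- Arg A + pi / 2"] F1 F2 s(2) cont by auto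
    then obtain x y where "x \<in> S1" "y \<in> S1" "s = x \<odot> F t \<odot> y"
      using S1_double_coset[OF FS s(1)] by blast
    then show ?thesis using T FT S1 by blast
  qed
  show ?thesis
  proof (rule S3_generated_by_ball[OF T])
    show "1 - \<rho> > 0" using \<rho> by simp
    fix v assume v: "v \<in> S3" "norm (v - qone) < 1 - \<rho>"
    have "cmod (fst v - 1) < 1 - \<rho>" using norm_fst_minus_one[of v] v by linarith
    moreover have "cmod 1 - cmod (fst v) \<le> cmod (fst v - 1)" by (metis norm_minus_commute norm_triangle_ineq2)
    ultimately show "v \<in> T" using v by (intro big) auto
  qed auto
qed

text \<open>All words are allowed, reduced or not, so a product of values is the value of the
  concatenation; words over two letters are countable, which makes density a measurable
  condition.\<close>

definition generated_by :: "('g, 'm) monoid_scheme \<Rightarrow> 'g \<Rightarrow> 'g \<Rightarrow> 'g set" where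
  "generated_by G x y = range (word_value G (\<lambda>b. if b then x else y))"

context group
begin

lemma generated_by_properties:
  assumes x: "x \<in> carrier G" and y: "y \<in> carrier G"
  shows "generated_by G x y \<subseteq> carrier G" "x \<in> generated_by G x y" "y \<in> generated_by G x y"
    "\<one> \<in> generated_by G x y"
    "\<And>g h. g \<in> generated_by G x y \<Longrightarrow> h \<in> generated_by G x y \<Longrightarrow> g \<otimes> h \<in> generated_by G x y"
    "\<And>g. g \<in> generated_by G x y \<Longrightarrow> inv g \<in> generated_by G x y"
proof -
  let ?f = "\<lambda>b. if b then x else y"
  let ?w = "word_value G ?f"
  have f: "?f \<in> UNIV \<rightarrow> carrier G" using x y by auto
  have wc: "?w u \<in> carrier G" for u using word_value_closed[OF group_axioms f, of u] by simp
  have lc: "letter_value G ?f a \<in> carrier G" for a using letter_value_closed[OF group_axioms f, of a] by simp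
  have lflip: "letter_value G ?f (flip a) = inv (letter_value G ?f a)" for a
    using letter_value_flip[OF group_axioms f, of a] by simp
  show "generated_by G x y \<subseteq> carrier G" using wc by (auto simp: generated_by_def)
  have "?w [(True, True)] = x" "?w [(False, True)] = y" "?w [] = \<one>"
    using x y by (simp_all add: letter_value_def)
  then show "x \<in> generated_by G x y" "y \<in> generated_by G x y" "\<one> \<in> generated_by G x y"
    unfolding generated_by_def
    by (auto intro: range_eqI[of _ _ "[(True, True)]"] range_eqI[of _ _ "[(False, True)]"] range_eqI[of _ _ "[]"])
  have app: "?w (u @ v) = ?w u \<otimes> ?w v" for u v
    by (induction u) (simp_all add: wc lc m_assoc)
  show "g \<otimes> h \<in> generated_by G x y" if gh: "g \<in> generated_by G x y" "h \<in> generated_by G x y" for g h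
  proof -
    obtain u where "g = ?w u" using gh(1) unfolding generated_by_def by (rule rangeE)
    moreover obtain v where "h = ?w v" using gh(2) unfolding generated_by_def by (rule rangeE)
    ultimately have "g \<otimes> h = ?w (u @ v)" using app by simp
    then show ?thesis unfolding generated_by_def by simp
  qed
  have inv: "?w (rev (map flip u)) = inv (?w u)" for u
    by (induction u) (simp_all add: app wc lc lflip inv_mult_group)
  then show "inv g \<in> generated_by G x y" if g: "g \<in> generated_by G x y" for g
  proof -
    obtain u where "g = ?w u" using g unfolding generated_by_def by (rule rangeE)
    then have "inv g = ?w (rev (map flip u))" using inv by simp
    then show ?thesis unfolding generated_by_def by simp
  qed
qed

end

context compact_haar_group
begin

text \<open>Left translations by elements of \<open>D\<close> preserve the closure, and then right
  translations by elements of the closure do so as well.\<close>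

lemma closure_of_subgroup_mult:
  assumes D: "D \<subseteq> carrier G" "\<And>x y. x \<in> D \<Longrightarrow> y \<in> D \<Longrightarrow> x \<otimes> y \<in> D"
    and x: "x \<in> X closure_of D" and y: "y \<in> X closure_of D"
  shows "x \<otimes> y \<in> X closure_of D"
proof -
  have cl: "X closure_of D \<subseteq> carrier G" using closure_of_subset_topspace[of X D] by (simp add: topspace_X)
  have 1: "u \<otimes> v \<in> X closure_of D" if u: "u \<in> D" and v: "v \<in> X closure_of D" for u v
  proof -
    have "(\<lambda>v. u \<otimes> v) ` (X closure_of D) \<subseteq> X closure_of ((\<lambda>v. u \<otimes> v) ` D)"
      using u D by (intro continuous_map_image_closure_subset continuous_mult_left) auto
    also have "\<dots> \<subseteq> X closure_of D" using u D by (intro closure_of_mono) auto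
    finally show ?thesis using v by blast
  qed
  have "(\<lambda>u. u \<otimes> y) ` (X closure_of D) \<subseteq> X closure_of ((\<lambda>u. u \<otimes> y) ` D)"
    using y cl by (intro continuous_map_image_closure_subset continuous_mult_right) auto
  also have "\<dots> \<subseteq> X closure_of (X closure_of D)" using 1[OF _ y] by (intro closure_of_mono) auto
  finally show ?thesis using x by auto
qed

end

section \<open>Lifting to the product of the factors\<close>

locale factored_group = compact_haar_group +
  fixes a N :: nat and p :: "nat \<Rightarrow> quat \<Rightarrow> 'a"
  assumes factors: "factor_system a N p"
begin

lemmas factor_conds = factors[unfolded factor_system_def]

lemma p_closed: "k < N \<Longrightarrow> s \<in> fac a k \<Longrightarrow> p k s \<in> carrier G"
  using conjunct1[OF factor_conds] by blast

lemma p_hom: "k < N \<Longrightarrow> s \<in> fac a k \<Longrightarrow> t \<in> fac a k \<Longrightarrow> p k (s \<odot> t) = p k s \<otimes> p k t"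
  using conjunct1[OF conjunct2[OF factor_conds]] by blast

lemma p_cont: "k < N \<Longrightarrow> continuous_map (top_of_set (fac a k)) X (p k)"
  using conjunct1[OF conjunct2[OF conjunct2[OF factor_conds]]] by blast

lemma p_comm:
  "j < N \<Longrightarrow> k < N \<Longrightarrow> j \<noteq> k \<Longrightarrow> s \<in> fac a j \<Longrightarrow> t \<in> fac a k \<Longrightarrow> p j s \<otimes> p k t = p k t \<otimes> p j s"
  using conjunct1[OF conjunct2[OF conjunct2[OF conjunct2[OF factor_conds]]]] by blast

definition P :: "(nat \<Rightarrow> quat) \<Rightarrow> 'a" where "P l = gprod G N (\<lambda>k. p k (l k))"

definition L :: "(nat \<Rightarrow> quat) set" where "L = {l. \<forall>k<N. l k \<in> fac a k}"

lemma P_surj: "g \<in> carrier G \<Longrightarrow> \<exists>l\<in>L. g = P l"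
  using conjunct2[OF conjunct2[OF conjunct2[OF conjunct2[OF factor_conds]]]]
  unfolding P_def L_def by blast

lemma P_closed: "l \<in> L \<Longrightarrow> P l \<in> carrier G"
  unfolding P_def L_def by (intro gprod_closed p_closed) auto

lemma P_mult:
  assumes "l \<in> L" "m \<in> L" shows "P (\<lambda>k. l k \<odot> m k) = P l \<otimes> P m"
proof -
  have "P (\<lambda>k. l k \<odot> m k) = gprod G N (\<lambda>k. p k (l k) \<otimes> p k (m k))"
    unfolding P_def by (rule gprod_cong) (use assms p_hom in \<open>simp add: L_def\<close>)
  also have "\<dots> = P l \<otimes> P m"
    unfolding P_def by (rule gprod_mult) (use assms p_closed p_comm in \<open>simp_all add: L_def\<close>)
  finally show ?thesis .
qed

lemma p_one: "k < N \<Longrightarrow> p k qone = \<one>"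
  using p_hom[of k qone qone] p_closed[of k qone] by simp

lemma P_one: "P (\<lambda>k. qone) = \<one>"
  unfolding P_def using gprod_cong[of N "\<lambda>k. p k qone" "\<lambda>k. \<one>" G] by (simp add: p_one)

lemma P_single:
  assumes "k < N" "s \<in> fac a k" shows "P (\<lambda>i. if i = k then s else qone) = p k s"
proof -
  have "P (\<lambda>i. if i = k then s else qone) = gprod G N (\<lambda>i. if i = k then p k s else \<one>)"
    unfolding P_def by (rule gprod_cong) (simp add: p_one)
  then show ?thesis using gprod_single[of "p k s" N k] assms p_closed by simp
qed

lemma L_single: "s \<in> fac a k \<Longrightarrow> (\<lambda>i. if i = k then s else qone) \<in> L"
  by (simp add: L_def)

lemma P_inv: "l \<in> L \<Longrightarrow> inv (P l) = P (\<lambda>k. qcnj (l k))"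
proof -
  assume l: "l \<in> L"
  then have l': "(\<lambda>k. qcnj (l k)) \<in> L" by (simp add: L_def)
  have "P l \<otimes> P (\<lambda>k. qcnj (l k)) = P (\<lambda>k. l k \<odot> qcnj (l k))" by (rule P_mult[symmetric, OF l l'])
  also have "\<dots> = P (\<lambda>k. qone)"
    unfolding P_def using l by (intro gprod_cong) (auto simp: L_def dest!: fac_subset_S3)
  finally show ?thesis using P_closed[OF l] P_closed[OF l'] by (metis P_one inv_equality inv_inv inv_closed)
qed

text \<open>Conjugation acts factor by factor, so a single group element can move the circles of all
  SU(2) factors at once.\<close>

lemma P_conj:
  assumes l: "l \<in> L" and k: "k < N" and s: "s \<in> fac a k"
  shows "P l \<otimes> p k s \<otimes> inv (P l) = p k (l k \<odot> s \<odot> qcnj (l k))"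
proof -
  let ?e = "\<lambda>i. if i = k then s else qone"
  have l': "(\<lambda>k. qcnj (l k)) \<in> L" using l by (simp add: L_def)
  have le: "(\<lambda>k. l k \<odot> ?e k) \<in> L"
    unfolding L_def
  proof (intro CollectI allI impI)
    fix i assume "i < N"
    then show "l i \<odot> ?e i \<in> fac a i" using l s by (cases "i = k") (auto simp: L_def)
  qed
  have "P l \<otimes> p k s = P (\<lambda>i. l i \<odot> ?e i)"
    unfolding P_mult[OF l L_single[OF s]] P_single[OF k s] ..
  then have "P l \<otimes> p k s \<otimes> inv (P l) = P (\<lambda>i. (l i \<odot> ?e i) \<odot> qcnj (l i))"
    unfolding P_mult[OF le l'] P_inv[OF l] by simp
  also have "\<dots> = P (\<lambda>i. if i = k then l k \<odot> s \<odot> qcnj (l k) else qone)"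
    unfolding P_def using l by (intro gprod_cong) (auto simp: L_def dest!: fac_subset_S3)
  also have "\<dots> = p k (l k \<odot> s \<odot> qcnj (l k))"
    by (rule P_single[OF k]) (use l s k in \<open>simp add: L_def\<close>)
  finally show ?thesis .
qed

lemma gprod_near_one:
  assumes f: "\<And>k. k < n \<Longrightarrow> continuous_map euclideanreal X (f k)" "\<And>k. k < n \<Longrightarrow> f k 0 = \<one>"
    and W: "openin X W" "\<one> \<in> W"
  shows "\<exists>\<epsilon>>0. \<forall>t. (\<forall>k<n. \<bar>t k\<bar> < \<epsilon>) \<longrightarrow> gprod G n (\<lambda>k. f k (t k)) \<in> W"
  using f W
proof (induction n arbitrary: W)
  case 0 then show ?case by (auto intro: exI[of _ 1])
next
  case (Suc n)
  have "openin (prod_topology X X) {z \<in> topspace (prod_topology X X). (case z of (x, y) \<Rightarrow> x \<otimes> y) \<in> W}"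
    using continuous_mult Suc.prems(3) unfolding continuous_map_def by blast
  moreover have "(\<one>, \<one>) \<in> {z \<in> topspace (prod_topology X X). (case z of (x, y) \<Rightarrow> x \<otimes> y) \<in> W}"
    using Suc.prems(4) by (simp add: topspace_X)
  ultimately have "\<exists>V1 V2. openin X V1 \<and> openin X V2 \<and> \<one> \<in> V1 \<and> \<one> \<in> V2 \<and>
    V1 \<times> V2 \<subseteq> {z \<in> topspace (prod_topology X X). (case z of (x, y) \<Rightarrow> x \<otimes> y) \<in> W}"
    unfolding openin_prod_topology_alt by (elim allE impE)
  then obtain V1 V2 where V: "openin X V1" "openin X V2" "\<one> \<in> V1" "\<one> \<in> V2"
    "V1 \<times> V2 \<subseteq> {z \<in> topspace (prod_topology X X). (case z of (x, y) \<Rightarrow> x \<otimes> y) \<in> W}"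
    by (elim exE conjE)
  obtain \<epsilon>1 where e1: "\<epsilon>1 > 0" "\<And>t. (\<forall>k<n. \<bar>t k\<bar> < \<epsilon>1) \<Longrightarrow> gprod G n (\<lambda>k. f k (t k)) \<in> V1"
    using Suc.IH[of V1] Suc.prems V by auto
  have "open {t. f n t \<in> V2}" using Suc.prems(1)[of n] V(2) unfolding continuous_map_def by auto
  moreover have "0 \<in> {t. f n t \<in> V2}" using Suc.prems(2) V by simp
  ultimately obtain \<epsilon>2 where e2: "\<epsilon>2 > 0" "ball 0 \<epsilon>2 \<subseteq> {t. f n t \<in> V2}" by (rule openE)
  have "gprod G (Suc n) (\<lambda>k. f k (t k)) \<in> W" if t: "\<forall>k<Suc n. \<bar>t k\<bar> < min \<epsilon>1 \<epsilon>2" for t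
  proof -
    have "gprod G n (\<lambda>k. f k (t k)) \<in> V1" using e1(2)[of t] t by simp
    moreover have "t n \<in> ball 0 \<epsilon>2" using t by simp
    then have "f n (t n) \<in> V2" using e2(2) by blast
    ultimately have "(gprod G n (\<lambda>k. f k (t k)), f n (t n)) \<in> V1 \<times> V2" by blast
    then show ?thesis using V(5) by auto
  qed
  then show ?case using e1(1) e2(1) by (intro exI[of _ "min \<epsilon>1 \<epsilon>2"]) auto
qed

text \<open>Measured in turns, between 0 and 1/2; a complete invariant of conjugacy in
  SU(2).\<close>

definition angle :: "quat \<Rightarrow> real" where "angle s = arccos (qre s) / (2 * pi)"

text \<open>Linear independence over the rationals of the angles together with 1, stated with
  integer coefficients.\<close>

definition generic :: "(nat \<Rightarrow> quat) \<Rightarrow> bool" where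
  "generic l \<longleftrightarrow> (\<forall>m::nat \<Rightarrow> int. \<forall>m0::int.
    (\<Sum>k<N. real_of_int (m k) * angle (l k)) + real_of_int m0 = 0 \<longrightarrow> (\<forall>k<N. m k = (0::int)))"

lemma kronecker:
  assumes gen: "generic l" and eps: "\<epsilon> > 0"
  shows "\<exists>(n::int) m::nat \<Rightarrow> int. \<forall>k<N. \<bar>n * angle (l k) - m k - \<beta> k\<bar> < \<epsilon>"
proof -
  \<comment> \<open>The number 1 is appended at index \<open>N\<close>, because simultaneous
    approximation modulo integers asks for independence of the angles together with 1.\<close>
  define \<theta> where "\<theta> k = (if k < N then angle (l k) else 1)" for k
  interpret M: Modules.module "\<lambda>r x. real_of_int r * x"
    by unfold_locales (auto simp: algebra_simps)
  have key: "\<forall>k\<le>N. m k = 0" if "(\<Sum>k\<le>N. real_of_int (m k) * \<theta> k) = 0" for m :: "nat \<Rightarrow> int"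
  proof -
    have "(\<Sum>k\<le>N. real_of_int (m k) * \<theta> k) = (\<Sum>k<N. m k * angle (l k)) + m N"
      by (simp add: lessThan_Suc_atMost[symmetric] \<theta>_def)
    then have s: "(\<Sum>k<N. m k * angle (l k)) + m N = 0" using that by simp
    then have z: "\<forall>k<N. m k = 0" using gen unfolding generic_def by blast
    then have "(\<Sum>k<N. m k * angle (l k)) = 0" by simp
    then have "m N = 0" using s by simp
    then show ?thesis using z by (metis le_neq_implies_less)
  qed
  have inj: "inj_on \<theta> {..N}"
  proof (rule inj_onI, rule ccontr)
    fix i j assume ij: "i \<in> {..N}" "j \<in> {..N}" "\<theta> i = \<theta> j" "i \<noteq> j"
    define m :: "nat \<Rightarrow> int" where "m k = (if k = i then 1 else if k = j then - 1 else 0)" for k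
    have "(\<Sum>k\<le>N. real_of_int (m k) * \<theta> k) = (\<Sum>k\<in>{i, j}. real_of_int (m k) * \<theta> k)"
      by (rule sum.mono_neutral_right) (use ij in \<open>auto simp: m_def\<close>)
    also have "\<dots> = 0" using ij by (simp add: m_def)
    finally have "m i = 0" using key ij by blast
    then show False by (simp add: m_def)
  qed
  have "M.independent (\<theta> ` {..N})"
    unfolding M.dependent_finite[OF finite_imageI[OF finite_atMost]]
  proof clarify
    fix c x assume s: "(\<Sum>y\<in>\<theta> ` {..N}. real_of_int (c y) * y) = 0" and x: "x \<le> N" "c (\<theta> x) \<noteq> 0"
    have "(\<Sum>k\<le>N. real_of_int (c (\<theta> k)) * \<theta> k) = 0"
      using s sum.reindex[OF inj, of "\<lambda>y. real_of_int (c y) * y"] by (simp add: o_def)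
    from key[OF this] show False using x by auto
  qed
  then obtain n m where "\<And>i. i < N \<Longrightarrow> \<bar>of_int n * \<theta> i - of_int (m i) - \<beta> i\<bar> < \<epsilon>"
    using Kronecker_thm_2[of \<theta> N \<epsilon> \<beta>] inj eps by (auto simp: \<theta>_def)
  then show ?thesis by (intro exI[of _ n] exI[of _ m]) (auto simp: \<theta>_def)
qed

text \<open>The first element supplies a full maximal torus; the second one conjugates each of its
  SU(2) circles to a different circle.\<close>

lemma generic_pair_dense:
  assumes l: "l \<in> L" and gen: "generic l" and l': "l' \<in> L"
    and off: "\<And>k g. k < a \<Longrightarrow> k < N \<Longrightarrow> g \<in> S3 \<Longrightarrow> l k = g \<odot> (cis (arccos (qre (l k))), 0) \<odot> qcnj g \<Longrightarrow>
      \<exists>g\<in>S3. l k = g \<odot> (cis (arccos (qre (l k))), 0) \<odot> qcnj g \<and>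
        fst (qcnj g \<odot> l' k \<odot> g) \<noteq> 0 \<and> snd (qcnj g \<odot> l' k \<odot> g) \<noteq> 0"
  shows "dense_in (generated_by G (P l) (P l'))"
proof -
  define D where "D = generated_by G (P l) (P l')"
  note D = generated_by_properties[OF P_closed[OF l] P_closed[OF l'], folded D_def]
  define H where "H = X closure_of D"
  have HD: "D \<subseteq> H" unfolding H_def using D(1) by (intro closure_of_subset) (simp add: topspace_X)
  have HG: "H \<subseteq> carrier G" unfolding H_def using closure_of_subset_topspace[of X D] by (simp add: topspace_X)
  have Hm: "x \<otimes> y \<in> H" if "x \<in> H" "y \<in> H" for x y
    unfolding H_def by (rule closure_of_subgroup_mult[OF D(1,5)]) (use that in \<open>auto simp: H_def\<close>)
  have lS: "l k \<in> S3" if "k < N" for k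
    using l that fac_subset_S3[of "l k" a k] by (simp add: L_def)
  have "\<exists>g. g \<in> S3 \<and> l k = g \<odot> (cis (arccos (qre (l k))), 0) \<odot> qcnj g \<and>
      (k \<ge> a \<longrightarrow> (\<forall>z\<in>S1. g \<odot> z \<odot> qcnj g \<in> S1 \<and> qcnj g \<odot> z \<odot> g \<in> S1)) \<and>
      (k < a \<longrightarrow> fst (qcnj g \<odot> l' k \<odot> g) \<noteq> 0 \<and> snd (qcnj g \<odot> l' k \<odot> g) \<noteq> 0)" if k: "k < N" for k
  proof (cases "k < a")
    case True
    obtain g0 where "g0 \<in> S3" "l k = g0 \<odot> (cis (arccos (qre (l k))), 0) \<odot> qcnj g0"
      using S3_diagonalise[OF lS[OF k]] by blast
    from off[OF True k this] show ?thesis using True by auto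
  next
    case False
    then have "fac a k = S1" by (simp add: fac_def)
    then have "l k \<in> S1" using l k by (auto simp: L_def)
    then show ?thesis using S3_diagonalise[OF lS[OF k]] False by auto
  qed
  then obtain g where g: "\<And>k. k < N \<Longrightarrow> g k \<in> S3"
    and lg: "\<And>k. k < N \<Longrightarrow> l k = g k \<odot> (cis (arccos (qre (l k))), 0) \<odot> qcnj (g k)"
    and g1: "\<And>k z. k < N \<Longrightarrow> k \<ge> a \<Longrightarrow> z \<in> S1 \<Longrightarrow> g k \<odot> z \<odot> qcnj (g k) \<in> S1 \<and> qcnj (g k) \<odot> z \<odot> g k \<in> S1"
    and g3: "\<And>k. k < N \<Longrightarrow> k < a \<Longrightarrow> fst (qcnj (g k) \<odot> l' k \<odot> g k) \<noteq> 0 \<and> snd (qcnj (g k) \<odot> l' k \<odot> g k) \<noteq> 0"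
    by metis
  \<comment> \<open>The circle of the \<open>k\<close>-th factor through \<open>l k\<close>,
    parametrised with period 1 so that \<open>l k\<close> sits at the parameter
    \<open>angle (l k)\<close>.\<close>
  define c where "c k t = g k \<odot> (cis (2 * pi * t), 0) \<odot> qcnj (g k)" for k t
  have cis1: "(cis t, 0) \<in> S1" for t by (simp add: S1_iff)
  have c_fac: "c k t \<in> fac a k" if "k < N" for k t
  proof -
    have "(cis (2 * pi * t), 0) \<in> S3" using cis1 S1_subset_S3 by blast
    then show ?thesis using g[OF that] g1[OF that _ cis1] by (simp add: c_def fac_def)
  qed
  have c_add: "c k (s + t) = c k s \<odot> c k t" if "k < N" for k s t
  proof -
    have "(cis (2 * pi * (s + t)), 0) = (cis (2 * pi * s), 0) \<odot> (cis (2 * pi * t), 0)"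
      by (simp add: qmul_def cis_mult distrib_left)
    then show ?thesis using g[OF that] by (simp add: c_def qmul_assoc)
  qed
  have c_int: "c k (real_of_int n) = qone" if "k < N" for k n
  proof -
    have "cis (2 * pi * real_of_int n) = 1" by (rule cis_multiple_2pi) simp
    then show ?thesis using g[OF that] by (simp add: c_def qone_def[symmetric])
  qed
  have c_angle: "c k (angle (l k)) = l k" if "k < N" for k
    using lg[OF that] by (simp add: c_def angle_def)
  have cL: "(\<lambda>k. c k (t k)) \<in> L" for t using c_fac by (simp add: L_def)
  have Pc_add: "P (\<lambda>k. c k (s k + t k)) = P (\<lambda>k. c k (s k)) \<otimes> P (\<lambda>k. c k (t k))" for s t
    unfolding P_mult[OF cL cL, symmetric] by (simp add: P_def c_add cong: gprod_cong)
  have Pc_cong: "P (\<lambda>k. c k (s k)) = P (\<lambda>k. c k (t k))" if "\<And>k. k < N \<Longrightarrow> c k (s k) = c k (t k)" for s t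
    unfolding P_def by (rule gprod_cong) (simp add: that)
  have Pc0: "P (\<lambda>k. c k 0) = \<one>"
    using c_int[of _ 0] P_one unfolding P_def by (simp cong: gprod_cong)
  have nat_D: "P (\<lambda>k. c k (real n * angle (l k))) \<in> D" for n
  proof (induction n)
    case 0 then show ?case using Pc0 D(4) by simp
  next
    case (Suc n)
    have "P (\<lambda>k. c k (real (Suc n) * angle (l k))) =
        P (\<lambda>k. c k (angle (l k))) \<otimes> P (\<lambda>k. c k (real n * angle (l k)))"
      unfolding Pc_add[symmetric] by (simp add: algebra_simps)
    also have "P (\<lambda>k. c k (angle (l k))) = P l" unfolding P_def by (rule gprod_cong) (simp add: c_angle)
    finally show ?case using Suc D(2,5) by simp
  qed
  have int_D: "P (\<lambda>k. c k (real_of_int n * angle (l k))) \<in> D" for n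
  proof (cases "n \<ge> 0")
    case True then show ?thesis using nat_D[of "nat n"] by simp
  next
    case False
    let ?x = "P (\<lambda>k. c k (real_of_int n * angle (l k)))" and ?y = "P (\<lambda>k. c k (real (nat (- n)) * angle (l k)))"
    have "?x \<otimes> ?y = P (\<lambda>k. c k (real_of_int n * angle (l k) + real (nat (- n)) * angle (l k)))" by (rule Pc_add[symmetric])
    also have "\<dots> = \<one>" using False Pc0 by (simp add: distrib_right[symmetric])
    finally have "?x = inv ?y" using P_closed[OF cL] by (metis inv_equality inv_inv)
    then show ?thesis using D(6)[OF nat_D[of "nat (- n)"]] by simp
  qed
  \<comment> \<open>Some integer power of \<open>P l\<close> comes arbitrarily close to a given
    torus point by Kronecker's theorem, as integer shifts of the parameters do not change
    \<open>c\<close>.\<close>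
  have torus: "P (\<lambda>k. c k (\<beta> k)) \<in> H" for \<beta>
    unfolding H_def in_closure_of
  proof (intro conjI allI impI)
    show "P (\<lambda>k. c k (\<beta> k)) \<in> topspace X" using P_closed[OF cL] by (simp add: topspace_X)
    fix W assume W: "P (\<lambda>k. c k (\<beta> k)) \<in> W \<and> openin X W"
    have "openin X {x \<in> topspace X. P (\<lambda>k. c k (\<beta> k)) \<otimes> x \<in> W}"
      using continuous_mult_left[OF P_closed[OF cL[of \<beta>]]] W unfolding continuous_map_def by blast
    moreover have "\<one> \<in> {x \<in> topspace X. P (\<lambda>k. c k (\<beta> k)) \<otimes> x \<in> W}"
      using W P_closed[OF cL] by (simp add: topspace_X)
    moreover have "continuous_map euclideanreal X (\<lambda>t. p k (c k t))" if k: "k < N" for k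
    proof -
      have "continuous_on UNIV (c k)" unfolding c_def by (intro continuous_intros)
      then have "continuous_map euclideanreal (top_of_set (fac a k)) (c k)"
        using c_fac[OF k] by (simp add: continuous_map_in_subtopology image_subset_iff)
      from continuous_map_compose[OF this p_cont[OF k]] show ?thesis by (simp add: o_def)
    qed
    moreover have "p k (c k 0) = \<one>" if "k < N" for k using c_int[OF that, of 0] p_one[OF that] by simp
    ultimately obtain \<epsilon> where \<epsilon>: "\<epsilon> > 0" "\<forall>t. (\<forall>k<N. \<bar>t k\<bar> < \<epsilon>) \<longrightarrow>
      gprod G N (\<lambda>k. p k (c k (t k))) \<in> {x \<in> topspace X. P (\<lambda>k. c k (\<beta> k)) \<otimes> x \<in> W}"
      using gprod_near_one[of N "\<lambda>k t. p k (c k t)" "{x \<in> topspace X. P (\<lambda>k. c k (\<beta> k)) \<otimes> x \<in> W}"] by auto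
    obtain n :: int and m :: "nat \<Rightarrow> int" where nm: "\<forall>k<N. \<bar>n * angle (l k) - m k - \<beta> k\<bar> < \<epsilon>"
      using kronecker[OF gen \<epsilon>(1)] by blast
    define t where "t k = n * angle (l k) - m k - \<beta> k" for k
    have "P (\<lambda>k. c k (\<beta> k)) \<otimes> P (\<lambda>k. c k (t k)) \<in> W"
      using \<epsilon>(2)[rule_format, of t] nm by (simp add: t_def P_def)
    also have "P (\<lambda>k. c k (\<beta> k)) \<otimes> P (\<lambda>k. c k (t k)) = P (\<lambda>k. c k (n * angle (l k)))"
      unfolding Pc_add[symmetric]
    proof (rule Pc_cong)
      fix k assume k: "k < N"
      have "c k (\<beta> k + t k) = c k (n * angle (l k) + real_of_int (- m k))" by (simp add: t_def)
      also have "\<dots> = c k (n * angle (l k))" unfolding c_add[OF k] c_int[OF k] by simp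
      finally show "c k (\<beta> k + t k) = c k (n * angle (l k))" .
    qed
    finally show "\<exists>y. y \<in> D \<and> y \<in> W" using int_D by blast
  qed
  have circ: "p k (c k t) \<in> H" if k: "k < N" for k t
  proof -
    have "P (\<lambda>i. c i (if i = k then t else 0)) = P (\<lambda>i. if i = k then c k t else qone)"
      unfolding P_def using c_int[of _ 0] by (intro gprod_cong) auto
    then show ?thesis using torus[of "\<lambda>i. if i = k then t else 0"] P_single[OF k c_fac[OF k]] by simp
  qed
  have S1_cis: "\<exists>t. z = (cis (2 * pi * t), 0)" if "z \<in> S1" for z
  proof -
    have "cmod (fst z) = 1" using that by (simp add: S1_iff)
    moreover from this have "fst z \<noteq> 0" by (metis norm_zero zero_neq_one)
    ultimately have "fst z = cis (Arg (fst z))" by (simp add: cis_Arg sgn_eq)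
    then show ?thesis using that by (intro exI[of _ "Arg (fst z) / (2 * pi)"]) (simp add: S1_iff prod_eq_iff)
  qed
  have all: "p k s \<in> H" if k: "k < N" and s: "s \<in> fac a k" for k s
  proof (cases "k < a")
    case False
    then have "qcnj (g k) \<odot> s \<odot> g k \<in> S1" using g1[OF k] s by (simp add: fac_def)
    then obtain t where t: "qcnj (g k) \<odot> s \<odot> g k = (cis (2 * pi * t), 0)" using S1_cis by blast
    have "c k t = s" unfolding c_def t[symmetric] using g[OF k] by (simp add: qmul_assoc)
    then show ?thesis using circ[OF k, of t] by simp
  next
    case True
    then have fac3: "fac a k = S3" by (simp add: fac_def)
    \<comment> \<open>In the frame \<open>g k\<close> the known circle of this factor becomes
      \<open>S1\<close>, and \<open>w\<close> is the second element seen in the same frame.\<close>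
    define T where "T = {u \<in> S3. p k (g k \<odot> u \<odot> qcnj (g k)) \<in> H}"
    define w where "w = qcnj (g k) \<odot> l' k \<odot> g k"
    have l'k: "l' k \<in> S3" using l' k fac3 by (auto simp: L_def)
    have w: "w \<in> S3" using g[OF k] l'k by (simp add: w_def)
    have "S3 \<subseteq> T"
    proof (rule circles_generate_S3[OF _ _ w])
      fix u v assume uv: "u \<in> T" "v \<in> T"
      then have "p k (g k \<odot> u \<odot> qcnj (g k)) \<otimes> p k (g k \<odot> v \<odot> qcnj (g k)) \<in> H" by (intro Hm) (auto simp: T_def)
      also have "p k (g k \<odot> u \<odot> qcnj (g k)) \<otimes> p k (g k \<odot> v \<odot> qcnj (g k)) =
          p k ((g k \<odot> u \<odot> qcnj (g k)) \<odot> (g k \<odot> v \<odot> qcnj (g k)))"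
        using uv g[OF k] by (intro p_hom[OF k, symmetric]) (auto simp: fac3 T_def)
      also have "(g k \<odot> u \<odot> qcnj (g k)) \<odot> (g k \<odot> v \<odot> qcnj (g k)) = g k \<odot> (u \<odot> v) \<odot> qcnj (g k)"
        using g[OF k] by (simp add: qmul_assoc)
      finally show "u \<odot> v \<in> T" using uv by (simp add: T_def)
    next
      show S1T: "S1 \<subseteq> T"
      proof
        fix z assume z: "z \<in> S1"
        then obtain t where "z = (cis (2 * pi * t), 0)" using S1_cis by blast
        then show "z \<in> T" using circ[OF k, of t] z S1_subset_S3 by (auto simp: T_def c_def)
      qed
      show "fst w \<noteq> 0" "snd w \<noteq> 0" using g3[OF k True] by (auto simp: w_def)
      fix z assume z: "z \<in> S1"
      have zS: "z \<in> S3" using z S1_subset_S3 by blast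
      have zf: "g k \<odot> z \<odot> qcnj (g k) \<in> fac a k" using zS g[OF k] by (simp add: fac3)
      have "P l' \<otimes> p k (g k \<odot> z \<odot> qcnj (g k)) \<otimes> inv (P l') \<in> H"
        using HD D(3,6) S1T z by (intro Hm) (auto simp: T_def)
      also have "P l' \<otimes> p k (g k \<odot> z \<odot> qcnj (g k)) \<otimes> inv (P l') =
          p k (l' k \<odot> (g k \<odot> z \<odot> qcnj (g k)) \<odot> qcnj (l' k))" by (rule P_conj[OF l' k zf])
      also have "l' k \<odot> (g k \<odot> z \<odot> qcnj (g k)) \<odot> qcnj (l' k) = g k \<odot> (w \<odot> z \<odot> qcnj w) \<odot> qcnj (g k)"
        using g[OF k] by (simp add: w_def qmul_assoc qcnj_qmul)
      finally show "w \<odot> z \<odot> qcnj w \<in> T" using w zS by (simp add: T_def)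
    qed
    moreover have "qcnj (g k) \<odot> s \<odot> g k \<in> S3" using s g[OF k] by (simp add: fac3)
    ultimately have "p k (g k \<odot> (qcnj (g k) \<odot> s \<odot> g k) \<odot> qcnj (g k)) \<in> H" by (auto simp: T_def)
    then show ?thesis using g[OF k] by (simp add: qmul_assoc)
  qed
  have "carrier G \<subseteq> H"
  proof
    fix x assume "x \<in> carrier G"
    then obtain m where m: "m \<in> L" "x = P m" using P_surj by blast
    have "gprod G n (\<lambda>k. p k (m k)) \<in> H" if "n \<le> N" for n
      using that by (induction n) (use m(1) all Hm HD D(4) in \<open>auto simp: L_def\<close>)
    then show "x \<in> H" by (simp add: m P_def)
  qed
  then have "X closure_of D = topspace X" using HG by (auto simp: H_def topspace_X)
  then show ?thesis unfolding dense_in_def D_def dense_intersects_open by blast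
qed

end

section \<open>Invariant measures on SU(2) and on its maximal torus\<close>

text \<open>Level sets of the real part are the conjugacy classes of SU(2). The genericity
  statements below reduce to their being null, together with invariance.\<close>

definition invariant_measure :: "quat set \<Rightarrow> quat measure \<Rightarrow> bool" where
  "invariant_measure S \<nu> \<longleftrightarrow> sets \<nu> = sets (restrict_space borel S) \<and>
    emeasure \<nu> S < \<infinity> \<and> emeasure \<nu> S > 0 \<and>
    (\<forall>s\<in>S. distr \<nu> \<nu> (\<lambda>h. s \<odot> h) = \<nu>) \<and> (\<forall>c. emeasure \<nu> {h \<in> S. qre h = c} = 0)"

text \<open>For \<open>\<bar>c\<bar> < 1\<close> the cone is met at most once by each ray from the base point \<open>\<plusminus>v\<close> outside of it.\<close>

lemma negligible_cone:
  fixes v :: "'a::euclidean_space"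
  assumes v: "norm v = 1" and dim: "DIM('a) > 1"
  shows "negligible {x. v \<bullet> x = c * norm x}"
proof (cases "\<bar>c\<bar> < 1")
  case True
  define a where "a = (if c \<ge> 0 then - v else v)"
  show ?thesis
  proof (rule starlike_negligible_strong[of _ a])
    show "closed {x. v \<bullet> x = c * norm x}" by (intro closed_Collect_eq continuous_intros)
    fix t :: real and x assume t: "0 \<le> t" "t < 1" and "a + x \<in> {x. v \<bullet> x = c * norm x}"
    then have y: "v \<bullet> (a + x) = c * norm (a + x)" by simp
    show "a + t *\<^sub>R x \<notin> {x. v \<bullet> x = c * norm x}"
    proof
      assume "a + t *\<^sub>R x \<in> {x. v \<bullet> x = c * norm x}"
      then have z: "v \<bullet> (a + t *\<^sub>R x) = c * norm (a + t *\<^sub>R x)" by simp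
      have e: "a + t *\<^sub>R x = (1 - t) *\<^sub>R a + t *\<^sub>R (a + x)" by (simp add: algebra_simps)
      have na: "norm a = 1" using v by (simp add: a_def)
      have "norm (t *\<^sub>R (a + x)) - norm ((1 - t) *\<^sub>R a) \<le> norm (a + t *\<^sub>R x)"
        unfolding e by (metis add.commute norm_diff_ineq)
      then have n: "t * norm (a + x) - (1 - t) \<le> norm (a + t *\<^sub>R x)" using t na by simp
      have vz: "v \<bullet> (a + t *\<^sub>R x) = (1 - t) * (v \<bullet> a) + t * (c * norm (a + x))"
        unfolding e inner_add_right[of v "(1 - t) *\<^sub>R a"] inner_scaleR_right y ..
      have vv: "v \<bullet> v = 1" using v by (simp add: dot_square_norm)
      show False
      proof (cases "c \<ge> 0")
        case c: True
        have "c * (t * norm (a + x) - (1 - t)) \<le> c * norm (a + t *\<^sub>R x)" using n c by (rule mult_left_mono)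
        also have "\<dots> = - (1 - t) + t * (c * norm (a + x))" using z vz c vv by (simp add: a_def)
        finally have "(1 - t) * (1 - c) \<le> 0" by (simp add: algebra_simps)
        moreover have "(1 - t) * (1 - c) > 0" using t True by (intro mult_pos_pos) auto
        ultimately show False by simp
      next
        case c: False
        have "c * norm (a + t *\<^sub>R x) \<le> c * (t * norm (a + x) - (1 - t))" using n c by (intro mult_left_mono_neg) auto
        moreover have "c * norm (a + t *\<^sub>R x) = (1 - t) + t * (c * norm (a + x))" using z vz c vv by (simp add: a_def)
        ultimately have "(1 - t) * (1 + c) \<le> 0" by (simp add: algebra_simps)
        moreover have "(1 - t) * (1 + c) > 0" using t True by (intro mult_pos_pos) auto
        ultimately show False by simp
      qed
    qed
  qed
next
  case False
  \<comment> \<open>In this case equality in the Cauchy-Schwarz inequality forces \<open>x\<close>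
    onto the line through \<open>v\<close>, which is negligible in dimension above 1.\<close>
  have "x \<in> span {v}" if x: "v \<bullet> x = c * norm x" for x
  proof (cases "x = 0")
    case True then show ?thesis by (simp add: span_zero)
  next
    case x0: False
    have "\<bar>c\<bar> * norm x = \<bar>v \<bullet> x\<bar>" by (simp add: x abs_mult)
    also have "\<dots> \<le> norm x" using Cauchy_Schwarz_ineq2[of v x] v by simp
    finally have "\<bar>c\<bar> \<le> 1" using x0 by simp
    then have "\<bar>v \<bullet> x\<bar> = norm v * norm x" using False x v by (simp add: abs_mult)
    then have "norm v *\<^sub>R x = norm x *\<^sub>R v \<or> norm v *\<^sub>R x = - norm x *\<^sub>R v" unfolding norm_cauchy_schwarz_abs_eq .
    then have "x = norm x *\<^sub>R v \<or> x = (- norm x) *\<^sub>R v" using v by simp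
    then show ?thesis by (metis span_base span_scale singletonI)
  qed
  then have sub: "{x. v \<bullet> x = c * norm x} \<subseteq> span {v}" by blast
  have "dim (span {v}) \<le> card {v}" unfolding dim_span by (rule dim_le_card) (auto intro: span_base)
  then have "negligible (span {v})" using dim by (intro negligible_lowdim) simp
  then show ?thesis using sub negligible_subset by blast
qed

text \<open>One construction for both spheres: \<open>\<iota>\<close> will map R^4 onto all
  quaternions, or R^2 onto those with vanishing second entry. The vector \<open>v\<close> represents
  the real part as an inner product.\<close>

locale isometric_coordinates =
  fixes \<iota> :: "real^'n::{finite,wellorder} \<Rightarrow> quat" and S :: "quat set" and v :: "real^'n::{finite,wellorder}"
  assumes lin: "linear \<iota>" and iso: "\<And>x. norm (\<iota> x) = norm x"
    and S: "S = S3 \<inter> range \<iota>" and mult: "\<And>s x. s \<in> S \<Longrightarrow> s \<odot> \<iota> x \<in> range \<iota>" and inv: "\<And>s. s \<in> S \<Longrightarrow> qcnj s \<in> S"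
    and v: "norm v = 1" "\<And>x. qre (\<iota> x) = v \<bullet> x" and dim: "CARD('n) > 1"
begin

abbreviation D :: "(real^'n::{finite,wellorder}) set" where "D \<equiv> ball 0 1 - {0}"

definition proj :: "real^'n::{finite,wellorder} \<Rightarrow> quat" where "proj x = \<iota> x /\<^sub>R norm x"

text \<open>The cone measure: Lebesgue measure of the punctured unit ball pushed radially onto the
  sphere. Its invariance comes down to that of Lebesgue measure under orthogonal maps.\<close>

definition \<nu> :: "quat measure" where
  "\<nu> = distr (restrict_space lborel D) (restrict_space borel S) proj"

lemma inj_\<iota>: "inj \<iota>"
  using linear_injective_0[OF lin] iso by (metis norm_eq_zero)

lemma D_sets: "D \<in> sets borel"
  by (intro sets.Diff borel_open borel_closed) auto

lemma cont_\<iota>: "continuous_on A \<iota>"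
  using lin by (simp add: linear_continuous_on linear_conv_bounded_linear)

lemma proj_S: "x \<in> D \<Longrightarrow> proj x \<in> S"
proof -
  assume x: "x \<in> D"
  have "proj x = \<iota> (x /\<^sub>R norm x)" by (simp add: proj_def linear_scale[OF lin])
  moreover have "norm (proj x) = 1" using x by (simp add: proj_def iso)
  ultimately show ?thesis by (simp add: S S3_def)
qed

lemma proj_measurable: "proj \<in> measurable (restrict_space lborel D) (restrict_space borel S)"
proof (rule measurable_restrict_space2)
  show "proj \<in> space (restrict_space lborel D) \<rightarrow> S" using proj_S by (auto simp: space_restrict_space)
  have "continuous_on D proj" unfolding proj_def by (intro continuous_intros cont_\<iota>) auto
  then have "proj \<in> borel_measurable (restrict_space borel D)" by (rule borel_measurable_continuous_on_restrict)
  then show "proj \<in> borel_measurable (restrict_space lborel D)"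
    by (simp add: measurable_cong_sets[OF sets_restrict_space_cong[OF sets_lborel] refl])
qed

lemma sets_\<nu> [simp]: "sets \<nu> = sets (restrict_space borel S)" and space_\<nu> [simp]: "space \<nu> = S"
  by (simp_all add: \<nu>_def space_restrict_space)

lemma preimage_sets: "B \<in> sets \<nu> \<Longrightarrow> {x \<in> D. proj x \<in> B} \<in> sets borel"
proof -
  assume "B \<in> sets \<nu>"
  then have "proj -` B \<inter> space (restrict_space lborel D) \<in> sets (restrict_space lborel D)"
    using measurable_sets[OF proj_measurable] by simp
  moreover have "proj -` B \<inter> space (restrict_space lborel D) = {x \<in> D. proj x \<in> B}"
    by (auto simp: space_restrict_space)
  ultimately show ?thesis using D_sets by (simp add: sets_restrict_space_iff)
qed

lemma emeasure_\<nu>: "B \<in> sets \<nu> \<Longrightarrow> emeasure \<nu> B = emeasure lborel {x \<in> D. proj x \<in> B}"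
proof -
  assume B: "B \<in> sets \<nu>"
  have e: "proj -` B \<inter> space (restrict_space lborel D) = {x \<in> D. proj x \<in> B}"
    by (auto simp: space_restrict_space)
  have "emeasure \<nu> B = emeasure (restrict_space lborel D) {x \<in> D. proj x \<in> B}"
    unfolding \<nu>_def using emeasure_distr[OF proj_measurable, of B] B e by simp
  also have "\<dots> = emeasure lborel {x \<in> D. proj x \<in> B}"
    using D_sets by (intro emeasure_restrict_space) auto
  finally show ?thesis .
qed

lemma finite_D: "A \<subseteq> D \<Longrightarrow> A \<in> sets borel \<Longrightarrow> A \<in> lmeasurable"
  by (rule bounded_set_imp_lmeasurable) (auto intro: bounded_subset[OF bounded_ball])

lemma mult_S: "s \<in> S \<Longrightarrow> h \<in> S \<Longrightarrow> s \<odot> h \<in> S"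
proof -
  assume s: "s \<in> S" and h: "h \<in> S"
  then have "s \<in> S3" "h \<in> S3" "h \<in> range \<iota>" using S by auto
  then show "s \<odot> h \<in> S" using mult[OF s] by (subst S) auto
qed

text \<open>Left multiplication by a unit quaternion, read in the coordinates
  \<open>\<iota>\<close>, is an orthogonal map that preserves the punctured ball and commutes with
  the radial projection.\<close>

lemma invariance:
  assumes s: "s \<in> S" and B: "B \<in> sets \<nu>"
  shows "{h \<in> S. s \<odot> h \<in> B} \<in> sets \<nu> \<and> emeasure \<nu> {h \<in> S. s \<odot> h \<in> B} = emeasure \<nu> B"
proof -
  have sS3: "s \<in> S3" using s S by blast
  define T where "T x = inv_into UNIV \<iota> (s \<odot> \<iota> x)" for x
  have \<iota>T: "\<iota> (T x) = s \<odot> \<iota> x" for x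
    unfolding T_def using mult[OF s] by (simp add: f_inv_into_f)
  have nT: "norm (T x) = norm x" for x using iso[of "T x"] sS3 by (simp add: \<iota>T norm_qmul S3_def iso)
  have "linear T"
  proof (rule linearI)
    fix x y show "T (x + y) = T x + T y"
      by (rule injD[OF inj_\<iota>]) (simp add: \<iota>T linear_add[OF lin] qmul_add)
  next
    fix r x show "T (r *\<^sub>R x) = r *\<^sub>R T x"
      by (rule injD[OF inj_\<iota>]) (simp add: \<iota>T linear_scale[OF lin])
  qed
  then have orth: "orthogonal_transformation T" using nT by (simp add: orthogonal_transformation)
  have pT: "proj (T x) = s \<odot> proj x" for x by (simp add: proj_def \<iota>T nT)
  have TD: "T x \<in> D \<longleftrightarrow> x \<in> D" for x using nT[of x] by (metis Diff_iff insert_iff mem_ball_0 norm_eq_zero singletonD)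
  have m: "(\<lambda>h. s \<odot> h) \<in> measurable \<nu> \<nu>"
  proof -
    have "(\<lambda>h. s \<odot> h) \<in> measurable (restrict_space borel S) (restrict_space borel S)"
    proof (rule measurable_restrict_space2)
      show "(\<lambda>h. s \<odot> h) \<in> space (restrict_space borel S) \<rightarrow> S" using mult_S s by (auto simp: space_restrict_space)
      show "(\<lambda>h. s \<odot> h) \<in> borel_measurable (restrict_space borel S)"
        by (intro borel_measurable_continuous_on_restrict continuous_intros)
    qed
    then show ?thesis unfolding measurable_cong_sets[OF sets_\<nu> sets_\<nu>] .
  qed
  then have B': "{h \<in> S. s \<odot> h \<in> B} \<in> sets \<nu>"
    using measurable_sets[OF m B] by (simp add: vimage_def Int_def conj_commute)
  let ?A = "{x \<in> D. proj x \<in> B}" and ?A' = "{x \<in> D. proj x \<in> {h \<in> S. s \<odot> h \<in> B}}"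
  have A'eq: "?A' = {x. T x \<in> ?A}" using TD proj_S by (auto simp: pT)
  have "surj T" using orth orthogonal_transformation_surj by blast
  then have "T ` ?A' = ?A" unfolding A'eq by (auto simp: image_iff surj_def)
  moreover have l: "?A' \<in> lmeasurable" "?A \<in> lmeasurable"
    by (intro finite_D preimage_sets B B'; blast)+
  ultimately have "measure lebesgue ?A' = measure lebesgue ?A"
    using measure_orthogonal_image[OF orth l(1)] by simp
  then have "emeasure lebesgue ?A' = emeasure lebesgue ?A"
    unfolding emeasure_eq_measure2[OF l(1)] emeasure_eq_measure2[OF l(2)] by simp
  then have "emeasure lborel ?A' = emeasure lborel ?A"
    using preimage_sets[OF B] preimage_sets[OF B'] by simp
  then show ?thesis using B' emeasure_\<nu>[OF B] emeasure_\<nu>[OF B'] by simp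
qed

lemma invariant_measure: "invariant_measure S \<nu>"
  unfolding invariant_measure_def
proof (intro conjI ballI allI)
  show "sets \<nu> = sets (restrict_space borel S)" by simp
  have eS: "emeasure \<nu> S = emeasure lborel D"
  proof -
    have "S \<in> sets \<nu>" using sets.top[of \<nu>] by simp
    moreover have "{x \<in> D. proj x \<in> S} = D" using proj_S by blast
    ultimately show ?thesis using emeasure_\<nu>[of S] by simp
  qed
  have "emeasure lborel D \<le> emeasure lborel (ball (0::real^'n::{finite,wellorder}) 1)" by (intro emeasure_mono) auto
  also have "\<dots> < \<infinity>" using emeasure_lborel_ball_finite by simp
  finally show "emeasure \<nu> S < \<infinity>" using eS by simp
  have "emeasure lborel D \<noteq> 0"
  proof
    assume "emeasure lborel D = 0"
    then have "negligible D" using D_sets by (simp add: negligible_iff_null_sets null_sets_def)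
    moreover have "open D" by (intro open_Diff) auto
    ultimately have "D = {}" using open_not_negligible by blast
    moreover have "(1/2) *\<^sub>R v \<in> D" using v(1) by auto
    ultimately show False by blast
  qed
  then show "emeasure \<nu> S > 0" using eS by (simp add: zero_less_iff_neq_zero)
  show "distr \<nu> \<nu> (\<lambda>h. s \<odot> h) = \<nu>" if s: "s \<in> S" for s
  proof (rule measure_eqI)
    fix B assume "B \<in> sets (distr \<nu> \<nu> (\<lambda>h. s \<odot> h))"
    then have B: "B \<in> sets \<nu>" by simp
    have m: "(\<lambda>h. s \<odot> h) \<in> measurable \<nu> \<nu>"
      by (rule measurableI) (use invariance[OF s] mult_S[OF s] in \<open>auto simp: vimage_def Int_def conj_commute\<close>)
    have "(\<lambda>h. s \<odot> h) -` B \<inter> space \<nu> = {h \<in> S. s \<odot> h \<in> B}" by auto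
    then show "emeasure (distr \<nu> \<nu> (\<lambda>h. s \<odot> h)) B = emeasure \<nu> B"
      using emeasure_distr[OF m B] invariance[OF s B] by simp
  qed simp
  fix c
  have C: "{h \<in> S. qre h = c} \<in> sets \<nu>"
  proof -
    have "closed {h. qre h = c}" by (intro closed_Collect_eq continuous_intros)
    then have "{h. qre h = c} \<in> sets borel" by (rule borel_closed)
    moreover have "{h \<in> S. qre h = c} = S \<inter> {h. qre h = c}" by blast
    ultimately show ?thesis by (auto simp: sets_restrict_space)
  qed
  \<comment> \<open>The radial preimage of a level set of the real part lies in a cone around
    \<open>v\<close>.\<close>
  have "{x \<in> D. proj x \<in> {h \<in> S. qre h = c}} \<subseteq> {x. v \<bullet> x = c * norm x}"
  proof
    fix x assume "x \<in> {x \<in> D. proj x \<in> {h \<in> S. qre h = c}}"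
    then have x: "x \<in> D" "qre (proj x) = c" by auto
    have "qre (proj x) = (v \<bullet> x) / norm x" by (simp add: proj_def qre_def divide_inverse mult.commute flip: v(2))
    then show "x \<in> {x. v \<bullet> x = c * norm x}" using x by (auto simp: field_simps)
  qed
  moreover have "negligible {x. v \<bullet> x = c * norm x}"
    by (rule negligible_cone[OF v(1)]) (use dim in simp)
  ultimately have "negligible {x \<in> D. proj x \<in> {h \<in> S. qre h = c}}"
    using negligible_subset by blast
  then have "emeasure lebesgue {x \<in> D. proj x \<in> {h \<in> S. qre h = c}} = 0"
    by (simp add: negligible_iff_null_sets null_sets_def)
  then show "emeasure \<nu> {h \<in> S. qre h = c} = 0"
    using emeasure_\<nu>[OF C] preimage_sets[OF C] by simp
qed

end

lemma invariant_measure_S3: "\<exists>\<nu>. invariant_measure S3 \<nu>"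
proof -
  define \<iota> where "\<iota> x = (Complex (x $ 1) (x $ 2), Complex (x $ 3) (x $ 4))" for x :: "real^4"
  have surj: "\<exists>x. \<iota> x = q" for q
  proof -
    have "\<iota> (\<chi> i. if i = 1 then Re (fst q) else if i = 2 then Im (fst q) else if i = 3 then Re (snd q) else Im (snd q)) = q"
      by (simp add: \<iota>_def prod_eq_iff complex_eq_iff)
    then show ?thesis by blast
  qed
  interpret isometric_coordinates \<iota> S3 "axis 1 1"
  proof (rule isometric_coordinates.intro)
    show "linear \<iota>" by (rule linearI) (simp_all add: \<iota>_def complex_eq_iff)
    show "norm (\<iota> x) = norm x" for x
      by (simp add: \<iota>_def norm_prod_def cmod_def norm_vec_def L2_set_def sum_4 add.assoc)
    show "S3 = S3 \<inter> range \<iota>" using surj by (auto simp: image_iff) metis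
    show "s \<odot> \<iota> x \<in> range \<iota>" for s x using surj by (metis rangeI)
    show "qre (\<iota> x) = axis 1 1 \<bullet> x" for x by (simp add: \<iota>_def qre_def inner_axis' )
  qed (simp_all)
  show ?thesis using invariant_measure by blast
qed

lemma invariant_measure_S1: "\<exists>\<nu>. invariant_measure S1 \<nu>"
proof -
  define \<iota> where "\<iota> x = (Complex (x $ 1) (x $ 2), 0::complex)" for x :: "real^2"
  have surj: "\<exists>x. \<iota> x = q" if "snd q = 0" for q
  proof -
    have "\<iota> (\<chi> i. if i = 1 then Re (fst q) else Im (fst q)) = q"
      using that by (simp add: \<iota>_def prod_eq_iff complex_eq_iff)
    then show ?thesis by blast
  qed
  interpret isometric_coordinates \<iota> S1 "axis 1 1"
  proof (rule isometric_coordinates.intro)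
    show "linear \<iota>" by (rule linearI) (simp_all add: \<iota>_def complex_eq_iff zero_prod_def)
    show "norm (\<iota> x) = norm x" for x
      by (simp add: \<iota>_def norm_prod_def cmod_def norm_vec_def L2_set_def sum_2)
    show "S1 = S3 \<inter> range \<iota>"
    proof
      show "S1 \<subseteq> S3 \<inter> range \<iota>" using surj unfolding S1_def by (auto simp: image_iff) metis
      show "S3 \<inter> range \<iota> \<subseteq> S1" by (auto simp: S1_def \<iota>_def)
    qed
    show "s \<odot> \<iota> x \<in> range \<iota>" if "s \<in> S1" for s x
    proof -
      have "snd (s \<odot> \<iota> x) = 0" using that by (simp add: S1_iff \<iota>_def qmul_def)
      then show ?thesis using surj by (metis rangeI)
    qed
    show "qre (\<iota> x) = axis 1 1 \<bullet> x" for x by (simp add: \<iota>_def qre_def inner_axis')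
  qed (simp_all)
  show ?thesis using invariant_measure by blast
qed

section \<open>Almost every pair generates a dense subgroup\<close>

lemma invariant_measure_exists: "\<exists>\<nu>. invariant_measure (fac a k) \<nu>"
  by (simp add: fac_def invariant_measure_S3 invariant_measure_S1)

section \<open>The product measure on the factors and its image in the group\<close>

context factored_group
begin

definition \<nu> :: "nat \<Rightarrow> quat measure" where "\<nu> k = (SOME \<nu>. invariant_measure (fac a k) \<nu>)"

lemma \<nu>: "invariant_measure (fac a k) (\<nu> k)"
  unfolding \<nu>_def using invariant_measure_exists by (rule someI_ex)

lemma sets_\<nu>: "sets (\<nu> k) = sets (restrict_space borel (fac a k))"
  using \<nu>[of k] by (simp add: invariant_measure_def)

lemma space_\<nu> [simp]: "space (\<nu> k) = fac a k"
  using sets_eq_imp_space_eq[OF sets_\<nu>[of k]] by (simp add: space_restrict_space)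

lemma emeasure_\<nu>: "emeasure (\<nu> k) (fac a k) < \<infinity>" "emeasure (\<nu> k) (fac a k) > 0"
  using \<nu>[of k] by (simp_all add: invariant_measure_def)

lemma \<nu>_shift: "s \<in> fac a k \<Longrightarrow> distr (\<nu> k) (\<nu> k) (\<lambda>h. s \<odot> h) = \<nu> k"
  using \<nu>[of k] by (simp add: invariant_measure_def)

lemma \<nu>_qre: "emeasure (\<nu> k) {h \<in> fac a k. qre h = c} = 0"
  using \<nu>[of k] by (simp add: invariant_measure_def)

lemma sets_\<nu>_closed: "closed C \<Longrightarrow> {h \<in> fac a k. h \<in> C} \<in> sets (\<nu> k)"
proof -
  assume "closed C"
  then have "C \<in> sets borel" by (rule borel_closed)
  moreover have "{h \<in> fac a k. h \<in> C} = fac a k \<inter> C" by blast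
  ultimately show ?thesis by (auto simp: sets_\<nu> sets_restrict_space)
qed

lemma measurable_\<nu>_continuous: "continuous_on (fac a k) f \<Longrightarrow> f \<in> borel_measurable (\<nu> k)"
  using borel_measurable_continuous_on_restrict[of "fac a k" f]
  by (simp add: measurable_cong_sets[OF sets_\<nu> refl])

lemma measurable_qmul_left: "s \<in> fac a k \<Longrightarrow> (\<lambda>h. s \<odot> h) \<in> measurable (\<nu> k) (\<nu> k)"
proof -
  assume s: "s \<in> fac a k"
  have "(\<lambda>h. s \<odot> h) \<in> measurable (\<nu> k) (restrict_space borel (fac a k))"
    by (rule measurable_restrict_space2) (use s in \<open>auto intro!: measurable_\<nu>_continuous continuous_intros\<close>)
  then show ?thesis by (simp only: measurable_cong_sets[OF refl sets_\<nu>])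
qed

sublocale \<nu>: product_sigma_finite \<nu>
proof (rule product_sigma_finite.intro)
  fix k
  interpret finite_measure "\<nu> k" by (rule finite_measureI) (use emeasure_\<nu>(1)[of k] in simp)
  show "sigma_finite_measure (\<nu> k)" by unfold_locales
qed

definition \<nu>L :: "(nat \<Rightarrow> quat) measure" where "\<nu>L = Pi\<^sub>M {..<N} \<nu>"

lemma space_\<nu>L: "space \<nu>L = Pi\<^sub>E {..<N} (fac a)"
  by (simp add: \<nu>L_def space_PiM)

lemma space_\<nu>L_L: "l \<in> space \<nu>L \<Longrightarrow> l \<in> L"
  by (auto simp: space_\<nu>L L_def)

lemma emeasure_\<nu>L_space: "emeasure \<nu>L (space \<nu>L) < \<infinity>" "emeasure \<nu>L (space \<nu>L) > 0"
proof -
  have m: "fac a k \<in> sets (\<nu> k)" for k using sets.top[of "\<nu> k"] by simp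
  have e: "emeasure \<nu>L (space \<nu>L) = (\<Prod>k<N. emeasure (\<nu> k) (fac a k))"
    unfolding space_\<nu>L unfolding \<nu>L_def by (rule \<nu>.emeasure_PiM) (use m in auto)
  show "emeasure \<nu>L (space \<nu>L) < \<infinity>"
    unfolding e using emeasure_\<nu>(1) by (simp add: ennreal_prod_eq_top less_top[symmetric]) 
  show "emeasure \<nu>L (space \<nu>L) > 0"
    unfolding e using emeasure_\<nu>(2) by (simp add: zero_less_iff_neq_zero prod_zero_iff)
qed

sublocale \<nu>L: finite_measure \<nu>L
  by (rule finite_measureI) (use emeasure_\<nu>L_space(1) in simp)

lemma \<nu>L_shift:
  assumes m: "m \<in> L"
  shows "distr \<nu>L \<nu>L (\<lambda>l. \<lambda>k\<in>{..<N}. m k \<odot> l k) = \<nu>L"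
    and "(\<lambda>l. \<lambda>k\<in>{..<N}. m k \<odot> l k) \<in> measurable \<nu>L \<nu>L"
proof -
  let ?T = "\<lambda>l. \<lambda>k\<in>{..<N}. m k \<odot> l k"
  have mk: "m k \<in> fac a k" if "k < N" for k using m that by (simp add: L_def)
  show T: "?T \<in> measurable \<nu>L \<nu>L"
    unfolding \<nu>L_def
  proof (rule measurable_restrict)
    fix k assume "k \<in> {..<N}"
    then have k: "k < N" by simp
    have "(\<lambda>l. l k) \<in> measurable (Pi\<^sub>M {..<N} \<nu>) (\<nu> k)" using k by (intro measurable_component_singleton) simp
    then show "(\<lambda>l. m k \<odot> l k) \<in> measurable (Pi\<^sub>M {..<N} \<nu>) (\<nu> k)"
      by (rule measurable_compose[OF _ measurable_qmul_left[OF mk[OF k]]])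
  qed
  have "distr \<nu>L \<nu>L ?T = Pi\<^sub>M {..<N} \<nu>"
  proof (rule \<nu>.PiM_eqI)
    show "sets (distr \<nu>L \<nu>L ?T) = sets (Pi\<^sub>M {..<N} \<nu>)" by (simp add: \<nu>L_def)
    fix A assume A: "\<And>k. k \<in> {..<N} \<Longrightarrow> A k \<in> sets (\<nu> k)"
    define A' where "A' k = {h \<in> fac a k. m k \<odot> h \<in> A k}" for k
    have A': "A' k \<in> sets (\<nu> k) \<and> emeasure (\<nu> k) (A' k) = emeasure (\<nu> k) (A k)" if k: "k < N" for k
    proof
      have e: "A' k = (\<lambda>h. m k \<odot> h) -` A k \<inter> space (\<nu> k)" by (auto simp: A'_def)
      show "A' k \<in> sets (\<nu> k)" unfolding e using A k by (intro measurable_sets[OF measurable_qmul_left[OF mk[OF k]]]) simp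
      have "emeasure (\<nu> k) (A' k) = emeasure (distr (\<nu> k) (\<nu> k) (\<lambda>h. m k \<odot> h)) (A k)"
        unfolding e using A k by (intro emeasure_distr[OF measurable_qmul_left[OF mk[OF k]], symmetric]) simp
      then show "emeasure (\<nu> k) (A' k) = emeasure (\<nu> k) (A k)" by (simp only: \<nu>_shift[OF mk[OF k]])
    qed
    have AP: "Pi\<^sub>E {..<N} A \<in> sets \<nu>L" unfolding \<nu>L_def by (rule sets_PiM_I_finite) (use A in auto)
    have "?T -` Pi\<^sub>E {..<N} A \<inter> space \<nu>L = Pi\<^sub>E {..<N} A'"
    proof (intro equalityI subsetI)
      fix l assume "l \<in> ?T -` Pi\<^sub>E {..<N} A \<inter> space \<nu>L"
      then have l: "?T l \<in> Pi\<^sub>E {..<N} A" "l \<in> Pi\<^sub>E {..<N} (fac a)" by (simp_all add: space_\<nu>L)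
      show "l \<in> Pi\<^sub>E {..<N} A'"
      proof (rule PiE_I)
        fix k assume k: "k \<in> {..<N}"
        show "l k \<in> A' k" using PiE_mem[OF l(1) k] PiE_mem[OF l(2) k] k by (simp add: A'_def)
      next
        fix k assume "k \<notin> {..<N}" then show "l k = undefined" by (rule PiE_arb[OF l(2)])
      qed
    next
      fix l assume l: "l \<in> Pi\<^sub>E {..<N} A'"
      have "?T l \<in> Pi\<^sub>E {..<N} A"
      proof (rule PiE_I)
        fix k assume k: "k \<in> {..<N}"
        show "?T l k \<in> A k" using PiE_mem[OF l k] k by (simp add: A'_def)
      qed simp
      moreover have "l \<in> Pi\<^sub>E {..<N} (fac a)"
      proof (rule PiE_I)
        fix k assume k: "k \<in> {..<N}"
        show "l k \<in> fac a k" using PiE_mem[OF l k] by (simp add: A'_def)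
      next
        fix k assume "k \<notin> {..<N}" then show "l k = undefined" by (rule PiE_arb[OF l])
      qed
      ultimately show "l \<in> ?T -` Pi\<^sub>E {..<N} A \<inter> space \<nu>L" by (simp add: space_\<nu>L)
    qed
    then have "emeasure (distr \<nu>L \<nu>L ?T) (Pi\<^sub>E {..<N} A) = emeasure \<nu>L (Pi\<^sub>E {..<N} A')"
      using emeasure_distr[OF T AP] by simp
    also have "\<dots> = (\<Prod>k<N. emeasure (\<nu> k) (A' k))"
      unfolding \<nu>L_def by (rule \<nu>.emeasure_PiM) (use A' in auto)
    also have "\<dots> = (\<Prod>k<N. emeasure (\<nu> k) (A k))" by (rule prod.cong) (use A' in auto)
    finally show "emeasure (distr \<nu>L \<nu>L ?T) (Pi\<^sub>E {..<N} A) = (\<Prod>k<N. emeasure (\<nu> k) (A k))" .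
  qed simp
  then show "distr \<nu>L \<nu>L ?T = \<nu>L" by (simp add: \<nu>L_def)
qed

lemma measurable_P: "P \<in> measurable \<nu>L \<mu>"
proof -
  have comp: "(\<lambda>l. p k (l k)) \<in> measurable \<nu>L \<mu>" if k: "k < N" for k
  proof -
    have "p k \<in> measurable (\<nu> k) \<mu>"
    proof (rule measurable_borel_of[OF borel_of_\<mu>])
      show "p k \<in> space (\<nu> k) \<rightarrow> topspace X" using p_closed[OF k] by (auto simp: topspace_X)
      fix U assume "openin X U"
      then have "openin (top_of_set (fac a k)) {s \<in> fac a k. p k s \<in> U}"
        using p_cont[OF k] unfolding continuous_map_def by simp
      then obtain T where T: "open T" "{s \<in> fac a k. p k s \<in> U} = fac a k \<inter> T" by (auto simp: openin_open)
      then show "{s \<in> space (\<nu> k). p k s \<in> U} \<in> sets (\<nu> k)" by (auto simp: sets_\<nu> sets_restrict_space)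
    qed
    moreover have "(\<lambda>l. l k) \<in> measurable \<nu>L (\<nu> k)"
      unfolding \<nu>L_def using k by (intro measurable_component_singleton) simp
    ultimately show ?thesis by (rule measurable_compose[rotated])
  qed
  have "(\<lambda>l. gprod G n (\<lambda>k. p k (l k))) \<in> measurable \<nu>L \<mu>" if "n \<le> N" for n
    using that
  proof (induction n)
    case (Suc n)
    have "(\<lambda>l. (gprod G n (\<lambda>k. p k (l k)), p n (l n))) \<in> measurable \<nu>L (\<mu> \<Otimes>\<^sub>M \<mu>)"
      using Suc comp by (intro measurable_Pair) simp_all
    from measurable_compose[OF this measurable_mult] show ?case by simp
  qed simp
  then show ?thesis unfolding P_def by simp
qed

lemma P_cong: "(\<And>k. k < N \<Longrightarrow> l k = m k) \<Longrightarrow> P l = P m"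
  unfolding P_def by (rule gprod_cong) simp

text \<open>\<open>P\<close> is a surjective homomorphism, so every left translation of
  \<open>G\<close> lifts to a translation of the product, which preserves
  \<open>\<nu>L\<close>.\<close>

lemma left_inv_distr_P: "left_inv (distr \<nu>L \<mu> P)"
  unfolding left_inv_def
proof (intro conjI ballI)
  fix g B assume g: "g \<in> carrier G" and B: "B \<in> sets \<mu>"
  obtain m where m: "m \<in> L" "g = P m" using P_surj[OF g] by blast
  let ?T = "\<lambda>l. \<lambda>k\<in>{..<N}. m k \<odot> l k"
  have V: "{y \<in> carrier G. g \<otimes> y \<in> B} \<in> sets \<mu>"
    using measurable_sets[OF measurable_mult_left[OF g] B] by (simp add: vimage_def Int_def conj_commute)
  have PT: "P (?T l) = g \<otimes> P l" if "l \<in> space \<nu>L" for l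
  proof -
    have "P (?T l) = P (\<lambda>k. m k \<odot> l k)" by (rule P_cong) simp
    then show ?thesis using P_mult[OF m(1) space_\<nu>L_L[OF that]] m(2) by simp
  qed
  have "emeasure (distr \<nu>L \<mu> P) {y \<in> carrier G. g \<otimes> y \<in> B} = emeasure \<nu>L (P -` {y \<in> carrier G. g \<otimes> y \<in> B} \<inter> space \<nu>L)"
    by (rule emeasure_distr[OF measurable_P V])
  also have "P -` {y \<in> carrier G. g \<otimes> y \<in> B} \<inter> space \<nu>L = ?T -` (P -` B \<inter> space \<nu>L) \<inter> space \<nu>L"
    using PT P_closed[OF space_\<nu>L_L] measurable_space[OF \<nu>L_shift(2)[OF m(1)]] by auto
  also have "emeasure \<nu>L \<dots> = emeasure (distr \<nu>L \<nu>L ?T) (P -` B \<inter> space \<nu>L)"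
    using measurable_sets[OF measurable_P B] by (intro emeasure_distr[OF \<nu>L_shift(2)[OF m(1)], symmetric])
  also have "\<dots> = emeasure (distr \<nu>L \<mu> P) B"
    unfolding \<nu>L_shift(1)[OF m(1)] by (rule emeasure_distr[OF measurable_P B, symmetric])
  finally show "emeasure (distr \<nu>L \<mu> P) {y \<in> carrier G. g \<otimes> y \<in> B} = emeasure (distr \<nu>L \<mu> P) B" .
qed simp

text \<open>By uniqueness the image of \<open>\<nu>L\<close> is a positive multiple of
  \<open>\<mu>\<close>, so null sets of \<open>G\<close> can be recognised in coordinates.\<close>

lemma null_transfer:
  assumes B: "B \<in> sets \<mu>" and null: "AE l in \<nu>L. P l \<notin> B"
  shows "emeasure \<mu> B = 0"
proof -
  let ?\<rho> = "distr \<nu>L \<mu> P"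
  have "P -` carrier G \<inter> space \<nu>L = space \<nu>L" using P_closed[OF space_\<nu>L_L] by auto
  then have tot: "emeasure ?\<rho> (carrier G) = emeasure \<nu>L (space \<nu>L)"
    using emeasure_distr[OF measurable_P, of "carrier G"] sets.top[of \<mu>] by simp
  have "P -` B \<inter> space \<nu>L \<in> sets \<nu>L" by (rule measurable_sets[OF measurable_P B])
  moreover have "P -` B \<inter> space \<nu>L = {l \<in> space \<nu>L. \<not> P l \<notin> B}" by auto
  ultimately have "emeasure \<nu>L (P -` B \<inter> space \<nu>L) = 0"
    using AE_iff_measurable[of "P -` B \<inter> space \<nu>L" \<nu>L "\<lambda>l. P l \<notin> B"] null by simp
  then have "emeasure ?\<rho> B = 0" using emeasure_distr[OF measurable_P B] by simp
  then have "emeasure ?\<rho> (carrier G) * emeasure \<mu> B = 0"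
    using haar_unique[OF left_inv_distr_P _ B] tot emeasure_\<nu>L_space(1) by simp
  then show ?thesis using tot emeasure_\<nu>L_space(2) by auto
qed

lemma angle_measurable: "angle \<in> borel_measurable (\<nu> k)"
proof (rule measurable_\<nu>_continuous)
  have "- 1 \<le> qre s \<and> qre s \<le> 1" if "s \<in> fac a k" for s
    using qre_le[of s] fac_subset_S3[OF that] by (auto simp: S3_def abs_le_iff)
  then show "continuous_on (fac a k) angle"
    unfolding angle_def by (intro continuous_intros) auto
qed

lemma angle_null: "emeasure (\<nu> k) {h \<in> fac a k. angle h = c} = 0"
proof -
  have "{h \<in> fac a k. angle h = c} \<subseteq> {h \<in> fac a k. qre h = cos (2 * pi * c)}"
  proof clarify
    fix h assume h: "h \<in> fac a k"
    have q: "\<bar>qre h\<bar> \<le> 1" using qre_le[of h] fac_subset_S3[OF h] by (simp add: S3_def)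
    have "2 * pi * angle h = arccos (qre h)" by (simp add: angle_def)
    then have "cos (2 * pi * angle h) = qre h" using q by (simp add: cos_arccos_abs)
    then show "qre h = cos (2 * pi * angle h)" by simp
  qed
  moreover have "{h \<in> fac a k. qre h = cos (2 * pi * c)} \<in> sets (\<nu> k)"
  proof -
    have "closed {h. qre h = cos (2 * pi * c)}" by (intro closed_Collect_eq continuous_intros)
    from sets_\<nu>_closed[OF this] show ?thesis by simp
  qed
  ultimately have "emeasure (\<nu> k) {h \<in> fac a k. angle h = c} \<le> emeasure (\<nu> k) {h \<in> fac a k. qre h = cos (2 * pi * c)}"
    by (rule emeasure_mono)
  then show ?thesis using \<nu>_qre by simp
qed

text \<open>Fubini in a coordinate with nonzero coefficient: once the others are fixed, the relation
  prescribes a single value of \<open>angle\<close>, which has measure zero.\<close>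

lemma relation_null:
  fixes m :: "nat \<Rightarrow> int" and m0 :: int
  assumes i: "i < N" "m i \<noteq> 0"
  shows "AE l in \<nu>L. (\<Sum>k<N. real_of_int (m k) * angle (l k)) + real_of_int m0 \<noteq> 0"
proof -
  let ?f = "\<lambda>l. (\<Sum>k<N. real_of_int (m k) * angle (l k)) + real_of_int m0"
  define J where "J = {..<N} - {i}"
  have J: "insert i J = {..<N}" "i \<notin> J" "finite J" using i by (auto simp: J_def)
  have comp: "(\<lambda>l. angle (l k)) \<in> borel_measurable \<nu>L" if "k < N" for k
  proof -
    have "(\<lambda>l. l k) \<in> measurable \<nu>L (\<nu> k)"
      unfolding \<nu>L_def using that by (intro measurable_component_singleton) simp
    then show ?thesis using measurable_compose[OF _ angle_measurable] by blast
  qed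
  then have f: "?f \<in> borel_measurable \<nu>L" by simp
  define E where "E = {l \<in> space \<nu>L. ?f l = 0}"
  have E: "E \<in> sets \<nu>L" unfolding E_def using f by simp
  have "emeasure \<nu>L E = integral\<^sup>N (Pi\<^sub>M (insert i J) \<nu>) (indicator E)"
    using E by (simp add: J \<nu>L_def)
  also have "\<dots> = (\<integral>\<^sup>+ x. (\<integral>\<^sup>+ y. indicator E (x(i := y)) \<partial>\<nu> i) \<partial>Pi\<^sub>M J \<nu>)"
    using E J by (intro \<nu>.product_nn_integral_insert) (auto simp: \<nu>L_def)
  also have "\<dots> = (\<integral>\<^sup>+ x. 0 \<partial>Pi\<^sub>M J \<nu>)"
  proof (rule nn_integral_cong)
    fix x assume "x \<in> space (Pi\<^sub>M J \<nu>)"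
    define c where "c = - ((\<Sum>k\<in>J. real_of_int (m k) * angle (x k)) + real_of_int m0) / real_of_int (m i)"
    have "(indicator E (x(i := y)) :: ennreal) \<le> indicator {h \<in> fac a i. angle h = c} y" if "y \<in> space (\<nu> i)" for y
    proof -
      have "angle y = c" if "x(i := y) \<in> E"
      proof -
        have "(\<Sum>k\<in>insert i J. real_of_int (m k) * angle ((x(i := y)) k)) + real_of_int m0 = 0"
          using that by (simp only: E_def J mem_Collect_eq)
        moreover have "(\<Sum>k\<in>J. real_of_int (m k) * angle ((x(i := y)) k)) = (\<Sum>k\<in>J. real_of_int (m k) * angle (x k))"
          by (rule sum.cong) (use J in auto)
        ultimately have "real_of_int (m i) * angle y = - ((\<Sum>k\<in>J. real_of_int (m k) * angle (x k)) + real_of_int m0)"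
          by (simp add: sum.insert[OF J(3) J(2)])
        then show ?thesis using i(2) by (simp add: c_def field_simps)
      qed
      then show ?thesis using that by (cases "x(i := y) \<in> E") auto
    qed
    then have "(\<integral>\<^sup>+ y. indicator E (x(i := y)) \<partial>\<nu> i) \<le> (\<integral>\<^sup>+ y. indicator {h \<in> fac a i. angle h = c} y \<partial>\<nu> i)"
      by (rule nn_integral_mono)
    also have "\<dots> = emeasure (\<nu> i) {h \<in> fac a i. angle h = c}"
    proof -
      have "{h \<in> space (\<nu> i). angle h = c} \<in> sets (\<nu> i)" 
        using measurable_sets[OF angle_measurable[of i], of "{c}"] by (simp add: vimage_def Int_def conj_commute)
      then show ?thesis by simp
    qed
    finally show "(\<integral>\<^sup>+ y. indicator E (x(i := y)) \<partial>\<nu> i) = 0" by (simp add: angle_null)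
  qed
  finally have "emeasure \<nu>L E = 0" by simp
  then show ?thesis using E AE_iff_measurable[of E \<nu>L "\<lambda>l. ?f l \<noteq> 0"] by (simp add: E_def)
qed

lemma AE_generic: "AE l in \<nu>L. generic l"
proof -
  \<comment> \<open>Coefficients are restricted to \<open>{..<N}\<close> because the functions from
    \<open>nat\<close> to \<open>int\<close> are uncountable.\<close>
  define R :: "((nat \<Rightarrow> int) \<times> int) set" where
    "R = {r. fst r \<in> Pi\<^sub>E {..<N} (\<lambda>_. UNIV) \<and> (\<exists>i<N. fst r i \<noteq> 0)}"
  have "countable (Pi\<^sub>E {..<N} (\<lambda>_. UNIV :: int set))" by (rule countable_PiE) auto
  then have "countable (Pi\<^sub>E {..<N} (\<lambda>_. UNIV :: int set) \<times> (UNIV :: int set))" by simp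
  moreover have "R \<subseteq> Pi\<^sub>E {..<N} (\<lambda>_. UNIV) \<times> UNIV"
  proof
    fix r assume "r \<in> R"
    then have "fst r \<in> Pi\<^sub>E {..<N} (\<lambda>_. UNIV)" unfolding R_def by blast
    then show "r \<in> Pi\<^sub>E {..<N} (\<lambda>_. UNIV) \<times> UNIV" by (cases r) simp
  qed
  ultimately have "countable R" by (rule countable_subset[rotated])
  moreover have "AE l in \<nu>L. (\<Sum>k<N. real_of_int (fst r k) * angle (l k)) + real_of_int (snd r) \<noteq> 0" if r: "r \<in> R" for r
  proof -
    obtain i where "i < N" "fst r i \<noteq> 0" using r unfolding R_def by blast
    then show ?thesis by (rule relation_null)
  qed
  ultimately have "AE l in \<nu>L. \<forall>r\<in>R. (\<Sum>k<N. real_of_int (fst r k) * angle (l k)) + real_of_int (snd r) \<noteq> 0"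
    by (subst AE_ball_countable) blast+
  then show ?thesis
  proof (rule AE_mp, intro AE_I2 impI)
    fix l assume l: "\<forall>r\<in>R. (\<Sum>k<N. real_of_int (fst r k) * angle (l k)) + real_of_int (snd r) \<noteq> 0"
    show "generic l"
      unfolding generic_def
    proof (intro allI impI, rule ccontr)
      fix m :: "nat \<Rightarrow> int" and m0 :: int and k
      assume s: "(\<Sum>k<N. real_of_int (m k) * angle (l k)) + real_of_int m0 = 0" and k: "k < N" "m k \<noteq> 0"
      have "fst (restrict m {..<N}, m0) \<in> Pi\<^sub>E {..<N} (\<lambda>_. UNIV)" by simp
      moreover have "fst (restrict m {..<N}, m0) k \<noteq> 0" using k by simp
      ultimately have "(restrict m {..<N}, m0) \<in> R" unfolding R_def using k(1) by blast
      from bspec[OF l this] have "(\<Sum>k<N. real_of_int (restrict m {..<N} k) * angle (l k)) + real_of_int m0 \<noteq> 0"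
        by (simp only: fst_conv snd_conv not_False_eq_True)
      then show False using s by simp
    qed
  qed
qed

text \<open>Both conditions are expressed through the real part, whose level sets are null: the
  first entry is nonzero if the real part is, the second if the real part of the product with
  \<open>j\<close> is. Translation by \<open>s\<close>, the conjugate of \<open>j\<close> by
  \<open>g\<close>, reduces the second case to the first.\<close>

lemma AE_off_circle:
  assumes g: "g \<in> S3" and k: "k < N" "k < a"
  shows "AE l in \<nu>L. fst (qcnj g \<odot> l k \<odot> g) \<noteq> 0 \<and> snd (qcnj g \<odot> l k \<odot> g) \<noteq> 0"
proof -
  have fac3: "fac a k = S3" using k by (simp add: fac_def)
  have trace: "qre (u \<odot> v) = qre (v \<odot> u)" for u v by (simp add: qre_def qmul_def algebra_simps)
  define j :: quat where "j = (0, 1)"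
  define s where "s = g \<odot> j \<odot> qcnj g"
  have j: "j \<in> S3" by (simp add: j_def S3_def norm_prod_def)
  have s: "s \<in> S3" using g j by (simp add: s_def)
  have comp_null: "AE l in \<nu>L. l k \<notin> A" if A: "A \<in> sets (\<nu> k)" "emeasure (\<nu> k) A = 0" for A
  proof -
    define B where "B = (\<lambda>i. if i = k then A else fac a i)"
    have B: "B i \<in> sets (\<nu> i)" for i using A(1) sets.top[of "\<nu> i"] by (auto simp: B_def)
    have "emeasure \<nu>L (Pi\<^sub>E {..<N} B) = (\<Prod>i<N. emeasure (\<nu> i) (B i))"
      unfolding \<nu>L_def by (rule \<nu>.emeasure_PiM) (use B in auto)
    also have "\<dots> = 0" using k A(2) by (intro prod_zero) (auto simp: B_def)
    finally have z: "emeasure \<nu>L (Pi\<^sub>E {..<N} B) = 0" .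
    have e: "{l \<in> space \<nu>L. \<not> l k \<notin> A} = Pi\<^sub>E {..<N} B"
    proof (intro equalityI subsetI)
      fix l assume "l \<in> {l \<in> space \<nu>L. \<not> l k \<notin> A}"
      then have "l \<in> (\<Pi>\<^sub>E i\<in>{..<N}. fac a i)" "l k \<in> A" by (simp_all add: space_\<nu>L)
      then show "l \<in> Pi\<^sub>E {..<N} B" unfolding PiE_iff B_def by auto
    next
      fix l assume l: "l \<in> Pi\<^sub>E {..<N} B"
      have "B i \<subseteq> fac a i" for i using sets.sets_into_space[OF B[of i]] by simp
      then have "l \<in> (\<Pi>\<^sub>E i\<in>{..<N}. fac a i)" using l PiE_mono[of "{..<N}" B "fac a"] by blast
      moreover have "l k \<in> A" using PiE_mem[OF l, of k] k by (simp add: B_def)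
      ultimately show "l \<in> {l \<in> space \<nu>L. \<not> l k \<notin> A}" by (simp add: space_\<nu>L)
    qed
    have m: "Pi\<^sub>E {..<N} B \<in> sets \<nu>L" unfolding \<nu>L_def by (rule sets_PiM_I_finite) (use B in auto)
    show ?thesis using AE_iff_measurable[OF m e] z by simp
  qed
  have q0: "{h \<in> fac a k. qre h = 0} \<in> sets (\<nu> k)"
  proof -
    have "closed {h. qre h = 0}" by (intro closed_Collect_eq continuous_intros)
    from sets_\<nu>_closed[OF this] show ?thesis by simp
  qed
  have "AE l in \<nu>L. l k \<notin> {h \<in> fac a k. qre h = 0}" by (rule comp_null[OF q0 \<nu>_qre])
  moreover have "AE l in \<nu>L. l k \<notin> (\<lambda>h. s \<odot> h) -` {h \<in> fac a k. qre h = 0} \<inter> space (\<nu> k)"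
  proof (rule comp_null)
    have m: "(\<lambda>h. s \<odot> h) \<in> measurable (\<nu> k) (\<nu> k)" by (rule measurable_qmul_left) (simp add: fac3 s)
    show "(\<lambda>h. s \<odot> h) -` {h \<in> fac a k. qre h = 0} \<inter> space (\<nu> k) \<in> sets (\<nu> k)"
      by (rule measurable_sets[OF m q0])
    show "emeasure (\<nu> k) ((\<lambda>h. s \<odot> h) -` {h \<in> fac a k. qre h = 0} \<inter> space (\<nu> k)) = 0"
      using emeasure_distr[OF m q0] \<nu>_shift[of s k] \<nu>_qre[of k 0] s by (simp add: fac3)
  qed
  moreover have "AE l in \<nu>L. l \<in> space \<nu>L" by (rule AE_space)
  ultimately show ?thesis
  proof eventually_elim
    case (elim l)
    then have h: "l k \<in> S3" using k by (auto simp: space_\<nu>L fac3[symmetric])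
    have n1: "qre (l k) \<noteq> 0" using elim(1) h by (simp add: fac3)
    have n2: "qre (s \<odot> l k) \<noteq> 0" using elim(2) h s by (simp add: fac3)
    let ?w = "qcnj g \<odot> l k \<odot> g"
    have "qre ?w = qre (l k)" using trace[of "qcnj g \<odot> l k" g] g by (simp add: qmul_assoc[symmetric])
    then have w1: "fst ?w \<noteq> 0" using n1 by (auto simp: qre_def)
    have "qre (?w \<odot> j) = qre (s \<odot> l k)"
      using trace[of "qcnj g" "l k \<odot> g \<odot> j"] trace[of "l k" s] by (simp add: s_def qmul_assoc)
    then have "qre (?w \<odot> j) \<noteq> 0" using n2 by simp
    moreover have "qre (u \<odot> j) = 0" if "snd u = 0" for u
      using that by (simp add: j_def qre_def qmul_def)
    ultimately have "snd ?w \<noteq> 0" by blast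
    with w1 show ?case by blast
  qed
qed

lemma AE_dense_\<nu>L:
  assumes l: "l \<in> L" "generic l"
  shows "AE l' in \<nu>L. dense_in (generated_by G (P l) (P l'))"
proof -
  let ?diag = "\<lambda>k g. l k = g \<odot> (cis (arccos (qre (l k))), 0) \<odot> qcnj g"
  have "\<forall>k. k < N \<longrightarrow> (\<exists>g. g \<in> S3 \<and> ?diag k g)"
    using S3_diagonalise l(1) fac_subset_S3 unfolding L_def by blast
  then obtain g where g: "\<And>k. k < N \<Longrightarrow> g k \<in> S3 \<and> ?diag k (g k)" by metis
  have "AE l' in \<nu>L. \<forall>k\<in>{k. k < N \<and> k < a}. fst (qcnj (g k) \<odot> l' k \<odot> g k) \<noteq> 0 \<and> snd (qcnj (g k) \<odot> l' k \<odot> g k) \<noteq> 0"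
  proof (subst AE_ball_countable)
    show "countable {k. k < N \<and> k < a}" by (rule countable_subset[of _ UNIV]) auto
    show "\<forall>k\<in>{k. k < N \<and> k < a}. AE l' in \<nu>L. fst (qcnj (g k) \<odot> l' k \<odot> g k) \<noteq> 0 \<and> snd (qcnj (g k) \<odot> l' k \<odot> g k) \<noteq> 0"
      using AE_off_circle g by blast
  qed
  moreover have "AE l' in \<nu>L. l' \<in> space \<nu>L" by (rule AE_space)
  ultimately show ?thesis
  proof eventually_elim
    case (elim l')
    show ?case
      by (rule generic_pair_dense[OF l space_\<nu>L_L[OF elim(2)]]) (use g elim(1) in blast)
  qed
qed

end

section \<open>Density of almost every pair in the group\<close>

context compact_haar_group
begin

text \<open>Density only asks that each nonempty set of a countable base contain the value of one of
  countably many words, and each word is a measurable function of the pair.\<close>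

lemma dense_pairs_measurable:
  "{z \<in> carrier G \<times> carrier G. dense_in (generated_by G (fst z) (snd z))} \<in> sets (\<mu> \<Otimes>\<^sub>M \<mu>)"
proof -
  obtain \<B> where \<B>: "countable \<B>" "\<And>V. V \<in> \<B> \<Longrightarrow> openin X V"
      "\<And>U x. openin X U \<Longrightarrow> x \<in> U \<Longrightarrow> \<exists>V\<in>\<B>. x \<in> V \<and> V \<subseteq> U"
    using second_countable_X unfolding second_countable_def by metis
  let ?w = "\<lambda>w z. word_value G (\<lambda>b. if b then fst z else snd z) w"
  have sp: "space (\<mu> \<Otimes>\<^sub>M \<mu>) = carrier G \<times> carrier G" by (simp add: space_pair_measure)
  have wm: "?w w \<in> measurable (\<mu> \<Otimes>\<^sub>M \<mu>) \<mu>" for w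
  proof (induction w)
    case (Cons x w)
    have "(\<lambda>z. letter_value G (\<lambda>b. if b then fst z else snd z) x) \<in> measurable (\<mu> \<Otimes>\<^sub>M \<mu>) \<mu>"
      using measurable_compose[OF measurable_fst measurable_inv]
        measurable_compose[OF measurable_snd measurable_inv]
      by (cases "fst x"; cases "snd x") (simp_all add: letter_value_def)
    then have "(\<lambda>z. (letter_value G (\<lambda>b. if b then fst z else snd z) x, ?w w z)) \<in> measurable (\<mu> \<Otimes>\<^sub>M \<mu>) (\<mu> \<Otimes>\<^sub>M \<mu>)"
      using Cons by (intro measurable_Pair)
    from measurable_compose[OF this measurable_mult] show ?case by simp
  qed simp
  have dense_iff: "dense_in (generated_by G x y) \<longleftrightarrow> (\<forall>V\<in>{V\<in>\<B>. V \<noteq> {}}. \<exists>w. ?w w (x, y) \<in> V)" for x y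
  proof
    assume d: "dense_in (generated_by G x y)"
    show "\<forall>V\<in>{V\<in>\<B>. V \<noteq> {}}. \<exists>w. ?w w (x, y) \<in> V"
    proof
      fix V assume "V \<in> {V\<in>\<B>. V \<noteq> {}}"
      then have "openin X V \<and> V \<noteq> {}" using \<B>(2) by simp
      then have "V \<inter> generated_by G x y \<noteq> {}" using d unfolding dense_in_def by blast
      then obtain w where "word_value G (\<lambda>b. if b then x else y) w \<in> V" unfolding generated_by_def by blast
      then show "\<exists>w. ?w w (x, y) \<in> V" by (intro exI[of _ w]) (simp only: fst_conv snd_conv)
    qed
  next
    assume *: "\<forall>V\<in>{V\<in>\<B>. V \<noteq> {}}. \<exists>w. ?w w (x, y) \<in> V"
    show "dense_in (generated_by G x y)"
      unfolding dense_in_def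
    proof (intro allI impI)
      fix U assume "openin X U \<and> U \<noteq> {}"
      then obtain V where "V \<in> \<B>" "V \<noteq> {}" "V \<subseteq> U" using \<B>(3) by blast
      then obtain w where "?w w (x, y) \<in> U" using * by blast
      then have "word_value G (\<lambda>b. if b then x else y) w \<in> U" by (simp only: fst_conv snd_conv)
      then show "U \<inter> generated_by G x y \<noteq> {}" unfolding generated_by_def by blast
    qed
  qed
  have "dense_in (generated_by G (fst z) (snd z)) \<longleftrightarrow> (\<forall>V\<in>{V\<in>\<B>. V \<noteq> {}}. \<exists>w. ?w w z \<in> V)" for z
    using dense_iff[of "fst z" "snd z"] by (simp only: prod.collapse)
  then have "{z \<in> carrier G \<times> carrier G. dense_in (generated_by G (fst z) (snd z))} =
      {z \<in> space (\<mu> \<Otimes>\<^sub>M \<mu>). \<forall>V\<in>{V\<in>\<B>. V \<noteq> {}}. \<exists>w. ?w w z \<in> V}"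
    by (simp only: sp)
  also have "\<dots> \<in> sets (\<mu> \<Otimes>\<^sub>M \<mu>)"
  proof (rule sets.sets_Collect_countable_All')
    show "countable {V\<in>\<B>. V \<noteq> {}}" using \<B>(1) by simp
    fix V assume "V \<in> {V\<in>\<B>. V \<noteq> {}}"
    then have "V \<in> sets \<mu>" using \<B>(2) open_sets by blast
    then have "?w w -` V \<inter> space (\<mu> \<Otimes>\<^sub>M \<mu>) \<in> sets (\<mu> \<Otimes>\<^sub>M \<mu>)" for w
      by (rule measurable_sets[OF wm])
    moreover have "?w w -` V \<inter> space (\<mu> \<Otimes>\<^sub>M \<mu>) = {z \<in> space (\<mu> \<Otimes>\<^sub>M \<mu>). ?w w z \<in> V}" for w
      by blast
    ultimately have "{z \<in> space (\<mu> \<Otimes>\<^sub>M \<mu>). ?w w z \<in> V} \<in> sets (\<mu> \<Otimes>\<^sub>M \<mu>)" for w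
      by (simp only:)
    then show "{z \<in> space (\<mu> \<Otimes>\<^sub>M \<mu>). \<exists>w. ?w w z \<in> V} \<in> sets (\<mu> \<Otimes>\<^sub>M \<mu>)"
      by (rule sets.sets_Collect_countable_Ex)
  qed
  finally show ?thesis .
qed

text \<open>\<open>null_transfer\<close> is applied twice: for a generic first element to the set of
  bad second elements, then to the set of first elements whose bad set has positive measure. The
  latter is measurable because the bad pairs form a measurable subset of the product.\<close>

theorem AE_pair_dense:
  assumes conn: "connected_space X"
    and loc: "locally_isomorphic G X (SU2_U1_product a b) (SU2_U1_topology a b)"
  shows "AE x in \<mu>. AE y in \<mu>. dense_in (generated_by G x y)"
proof -
  obtain N p where "factor_system a N p" using locally_isomorphic_factor_system[OF conn loc] by blast
  then interpret factored_group G X \<mu> a N p by unfold_locales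
  let ?D = "{z \<in> carrier G \<times> carrier G. dense_in (generated_by G (fst z) (snd z))}"
  define C where "C = space (\<mu> \<Otimes>\<^sub>M \<mu>) - ?D"
  have C: "C \<in> sets (\<mu> \<Otimes>\<^sub>M \<mu>)" unfolding C_def by (intro sets.Diff sets.top dense_pairs_measurable)
  have CP: "Pair x -` C \<in> sets \<mu>" for x using C by (rule sets_Pair1)
  have CPe: "y \<in> Pair x -` C \<longleftrightarrow> y \<in> carrier G \<and> \<not> dense_in (generated_by G x y)" if "x \<in> carrier G" for x y
    using that by (auto simp: C_def space_pair_measure)
  have "(\<lambda>x. emeasure \<mu> (Pair x -` C)) \<in> borel_measurable \<mu>"
    by (rule \<mu>.measurable_emeasure_Pair[OF C])
  then have Z: "{x \<in> space \<mu>. emeasure \<mu> (Pair x -` C) \<noteq> 0} \<in> sets \<mu>" by measurable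
  have "AE l in \<nu>L. P l \<notin> {x \<in> space \<mu>. emeasure \<mu> (Pair x -` C) \<noteq> 0}"
    using AE_generic AE_space
  proof eventually_elim
    case (elim l)
    then have l: "l \<in> L" using space_\<nu>L_L by blast
    have "AE l' in \<nu>L. P l' \<notin> Pair (P l) -` C"
      using AE_dense_\<nu>L[OF l elim(1)] CPe[OF P_closed[OF l]] by auto
    from null_transfer[OF CP this] show ?case by simp
  qed
  then have "emeasure \<mu> {x \<in> space \<mu>. emeasure \<mu> (Pair x -` C) \<noteq> 0} = 0" by (rule null_transfer[OF Z])
  then have "AE x in \<mu>. emeasure \<mu> (Pair x -` C) = 0"
    using AE_iff_measurable[OF Z, of "\<lambda>x. emeasure \<mu> (Pair x -` C) = 0"] by simp
  then show ?thesis using AE_space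
  proof eventually_elim
    case (elim x)
    then have x: "x \<in> carrier G" by simp
    have e: "{y \<in> space \<mu>. \<not> dense_in (generated_by G x y)} = Pair x -` C" using CPe[OF x] by auto
    show ?case using AE_iff_measurable[OF CP e] elim(1) by blast
  qed
qed

end

section \<open>Nielsen moves\<close>

lemma Hom_free_group_exists:
  assumes G: "group G" and f: "f \<in> S \<rightarrow> carrier G"
  obtains \<rho> where "\<rho> \<in> Hom (free_group S) G" "\<And>s. s \<in> S \<Longrightarrow> \<rho> (gen s) = f s"
proof
  interpret group G by (rule G)
  show "restrict (word_value G f) (carrier (free_group S)) \<in> Hom (free_group S) G"
    by (rule word_value_Hom[OF G f])
  fix s assume s: "s \<in> S"
  then have "f s \<in> carrier G" using f by blast
  then have "word_value G f (gen s) = f s" by (simp add: gen_def letter_value_def)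
  then show "restrict (word_value G f) (carrier (free_group S)) (gen s) = f s"
    using gen_in_free_group[OF s] by simp
qed

lemma Hom_free_group_eqI:
  assumes G: "group G" and \<rho>: "\<rho> \<in> Hom (free_group S) G" and \<sigma>: "\<sigma> \<in> Hom (free_group S) G"
    and eq: "\<And>s. s \<in> S \<Longrightarrow> \<rho> (gen s) = \<sigma> (gen s)"
  shows "\<rho> = \<sigma>"
proof -
  have F: "group (free_group S)" by (rule group_free_group)
  have f: "(\<lambda>s. \<sigma> (gen s)) \<in> S \<rightarrow> carrier G"
    by (intro Pi_I Hom_closed[OF F G \<sigma>] gen_in_free_group)
  show ?thesis
  proof (rule Hom_eqI[OF F G \<rho> \<sigma>])
    fix w assume w: "w \<in> carrier (free_group S)"
    show "\<rho> w = \<sigma> w"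
      by (rule trans[OF Hom_free_group_unique[OF G f \<rho> eq w] Hom_free_group_unique[OF G f \<sigma> refl w, symmetric]])
  qed
qed

text \<open>The inverse transvection uses the inverse of \<open>gen j\<close>; both composites fix
  every generator and are therefore the identity.\<close>

lemma free_group_transvection:
  assumes i: "i \<in> S" and j: "j \<in> S" and ij: "i \<noteq> j"
  obtains \<psi> where "\<psi> \<in> auto (free_group S)" "\<psi> (gen i) = gen j \<otimes>\<^bsub>free_group S\<^esub> gen i"
    "\<And>k. k \<in> S \<Longrightarrow> k \<noteq> i \<Longrightarrow> \<psi> (gen k) = gen k"
proof -
  define F where "F = free_group S"
  have F: "group F" unfolding F_def by (rule group_free_group)
  interpret group F by (rule F)
  have gen: "gen k \<in> carrier F" if "k \<in> S" for k using gen_in_free_group[OF that] by (simp add: F_def)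
  have T: "\<exists>\<rho>. \<rho> \<in> Hom F F \<and> \<rho> (gen i) = g \<otimes>\<^bsub>F\<^esub> gen i \<and> (\<forall>k\<in>S. k \<noteq> i \<longrightarrow> \<rho> (gen k) = gen k)"
    if "g \<in> carrier F" for g
  proof -
    have "(\<lambda>k. if k = i then g \<otimes>\<^bsub>F\<^esub> gen i else gen k) \<in> S \<rightarrow> carrier F" using that gen by auto
    from Hom_free_group_exists[OF F this] obtain \<rho> where \<rho>: "\<rho> \<in> Hom F F"
      "\<And>s. s \<in> S \<Longrightarrow> \<rho> (gen s) = (if s = i then g \<otimes>\<^bsub>F\<^esub> gen i else gen s)" unfolding F_def by blast
    have "\<rho> (gen i) = g \<otimes>\<^bsub>F\<^esub> gen i" using \<rho>(2)[OF i] by simp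
    moreover have "\<rho> (gen k) = gen k" if "k \<in> S" "k \<noteq> i" for k using \<rho>(2)[OF that(1)] that(2) by simp
    ultimately show ?thesis using \<rho>(1) by blast
  qed
  have gj: "gen j \<in> carrier F" "inv\<^bsub>F\<^esub> gen j \<in> carrier F" using gen[OF j] by simp_all
  obtain \<psi> where \<psi>: "\<psi> \<in> Hom F F" "\<psi> (gen i) = gen j \<otimes>\<^bsub>F\<^esub> gen i" "\<And>k. k \<in> S \<Longrightarrow> k \<noteq> i \<Longrightarrow> \<psi> (gen k) = gen k"
    using T[OF gj(1)] by blast
  obtain \<theta> where \<theta>: "\<theta> \<in> Hom F F" "\<theta> (gen i) = inv\<^bsub>F\<^esub> gen j \<otimes>\<^bsub>F\<^esub> gen i" "\<And>k. k \<in> S \<Longrightarrow> k \<noteq> i \<Longrightarrow> \<theta> (gen k) = gen k"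
    using T[OF gj(2)] by blast
  have hom: "group_hom F F \<alpha>" if "\<alpha> \<in> Hom F F" for \<alpha>
    using that by (intro group_hom.intro group_hom_axioms.intro F) (simp add: Hom_def)
  have comp: "compose (carrier F) \<alpha> \<beta> \<in> Hom F F" if "\<alpha> \<in> Hom F F" "\<beta> \<in> Hom F F" for \<alpha> \<beta>
    using that hom_compose unfolding Hom_def by (auto simp: hom_def compose_def Pi_iff)
  have idF: "(\<lambda>w\<in>carrier F. w) \<in> Hom F F" by (auto simp: Hom_def hom_def)
  interpret \<psi>: group_hom F F \<psi> by (rule hom[OF \<psi>(1)])
  interpret \<theta>: group_hom F F \<theta> by (rule hom[OF \<theta>(1)])
  have ji: "\<psi> (gen j) = gen j" "\<theta> (gen j) = gen j" using \<psi>(3) \<theta>(3) j ij by auto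
  have c1: "\<psi> (\<theta> (gen i)) = gen i" "\<theta> (\<psi> (gen i)) = gen i"
    using gen[OF i] gj by (simp_all add: \<psi>(2) \<theta>(2) ji m_assoc[symmetric])
  have "compose (carrier F) \<psi> \<theta> = (\<lambda>w\<in>carrier F. w)"
    unfolding F_def
  proof (rule Hom_free_group_eqI[OF F[unfolded F_def] comp[OF \<psi>(1) \<theta>(1), unfolded F_def] idF[unfolded F_def]])
    fix s assume s: "s \<in> S"
    then show "compose (carrier (free_group S)) \<psi> \<theta> (gen s) = (\<lambda>w\<in>carrier (free_group S). w) (gen s)"
      using c1 \<psi>(3) \<theta>(3) gen_in_free_group[OF s] by (cases "s = i") (simp_all add: compose_def)
  qed
  moreover have "compose (carrier F) \<theta> \<psi> = (\<lambda>w\<in>carrier F. w)"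
    unfolding F_def
  proof (rule Hom_free_group_eqI[OF F[unfolded F_def] comp[OF \<theta>(1) \<psi>(1), unfolded F_def] idF[unfolded F_def]])
    fix s assume s: "s \<in> S"
    then show "compose (carrier (free_group S)) \<theta> \<psi> (gen s) = (\<lambda>w\<in>carrier (free_group S). w) (gen s)"
      using c1 \<psi>(3) \<theta>(3) gen_in_free_group[OF s] by (cases "s = i") (simp_all add: compose_def)
  qed
  ultimately have e: "\<psi> (\<theta> w) = w" "\<theta> (\<psi> w) = w" if "w \<in> carrier F" for w
    using that by (metis compose_eq restrict_apply')+
  have "bij_betw \<psi> (carrier F) (carrier F)"
    by (rule bij_betw_byWitness[where f' = \<theta>]) (use e in auto)
  then have "\<psi> \<in> auto F" using \<psi>(1) by (simp add: auto_def Bij_def Hom_def)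
  then show ?thesis using that[of \<psi>] \<psi>(2,3) unfolding F_def by blast
qed

lemma Nielsen_move:
  fixes G :: "('g, 'm) monoid_scheme"
  assumes G: "group G" and ij: "i < n" "j < n" "i \<noteq> j"
  obtains \<phi> where "\<phi> \<in> auto (free_group {..<n})"
    "\<And>\<rho>. \<rho> \<in> Hom (free_group {..<n}) G \<Longrightarrow>
      gen_values n (aut_act (free_group {..<n}) G \<phi> \<rho>) =
        (gen_values n \<rho>)(i := gen_values n \<rho> j \<otimes>\<^bsub>G\<^esub> gen_values n \<rho> i)"
proof -
  let ?F = "free_group {..<n}"
  have F: "group ?F" by (rule group_free_group)
  interpret Aut: group "AutoGroup ?F" by (rule group.AutoGroup[OF F])
  from ij obtain \<psi> where \<psi>: "\<psi> \<in> auto ?F" "\<psi> (gen i) = gen j \<otimes>\<^bsub>?F\<^esub> gen i"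
    "\<And>k. k \<in> {..<n} \<Longrightarrow> k \<noteq> i \<Longrightarrow> \<psi> (gen k) = gen k"
    using free_group_transvection[of i "{..<n}" j] by auto
  \<comment> \<open>The action precomposes with the inverse automorphism, so it is the inverse of
    the transvection that produces the stated move.\<close>
  define \<phi> where "\<phi> = inv\<^bsub>AutoGroup ?F\<^esub> \<psi>"
  have \<phi>: "\<phi> \<in> auto ?F" unfolding \<phi>_def by (rule aut_inv_auto[OF F F \<psi>(1)])
  have \<phi>inv: "inv\<^bsub>AutoGroup ?F\<^esub> \<phi> = \<psi>"
    unfolding \<phi>_def using \<psi>(1) by (intro Aut.inv_inv) (simp add: AutoGroup_simps)
  have "gen_values n (aut_act ?F G \<phi> \<rho>) = (gen_values n \<rho>)(i := gen_values n \<rho> j \<otimes>\<^bsub>G\<^esub> gen_values n \<rho> i)"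
    if \<rho>: "\<rho> \<in> Hom ?F G" for \<rho>
  proof
    fix k
    have g: "gen l \<in> carrier ?F" if "l < n" for l using that by (intro gen_in_free_group) simp
    have a: "aut_act ?F G \<phi> \<rho> (gen l) = \<rho> (\<psi> (gen l))" if "l < n" for l
      using aut_act_apply[OF F G \<rho> g[OF that], of \<phi>] by (simp add: \<phi>inv)
    have m: "\<rho> (gen j \<otimes>\<^bsub>?F\<^esub> gen i) = \<rho> (gen j) \<otimes>\<^bsub>G\<^esub> \<rho> (gen i)"
      using \<rho> g ij by (intro hom_mult[of \<rho> ?F G]) (simp_all add: Hom_def)
    show "gen_values n (aut_act ?F G \<phi> \<rho>) k = ((gen_values n \<rho>)(i := gen_values n \<rho> j \<otimes>\<^bsub>G\<^esub> gen_values n \<rho> i)) k"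
      using a[of k] ij \<psi>(2,3) m by (cases "k < n"; cases "k = i") (simp_all add: gen_values_def)
  qed
  with \<phi> show ?thesis by (rule that)
qed

lemma (in group) generated_by_subset:
  assumes x: "x \<in> S" "x \<in> carrier G" and y: "y \<in> S" "y \<in> carrier G" and one: "\<one> \<in> S"
    and m: "\<And>g h. g \<in> S \<Longrightarrow> h \<in> S \<Longrightarrow> g \<otimes> h \<in> S" and i: "\<And>g. g \<in> S \<Longrightarrow> inv g \<in> S"
  shows "generated_by G x y \<subseteq> S"
proof -
  have "word_value G (\<lambda>b. if b then x else y) w \<in> S" for w
  proof (induction w)
    case (Cons a w)
    have "letter_value G (\<lambda>b. if b then x else y) a \<in> S"
      using x y i by (simp add: letter_value_def)
    then show ?case using Cons m by simp
  qed (use one in simp)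
  then show ?thesis unfolding generated_by_def by blast
qed

section \<open>Averaging over one coordinate\<close>

locale finite_power = finite_measure M for M :: "'a measure" +
  fixes I :: "'i set"
  assumes finite_I: "finite I" and pos: "emeasure M (space M) > 0"
begin

abbreviation P :: "('i \<Rightarrow> 'a) measure" where
  "P \<equiv> Pi\<^sub>M I (\<lambda>_. M)"

sublocale product_sigma_finite "\<lambda>_. M"
  by unfold_locales

text \<open>Conditional expectation onto the functions independent of coordinate \<open>i\<close>,
  as a function defined everywhere; the division accounts for a measure that is not
  normalised.\<close>

definition avg :: "'i \<Rightarrow> (('i \<Rightarrow> 'a) \<Rightarrow> ennreal) \<Rightarrow> ('i \<Rightarrow> 'a) \<Rightarrow> ennreal" where
  "avg i u x = (\<integral>\<^sup>+ y. u (x(i := y)) \<partial>M) / emeasure M (space M)"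

lemma avg_const: "(\<integral>\<^sup>+ y. c \<partial>M) / emeasure M (space M) = c"
  using pos emeasure_finite by (simp add: ennreal_mult_divide_eq)

lemma upd_measurable:
  assumes "i \<in> I" shows "(\<lambda>(x, y). x(i := y)) \<in> measurable (P \<Otimes>\<^sub>M M) P"
  using measurable_add_dim[of i I "\<lambda>_. M"] assms by (simp add: insert_absorb)

lemma upd_space: "i \<in> I \<Longrightarrow> x \<in> space P \<Longrightarrow> y \<in> space M \<Longrightarrow> x(i := y) \<in> space P"
  by (auto simp: space_PiM PiE_iff extensional_def)

lemma section_measurable:
  assumes "i \<in> I" "x \<in> space P" "u \<in> measurable P N"
  shows "(\<lambda>y. u (x(i := y))) \<in> measurable M N"
proof -
  have "(\<lambda>y. (x, y)) \<in> measurable M (P \<Otimes>\<^sub>M M)" using assms(2) by (rule measurable_Pair1')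
  from measurable_compose[OF measurable_compose[OF this upd_measurable[OF assms(1)]] assms(3)]
  show ?thesis by simp
qed

lemma avg_measurable:
  assumes "i \<in> I" "u \<in> borel_measurable P"
  shows "avg i u \<in> borel_measurable P"
proof -
  have "(\<lambda>p. u ((\<lambda>(x, y). x(i := y)) p)) \<in> borel_measurable (P \<Otimes>\<^sub>M M)"
    by (rule measurable_compose[OF upd_measurable[OF assms(1)] assms(2)])
  then have "(\<lambda>x. \<integral>\<^sup>+ y. u (x(i := y)) \<partial>M) \<in> borel_measurable P"
    by (intro borel_measurable_nn_integral) (simp add: case_prod_unfold)
  then show ?thesis unfolding avg_def[abs_def] by (intro borel_measurable_divide_ennreal measurable_const) auto
qed

lemma avg_upd_same: "avg i u (x(i := y)) = avg i u x"
  by (simp add: avg_def)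

lemma nn_integral_avg:
  assumes i: "i \<in> I" and u: "u \<in> borel_measurable P"
  shows "(\<integral>\<^sup>+ x. avg i u x \<partial>P) = (\<integral>\<^sup>+ x. u x \<partial>P)"
proof -
  define J where "J = I - {i}"
  have J: "insert i J = I" "i \<notin> J" "finite J" using i finite_I by (auto simp: J_def)
  have split: "(\<integral>\<^sup>+ x. v x \<partial>P) = (\<integral>\<^sup>+ x. (\<integral>\<^sup>+ y. v (x(i := y)) \<partial>M) \<partial>Pi\<^sub>M J (\<lambda>_. M))"
    if "v \<in> borel_measurable P" for v :: "('i \<Rightarrow> 'a) \<Rightarrow> ennreal"
    using product_nn_integral_insert[OF J(3,2), of v] that by (simp only: J(1))
  have m: "(\<lambda>x. \<integral>\<^sup>+ y. u (x(i := y)) \<partial>M) \<in> borel_measurable (Pi\<^sub>M J (\<lambda>_. M))"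
  proof -
    have "(\<lambda>(x, y). x(i := y)) \<in> measurable (Pi\<^sub>M J (\<lambda>_. M) \<Otimes>\<^sub>M M) P"
      using measurable_add_dim[of i J "\<lambda>_. M"] by (simp add: J(1))
    from measurable_compose[OF this u] show ?thesis
      by (intro borel_measurable_nn_integral) (simp add: case_prod_unfold)
  qed
  have "(\<integral>\<^sup>+ x. avg i u x \<partial>P) = (\<integral>\<^sup>+ x. (\<integral>\<^sup>+ y. avg i u x \<partial>M) \<partial>Pi\<^sub>M J (\<lambda>_. M))"
    by (simp add: split[OF avg_measurable[OF i u]] avg_upd_same)
  also have "\<dots> = (\<integral>\<^sup>+ x. (\<integral>\<^sup>+ y. u (x(i := y)) \<partial>M) \<partial>Pi\<^sub>M J (\<lambda>_. M))"
  proof (rule nn_integral_cong)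
    have "emeasure M (space M) / emeasure M (space M) = 1"
      using pos emeasure_finite by (intro ennreal_divide_self) (auto simp: less_top[symmetric])
    then show "(\<integral>\<^sup>+ y. avg i u x \<partial>M) = (\<integral>\<^sup>+ y. u (x(i := y)) \<partial>M)" for x
      by (simp only: nn_integral_const) (simp add: avg_def ennreal_divide_times)
  qed
  also have "\<dots> = (\<integral>\<^sup>+ x. u x \<partial>P)" by (rule split[OF u, symmetric])
  finally show ?thesis .
qed

lemma AE_section:
  assumes i: "i \<in> I" and D: "D \<in> sets P" "emeasure P D = 0"
  shows "AE x in P. AE y in M. x(i := y) \<notin> D"
proof -
  have ind: "indicator D \<in> borel_measurable P" using D by simp
  have "(\<integral>\<^sup>+ x. avg i (indicator D) x \<partial>P) = 0"
    using nn_integral_avg[OF i ind] D by simp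
  then have "AE x in P. avg i (indicator D) x = 0"
    using nn_integral_0_iff_AE[OF avg_measurable[OF i ind]] by simp
  then show ?thesis using AE_space
  proof eventually_elim
    case (elim x)
    then have "(\<integral>\<^sup>+ y. indicator D (x(i := y)) \<partial>M) = 0"
      using emeasure_finite by (simp add: avg_def ennreal_divide_eq_0_iff)
    then have "AE y in M. indicator D (x(i := y)) = (0::ennreal)"
      using nn_integral_0_iff_AE[OF section_measurable[OF i elim(2) ind]] by simp
    then show ?case by (simp add: indicator_eq_0_iff)
  qed
qed

lemma avg_cong_AE:
  assumes i: "i \<in> I" and u: "u \<in> borel_measurable P" and v: "v \<in> borel_measurable P"
    and eq: "AE x in P. u x = v x"
  shows "AE x in P. avg i u x = avg i v x"
proof -
  have D: "{x \<in> space P. u x \<noteq> v x} \<in> sets P" using u v by (intro borel_measurable_neq)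
  moreover have "emeasure P {x \<in> space P. u x \<noteq> v x} = 0" using AE_iff_measurable[OF D refl] eq by simp
  ultimately have "AE x in P. AE y in M. x(i := y) \<notin> {x \<in> space P. u x \<noteq> v x}" by (rule AE_section[OF i])
  then show ?thesis using AE_space
  proof eventually_elim
    case (elim x)
    from elim(1) AE_space have "AE y in M. u (x(i := y)) = v (x(i := y))"
      by eventually_elim (use upd_space[OF i elim(2)] in blast)
    then have "(\<integral>\<^sup>+ y. u (x(i := y)) \<partial>M) = (\<integral>\<^sup>+ y. v (x(i := y)) \<partial>M)" by (rule nn_integral_cong_AE)
    then show ?case by (simp add: avg_def)
  qed
qed

text \<open>On a line where \<open>u\<close> is almost everywhere constant the average is that
  constant, so the set of disagreement has null sections there, and integrating over the sections
  makes it null.\<close>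

lemma avg_eq_AE:
  assumes i: "i \<in> I" and u: "u \<in> borel_measurable P"
    and const: "AE x in P. \<exists>c. AE y in M. u (x(i := y)) = c"
  shows "AE x in P. u x = avg i u x"
proof -
  define D where "D = {x \<in> space P. u x \<noteq> avg i u x}"
  have D: "D \<in> sets P" unfolding D_def using u avg_measurable[OF i u] by (intro borel_measurable_neq)
  have ind: "indicator D \<in> borel_measurable P" using D by simp
  have "AE x in P. avg i (indicator D) x = 0"
    using const
  proof eventually_elim
    case (elim x)
    then obtain c where c: "AE y in M. u (x(i := y)) = c" by blast
    then have "(\<integral>\<^sup>+ y. u (x(i := y)) \<partial>M) = (\<integral>\<^sup>+ y. c \<partial>M)" by (rule nn_integral_cong_AE)
    then have avg_c: "avg i u x = c" using avg_const by (simp add: avg_def)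
    have "AE y in M. indicator D (x(i := y)) = (0::ennreal)"
      using c by eventually_elim (simp add: D_def avg_upd_same avg_c)
    then have "(\<integral>\<^sup>+ y. indicator D (x(i := y)) \<partial>M) = (\<integral>\<^sup>+ y. 0 \<partial>M)" by (rule nn_integral_cong_AE)
    then show ?case by (simp add: avg_def)
  qed
  then have "emeasure P D = 0"
    using nn_integral_avg[OF i ind] nn_integral_0_iff_AE[OF avg_measurable[OF i ind]] D by simp
  then show ?thesis using AE_iff_measurable[OF D] by (simp add: D_def)
qed

text \<open>Averaging replaces \<open>u\<close>, coordinate by coordinate, by an almost everywhere
  equal function that is exactly independent of the coordinates treated so far. After the last
  coordinate it is constant on the whole space, without exceptional sets.\<close>

theorem AE_const_of_sections:
  fixes u :: "('i \<Rightarrow> 'a) \<Rightarrow> ennreal"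
  assumes u: "u \<in> borel_measurable P"
    and const: "\<And>i. i \<in> I \<Longrightarrow> AE x in P. \<exists>c. AE y in M. u (x(i := y)) = c"
  shows "\<exists>c. AE x in P. u x = c"
proof -
  have "\<exists>v::('i \<Rightarrow> 'a) \<Rightarrow> ennreal. v \<in> borel_measurable P \<and> (AE x in P. u x = v x) \<and> (\<forall>x i y. i \<in> J \<longrightarrow> v (x(i := y)) = v x)"
    if "J \<subseteq> I" for J
    using finite_subset[OF that finite_I] that
  proof (induction J rule: finite_induct)
    case empty
    show ?case using u by (intro exI[of _ u]) auto
  next
    case (insert i J)
    then obtain v where v: "v \<in> borel_measurable P" "AE x in P. u x = v x"
      "\<And>x i y. i \<in> J \<Longrightarrow> v (x(i := y)) = v x" by blast
    have i: "i \<in> I" using insert.prems by blast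
    have "AE x in P. u x = avg i v x"
      using avg_eq_AE[OF i u const[OF i]] avg_cong_AE[OF i u v(1,2)]
      by eventually_elim simp
    \<comment> \<open>Averaging in \<open>i\<close> keeps the independence of the earlier
      coordinates, as updates at different indices commute.\<close>
    moreover have "avg i v (x(j := y)) = avg i v x" if "j \<in> insert i J" for x j y
    proof (cases "j = i")
      case False
      then have "v (x(j := y, i := z)) = v (x(i := z))" for z
        using v(3)[of j "x(i := z)" y] that by (simp add: fun_upd_twist)
      then show ?thesis by (simp add: avg_def)
    qed (simp add: avg_upd_same)
    ultimately show ?case using avg_measurable[OF i v(1)] by blast
  qed
  from this[OF subset_refl] obtain v where v: "AE x in P. u x = v x"
      "\<And>x i y. i \<in> I \<Longrightarrow> v (x(i := y)) = v x" by blast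
  have eq: "v x = v x'" if x: "x \<in> space P" "x' \<in> space P" for x x'
  proof -
    have "v (\<lambda>k. if k \<in> J then x' k else x k) = v x" if "finite J" "J \<subseteq> I" for J
      using that
    proof (induction J rule: finite_induct)
      case (insert i J)
      have "(\<lambda>k. if k \<in> insert i J then x' k else x k) = (\<lambda>k. if k \<in> J then x' k else x k)(i := x' i)" by auto
      then show ?case using insert v(2)[of i] by simp
    qed simp
    from this[OF finite_I subset_refl] have "v (\<lambda>k. if k \<in> I then x' k else x k) = v x" .
    moreover have "(\<lambda>k. if k \<in> I then x' k else x k) = x'"
      using x by (auto simp: space_PiM PiE_iff extensional_def fun_eq_iff)
    ultimately show ?thesis by simp
  qed
  obtain m where "m \<in> space M" using pos by (metis emeasure_empty ex_in_conv less_irrefl)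
  then have m: "(\<lambda>i\<in>I. m) \<in> space P" by (auto simp: space_PiM)
  have "AE x in P. u x = v (\<lambda>i\<in>I. m)"
    using v(1) AE_space by eventually_elim (use eq m in metis)
  then show ?thesis by blast
qed

text \<open>Averaging the indicator of the bad set over the two coordinates in turn gives zero, and
  averaging preserves the integral.\<close>

lemma AE_two_coordinates:
  assumes jk: "j \<in> I" "k \<in> I" "j \<noteq> k" and D: "D \<in> sets (M \<Otimes>\<^sub>M M)"
    and AE: "AE y in M. AE z in M. (y, z) \<in> D"
  shows "AE x in P. (x j, x k) \<in> D"
proof -
  define N where "N = {x \<in> space P. (x j, x k) \<notin> D}"
  have "(\<lambda>x. (x j, x k)) \<in> measurable P (M \<Otimes>\<^sub>M M)"
    using jk by (intro measurable_Pair measurable_component_singleton)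
  from measurable_sets[OF this sets.compl_sets[OF D]]
  have "(\<lambda>x. (x j, x k)) -` (space (M \<Otimes>\<^sub>M M) - D) \<inter> space P \<in> sets P" .
  moreover have "(\<lambda>x. (x j, x k)) -` (space (M \<Otimes>\<^sub>M M) - D) \<inter> space P = N"
    
  proof -
    have "x j \<in> space M" "x k \<in> space M" if "x \<in> space P" for x
      using that jk by (auto simp: space_PiM)
    then show ?thesis unfolding N_def space_pair_measure by blast
  qed
  ultimately have N: "N \<in> sets P" by simp
  have ind: "indicator N \<in> borel_measurable P" using N by simp
  have "avg j (avg k (indicator N)) x = 0" for x
  proof -
    have "AE y in M. avg k (indicator N) (x(j := y)) = 0"
      using AE
    proof eventually_elim
      case (elim y)
      then have "AE z in M. indicator N (x(j := y, k := z)) = (0::ennreal)"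
        by eventually_elim (use jk in \<open>simp add: N_def\<close>)
      then have "(\<integral>\<^sup>+ z. indicator N (x(j := y, k := z)) \<partial>M) = (\<integral>\<^sup>+ z. 0 \<partial>M)" by (rule nn_integral_cong_AE)
      then show ?case by (simp add: avg_def)
    qed
    then have "(\<integral>\<^sup>+ y. avg k (indicator N) (x(j := y)) \<partial>M) = (\<integral>\<^sup>+ y. 0 \<partial>M)" by (rule nn_integral_cong_AE)
    then show ?thesis by (simp add: avg_def[of j])
  qed
  then have "(\<integral>\<^sup>+ x. indicator N x \<partial>P) = 0"
    using nn_integral_avg[OF jk(1) avg_measurable[OF jk(2) ind]] nn_integral_avg[OF jk(2) ind] by simp
  then have "emeasure P N = 0" using N by simp
  then show ?thesis using AE_iff_measurable[OF N] by (simp add: N_def)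
qed

end

section \<open>Ergodicity\<close>

context compact_haar_group
begin

lemma Nielsen_invariant_imp_AE_const:
  fixes F :: "(nat \<Rightarrow> 'g) \<Rightarrow> real"
  assumes n: "n > 2" and dense: "AE x in \<mu>. AE y in \<mu>. dense_in (generated_by G x y)"
    and F: "F \<in> borel_measurable (\<Pi>\<^sub>M i\<in>{..<n}. \<mu>)"
    and inv: "\<And>x i j. x \<in> (\<Pi>\<^sub>E i\<in>{..<n}. carrier G) \<Longrightarrow> i < n \<Longrightarrow> j < n \<Longrightarrow> i \<noteq> j \<Longrightarrow>
      F (x(i := x j \<otimes> x i)) = F x"
  shows "\<exists>c. AE x in (\<Pi>\<^sub>M i\<in>{..<n}. \<mu>). F x = c"
proof -
  interpret finite_power \<mu> "{..<n}"
    by unfold_locales (use emeasure_\<mu>_pos in simp_all)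
  have space_P: "space P = (\<Pi>\<^sub>E i\<in>{..<n}. carrier G)" by (simp add: space_PiM)
  define h where "h x = ennreal (arctan (F x) + 2)" for x
    \<comment> \<open>bounded, hence integrable, and determines \<open>F\<close>\<close>
  have h: "h \<in> borel_measurable P" unfolding h_def[abs_def] using F by measurable
  \<comment> \<open>As \<open>pi < 4\<close>, the shifted arctangent is positive, so passing to
    \<open>ennreal\<close> loses nothing.\<close>
  have bound: "arctan t + 2 > 0" "arctan t + 2 < 4" for t
    using arctan_lbound[of t] arctan_ubound[of t] pi_less_4 by linarith+
  have h_bound: "h x \<le> 4" for x
    using bound(2)[of "F x"] ennreal_leI[of "arctan (F x) + 2" 4] by (simp add: h_def)
  let ?D = "{z \<in> carrier G \<times> carrier G. dense_in (generated_by G (fst z) (snd z))}"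
  have AED: "AE y in \<mu>. AE z in \<mu>. (y, z) \<in> ?D"
    using dense AE_space
  proof eventually_elim
    case (elim y)
    from elim(1) AE_space show ?case by eventually_elim (use elim(2) in simp)
  qed
  have "AE x in P. \<exists>c. AE y in \<mu>. h (x(i := y)) = c" if i: "i \<in> {..<n}" for i
  proof -
    have "\<exists>j k. j < n \<and> k < n \<and> j \<noteq> i \<and> k \<noteq> i \<and> j \<noteq> k"
    proof -
      consider "i = 0" | "i = 1" | "i \<ge> 2" by linarith
      then show ?thesis
      proof cases
        case 1 then show ?thesis using n by (intro exI[of _ 1] exI[of _ 2]) auto
      next
        case 2 then show ?thesis using n by (intro exI[of _ 0] exI[of _ 2]) auto
      next
        case 3 then show ?thesis using n by (intro exI[of _ 0] exI[of _ 1]) auto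
      qed
    qed
    then obtain j k where jk: "j < n" "k < n" "j \<noteq> i" "k \<noteq> i" "j \<noteq> k" by blast
    have "AE x in P. (x j, x k) \<in> ?D"
      by (rule AE_two_coordinates[OF _ _ jk(5) dense_pairs_measurable AED]) (use jk in simp_all)
    then show ?thesis using AE_space
    proof eventually_elim
      case (elim x)
      then have d: "dense_in (generated_by G (x j) (x k))" and xj: "x j \<in> carrier G" and xk: "x k \<in> carrier G"
        by simp_all
      have upd: "x(i := y) \<in> (\<Pi>\<^sub>E i\<in>{..<n}. carrier G)" if "y \<in> carrier G" for y
        using upd_space[OF i elim(2), of y] that space_P by simp
      \<comment> \<open>The left translations that preserve the section through \<open>x\<close> in
        coordinate \<open>i\<close>: a subgroup, containing \<open>x j\<close> and
        \<open>x k\<close> by the Nielsen moves.\<close>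
      define S where "S = {g \<in> carrier G. \<forall>y\<in>carrier G. F (x(i := g \<otimes> y)) = F (x(i := y))}"
      have coord: "x l \<in> S" if l: "l < n" "l \<noteq> i" "x l \<in> carrier G" for l
        using inv[OF upd, of _ i l] i l by (simp add: S_def)
      have "generated_by G (x j) (x k) \<subseteq> S"
      proof (rule generated_by_subset)
        show "g \<otimes> h \<in> S" if "g \<in> S" "h \<in> S" for g h
          using that by (simp add: S_def m_assoc)
        show "inv g \<in> S" if "g \<in> S" for g
        proof -
          have g: "g \<in> carrier G" "\<And>y. y \<in> carrier G \<Longrightarrow> F (x(i := g \<otimes> y)) = F (x(i := y))"
            using that by (simp_all add: S_def)
          have "F (x(i := inv g \<otimes> y)) = F (x(i := y))" if y: "y \<in> carrier G" for y
            using g(2)[of "inv g \<otimes> y"] g(1) y by (simp add: m_assoc[symmetric])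
          then show ?thesis using g(1) by (simp add: S_def)
        qed
      qed (use coord jk xj xk in \<open>simp_all add: S_def\<close>)
      then have "h (x(i := g \<otimes> y)) = h (x(i := y))" if "g \<in> generated_by G (x j) (x k)" "y \<in> carrier G" for g y
        using that by (auto simp: S_def h_def)
      moreover have "(\<integral>\<^sup>+ y. h (x(i := y)) \<partial>\<mu>) < \<infinity>"
      proof -
        have "(\<integral>\<^sup>+ y. h (x(i := y)) \<partial>\<mu>) \<le> (\<integral>\<^sup>+ y. 4 \<partial>\<mu>)" by (intro nn_integral_mono h_bound)
        also have "\<dots> < \<infinity>" using emeasure_\<mu>_finite by (simp add: ennreal_mult_less_top)
        finally show ?thesis .
      qed
      ultimately show ?case
        using dense_invariant_imp_AE_const[OF section_measurable[OF i elim(2) h] generated_by_properties(1)[OF xj xk] d]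
        by blast
    qed
  qed
  from AE_const_of_sections[OF h this] obtain c where c: "AE x in P. h x = c" by blast
  from c have "AE x in P. F x = tan (enn2real c - 2)"
  proof eventually_elim
    case (elim x)
    have "arctan (F x) + 2 = enn2real c" using elim bound(1)[of "F x"] by (auto simp: h_def)
    then have "arctan (F x) = enn2real c - 2" by simp
    then show ?case by (metis tan_arctan)
  qed
  then show ?thesis by blast
qed

text \<open>The function on the quotient is read on tuples through the inverse of
  \<open>gen_values\<close>, where invariance under outer automorphism classes contains invariance
  under Nielsen moves; the exceptional null set is then carried back through both
  push-forwards.\<close>

theorem ergodic_of_AE_pair_dense:
  assumes n: "n > 2" and dense: "AE x in \<mu>. AE y in \<mu>. dense_in (generated_by G x y)"
  shows "ergodic_action (Out (free_group {..<n})) (Hom_mod_measure n G \<mu>) (out_act (free_group {..<n}) G)"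
  unfolding ergodic_action_def
proof (intro allI impI, elim conjE)
  let ?F = "free_group {..<n}"
  let ?H = "Hom ?F G" and ?Q = "Hom_mod ?F G" and ?q = "conj_class ?F G"
  let ?P = "\<Pi>\<^sub>M i\<in>{..<n}. \<mu>" and ?M = "Hom_mod_measure n G \<mu>"
  fix f :: "((nat \<times> bool) list \<Rightarrow> 'g) set \<Rightarrow> real"
  assume f: "f \<in> borel_measurable ?M"
    and inv: "\<forall>\<gamma>\<in>carrier (Out ?F). \<forall>x\<in>space ?M. f (out_act ?F G \<gamma> x) = f x"
  have F: "group ?F" by (rule group_free_group)
  note G = is_group
  have \<mu>: "space \<mu> = carrier G" by simp
  have space_P: "space ?P = (\<Pi>\<^sub>E i\<in>{..<n}. carrier G)" by (simp add: space_PiM)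
  have bij: "bij_betw (gen_values n) ?H (space ?P)"
    unfolding space_P by (rule bij_betw_gen_values[OF G])
  define r where "r = inv_into ?H (gen_values n)"
  have r: "r x \<in> ?H" "gen_values n (r x) = x" if "x \<in> space ?P" for x
    using bij_betwE[OF bij_betw_inv_into[OF bij]] bij_betw_inv_into_right[OF bij] that
    unfolding r_def by blast+
  have r_gen: "r (gen_values n \<rho>) = \<rho>" if "\<rho> \<in> ?H" for \<rho>
    unfolding r_def by (rule bij_betw_inv_into_left[OF bij that])
  have gen: "gen_values n \<rho> \<in> space ?P" if "\<rho> \<in> ?H" for \<rho>
    using bij_betwE[OF bij] that by blast
  have q: "?q \<rho> \<in> ?Q" if "\<rho> \<in> ?H" for \<rho>
    using that by (auto simp: conj_class_def Hom_mod_def orbits_def)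
  define \<Phi> where "\<Phi> x = f (?q (r x))" for x
  \<comment> \<open>Measurable sets of the quotient have measurable preimages by construction;
    \<open>B'\<close> is this preimage in coordinates.\<close>
  have pull: "\<exists>B'\<in>sets ?P. {\<rho>\<in>?H. ?q \<rho> \<in> B} = {\<rho>\<in>?H. gen_values n \<rho> \<in> B'} \<and>
      B' = {x \<in> space ?P. ?q (r x) \<in> B}"
    if B: "B \<in> sets ?M" for B
  proof -
    have "{\<rho>\<in>?H. ?q \<rho> \<in> B} \<in> sets (Hom_measure n G \<mu>)"
      using B unfolding sets_Hom_mod_measure[OF G \<mu>] by blast
    then obtain B' where B': "B' \<in> sets ?P" "{\<rho>\<in>?H. ?q \<rho> \<in> B} = {\<rho>\<in>?H. gen_values n \<rho> \<in> B'}"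
      unfolding sets_Hom_measure[OF G \<mu>] by blast
    have "x \<in> B' \<longleftrightarrow> ?q (r x) \<in> B" if x: "x \<in> space ?P" for x
    proof -
      have "r x \<in> {\<rho>\<in>?H. ?q \<rho> \<in> B} \<longleftrightarrow> r x \<in> {\<rho>\<in>?H. gen_values n \<rho> \<in> B'}" by (simp only: B'(2))
      then show ?thesis using r[OF x] by simp
    qed
    then have "B' = {x \<in> space ?P. ?q (r x) \<in> B}" using sets.sets_into_space[OF B'(1)] by blast
    with B' show ?thesis by blast
  qed
  have \<Phi>: "\<Phi> \<in> borel_measurable ?P"
  proof (rule measurableI)
    fix B :: "real set" assume "B \<in> sets borel"
    then have "f -` B \<inter> space ?M \<in> sets ?M" by (rule measurable_sets[OF f])
    from pull[OF this] have "{x \<in> space ?P. ?q (r x) \<in> f -` B \<inter> space ?M} \<in> sets ?P" by blast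
    moreover have "{x \<in> space ?P. ?q (r x) \<in> f -` B \<inter> space ?M} = \<Phi> -` B \<inter> space ?P"
      using q r(1) by (auto simp: \<Phi>_def space_Hom_mod_measure[OF G \<mu>])
    ultimately show "\<Phi> -` B \<inter> space ?P \<in> sets ?P" by simp
  qed simp
  have "\<Phi> (x(i := x j \<otimes> x i)) = \<Phi> x"
    if x: "x \<in> (\<Pi>\<^sub>E i\<in>{..<n}. carrier G)" and ij: "i < n" "j < n" "i \<noteq> j" for x i j
  proof -
    obtain \<phi> where \<phi>: "\<phi> \<in> auto ?F"
      "\<And>\<rho>. \<rho> \<in> ?H \<Longrightarrow> gen_values n (aut_act ?F G \<phi> \<rho>) = (gen_values n \<rho>)(i := gen_values n \<rho> j \<otimes> gen_values n \<rho> i)"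
      using Nielsen_move[OF G ij] by blast
    have x': "x \<in> space ?P" using x by (simp only: space_P)
    have "gen_values n (aut_act ?F G \<phi> (r x)) = x(i := x j \<otimes> x i)"
      using \<phi>(2)[OF r(1)[OF x']] by (simp only: r(2)[OF x'])
    then have "r (x(i := x j \<otimes> x i)) = aut_act ?F G \<phi> (r x)"
      using r_gen[OF aut_act_closed[OF F G \<phi>(1) r(1)[OF x']]] by simp
    then have "?q (r (x(i := x j \<otimes> x i))) = out_act ?F G (Inn ?F #>\<^bsub>AutoGroup ?F\<^esub> \<phi>) (?q (r x))"
      by (simp only: out_act_conj_class[OF F G \<phi>(1) r(1)[OF x']])
    moreover have "Inn ?F #>\<^bsub>AutoGroup ?F\<^esub> \<phi> \<in> carrier (Out ?F)"
      using \<phi>(1) by (auto simp: Out_def FactGroup_def RCOSETS_def AutoGroup_simps)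
    moreover have "?q (r x) \<in> space ?M" using q[OF r(1)[OF x']] by (simp add: space_Hom_mod_measure[OF G \<mu>])
    ultimately show ?thesis using inv by (simp add: \<Phi>_def)
  qed
  from Nielsen_invariant_imp_AE_const[OF n dense \<Phi> this] obtain c where c: "AE x in ?P. \<Phi> x = c" by blast
  define N where "N = {z \<in> space ?M. f z \<noteq> c}"
  have N: "N \<in> sets ?M" unfolding N_def using f by (intro borel_measurable_neq) auto
  obtain B' where B': "B' \<in> sets ?P" "{\<rho>\<in>?H. ?q \<rho> \<in> N} = {\<rho>\<in>?H. gen_values n \<rho> \<in> B'}"
    "B' = {x \<in> space ?P. ?q (r x) \<in> N}" using pull[OF N] by blast
  have B'_eq: "{x \<in> space ?P. \<not> \<Phi> x = c} = B'"
    using q r(1) unfolding B'(3) by (auto simp: N_def \<Phi>_def space_Hom_mod_measure[OF G \<mu>])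
  have "emeasure ?M N = emeasure ?P B'"
    using emeasure_Hom_mod_measure[OF G \<mu> N] emeasure_Hom_measure[OF G \<mu> B'(1)] B'(2) by simp
  also have "\<dots> = 0" using AE_iff_measurable[OF B'(1) B'_eq] c by blast
  finally have null: "emeasure ?M N = 0" .
  have "{z \<in> space ?M. \<not> f z = c} = N" by (simp add: N_def)
  from AE_iff_measurable[OF N this] null have "AE z in ?M. f z = c" by (rule iffD2)
  then show "\<exists>c. AE z in ?M. f z = c" by blast
qed

end

theorem mainTheorem1:
  fixes G :: "('g, 'm) monoid_scheme" and X :: "'g topology" and A :: "'g chart set"
    and \<mu> :: "'g measure" and d n :: nat
  assumes "lie_group d G X A" and "compact_space X" and "connected_space X"
    and "\<exists>a b. locally_isomorphic G X (SU2_U1_product a b) (SU2_U1_topology a b)"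
    and "haar_measure G X \<mu>"
    and "n > 2"
  shows "ergodic_action (Out (free_group {..<n})) (Hom_mod_measure n G \<mu>) (out_act (free_group {..<n}) G)"
proof -
  interpret compact_haar_group G X \<mu>
    using assms(1,2,5)
    by (simp add: compact_haar_group_def compact_haar_group_axioms_def lie_group_def
        smooth_manifold_def smooth_map_def)
  obtain a b where "locally_isomorphic G X (SU2_U1_product a b) (SU2_U1_topology a b)"
    using assms(4) by blast
  from ergodic_of_AE_pair_dense[OF assms(6) AE_pair_dense[OF assms(3) this]] show ?thesis .
qed

end
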